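(* There exists a Monte-Carlo algorithm that, for any $k\ge1$, any directed graph $G=(V,E)$ with $n$ vertices and any set $\mathcal{P}\subseteq V\times V$ of vertex pairs, computes in polynomial time a $k$-fault-tolerant reachability subgraph of $G$ for $\mathcal{P}$ with $\widetilde{O}(k\,2^k\,n^{\frac{2k}{k+1}}\,|\mathcal{P}|^{\frac{1}{k+1}})$ edges.
   Context: A subgraph $H$ of $G$ is a $k$-fault-tolerant reachability subgraph of $G$ for $\mathcal{P}$ if for every $(s,t)\in\mathcal{P}$ and every $F\subseteq E$ with $|F|\le k$, $t$ is reachable from $s$ in $G\setminus F$ iff $t$ is reachable from $s$ in $H\setminus F$. A Monte-Carlo algorithm produces a correct output with high probability. $\widetilde{O}$ hides polylogarithmic factors in $n$. *)

theory Defs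
  imports
    "Graph_Theory.Graph_Theory"
    "HOL-Probability.Probability_Mass_Function"
    "HOL-Computational_Algebra.Polynomial"
    "HOL-Library.Log_Nat"
begin

section \<open>Fault-tolerant reachability subgraphs\<close>

definition delete_arcs :: "'v pair_pre_digraph \<Rightarrow> ('v \<times> 'v) set \<Rightarrow> 'v pair_pre_digraph" where
  "delete_arcs G F = G\<lparr>parcs := parcs G - F\<rparr>"

definition fault_tolerant_reachability_subgraph ::
  "nat \<Rightarrow> 'v pair_pre_digraph \<Rightarrow> ('v \<times> 'v) set \<Rightarrow> 'v pair_pre_digraph \<Rightarrow> bool" where
  "fault_tolerant_reachability_subgraph k G P H \<longleftrightarrow>
     subgraph H G \<and>
     (\<forall>(s, t) \<in> P. \<forall>F. F \<subseteq> parcs G \<and> finite F \<and> card F \<le> k \<longrightarrow>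
        (s \<rightarrow>\<^sup>*\<^bsub>delete_arcs G F\<^esub> t \<longleftrightarrow> s \<rightarrow>\<^sup>*\<^bsub>delete_arcs H F\<^esub> t))"

section \<open>Randomized random-access machine\<close>

text \<open>
  Algorithms are structured programs for a unit-cost random-access machine with coin tosses.
  The memory consists of arrays of natural numbers, indirectly addressable; the name of an array
  is fixed in the program text, so a program uses finitely many of them. The only arithmetic
  operations are addition and truncated subtraction. One step increases the bit length of the
  largest number in memory by at most a constant depending on the program, so that unit-cost
  polynomial time is the same as polynomial time on probabilistic Turing machines. (A unit-cost
  multiplication would destroy this.)
\<close>

type_synonym memory = "string \<Rightarrow> nat \<Rightarrow> nat"

datatype aexp =
    Lit nat
  | Cell string aexp
  | Plus aexp aexp
  | Minus aexp aexp

datatype bexp =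
    Less aexp aexp
  | Neg bexp
  | Conj bexp bexp

datatype com =
    Skip
  | Store string aexp aexp
  | Toss string
  | Seq com com
  | If bexp com com
  | While bexp com

primrec aval :: "aexp \<Rightarrow> memory \<Rightarrow> nat" where
  "aval (Lit m) \<sigma> = m"
| "aval (Cell x e) \<sigma> = \<sigma> x (aval e \<sigma>)"
| "aval (Plus e f) \<sigma> = aval e \<sigma> + aval f \<sigma>"
| "aval (Minus e f) \<sigma> = aval e \<sigma> - aval f \<sigma>"

primrec bval :: "bexp \<Rightarrow> memory \<Rightarrow> bool" where
  "bval (Less e f) \<sigma> \<longleftrightarrow> aval e \<sigma> < aval f \<sigma>"
| "bval (Neg b) \<sigma> \<longleftrightarrow> \<not> bval b \<sigma>"
| "bval (Conj b c) \<sigma> \<longleftrightarrow> bval b \<sigma> \<and> bval c \<sigma>"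

definition mem_write :: "memory \<Rightarrow> string \<Rightarrow> nat \<Rightarrow> nat \<Rightarrow> memory" where
  "mem_write \<sigma> x i m = \<sigma>(x := (\<sigma> x)(i := m))"

text \<open>
  \<open>Toss x\<close> stores a fresh fair random bit in cell 0 of \<open>x\<close>. A configuration whose program is
  \<open>Skip\<close> has halted and does not change any more.
\<close>

primrec step :: "com \<Rightarrow> memory \<Rightarrow> (com \<times> memory) pmf" where
  "step Skip \<sigma> = return_pmf (Skip, \<sigma>)"
| "step (Store x i e) \<sigma> = return_pmf (Skip, mem_write \<sigma> x (aval i \<sigma>) (aval e \<sigma>))"
| "step (Toss x) \<sigma> = map_pmf (\<lambda>b. (Skip, mem_write \<sigma> x 0 (of_bool b))) (bernoulli_pmf (1 / 2))"
| "step (Seq c d) \<sigma> =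
     (if c = Skip then return_pmf (d, \<sigma>)
      else map_pmf (\<lambda>(c', \<sigma>'). (Seq c' d, \<sigma>')) (step c \<sigma>))"
| "step (If b c d) \<sigma> = return_pmf (if bval b \<sigma> then c else d, \<sigma>)"
| "step (While b c) \<sigma> =
     return_pmf (if bval b \<sigma> then Seq c (While b c) else Skip, \<sigma>)"

primrec steps :: "nat \<Rightarrow> com \<times> memory \<Rightarrow> (com \<times> memory) pmf" where
  "steps 0 cfg = return_pmf cfg"
| "steps (Suc T) cfg = bind_pmf (step (fst cfg) (snd cfg)) (steps T)"

text \<open>Halting within a time bound is required for all outcomes of the coin tosses.\<close>

definition halts_within :: "com \<Rightarrow> memory \<Rightarrow> nat \<Rightarrow> bool" where
  "halts_within c \<sigma> T \<longleftrightarrow> (\<forall>cfg \<in> set_pmf (steps T (c, \<sigma>)). fst cfg = Skip)"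

definition success_prob :: "com \<Rightarrow> memory \<Rightarrow> nat \<Rightarrow> (memory \<Rightarrow> bool) \<Rightarrow> real" where
  "success_prob c \<sigma> T Q =
     measure_pmf.prob (steps T (c, \<sigma>)) {cfg. fst cfg = Skip \<and> Q (snd cfg)}"

section \<open>Encoding of inputs and outputs\<close>

text \<open>
  A graph on the vertices \<open>0, \<dots>, n - 1\<close> and a set of vertex pairs are given by their
  adjacency matrices, stored row by row; all cells not mentioned are 0.
\<close>

definition matrix :: "nat \<Rightarrow> (nat \<times> nat) set \<Rightarrow> nat \<Rightarrow> nat" where
  "matrix n R l = of_bool (\<exists>i<n. \<exists>j<n. l = i * n + j \<and> (i, j) \<in> R)"

definition initial_memory :: "nat \<Rightarrow> nat \<Rightarrow> nat pair_pre_digraph \<Rightarrow> (nat \<times> nat) set \<Rightarrow> memory" where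
  "initial_memory n k G P =
     (\<lambda>_ _. 0)(''n'' := (\<lambda>_. 0)(0 := n), ''k'' := (\<lambda>_. 0)(0 := k),
               ''G'' := matrix n (parcs G), ''P'' := matrix n P)"

text \<open>The number of bits of the input: \<open>n\<close> and \<open>k\<close> in binary and two matrices.\<close>

definition input_size :: "nat \<Rightarrow> nat \<Rightarrow> nat" where
  "input_size n k = floorlog 2 n + floorlog 2 k + 2 * n\<^sup>2"

definition output_graph :: "nat \<Rightarrow> memory \<Rightarrow> nat pair_pre_digraph" where
  "output_graph n \<sigma> =
     \<lparr>pverts = {..<n}, parcs = {(i, j). i < n \<and> j < n \<and> \<sigma> ''H'' (i * n + j) \<noteq> 0}\<rparr>"

end

theory Submission
  imports Defs
begin

text \<open>
  Unless \<open>k\<close> is at least about \<open>log n\<close>, when \<open>G\<close> itself is small enough, let \<open>L\<close> be maximal with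
  \<open>L^(k + 1) * |P| \<le> n^2\<close>. For every pair, a search tree of depth \<open>k\<close> branches over the arcs of a shortest
  path that avoids the faults chosen so far, and paths with at most \<open>L\<close> arcs are put into \<open>H\<close>. The last
  fault needs no branching: a node adds \<open>O(log n)\<close> paths, each of which avoids as many as possible
  of the arcs common to the previous ones, so that every single further fault that leaves the pair
  connected is avoided by one of them. A pair and a set of faults for which this does not provide a path
  in \<open>H\<close> are connected via more than \<open>L\<close> vertices. A random set of about \<open>(n / L) * k * log n\<close> vertices
  meets all these sets of vertices with high probability. For each of its members \<open>v\<close>, subgraphs that
  preserve reachability from \<open>v\<close> and to \<open>v\<close> under \<open>k\<close> faults are added. They have \<open>2^(k + 1)\<close> arcs per vertex,
  by the method of Baswana, Choudhary and Roditty: an arc into \<open>t\<close> is kept if it carries flow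
  after the source set has been enlarged \<open>k\<close> times to the minimum cut closest to \<open>t\<close> and the heads of its arcs.
\<close>

text \<open>The choice of \<open>L\<close> balances two costs. A pair has \<open>L^(k-1)\<close>
  branches of \<open>k\<close> nodes with \<open>O(log n)\<close> paths of at most \<open>L\<close>
  arcs each, about \<open>L^k\<close> arcs up to a factor \<open>k log n\<close>; over all pairs
  this is \<open>|P| * L^k\<close>. The draws contribute about \<open>(n / L) * n * 2^k\<close>, up
  to the same factor. Apart from \<open>2^k\<close>, both are of order \<open>n^2 / L\<close> when
  \<open>|P| * L^(k+1)\<close> is close to \<open>n^2\<close>, and then \<open>n^2 / L\<close> is
  the required product of powers of \<open>n\<close> and \<open>|P|\<close>. Branching on the last
  fault as well would cost another factor \<open>L\<close> and spoil the exponent. The factor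
  \<open>k * log n\<close> in the number of draws comes from a union bound over roughly
  \<open>n^(2k)\<close> sets of faults. The time has to be polynomial in the number of bits of
  \<open>k\<close>, so no loop may run \<open>k\<close> times unless \<open>k\<close> is small. If
  \<open>k\<close> is at least the rounded-up binary logarithm \<open>b\<close> of \<open>n\<close>,
  then \<open>2^k >= n\<close> and \<open>G\<close> is copied. Otherwise \<open>2^(k+1)\<close> is
  at most \<open>2 * n\<close>, and a cap of order \<open>n^4\<close> is enough for every loop.
  Halting is demanded for all outcomes of the coins; this is why it is built into the loops and not
  derived from correctness.\<close>

section \<open>Programs with bounded loops\<close>

text \<open>
  The number of iterations of a loop is limited by the cell \<open>cap\<close>, which no program writes. Every
  program therefore halts in time polynomial in the content of \<open>cap\<close>, whatever it computes.
\<close>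

datatype prg =
    PSkip
  | PStore string aexp aexp
  | PToss string
  | PSeq prg prg  (infixr ";;" 60)
  | PIf bexp prg prg
  | PFor string string prg

abbreviation V :: "string \<Rightarrow> aexp" where "V x \<equiv> Cell x (Lit 0)"

abbreviation set_var :: "string \<Rightarrow> aexp \<Rightarrow> prg"  (infix ":::=" 61) where
  "x :::= e \<equiv> PStore x (Lit 0) e"

abbreviation inc :: "string \<Rightarrow> memory \<Rightarrow> memory" where
  "inc x s \<equiv> mem_write s x 0 (s x 0 + 1)"

primrec iter_pmf :: "nat \<Rightarrow> ('a \<Rightarrow> 'a pmf) \<Rightarrow> 'a \<Rightarrow> 'a pmf" where
  "iter_pmf 0 f s = return_pmf s"
| "iter_pmf (Suc m) f s = bind_pmf (f s) (iter_pmf m f)"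

primrec den :: "string \<Rightarrow> prg \<Rightarrow> memory \<Rightarrow> memory pmf" where
  "den cap PSkip s = return_pmf s"
| "den cap (PStore x i e) s = return_pmf (mem_write s x (aval i s) (aval e s))"
| "den cap (PToss x) s = map_pmf (\<lambda>b. mem_write s x 0 (of_bool b)) (bernoulli_pmf (1 / 2))"
| "den cap (PSeq c d) s = bind_pmf (den cap c s) (den cap d)"
| "den cap (PIf b c d) s = (if bval b s then den cap c s else den cap d s)"
| "den cap (PFor x l c) s =
     iter_pmf (min (s l 0) (s cap 0)) (\<lambda>s. map_pmf (inc x) (den cap c s)) (mem_write s x 0 0)"

primrec comp :: "string \<Rightarrow> prg \<Rightarrow> com" where
  "comp cap PSkip = Skip"
| "comp cap (PStore x i e) = Store x i e"
| "comp cap (PToss x) = Toss x"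
| "comp cap (PSeq c d) = Seq (comp cap c) (comp cap d)"
| "comp cap (PIf b c d) = If b (comp cap c) (comp cap d)"
| "comp cap (PFor x l c) = Seq (Store x (Lit 0) (Lit 0))
     (While (Conj (Less (V x) (V l)) (Less (V x) (V cap)))
       (Seq (comp cap c) (Store x (Lit 0) (Plus (V x) (Lit 1)))))"

primrec writes :: "prg \<Rightarrow> string set" where
  "writes PSkip = {}"
| "writes (PStore x i e) = {x}"
| "writes (PToss x) = {x}"
| "writes (PSeq c d) = writes c \<union> writes d"
| "writes (PIf b c d) = writes c \<union> writes d"
| "writes (PFor x l c) = insert x (writes c)"

text \<open>\<open>den\<close> fixes the number of iterations on entry, whereas the compiled loop
  tests its bounds in every iteration. The two agree because the body changes neither the counter
  nor the bound.\<close>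

primrec loops_ok :: "prg \<Rightarrow> bool" where
  "loops_ok PSkip \<longleftrightarrow> True"
| "loops_ok (PStore x i e) \<longleftrightarrow> True"
| "loops_ok (PToss x) \<longleftrightarrow> True"
| "loops_ok (PSeq c d) \<longleftrightarrow> loops_ok c \<and> loops_ok d"
| "loops_ok (PIf b c d) \<longleftrightarrow> loops_ok c \<and> loops_ok d"
| "loops_ok (PFor x l c) \<longleftrightarrow> x \<noteq> l \<and> x \<notin> writes c \<and> l \<notin> writes c \<and> loops_ok c"

text \<open>The variable stands for a bound on the content of \<open>cap\<close>. Branches are added
  because a maximum is not a polynomial. The 4 extra steps of an iteration are the test, the
  increment and the removal of a finished \<open>Skip\<close> from two sequences.\<close>

primrec time_poly :: "prg \<Rightarrow> nat poly" where
  "time_poly PSkip = 0"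
| "time_poly (PStore x i e) = 1"
| "time_poly (PToss x) = 1"
| "time_poly (PSeq c d) = time_poly c + time_poly d + 1"
| "time_poly (PIf b c d) = time_poly c + time_poly d + 1"
| "time_poly (PFor x l c) = [:0, 1:] * (time_poly c + 4) + 3"

text \<open>Halted configurations are stationary, so outcomes that stop at different moments share
  one distribution of final memories from time \<open>T\<close> on. Quantifying over all later times
  lets these bounds be weakened and composed.\<close>

definition runs :: "com \<Rightarrow> memory \<Rightarrow> nat \<Rightarrow> memory pmf \<Rightarrow> bool" where
  "runs C s T p \<longleftrightarrow> (\<forall>T'\<ge>T. steps T' (C, s) = map_pmf (Pair Skip) p)"

lemma steps_Skip: "steps T (Skip, s) = return_pmf (Skip, s)"
  by (induction T) (auto simp: bind_return_pmf)

lemma runs_mono: "runs C s T p \<Longrightarrow> T \<le> T' \<Longrightarrow> runs C s T' p"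
  by (auto simp: runs_def)

lemma runs_Skip: "runs Skip s 0 (return_pmf s)"
  by (simp add: runs_def steps_Skip)

lemma runs_step:
  assumes "step C s = return_pmf (C', s')" and "runs C' s' T p"
  shows "runs C s (Suc T) p"
  unfolding runs_def
proof (intro allI impI)
  fix T' assume "Suc T \<le> T'"
  then obtain T'' where "T' = Suc T''" "T \<le> T''" by (cases T') auto
  then show "steps T' (C, s) = map_pmf (Pair Skip) p"
    using assms by (simp add: bind_return_pmf runs_def)
qed

lemma runs_Store: "runs (Store x i e) s 1 (return_pmf (mem_write s x (aval i s) (aval e s)))"
  using runs_step[OF _ runs_Skip] by simp

lemma runs_Toss: "runs (Toss x) s 1 (map_pmf (\<lambda>b. mem_write s x 0 (of_bool b)) (bernoulli_pmf (1 / 2)))"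
  unfolding runs_def
proof (intro allI impI)
  fix T' :: nat assume "1 \<le> T'"
  then obtain T'' where "T' = Suc T''" by (cases T') auto
  then show "steps T' (Toss x, s) =
      map_pmf (Pair Skip) (map_pmf (\<lambda>b. mem_write s x 0 (of_bool b)) (bernoulli_pmf (1 / 2)))"
    by (simp add: map_pmf_def bind_assoc_pmf bind_return_pmf steps_Skip)
qed

text \<open>On some outcomes \<open>C\<close> halts early and \<open>D\<close> starts early. This is
  harmless because the distribution \<open>g\<close> no longer depends on the remaining time once
  that is at least \<open>T2\<close>. The additional 1 is the step that drops the finished
  \<open>Skip\<close>.\<close>

lemma steps_Seq:
  assumes "\<And>cfg. cfg \<in> set_pmf (steps T1 (C, s)) \<Longrightarrow>
             fst cfg = Skip \<and> (\<forall>T\<ge>T2. steps T (D, snd cfg) = g (snd cfg))"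
    and "T1 + T2 + 1 \<le> T"
  shows "steps T (Seq C D, s) = bind_pmf (steps T1 (C, s)) (\<lambda>cfg. g (snd cfg))"
  using assms
proof (induction T1 arbitrary: C s T)
  case 0
  then have "C = Skip" and g: "\<forall>T\<ge>T2. steps T (D, s) = g s" by auto
  moreover obtain T' where "T = Suc T'" "T2 \<le> T'" using 0 by (cases T) auto
  ultimately show ?case by (simp add: bind_return_pmf)
next
  case (Suc T1)
  obtain T' where T': "T = Suc T'" "T1 + T2 + 1 \<le> T'" using Suc.prems(2) by (cases T) auto
  show ?case
  proof (cases "C = Skip")
    case True
    have "\<forall>T\<ge>T2. steps T (D, s) = g s"
      using Suc.prems(1)[of "(Skip, s)"] True by (simp add: bind_return_pmf steps_Skip)
    then show ?thesis using True T' by (simp add: bind_return_pmf steps_Skip)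
  next
    case False
    have "steps T' (Seq (fst cfg) D, snd cfg) = bind_pmf (steps T1 cfg) (\<lambda>cfg. g (snd cfg))"
      if "cfg \<in> set_pmf (step C s)" for cfg
      using Suc.IH[of "fst cfg" "snd cfg" T'] Suc.prems(1) that T'(2) by (force simp: set_bind_pmf)
    then have "bind_pmf (step C s) (\<lambda>cfg. steps T' (Seq (fst cfg) D, snd cfg))
        = bind_pmf (step C s) (\<lambda>cfg. bind_pmf (steps T1 cfg) (\<lambda>cfg. g (snd cfg)))"
      by (intro bind_pmf_cong refl) auto
    then show ?thesis using False T'
      by (simp add: bind_map_pmf bind_assoc_pmf case_prod_beta)
  qed
qed

lemma runs_Seq:
  assumes C: "runs C s T1 p" and D: "\<And>s'. s' \<in> set_pmf p \<Longrightarrow> runs D s' T2 (q s')"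
  shows "runs (Seq C D) s (T1 + T2 + 1) (bind_pmf p q)"
  unfolding runs_def
proof (intro allI impI)
  fix T' assume T': "T1 + T2 + 1 \<le> T'"
  have e: "steps T1 (C, s) = map_pmf (Pair Skip) p" using C by (simp add: runs_def)
  have "steps T' (Seq C D, s) =
      bind_pmf (steps T1 (C, s)) (\<lambda>cfg. map_pmf (Pair Skip) (q (snd cfg)))"
    using T' D by (intro steps_Seq) (auto simp: e runs_def)
  then show "steps T' (Seq C D, s) = map_pmf (Pair Skip) (bind_pmf p q)"
    by (simp add: e bind_map_pmf map_bind_pmf)
qed

lemma iter_pmf_invariant:
  assumes "s' \<in> set_pmf (iter_pmf m f s)" and "I s"
    and "\<And>s s'. I s \<Longrightarrow> s' \<in> set_pmf (f s) \<Longrightarrow> I s'"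
  shows "I s'"
  using assms by (induction m arbitrary: s) (auto simp: set_bind_pmf)

lemma den_frame:
  assumes "s' \<in> set_pmf (den cap c s)" and "y \<notin> writes c"
  shows "s' y = s y"
  using assms
proof (induction c arbitrary: s s')
  case (PFor x l c)
  show ?case
  proof (rule iter_pmf_invariant[where I = "\<lambda>r. r y = s y"])
    show "s' \<in> set_pmf (iter_pmf (min (s l 0) (s cap 0)) (\<lambda>s. map_pmf (inc x) (den cap c s))
        (mem_write s x 0 0))"
      using PFor.prems by simp
    show "mem_write s x 0 0 y = s y" using PFor.prems by (simp add: mem_write_def)
    fix r r' assume "r y = s y" "r' \<in> set_pmf (map_pmf (inc x) (den cap c r))"
    then show "r' y = s y" using PFor by (auto simp: mem_write_def)
  qed
next
  case (PSeq c d)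
  then show ?case by (simp add: set_bind_pmf) metis
qed (auto simp: mem_write_def split: if_splits)

lemma runs_While:
  assumes body: "\<And>s. s cap 0 \<le> B \<Longrightarrow> runs (comp cap c) s t (den cap c s)"
    and ok: "x \<noteq> l" "x \<noteq> cap" "x \<notin> writes c" "l \<notin> writes c" "cap \<notin> writes c"
    and "s x 0 + m = min (s l 0) (s cap 0)" and "s cap 0 \<le> B"
  shows "runs (While (Conj (Less (V x) (V l)) (Less (V x) (V cap)))
           (Seq (comp cap c) (Store x (Lit 0) (Plus (V x) (Lit 1))))) s (m * (t + 4) + 1)
           (iter_pmf m (\<lambda>s. map_pmf (inc x) (den cap c s)) s)"
  using assms(7-)
proof (induction m arbitrary: s)
  case 0
  show ?case using runs_step[OF _ runs_Skip] 0 by (auto simp: min_def split: if_splits)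
next
  case (Suc m)
  let ?b = "Conj (Less (V x) (V l)) (Less (V x) (V cap))"
  let ?S = "Store x (Lit 0) (Plus (V x) (Lit 1))"
  let ?W = "While ?b (Seq (comp cap c) ?S)"
  have b: "bval ?b s" using Suc.prems by auto
  have inc: "runs ?S s' 1 (return_pmf (inc x s'))" for s'
    using runs_Store[of x "Lit 0" "Plus (V x) (Lit 1)" s'] by simp
  have 1: "runs (Seq (comp cap c) ?S) s (t + 1 + 1) (map_pmf (inc x) (den cap c s))"
    unfolding map_pmf_def by (rule runs_Seq) (use body Suc.prems(2) inc in auto)
  have 2: "runs ?W s' (m * (t + 4) + 1) (iter_pmf m (\<lambda>s. map_pmf (inc x) (den cap c s)) s')"
    if s': "s' \<in> set_pmf (map_pmf (inc x) (den cap c s))" for s'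
  proof (rule Suc.IH)
    obtain r where r: "r \<in> set_pmf (den cap c s)" "s' = inc x r" using s' by auto
    then have "r x = s x" "r l = s l" "r cap = s cap" using den_frame[OF r(1)] ok by auto
    then show "s' x 0 + m = min (s' l 0) (s' cap 0)" "s' cap 0 \<le> B"
      using Suc.prems r ok by (auto simp: mem_write_def)
  qed
  have "runs ?W s (Suc (t + 1 + 1 + (m * (t + 4) + 1) + 1))
      (iter_pmf (Suc m) (\<lambda>s. map_pmf (inc x) (den cap c s)) s)"
    using runs_step[OF _ runs_Seq[OF 1 2]] b by simp
  then show ?case by (rule runs_mono) simp
qed

theorem runs_comp:
  assumes "loops_ok c" and "cap \<notin> writes c" and "s cap 0 \<le> B"
  shows "runs (comp cap c) s (poly (time_poly c) B) (den cap c s)"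
  using assms
proof (induction c arbitrary: s)
  case PSkip show ?case by (simp add: runs_Skip)
next
  case (PStore x i e) then show ?case using runs_Store by simp
next
  case (PToss x) then show ?case using runs_Toss by simp
next
  case (PSeq c d)
  have "runs (comp cap d) s' (poly (time_poly d) B) (den cap d s')"
    if "s' \<in> set_pmf (den cap c s)" for s'
    using den_frame[OF that, of cap] PSeq by simp
  then show ?case using runs_Seq[OF PSeq.IH(1)] PSeq.prems by simp
next
  case (PIf b c d)
  have "runs (If b (comp cap c) (comp cap d)) s
      (Suc (poly (time_poly c) B + poly (time_poly d) B)) (den cap (PIf b c d) s)"
  proof (cases "bval b s")
    case True
    then show ?thesis
      using runs_step[OF _ runs_mono[OF PIf.IH(1)]] PIf.prems by simp
  next
    case False
    then show ?thesis
      using runs_step[OF _ runs_mono[OF PIf.IH(2)]] PIf.prems by simp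
  qed
  then show ?case by simp
next
  case (PFor x l c)
  let ?t = "poly (time_poly c) B"
  let ?s = "mem_write s x 0 0" and ?m = "min (s l 0) (s cap 0)"
  have "runs (While (Conj (Less (V x) (V l)) (Less (V x) (V cap)))
           (Seq (comp cap c) (Store x (Lit 0) (Plus (V x) (Lit 1))))) ?s (?m * (?t + 4) + 1)
           (iter_pmf ?m (\<lambda>s. map_pmf (inc x) (den cap c s)) ?s)"
    using PFor by (intro runs_While[where B = B]) (auto simp: mem_write_def)
  moreover have "runs (Store x (Lit 0) (Lit 0)) s 1 (return_pmf ?s)"
    using runs_Store[of x "Lit 0" "Lit 0" s] by simp
  ultimately have "runs (comp cap (PFor x l c)) s (1 + (?m * (?t + 4) + 1) + 1) (den cap (PFor x l c) s)"
    using runs_Seq[of "Store x (Lit 0) (Lit 0)" s 1 "return_pmf ?s"] by (simp add: bind_return_pmf)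
  moreover have "?m * (?t + 4) \<le> B * (?t + 4)" using PFor.prems by (intro mult_right_mono) auto
  ultimately show ?case by (elim runs_mono) simp
qed

section \<open>Weakest preconditions\<close>

definition wp :: "string \<Rightarrow> prg \<Rightarrow> (memory \<Rightarrow> bool) \<Rightarrow> memory \<Rightarrow> bool" where
  "wp cap c Q s \<longleftrightarrow> (\<forall>s'\<in>set_pmf (den cap c s). Q s')"

lemma wp_PSkip [simp]: "wp cap PSkip Q s \<longleftrightarrow> Q s"
  and wp_PStore [simp]: "wp cap (PStore x i e) Q s \<longleftrightarrow> Q (mem_write s x (aval i s) (aval e s))"
  and wp_PSeq [simp]: "wp cap (c ;; d) Q s \<longleftrightarrow> wp cap c (wp cap d Q) s"
  and wp_PIf [simp]: "wp cap (PIf b c d) Q s \<longleftrightarrow> (if bval b s then wp cap c Q s else wp cap d Q s)"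
  by (auto simp: wp_def set_bind_pmf)

lemma wp_frame:
  assumes "wp cap c Q s" and "\<And>s'. Q s' \<Longrightarrow> (\<And>y. y \<notin> writes c \<Longrightarrow> s' y = s y) \<Longrightarrow> R s'"
  shows "wp cap c R s"
  using assms den_frame by (fastforce simp: wp_def)

lemma wp_mono: "wp cap c Q s \<Longrightarrow> (\<And>s'. Q s' \<Longrightarrow> R s') \<Longrightarrow> wp cap c R s"
  by (auto simp: wp_def)

lemma iter_pmf_index:
  assumes "s' \<in> set_pmf (iter_pmf m f s)" and "I i s"
    and "\<And>i' s s'. i \<le> i' \<Longrightarrow> i' < i + m \<Longrightarrow> I i' s \<Longrightarrow> s' \<in> set_pmf (f s) \<Longrightarrow> I (Suc i') s'"
  shows "I (i + m) s'"
  using assms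
proof (induction m arbitrary: s i)
  case (Suc m)
  obtain r where r: "r \<in> set_pmf (f s)" "s' \<in> set_pmf (iter_pmf m f r)"
    using Suc.prems(1) by (auto simp: set_bind_pmf)
  have "I (Suc i) r" using Suc.prems(3)[of i, OF _ _ Suc.prems(2) r(1)] by simp
  then have "I (Suc i + m) s'" using r(2) Suc.prems(3) by (intro Suc.IH) auto
  then show ?case by simp
qed simp

text \<open>The first hypothesis says that the cap does not truncate the loop. Whether the cap is
  large enough is thus a question of correctness only; termination never depends on it.\<close>

lemma wp_PFor:
  assumes "s l 0 \<le> s cap 0" and ok: "x \<notin> writes c"
    and init: "I 0 (mem_write s x 0 0)"
    and step: "\<And>i r. i < s l 0 \<Longrightarrow> I i r \<Longrightarrow> r x 0 = i \<Longrightarrow>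
         (\<And>y. y \<noteq> x \<Longrightarrow> y \<notin> writes c \<Longrightarrow> r y = s y) \<Longrightarrow>
         wp cap c (\<lambda>r'. I (Suc i) (mem_write r' x 0 (Suc i))) r"
    and post: "\<And>r. I (s l 0) r \<Longrightarrow> (\<And>y. y \<noteq> x \<Longrightarrow> y \<notin> writes c \<Longrightarrow> r y = s y) \<Longrightarrow> Q r"
  shows "wp cap (PFor x l c) Q s"
  unfolding wp_def
proof
  fix s' assume s': "s' \<in> set_pmf (den cap (PFor x l c) s)"
  let ?I = "\<lambda>i r. I i r \<and> r x 0 = i \<and> (\<forall>y. y \<noteq> x \<longrightarrow> y \<notin> writes c \<longrightarrow> r y = s y)"
  have "?I (0 + s l 0) s'"
  proof (rule iter_pmf_index[where I = ?I])
    show "s' \<in> set_pmf (iter_pmf (s l 0) (\<lambda>s. map_pmf (inc x) (den cap c s)) (mem_write s x 0 0))"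
      using s' assms(1) by (simp add: min_absorb1)
    show "?I 0 (mem_write s x 0 0)" using init by (simp add: mem_write_def)
    fix i r r' assume "i < 0 + s l 0" and I: "?I i r"
      and "r' \<in> set_pmf (map_pmf (inc x) (den cap c r))"
    then obtain r0 where r0: "r0 \<in> set_pmf (den cap c r)" "r' = inc x r0" by auto
    have "I (Suc i) (mem_write r0 x 0 (Suc i))"
      using step[of i r] \<open>i < 0 + s l 0\<close> I r0(1) by (auto simp: wp_def)
    then show "?I (Suc i) r'" using den_frame[OF r0(1)] ok I r0(2) by (auto simp: mem_write_def)
  qed
  then show "Q s'" using post by simp
qed

lemma wp_map:
  assumes "s l 0 \<le> s cap 0" and ne: "A \<noteq> x"
    and step: "\<And>i r. i < s l 0 \<Longrightarrow> r x 0 = i \<Longrightarrow> (\<And>y. y \<noteq> A \<Longrightarrow> y \<noteq> x \<Longrightarrow> r y = s y) \<Longrightarrow>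
         (\<And>j. i \<le> j \<Longrightarrow> r A j = s A j) \<Longrightarrow> aval e r = f i"
    and post: "\<And>r. (\<And>y. y \<noteq> A \<Longrightarrow> y \<noteq> x \<Longrightarrow> r y = s y) \<Longrightarrow>
         r A = (\<lambda>j. if j < s l 0 then f j else s A j) \<Longrightarrow> Q r"
  shows "wp cap (PFor x l (PStore A (V x) e)) Q s"
proof (rule wp_PFor[where I = "\<lambda>i r. r A = (\<lambda>j. if j < i then f j else s A j)"])
  fix i r assume i: "i < s l 0" "r A = (\<lambda>j. if j < i then f j else s A j)" "r x 0 = i"
    and fr: "\<And>y. y \<noteq> x \<Longrightarrow> y \<notin> writes (PStore A (V x) e) \<Longrightarrow> r y = s y"
  have "aval e r = f i" using i fr by (intro step) auto
  then show "wp cap (PStore A (V x) e)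
      (\<lambda>r'. mem_write r' x 0 (Suc i) A = (\<lambda>j. if j < Suc i then f j else s A j)) r"
    using i ne by (auto simp: mem_write_def fun_eq_iff)
qed (use assms in \<open>auto simp: mem_write_def\<close>)

lemma wp_loop:
  assumes "s l 0 \<le> s cap 0" and "x \<notin> writes c"
    and ins: "\<And>i j r. I i r \<Longrightarrow> I i (mem_write r x 0 j)"
    and init: "I 0 s"
    and step: "\<And>i r. i < s l 0 \<Longrightarrow> I i r \<Longrightarrow> r x 0 = i \<Longrightarrow>
         (\<And>y. y \<noteq> x \<Longrightarrow> y \<notin> writes c \<Longrightarrow> r y = s y) \<Longrightarrow> wp cap c (I (Suc i)) r"
    and post: "\<And>r. I (s l 0) r \<Longrightarrow> (\<And>y. y \<noteq> x \<Longrightarrow> y \<notin> writes c \<Longrightarrow> r y = s y) \<Longrightarrow> Q r"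
  shows "wp cap (PFor x l c) Q s"
  using assms(1,2) ins[OF init] _ post
proof (rule wp_PFor[where I = I])
  fix i r assume "i < s l 0" "I i r" "r x 0 = i" "\<And>y. y \<noteq> x \<Longrightarrow> y \<notin> writes c \<Longrightarrow> r y = s y"
  then have "wp cap c (I (Suc i)) r" by (rule step)
  then show "wp cap c (\<lambda>r'. I (Suc i) (mem_write r' x 0 (Suc i))) r" by (rule wp_mono) (rule ins)
qed

lemma wp_seqI: "wp cap c (wp cap d Q) s \<Longrightarrow> wp cap (c ;; d) Q s"
  by simp

lemma mem_write_apply [simp]: "mem_write s x i m y = (if y = x then (s x)(i := m) else s y)"
  by (simp add: mem_write_def)

abbreviation eq_exp :: "aexp \<Rightarrow> aexp \<Rightarrow> bexp"  (infix "===" 50) where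
  "e === f \<equiv> Conj (Neg (Less e f)) (Neg (Less f e))"

abbreviation pos_exp :: "aexp \<Rightarrow> bexp" where
  "pos_exp e \<equiv> Less (Lit 0) e"

section \<open>Cuts and residual graphs\<close>

definition cut :: "('a \<times> 'a) set \<Rightarrow> 'a set \<Rightarrow> nat" where
  "cut E B = card {(x, y) \<in> E. x \<in> B \<and> y \<notin> B}"

lemma cut_eq_sum: "finite E \<Longrightarrow> cut E B = (\<Sum>e\<in>E. of_bool (fst e \<in> B \<and> snd e \<notin> B))"
proof -
  assume "finite E"
  moreover have "{(x, y) \<in> E. x \<in> B \<and> y \<notin> B} = {e \<in> E. fst e \<in> B \<and> snd e \<notin> B}" by auto
  ultimately show ?thesis unfolding cut_def by (simp add: Int_def)
qed

lemma cut_submodular: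
  assumes "finite E"
  shows "cut E (A \<inter> B) + cut E (A \<union> B) \<le> cut E A + cut E B"
  unfolding cut_eq_sum[OF assms] sum.distrib[symmetric] by (intro sum_mono) auto

lemma cut_mono: "finite E \<Longrightarrow> {(x, y) \<in> D. x \<in> B \<and> y \<notin> B} \<subseteq> E \<Longrightarrow> cut D B \<le> cut E B"
  unfolding cut_def by (intro card_mono) (auto intro: finite_subset[of _ E])

text \<open>The change depends only on the ends of the reversed arc, so it telescopes when the arcs
  of a path are reversed one after another.\<close>

lemma cut_flip:
  assumes "finite R" and "(x, y) \<in> R" and "(y, x) \<notin> R" and "x \<noteq> y"
  shows "int (cut (insert (y, x) (R - {(x, y)})) B) =
    int (cut R B) - of_bool (x \<in> B) + of_bool (y \<in> B)"
proof -
  have "cut R B = of_bool (x \<in> B \<and> y \<notin> B) + cut (R - {(x, y)}) B"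
    using assms unfolding cut_eq_sum[OF assms(1)] cut_eq_sum[OF finite_Diff[OF assms(1)]]
    by (subst sum.remove[of R "(x, y)"]) auto
  moreover have "cut (insert (y, x) (R - {(x, y)})) B =
      of_bool (y \<in> B \<and> x \<notin> B) + cut (R - {(x, y)}) B"
    using assms by (simp add: cut_eq_sum del: sum_of_bool_eq)
  ultimately show ?thesis by auto
qed

primrec flip_path :: "('a \<times> 'a) set \<Rightarrow> (nat \<Rightarrow> 'a) \<Rightarrow> nat \<Rightarrow> ('a \<times> 'a) set" where
  "flip_path R p 0 = R"
| "flip_path R p (Suc i) = insert (p (Suc i), p i) (flip_path R p i - {(p i, p (Suc i))})"

lemma rtrancl_leaves:
  assumes "(s, t) \<in> R\<^sup>*" and "s \<in> B" and "t \<notin> B"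
  shows "\<exists>x y. (x, y) \<in> R \<and> x \<in> B \<and> y \<notin> B \<and> (s, x) \<in> R\<^sup>*"
  using assms by (induction rule: rtrancl_induct) blast+

text \<open>Without antiparallel arcs a residual graph is again a plain relation, since a reversed
  arc never coincides with another arc. Out-degree 2 makes an expansion at most double the cut. As
  no arc leaves \<open>z\<close>, the residual arcs into \<open>z\<close> are exactly the arcs of
  \<open>E\<close> into \<open>z\<close> that carry no flow.\<close>

locale network =
  fixes V :: "'a set" and E :: "('a \<times> 'a) set" and s z :: 'a
  assumes finite_V: "finite V" and E_subset: "E \<subseteq> V \<times> V"
    and asym_E: "(x, y) \<in> E \<Longrightarrow> (y, x) \<notin> E"
    and out_degree: "card {y. (x, y) \<in> E} \<le> 2"
    and no_out: "(z, y) \<notin> E"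
    and s_in: "s \<in> V" and z_in: "z \<in> V" and s_ne_z: "s \<noteq> z"
begin

text \<open>
  A flow in \<open>E\<close> from \<open>S\<close> to \<open>z\<close> is represented only by its residual graph \<open>R\<close>, in which the arcs
  carrying flow are reversed: the last condition says that its value is \<open>f\<close>. \<open>key S j\<close> is what the
  expansions of the source set achieve: a set \<open>Q\<close> that connects \<open>s\<close> to a vertex \<open>u\<close>
  is left by many arcs inside every cut that separates \<open>S\<close> from \<open>u\<close>.
\<close>

definition key :: "'a set \<Rightarrow> nat \<Rightarrow> bool" where
  "key S j \<longleftrightarrow> (\<forall>Q u A. Q \<subseteq> V \<longrightarrow> z \<notin> Q \<longrightarrow> (s, u) \<in> (E \<inter> Q \<times> Q)\<^sup>* \<longrightarrow>
     S \<subseteq> A \<longrightarrow> A \<subseteq> V \<longrightarrow> z \<notin> A \<longrightarrow> u \<notin> A \<longrightarrow> Suc j \<le> cut E (Q \<inter> A))"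

definition residual :: "'a set \<Rightarrow> nat \<Rightarrow> nat \<Rightarrow> ('a \<times> 'a) set \<Rightarrow> bool" where
  "residual S j f R \<longleftrightarrow> s \<in> S \<and> S \<subseteq> V \<and> z \<notin> S \<and> cut E S \<le> 2 ^ Suc j \<and> key S j \<and>
     R \<subseteq> E \<union> E\<inverse> \<and> (\<forall>x y. (x, y) \<in> R \<longrightarrow> (y, x) \<notin> R) \<and>
     (\<forall>B. S \<subseteq> B \<longrightarrow> B \<subseteq> V \<longrightarrow> z \<notin> B \<longrightarrow> cut R B + f = cut E B)"

lemma finite_E: "finite E"
  by (rule finite_subset[OF E_subset]) (use finite_V in simp)

lemma residual_subset: "residual S j f R \<Longrightarrow> R \<subseteq> E \<union> E\<inverse>"
  by (simp add: residual_def)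

lemma residual_finite: "residual S j f R \<Longrightarrow> finite R"
  using finite_subset[OF residual_subset] finite_E by simp

lemma residual_cut:
  "residual S j f R \<Longrightarrow> S \<subseteq> B \<Longrightarrow> B \<subseteq> V \<Longrightarrow> z \<notin> B \<Longrightarrow> cut R B + f = cut E B"
  by (simp add: residual_def)

lemma residual_key:
  assumes "residual S j f R" and "Q \<subseteq> V" and "z \<notin> Q" and "(s, u) \<in> (E \<inter> Q \<times> Q)\<^sup>*"
    and "S \<subseteq> A" and "A \<subseteq> V" and "z \<notin> A" and "u \<notin> A"
  shows "Suc j \<le> cut E (Q \<inter> A)"
  using assms unfolding residual_def key_def by (elim conjE allE[of _ Q] allE[of _ u] allE[of _ A]) simp

lemma residual_V: "residual S j f R \<Longrightarrow> R \<subseteq> V \<times> V"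
  using residual_subset E_subset by blast

lemma cut_pos:
  assumes "finite R" and "(x, y) \<in> R" and "x \<in> B" and "y \<notin> B"
  shows "0 < cut R B"
  using assms unfolding cut_def by (subst card_gt_0_iff) (auto intro: finite_subset[of _ R])

lemma residual_init: "residual {s} 0 0 E"
proof -
  have "cut E {s} \<le> card ({s} \<times> {y. (s, y) \<in> E})"
    unfolding cut_def using E_subset finite_V
    by (intro card_mono) (auto intro!: finite_subset[of "{y. (s, y) \<in> E}" V])
  also have "\<dots> \<le> 2" using out_degree[of s] by (simp add: card_cartesian_product)
  finally have "cut E {s} \<le> 2" .
  moreover have "key {s} 0"
    unfolding key_def
  proof (intro allI impI)
    fix Q u A assume *: "(s, u) \<in> (E \<inter> Q \<times> Q)\<^sup>*" "{s} \<subseteq> A" "u \<notin> A"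
    then obtain x y where xy: "(x, y) \<in> E \<inter> Q \<times> Q" "x \<in> A" "y \<notin> A"
      using rtrancl_leaves[OF *(1), of A] by auto
    then have "0 < cut E (Q \<inter> A)" using finite_E by (intro cut_pos[of _ x y]) auto
    then show "Suc 0 \<le> cut E (Q \<inter> A)" by simp
  qed
  ultimately show ?thesis
    using asym_E s_in s_ne_z by (auto simp: residual_def)
qed

lemma residual_le:
  assumes "residual S j f R" shows "f \<le> 2 ^ Suc j"
proof -
  have "cut R S + f = cut E S" "cut E S \<le> 2 ^ Suc j" using assms by (auto simp: residual_def)
  then show ?thesis by linarith
qed

text \<open>After \<open>i\<close> reversals every cut has changed only by the terms for
  \<open>p 0\<close> and \<open>p i\<close>. At the end a set that contains \<open>S\<close> but not
  \<open>z\<close> has lost exactly 1. Injectivity of \<open>p\<close> keeps the arcs still to be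
  reversed intact and prevents antiparallel pairs.\<close>

lemma residual_augment:
  assumes R: "residual S j f R" and inj: "inj_on p {..m}" and "p 0 \<in> S" and "p m = z"
    and arc: "\<And>i. i < m \<Longrightarrow> (p i, p (Suc i)) \<in> R"
  shows "residual S j (Suc f) (flip_path R p m)"
proof -
  have "flip_path R p i \<subseteq> E \<union> E\<inverse> \<and> (\<forall>x y. (x, y) \<in> flip_path R p i \<longrightarrow> (y, x) \<notin> flip_path R p i) \<and>
     (\<forall>i'. i \<le> i' \<longrightarrow> i' < m \<longrightarrow> (p i', p (Suc i')) \<in> flip_path R p i) \<and>
     (\<forall>B. int (cut (flip_path R p i) B) = int (cut R B) - of_bool (p 0 \<in> B) + of_bool (p i \<in> B))"
    if "i \<le> m" for i
    using that
  proof (induction i)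
    case 0
    then show ?case using R arc by (auto simp: residual_def)
  next
    case (Suc i)
    let ?R = "flip_path R p i"
    have IH: "?R \<subseteq> E \<union> E\<inverse>" "\<And>x y. (x, y) \<in> ?R \<Longrightarrow> (y, x) \<notin> ?R"
      "\<And>i'. i \<le> i' \<Longrightarrow> i' < m \<Longrightarrow> (p i', p (Suc i')) \<in> ?R"
      "\<And>B. int (cut ?R B) = int (cut R B) - of_bool (p 0 \<in> B) + of_bool (p i \<in> B)"
      using Suc by auto
    have a: "(p i, p (Suc i)) \<in> ?R" using IH(3) Suc.prems by simp
    have ne: "p i' \<noteq> p i" if "i < i'" "i' \<le> m" for i'
      using inj_onD[OF inj, of i' i] that by auto
    have fin: "finite ?R" using IH(1) finite_E by (auto intro: finite_subset)
    have "flip_path R p (Suc i) \<subseteq> E \<union> E\<inverse>" using IH(1) a by auto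
    moreover have "(y, x) \<notin> flip_path R p (Suc i)" if "(x, y) \<in> flip_path R p (Suc i)" for x y
      using that IH(2) a ne[of "Suc i"] Suc.prems by auto
    moreover have "(p i', p (Suc i')) \<in> flip_path R p (Suc i)" if "Suc i \<le> i'" "i' < m" for i'
      using IH(3)[of i'] that ne[of i'] by auto
    moreover have "int (cut (flip_path R p (Suc i)) B) =
        int (cut R B) - of_bool (p 0 \<in> B) + of_bool (p (Suc i) \<in> B)" for B
      using cut_flip[OF fin a IH(2)[OF a], of B] ne[of "Suc i"] Suc.prems IH(4)[of B] by simp
    ultimately show ?case by blast
  qed
  from this[of m] have fl: "flip_path R p m \<subseteq> E \<union> E\<inverse>"
    "\<And>x y. (x, y) \<in> flip_path R p m \<Longrightarrow> (y, x) \<notin> flip_path R p m"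
    "\<And>B. int (cut (flip_path R p m) B) = int (cut R B) - of_bool (p 0 \<in> B) + of_bool (p m \<in> B)"
    by auto
  have "cut (flip_path R p m) B + Suc f = cut E B" if "S \<subseteq> B" "B \<subseteq> V" "z \<notin> B" for B
  proof -
    have "cut R B + f = cut E B" using R that by (auto simp: residual_def)
    moreover have "p 0 \<in> B" "p m \<notin> B" using assms that by auto
    ultimately show ?thesis using fl(3)[of B] by simp
  qed
  then show ?thesis using R fl(1,2) unfolding residual_def by auto
qed

text \<open>When no augmenting path starts in \<open>S\<close>, this is the source side of the
  minimum cut closest to \<open>z\<close>.\<close>

definition blocked :: "('a \<times> 'a) set \<Rightarrow> 'a set" where
  "blocked R = {x \<in> V. (x, z) \<notin> R\<^sup>*}"

lemma blocked_cut: "R \<subseteq> V \<times> V \<Longrightarrow> cut R (blocked R) = 0"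
proof -
  assume R: "R \<subseteq> V \<times> V"
  have "{(x, y) \<in> R. x \<in> blocked R \<and> y \<notin> blocked R} = {}"
    using R converse_rtrancl_into_rtrancl[of _ _ R z] unfolding blocked_def by blast
  then show ?thesis unfolding cut_def by (simp only: card.empty)
qed

lemma residual_blocked:
  assumes R: "residual S j f R" and "S \<subseteq> blocked R"
  shows "cut E (blocked R) = f" and "z \<notin> blocked R" and "blocked R \<subseteq> V"
proof -
  show "z \<notin> blocked R" "blocked R \<subseteq> V" by (auto simp: blocked_def)
  then have "cut R (blocked R) + f = cut E (blocked R)"
    using R assms(2) by (simp add: residual_def)
  then show "cut E (blocked R) = f" using blocked_cut residual_V[OF R] by simp
qed

text \<open>The residual path from \<open>y\<close> to \<open>z\<close> leaves \<open>B\<close>, so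
  the residual cut of \<open>B\<close> is positive. Hence no minimum cut reaches beyond
  \<open>blocked R\<close>.\<close>

lemma residual_farthest:
  assumes R: "residual S j f R" and B: "S \<subseteq> B" "B \<subseteq> V" "z \<notin> B" "y \<in> B" "y \<notin> blocked R"
  shows "Suc f \<le> cut E B"
proof -
  have "(y, z) \<in> R\<^sup>*" using B(2,4,5) unfolding blocked_def by blast
  from rtrancl_leaves[OF this B(4) B(3)] obtain a b where ab: "(a, b) \<in> R" "a \<in> B" "b \<notin> B" by auto
  have "0 < cut R B" by (rule cut_pos[OF residual_finite[OF R] ab])
  moreover have "cut R B + f = cut E B" using R B by (simp add: residual_def)
  ultimately show ?thesis by simp
qed

text \<open>Write \<open>A\<close> for \<open>blocked R\<close>, whose cut is \<open>f\<close>. The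
  new source set contains the heads of all arcs that leave \<open>A\<close>, except
  \<open>z\<close>. So \<open>Q\<close>, which has an arc leaving \<open>A\<close>, meets
  \<open>B\<close> outside \<open>A\<close>, and the cut of \<open>(Q \<inter> B) \<union> A\<close>
  is at least \<open>f + 1\<close> because \<open>A\<close> is the closest minimum cut. The old
  \<open>key\<close> gives at least \<open>j + 1\<close> for \<open>Q \<inter> A\<close>.
  Submodularity adds the two and subtracts \<open>f\<close>, which leaves \<open>j + 2\<close> for
  \<open>Q \<inter> B\<close>.\<close>

lemma residual_expand:
  assumes R: "residual S j f R" and S: "S \<subseteq> blocked R"
  shows "residual (blocked R \<union> {y. \<exists>x\<in>blocked R. (x, y) \<in> E} - {z}) (Suc j) f R"
    (is "residual ?S _ _ _")
proof -
  let ?A = "blocked R" and ?D = "{(x, y) \<in> E. x \<in> blocked R \<and> y \<notin> blocked R}"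
  note A = residual_blocked[OF R S]
  have finD: "finite ?D" using finite_E by (auto intro: finite_subset[of _ E])
  have AS: "?A \<subseteq> ?S" using A by auto
  have SV: "?S \<subseteq> V" using A(3) E_subset by auto
  \<comment> \<open>An arc that leaves the new set is an arc from \<open>A\<close> to
    \<open>z\<close> or leaves the head of an arc of the old cut. Each of the \<open>f\<close> arcs
    of that cut is therefore charged at most twice.\<close>
  let ?g = "\<lambda>e. if snd e = z then {e} else Pair (snd e) ` {y. (snd e, y) \<in> E}"
  have fing: "finite (?g e)" for e
    using finite_E by (auto intro!: finite_imageI finite_subset[of "{y. (snd e, y) \<in> E}" "snd ` E"]) force
  have "{(x, y) \<in> E. x \<in> ?S \<and> y \<notin> ?S} \<subseteq> (\<Union>e\<in>?D. ?g e)"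
  proof
    fix e assume "e \<in> {(x, y) \<in> E. x \<in> ?S \<and> y \<notin> ?S}"
    then obtain x y where e: "e = (x, y)" and xy: "(x, y) \<in> E" "x \<in> ?S" "y \<notin> ?S" by blast
    show "e \<in> (\<Union>e\<in>?D. ?g e)"
    proof (cases "x \<in> ?A")
      case True
      then have "y = z" "y \<notin> ?A" using xy A by auto
      then have "(x, y) \<in> ?D" "(x, y) \<in> ?g (x, y)" using True xy by auto
      then show ?thesis unfolding e by (rule UN_I)
    next
      case False
      then obtain a where a: "a \<in> ?A" "(a, x) \<in> E" "x \<noteq> z" using xy by auto
      then have "(a, x) \<in> ?D" "(x, y) \<in> ?g (a, x)" using False xy by auto
      then show ?thesis unfolding e by (rule UN_I)
    qed
  qed
  then have "cut E ?S \<le> card (\<Union>e\<in>?D. ?g e)"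
    unfolding cut_def using finD fing by (intro card_mono) blast+
  also have "\<dots> \<le> (\<Sum>e\<in>?D. card (?g e))" by (rule card_UN_le[OF finD])
  also have "\<dots> \<le> (\<Sum>e\<in>?D. 2)"
    using out_degree by (intro sum_mono) (auto simp: card_image inj_on_def)
  also have "\<dots> = 2 * f" using A(1) by (simp add: cut_def)
  also have "\<dots> \<le> 2 ^ Suc (Suc j)" using residual_le[OF R] by simp
  finally have deg: "cut E ?S \<le> 2 ^ Suc (Suc j)" .
  have key: "key ?S (Suc j)"
    unfolding key_def
  proof (intro allI impI)
    fix Q u B
    assume Q: "Q \<subseteq> V" "z \<notin> Q" "(s, u) \<in> (E \<inter> Q \<times> Q)\<^sup>*" and B: "?S \<subseteq> B" "B \<subseteq> V" "z \<notin> B" "u \<notin> B"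
    have AB: "?A \<subseteq> B" using AS B by blast
    have "s \<in> ?A" "u \<notin> ?A" using R S AB B by (auto simp: residual_def)
    then obtain x y where xy: "(x, y) \<in> E" "x \<in> Q" "y \<in> Q" "x \<in> ?A" "y \<notin> ?A"
      using rtrancl_leaves[OF Q(3), of ?A] by auto
    then have "y \<in> B" using Q B by auto
    have "Suc j \<le> cut E (Q \<inter> ?A)"
      by (rule residual_key[OF R Q S A(3,2) \<open>u \<notin> ?A\<close>])
    moreover have "Q \<inter> ?A = Q \<inter> B \<inter> ?A" using AB by auto
    moreover have "Suc f \<le> cut E (Q \<inter> B \<union> ?A)"
      using xy Q B S A \<open>y \<in> B\<close> by (intro residual_farthest[OF R, of _ y]) auto
    moreover have "cut E (Q \<inter> B \<inter> ?A) + cut E (Q \<inter> B \<union> ?A) \<le> cut E (Q \<inter> B) + cut E ?A"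
      by (rule cut_submodular[OF finite_E])
    ultimately show "Suc (Suc j) \<le> cut E (Q \<inter> B)" using A(1) by simp
  qed
  have "s \<in> ?S" using R S AS by (auto simp: residual_def)
  moreover have "S \<subseteq> ?S" using S AS by blast
  ultimately show ?thesis using R key deg SV unfolding residual_def by auto
qed

text \<open>Suppose that the set \<open>Q\<close> reached in the thinned graph \<open>?E'\<close>
  misses \<open>z\<close>. All arcs of \<open>?E'\<close> leaving \<open>Q\<close> are faults, at
  most \<open>k\<close>, and the cut of \<open>?A\<close> is at most \<open>f\<close>. On the other
  hand \<open>Q \<inter> ?A\<close> has a cut of at least \<open>k + 1\<close> by
  \<open>key\<close>, also in \<open>?E'\<close>, since no dropped arc starts in \<open>?A\<close>;
  and \<open>Q \<union> ?A\<close> has a cut of at least \<open>f\<close>. This contradicts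
  submodularity.\<close>

lemma residual_preserves:
  assumes R: "residual S k f R" and S: "S \<subseteq> blocked R"
    and F: "finite F" "card F \<le> k" and path: "(s, z) \<in> (E - F)\<^sup>*"
  shows "(s, z) \<in> (E - {(u, z') \<in> R. z' = z} - F)\<^sup>*"
proof (rule ccontr)
  let ?E' = "E - {(u, z') \<in> R. z' = z}" and ?A = "blocked R"
  assume no: "(s, z) \<notin> (?E' - F)\<^sup>*"
  define Q where "Q = {x. (s, x) \<in> (?E' - F)\<^sup>*}"
  have fin: "finite ?E'" using finite_E by simp
  have "s \<in> Q" "z \<notin> Q" using no by (auto simp: Q_def)
  then obtain u y where uy: "(u, y) \<in> E - F" "u \<in> Q" "y \<notin> Q"
    using rtrancl_leaves[OF path, of Q] by auto
  have "(u, y) \<notin> ?E' - F"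
  proof
    assume "(u, y) \<in> ?E' - F"
    from rtrancl_into_rtrancl[OF _ this, of s] uy show False unfolding Q_def by simp
  qed
  then have uz: "y = z" "(u, z) \<in> R" using uy by auto
  then have "u \<notin> ?A" by (auto simp: blocked_def)
  note A = residual_blocked[OF R S]
  have QV: "Q \<subseteq> V"
  proof
    fix x assume "x \<in> Q"
    then have "(s, x) \<in> (?E' - F)\<^sup>*" by (simp add: Q_def)
    then show "x \<in> V" by (induction rule: rtrancl_induct) (use s_in E_subset in auto)
  qed
  have "(s, u) \<in> (E \<inter> Q \<times> Q)\<^sup>*"
  proof -
    have "(s, u) \<in> (?E' - F)\<^sup>*" using uy by (simp add: Q_def)
    then show ?thesis
    proof (induction rule: rtrancl_induct)
      case (step a b)
      then have "(s, b) \<in> (?E' - F)\<^sup>*" by (rule_tac rtrancl_into_rtrancl)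
      then have "a \<in> Q" "b \<in> Q" using step(1) by (auto simp: Q_def)
      then have "(a, b) \<in> E \<inter> Q \<times> Q" using step(2) by auto
      then show ?case by (rule rtrancl_into_rtrancl[OF step(3)])
    qed simp
  qed
  then have "Suc k \<le> cut E (Q \<inter> ?A)"
    using residual_key[OF R QV \<open>z \<notin> Q\<close> _ S A(3,2) \<open>u \<notin> ?A\<close>] by simp
  also have "cut E (Q \<inter> ?A) \<le> cut ?E' (Q \<inter> ?A)"
    using fin by (intro cut_mono) (auto simp: blocked_def)
  finally have 1: "Suc k \<le> cut ?E' (Q \<inter> ?A)" .
  have "cut ?E' Q \<le> card F"
    unfolding cut_def
  proof (rule card_mono[OF F(1)], rule subsetI)
    fix e assume "e \<in> {(x, y) \<in> ?E'. x \<in> Q \<and> y \<notin> Q}"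
    then obtain x y where e: "e = (x, y)" and xy: "(x, y) \<in> ?E'" "x \<in> Q" "y \<notin> Q" by blast
    show "e \<in> F"
      unfolding e
    proof (rule ccontr)
      assume "(x, y) \<notin> F"
      then have "(x, y) \<in> ?E' - F" using xy by blast
      from rtrancl_into_rtrancl[OF _ this, of s] xy show False unfolding Q_def by simp
    qed
  qed
  then have 2: "cut ?E' Q \<le> k" using F(2) by simp
  have 3: "cut ?E' ?A \<le> f" using cut_mono[OF finite_E, of ?E' ?A] A(1) by auto
  let ?B = "Q \<union> ?A"
  \<comment> \<open>A dropped arc that leaves \<open>?B\<close> is a residual arc, and the residual
    cut of \<open>?B\<close> is exactly the excess of its cut over \<open>f\<close>. What remains in
    \<open>?E'\<close> is still at least \<open>f\<close>.\<close>
  have "cut E ?B \<le> cut ?E' ?B + cut R ?B"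
  proof -
    have "{(x, y) \<in> E. x \<in> ?B \<and> y \<notin> ?B} \<subseteq>
        {(x, y) \<in> ?E'. x \<in> ?B \<and> y \<notin> ?B} \<union> {(x, y) \<in> R. x \<in> ?B \<and> y \<notin> ?B}" by auto
    then have "cut E ?B \<le> card ({(x, y) \<in> ?E'. x \<in> ?B \<and> y \<notin> ?B} \<union> {(x, y) \<in> R. x \<in> ?B \<and> y \<notin> ?B})"
      unfolding cut_def using fin residual_finite[OF R]
      by (intro card_mono) (auto intro: finite_subset[of _ E] finite_subset[of _ R] finite_E)
    also have "\<dots> \<le> cut ?E' ?B + cut R ?B" unfolding cut_def by (rule card_Un_le)
    finally show ?thesis .
  qed
  moreover have "cut R ?B + f = cut E ?B"
    using S A QV \<open>z \<notin> Q\<close> by (intro residual_cut[OF R]) auto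
  ultimately have "f \<le> cut ?E' ?B" by simp
  then show False using 1 2 3 cut_submodular[OF fin, of Q ?A] by simp
qed

text \<open>For the cut around all vertices but \<open>z\<close>, the residual identity says that
  the arcs into \<open>z\<close> missing from \<open>R\<close> are as many as the value
  \<open>f\<close> of the flow.\<close>

lemma residual_in_degree:
  assumes R: "residual S j f R"
  shows "card {u. (u, z) \<in> E \<and> (u, z) \<notin> R} \<le> 2 ^ Suc j"
proof -
  let ?B = "V - {z}" and ?K = "{u. (u, z) \<in> E \<and> (u, z) \<notin> R}"
  have sub: "(u, z) \<in> E" if "(u, z) \<in> R" for u using residual_subset[OF R] that no_out by blast
  have nz: "(z, z) \<notin> E" using no_out by simp
  have "S \<subseteq> V" "z \<notin> S" using R by (simp_all add: residual_def)
  then have "cut R ?B + f = cut E ?B" by (intro residual_cut[OF R]) auto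
  moreover have cE: "cut E ?B = card {u. (u, z) \<in> E}"
  proof -
    have "{(x, y) \<in> E. x \<in> ?B \<and> y \<notin> ?B} = (\<lambda>u. (u, z)) ` {u. (u, z) \<in> E}"
      using E_subset nz by blast
    then show ?thesis unfolding cut_def by (simp add: card_image inj_on_def)
  qed
  moreover have cR: "cut R ?B = card {u. (u, z) \<in> R}"
  proof -
    have "{(x, y) \<in> R. x \<in> ?B \<and> y \<notin> ?B} = (\<lambda>u. (u, z)) ` {u. (u, z) \<in> R}"
      using residual_V[OF R] sub nz by blast
    then show ?thesis unfolding cut_def by (simp add: card_image inj_on_def)
  qed
  moreover have "card ?K + card {u. (u, z) \<in> R} = card {u. (u, z) \<in> E}"
  proof -
    have "?K \<union> {u. (u, z) \<in> R} = {u. (u, z) \<in> E}" using sub by auto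
    moreover have fin: "finite {u. (u, z) \<in> E}" by (rule finite_subset[OF _ finite_V]) (use E_subset in blast)
    moreover have "finite ?K" "finite {u. (u, z) \<in> R}"
      by (rule finite_subset[OF _ fin], use sub in blast)+
    moreover have "?K \<inter> {u. (u, z) \<in> R} = {}" by blast
    ultimately show ?thesis using card_Un_disjoint[of ?K "{u. (u, z) \<in> R}"] by simp
  qed
  ultimately have "card ?K = f" by simp
  then show ?thesis using residual_le[OF R] by simp
qed

end

section \<open>Reduction of the in-degree of a vertex\<close>

text \<open>
  The out-neighbours of a vertex \<open>u\<close> are distributed over a path of \<open>n\<close> nodes \<open>u * n + v\<close>, which
  makes all out-degrees at most 2. Arcs out of the target are left out.
\<close>

definition split_graph :: "nat \<Rightarrow> (nat \<times> nat) set \<Rightarrow> nat \<Rightarrow> (nat \<times> nat) set" where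
  "split_graph n G t =
     {(u * n + v, u * n + v + 1) | u v. u < n \<and> v + 1 < n \<and> u \<noteq> t} \<union>
     {(u * n + v, v * n) | u v. (u, v) \<in> G \<and> u \<noteq> t}"

lemma split_graphE:
  assumes "(x, y) \<in> split_graph n G t"
  obtains (chain) u v where "x = u * n + v" "y = u * n + (v + 1)" "u < n" "v + 1 < n" "u \<noteq> t"
    | (jump) u v where "x = u * n + v" "y = v * n" "(u, v) \<in> G" "u \<noteq> t"
  using assms unfolding split_graph_def by auto

lemma index_div: "v < n \<Longrightarrow> (u * n + v) div n = (u::nat)"
  by simp

lemma index_inject:
  assumes "u * n + v = u' * n + v'" and "v < n" and "v' < (n::nat)"
  shows "u = u' \<and> v = v'"
proof -
  have "u = (u * n + v) div n" "v = (u * n + v) mod n" "u' = (u' * n + v') div n" "v' = (u' * n + v') mod n"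
    using assms(2,3) by auto
  then show ?thesis using assms(1) by metis
qed

lemma index_bound: "u < n \<Longrightarrow> v < n \<Longrightarrow> u * n + v < n * (n::nat)"
proof -
  assume "u < n" "v < n"
  then have "u * n + v < Suc u * n" by simp
  also have "\<dots> \<le> n * n" using \<open>u < n\<close> by (intro mult_right_mono) auto
  finally show ?thesis .
qed

text \<open>Two antiparallel arcs of the split graph would force a loop of \<open>G\<close>. This is
  the reason why loops are removed from the graph beforehand.\<close>

lemma network_split:
  assumes G: "G \<subseteq> {..<n} \<times> {..<n}" and loop: "\<And>u. (u, u) \<notin> G" and st: "s < n" "t < n" "s \<noteq> t"
  shows "network {..<n * n} (split_graph n G t) (s * n) (t * n)"
proof
  show "finite {..<n * n}" by simp
  show "split_graph n G t \<subseteq> {..<n * n} \<times> {..<n * n}"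
    using G index_bound[of _ n] index_bound[of _ n 0] by (fastforce simp: split_graph_def)
  show "s * n \<in> {..<n * n}" "t * n \<in> {..<n * n}" "s * n \<noteq> t * n" using st by auto
next
  fix x y assume xy: "(x, y) \<in> split_graph n G t"
  show "(y, x) \<notin> split_graph n G t"
  proof
    assume "(y, x) \<in> split_graph n G t"
    have jump_chain: False if "x = u * n + v" "y = u * n + (v + 1)" "v + 1 < n"
        "y = u' * n + v'" "x = v' * n" "(u', v') \<in> G" for x y u v u' v'
    proof -
      have "v' < n" using that G by auto
      have "u * n + v = v' * n + 0" using that by simp
      from index_inject[OF this] have 1: "u = v'" "v = 0" using that by auto
      have "u * n + (v + 1) = u' * n + v'" using that by simp
      from index_inject[OF this] have "u = u'" "v + 1 = v'" using that \<open>v' < n\<close> by auto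
      then show False using that loop 1 by simp
    qed
    from xy show False
    proof (cases rule: split_graphE)
      case c: (chain u v)
      from \<open>(y, x) \<in> split_graph n G t\<close> show False
      proof (cases rule: split_graphE)
        case (chain u' v')
        then show False using c by simp
      next
        case (jump u' v')
        then show False using jump_chain c by blast
      qed
    next
      case j: (jump u v)
      from \<open>(y, x) \<in> split_graph n G t\<close> show False
      proof (cases rule: split_graphE)
        case (chain u' v')
        then show False using jump_chain j by blast
      next
        case (jump u' v')
        have lt: "v < n" "v' < n" using G j jump by auto
        have "u * n + v = v' * n + 0" using j jump by simp
        from index_inject[OF this] have 1: "u = v'" "v = 0" using lt by auto
        have "u' * n + v' = v * n + 0" using j jump by simp
        from index_inject[OF this] have "u' = v" "v' = 0" using lt by auto
        then show False using 1 jump loop by simp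
      qed
    qed
  qed
next
  fix x
  have "{y. (x, y) \<in> split_graph n G t} \<subseteq> {x + 1, (x mod n) * n}"
    using G by (auto simp: split_graph_def)
  then have "card {y. (x, y) \<in> split_graph n G t} \<le> card {x + 1, (x mod n) * n}" by (intro card_mono) auto
  also have "\<dots> \<le> 2" by (simp add: card_insert_if)
  finally show "card {y. (x, y) \<in> split_graph n G t} \<le> 2" .
next
  fix y
  show "(t * n, y) \<notin> split_graph n G t"
  proof
    assume "(t * n, y) \<in> split_graph n G t"
    then obtain u v where "t * n + 0 = u * n + v" "v < n" "u \<noteq> t" using G by (auto simp: split_graph_def)
    then show False using index_inject[of t n 0 u v] by auto
  qed
qed

text \<open>A walk can be stopped at its first visit of \<open>t\<close>, so arcs out of the target
  are dispensable.\<close>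

lemma rtrancl_to_target:
  assumes "(s, t) \<in> R\<^sup>*" shows "(s, t) \<in> {(u, v) \<in> R. u \<noteq> t}\<^sup>*"
  using assms
proof (induction rule: converse_rtrancl_induct)
  case (step x y)
  then show ?case by (cases "x = t") (auto intro: converse_rtrancl_into_rtrancl)
qed simp

abbreviation split_arcs :: "nat \<Rightarrow> (nat \<times> nat) set \<Rightarrow> (nat \<times> nat) set" where
  "split_arcs n F \<equiv> (\<lambda>(u, v). (u * n + v, v * n)) ` F"

text \<open>A fault of \<open>G\<close> becomes a single arc between chains. Arcs inside a chain are
  never hit, since they do not end in multiples of \<open>n\<close>.\<close>

lemma split_graph_path:
  assumes G: "G \<subseteq> {..<n} \<times> {..<n}" and "F \<subseteq> {..<n} \<times> {..<n}" and "(s, t) \<in> (G - F)\<^sup>*"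
  shows "(s * n, t * n) \<in> (split_graph n G t - split_arcs n F)\<^sup>*"
proof -
  let ?E = "split_graph n G t - split_arcs n F"
  have chain: "(u * n, u * n + v) \<in> ?E\<^sup>*" if "u < n" "u \<noteq> t" "v < n" for u v
    using that(3)
  proof (induction v)
    case (Suc v)
    have "(u * n + v, u * n + v + 1) \<in> ?E"
    proof
      show "(u * n + v, u * n + v + 1) \<in> split_graph n G t" using Suc that by (auto simp: split_graph_def)
      show "(u * n + v, u * n + v + 1) \<notin> split_arcs n F"
      proof
        assume "(u * n + v, u * n + v + 1) \<in> split_arcs n F"
        then obtain v' where "u * n + (v + 1) = v' * n + 0" by auto
        then show False using index_inject[of u n "v + 1" v' 0] Suc by simp
      qed
    qed
    then show ?case using Suc by (auto intro: rtrancl_into_rtrancl)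
  qed simp
  have jump: "(u * n + v, v * n) \<in> ?E" if "(u, v) \<in> G - F" "u \<noteq> t" for u v
  proof
    show "(u * n + v, v * n) \<in> split_graph n G t" using that by (auto simp: split_graph_def)
    show "(u * n + v, v * n) \<notin> split_arcs n F"
    proof
      assume "(u * n + v, v * n) \<in> split_arcs n F"
      then obtain u' v' where "(u', v') \<in> F" "u * n + v = u' * n + v'" by auto
      then have "(u, v) \<in> F" using index_inject[of u n v u' v'] that assms by auto
      then show False using that by simp
    qed
  qed
  have "(s * n, x * n) \<in> ?E\<^sup>*" if "(s, x) \<in> {(u, v) \<in> G - F. u \<noteq> t}\<^sup>*" for x
    using that
  proof (induction rule: rtrancl_induct)
    case (step u v)
    then have uv: "(u, v) \<in> G - F" "u \<noteq> t" by auto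
    then have "u < n" "v < n" using G by auto
    then have h: "(u * n, u * n + v) \<in> ?E\<^sup>*" "(u * n + v, v * n) \<in> ?E" using chain jump uv by simp_all
    show ?case by (rule rtrancl_into_rtrancl[OF rtrancl_trans[OF step(3) h(1)] h(2)])
  qed simp
  from this[OF rtrancl_to_target[OF assms(3)]] show ?thesis .
qed

text \<open>Division by \<open>n\<close> projects nodes to vertices: arcs inside a chain collapse,
  and the others become arcs of \<open>G\<close>.\<close>

lemma split_graph_path_back:
  assumes G: "G \<subseteq> {..<n} \<times> {..<n}" and n: "0 < n"
    and "(s * n, t * n) \<in> (split_graph n G t - {(u, z) \<in> R. z = t * n} - split_arcs n F)\<^sup>*"
  shows "(s, t) \<in> (G - {(u, v). v = t \<and> (u * n + t, t * n) \<in> R} - F)\<^sup>*" (is "_ \<in> ?G\<^sup>*")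
proof -
  have "(s, x div n) \<in> ?G\<^sup>*"
    if "(s * n, x) \<in> (split_graph n G t - {(u, z) \<in> R. z = t * n} - split_arcs n F)\<^sup>*" for x
    using that
  proof (induction rule: rtrancl_induct)
    case base then show ?case using n by simp
  next
    case (step x y)
    from step(2) have a: "(x, y) \<in> split_graph n G t" "\<not> ((x, y) \<in> R \<and> y = t * n)" "(x, y) \<notin> split_arcs n F"
      by auto
    from a(1) show ?case
    proof (cases rule: split_graphE)
      case (chain u v)
      then have "x div n = u" "y div n = u" using index_div[of v n u] index_div[of "v + 1" n u] by simp_all
      then show ?thesis using step(3) by simp
    next
      case (jump u v)
      then have "x div n = u" "y div n = v" using G by auto
      moreover have "(u, v) \<in> ?G" using jump a by (auto simp: image_iff)
      ultimately show ?thesis using step(3) by (auto intro: rtrancl_into_rtrancl)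
    qed
  qed
  from this[OF assms(3)] show ?thesis using n by simp
qed

text \<open>One implication suffices, since the converse is immediate for subgraphs. The faults are
  not restricted to arcs of \<open>G\<close>, which makes the relation transitive without any
  adjustment of \<open>F\<close>.\<close>

definition reach_preserver :: "nat \<Rightarrow> nat \<Rightarrow> (nat \<times> nat) set \<Rightarrow> (nat \<times> nat) set \<Rightarrow> bool" where
  "reach_preserver k s G H \<longleftrightarrow>
     (\<forall>F x. finite F \<longrightarrow> card F \<le> k \<longrightarrow> (s, x) \<in> (G - F)\<^sup>* \<longrightarrow> (s, x) \<in> (H - F)\<^sup>*)"

lemma reach_preserver_refl: "reach_preserver k s G G"
  by (simp add: reach_preserver_def)

lemma reach_preserver_trans:
  "reach_preserver k s G H \<Longrightarrow> reach_preserver k s H I \<Longrightarrow> reach_preserver k s G I"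
  by (simp add: reach_preserver_def)

text \<open>Along a path every arc into a vertex other than \<open>t\<close> survives, and each
  arrival at \<open>t\<close> is replaced by the path that the hypothesis provides. Thinning the
  arcs into \<open>t\<close> thus preserves reachability of all vertices, and the targets can be
  treated one after another.\<close>

lemma reach_preserver_target:
  assumes "\<And>u v. (u, v) \<in> G \<Longrightarrow> (u, v) \<notin> H \<Longrightarrow> v = t"
    and "\<And>F. finite F \<Longrightarrow> card F \<le> k \<Longrightarrow> (s, t) \<in> (G - F)\<^sup>* \<Longrightarrow> (s, t) \<in> (H - F)\<^sup>*"
  shows "reach_preserver k s G H"
  unfolding reach_preserver_def
proof (intro allI impI)
  fix F x assume F: "finite F" "card F \<le> k" and path: "(s, x) \<in> (G - F)\<^sup>*"
  from path show "(s, x) \<in> (H - F)\<^sup>*"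
  proof (induction rule: rtrancl_induct)
    case (step y x)
    show ?case
    proof (cases "x = t")
      case True
      have "(s, t) \<in> (G - F)\<^sup>*" using step(1,2) True by (auto intro: rtrancl_into_rtrancl)
      then show ?thesis using assms(2)[OF F] True by simp
    next
      case False
      then have "(y, x) \<in> H - F" using step(2) assms(1) by auto
      then show ?thesis using step(3) by (auto intro: rtrancl_into_rtrancl)
    qed
  qed simp
qed

lemma split_reduction:
  assumes G: "G \<subseteq> {..<n} \<times> {..<n}" and loop: "\<And>u. (u, u) \<notin> G" and st: "s < n" "t < n" "s \<noteq> t"
    and R: "network.residual {..<n * n} (split_graph n G t) (s * n) (t * n) S k f R"
    and S: "S \<subseteq> network.blocked {..<n * n} (t * n) R"
    and H: "H = G - {(u, v). v = t \<and> (u * n + t, t * n) \<in> R}"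
  shows "reach_preserver k s G H" and "card {u. (u, t) \<in> H} \<le> 2 ^ Suc k"
proof -
  interpret network "{..<n * n}" "split_graph n G t" "s * n" "t * n"
    by (rule network_split[OF G loop st])
  show "reach_preserver k s G H"
  proof (rule reach_preserver_target[where t = t])
    fix F assume F: "finite F" "card F \<le> k" "(s, t) \<in> (G - F)\<^sup>*"
    \<comment> \<open>Faults that are not pairs of vertices are discarded first, as their encoding
      could coincide with that of an arc.\<close>
    let ?F = "F \<inter> {..<n} \<times> {..<n}"
    have "G - F = G - ?F" using G by auto
    then have "(s * n, t * n) \<in> (split_graph n G t - split_arcs n ?F)\<^sup>*"
      using F by (intro split_graph_path[OF G]) auto
    moreover have "card (split_arcs n ?F) \<le> k"
    proof -
      have "card (split_arcs n ?F) \<le> card ?F" using F by (intro card_image_le) auto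
      also have "\<dots> \<le> card F" using F by (intro card_mono) auto
      finally show ?thesis using F by simp
    qed
    ultimately have "(s * n, t * n) \<in> (split_graph n G t - {(u, z) \<in> R. z = t * n} - split_arcs n ?F)\<^sup>*"
      using residual_preserves[OF R S] F(1) by simp
    then have "(s, t) \<in> (H - ?F)\<^sup>*" unfolding H using st by (intro split_graph_path_back[OF G]) auto
    moreover have "H - ?F = H - F" using G H by auto
    ultimately show "(s, t) \<in> (H - F)\<^sup>*" by simp
  qed (auto simp: H)
  have "card {u. (u, t) \<in> H} = card ((\<lambda>u. u * n + t) ` {u. (u, t) \<in> H})"
    using G H st by (subst card_image) (auto simp: inj_on_def)
  also have "\<dots> \<le> card {u. (u, t * n) \<in> split_graph n G t \<and> (u, t * n) \<notin> R}"
  proof (intro card_mono)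
    show "finite {u. (u, t * n) \<in> split_graph n G t \<and> (u, t * n) \<notin> R}"
      by (rule finite_subset[of _ "{..<n * n}"]) (use E_subset in auto)
    show "(\<lambda>u. u * n + t) ` {u. (u, t) \<in> H} \<subseteq> {u. (u, t * n) \<in> split_graph n G t \<and> (u, t * n) \<notin> R}"
      using loop unfolding H split_graph_def by force
  qed
  also have "\<dots> \<le> 2 ^ Suc k" by (rule residual_in_degree[OF R])
  finally show "card {u. (u, t) \<in> H} \<le> 2 ^ Suc k" .
qed

section \<open>Shortest paths\<close>

text \<open>
  \<open>w u v = 0\<close> means that there is no arc from \<open>u\<close> to \<open>v\<close>, and \<open>c\<close> plays the role of infinity.
\<close>

definition potential :: "nat \<Rightarrow> (nat \<Rightarrow> nat \<Rightarrow> nat) \<Rightarrow> nat \<Rightarrow> nat \<Rightarrow> (nat \<Rightarrow> nat) \<Rightarrow> bool" where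
  "potential N w z c D \<longleftrightarrow> D z = 0 \<and> (\<forall>v<N. D v \<le> c) \<and>
     (\<forall>v<N. v \<noteq> z \<longrightarrow> D v < c \<longrightarrow> (\<exists>y<N. 0 < w v y \<and> D v = w v y + D y)) \<and>
     (\<forall>v<N. \<forall>y<N. 0 < w v y \<longrightarrow> D v \<le> w v y + D y)"

text \<open>The greatest candidate is taken because the scan in \<open>NEXT\<close> keeps the last
  one it meets. A definite choice is needed so that repeated computations find the same
  path.\<close>

definition next_vertex :: "nat \<Rightarrow> (nat \<Rightarrow> nat \<Rightarrow> nat) \<Rightarrow> (nat \<Rightarrow> nat) \<Rightarrow> nat \<Rightarrow> nat" where
  "next_vertex N w D x = (GREATEST y. y < N \<and> 0 < w x y \<and> D x = w x y + D y)"

definition tight_path :: "nat \<Rightarrow> (nat \<Rightarrow> nat \<Rightarrow> nat) \<Rightarrow> (nat \<Rightarrow> nat) \<Rightarrow> nat \<Rightarrow> (nat \<Rightarrow> nat) \<Rightarrow> nat \<Rightarrow> bool" where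
  "tight_path N w D z p m \<longleftrightarrow> p m = z \<and> (\<forall>i\<le>m. p i < N) \<and>
     (\<forall>i<m. 0 < w (p i) (p (Suc i)) \<and> D (p i) = w (p i) (p (Suc i)) + D (p (Suc i)))"

text \<open>Induction along the tight arcs of \<open>D'\<close>, on which \<open>D'\<close>
  decreases because weights are positive. Used in both directions it shows that potentials are
  unique on the vertices.\<close>

lemma potential_le:
  assumes D: "potential N w z c D" and D': "potential N w z c D'" and v: "v < N"
  shows "D v \<le> D' v"
  using v
proof (induction "D' v" arbitrary: v rule: less_induct)
  case less
  consider "v = z" | "c \<le> D' v" | "v \<noteq> z" "D' v < c" by linarith
  then show ?case
  proof cases
    case 1 then show ?thesis using D by (simp add: potential_def)
  next
    case 2 then show ?thesis using D less.prems by (auto simp: potential_def intro: le_trans)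
  next
    case 3
    then obtain y where y: "y < N" "0 < w v y" "D' v = w v y + D' y"
      using D' less.prems unfolding potential_def by blast
    then have "D y \<le> D' y" by (intro less.hyps) auto
    moreover have "D v \<le> w v y + D y" using D y less.prems by (simp add: potential_def)
    ultimately show ?thesis using y by simp
  qed
qed

lemma potential_unique:
  "potential N w z c D \<Longrightarrow> potential N w z c D' \<Longrightarrow> v < N \<Longrightarrow> D v = D' v"
  by (intro antisym potential_le)

lemma potential_walk:
  assumes D: "potential N w z c D" and "(x, z) \<in> R ^^ m"
    and R: "\<And>u v. (u, v) \<in> R \<Longrightarrow> u < N \<and> v < N \<and> 0 < w u v \<and> w u v \<le> B"
  shows "D x \<le> B * m"
  using assms(2)
proof (induction m arbitrary: x)
  case 0
  then show ?case using D by (simp add: potential_def)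
next
  case (Suc m)
  from relpow_Suc_D2[OF Suc.prems] obtain y where y: "(x, y) \<in> R" "(y, z) \<in> R ^^ m" by blast
  then have "D x \<le> w x y + D y" "w x y \<le> B" using D R[OF y(1)] by (auto simp: potential_def)
  then show ?case using Suc.IH[OF y(2)] by simp
qed

text \<open>A connecting walk needs at most \<open>card R\<close> arcs, which is at most
  \<open>N * N\<close>. So a number \<open>c\<close> beyond \<open>B * (N * N)\<close> exceeds all
  true distances and can serve as infinity.\<close>

lemma potential_reach:
  assumes D: "potential N w z c D" and "(x, z) \<in> R\<^sup>*"
    and R: "\<And>u v. (u, v) \<in> R \<Longrightarrow> u < N \<and> v < N \<and> 0 < w u v \<and> w u v \<le> B"
    and "B * (N * N) < c"
  shows "D x < c"
proof -
  have sub: "R \<subseteq> {..<N} \<times> {..<N}" using R by auto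
  then have fin: "finite R" by (rule finite_subset) simp
  obtain m where m: "(x, z) \<in> R ^^ m" "m \<le> card R"
    using assms(2) relpow_finite_bounded[OF fin] unfolding rtrancl_power by fastforce
  have "card R \<le> N * N" using card_mono[OF _ sub] by simp
  then have "B * m \<le> B * (N * N)" using m(2) by (intro mult_left_mono) auto
  with potential_walk[OF D m(1) R] assms(4) show ?thesis by linarith
qed

lemma potential_imp_reach:
  assumes D: "potential N w z c D" and "x < N" and "D x < c"
  shows "(x, z) \<in> {(u, v). u < N \<and> v < N \<and> 0 < w u v}\<^sup>*"
  using assms(2,3)
proof (induction "D x" arbitrary: x rule: less_induct)
  case less
  show ?case
  proof (cases "x = z")
    case False
    then obtain y where y: "y < N" "0 < w x y" "D x = w x y + D y"
      using D less.prems unfolding potential_def by blast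
    then have "(y, z) \<in> {(u, v). u < N \<and> v < N \<and> 0 < w u v}\<^sup>*"
      using less.prems by (intro less.hyps) auto
    moreover have "(x, y) \<in> {(u, v). u < N \<and> v < N \<and> 0 < w u v}" using y less.prems by simp
    ultimately show ?thesis by (rule converse_rtrancl_into_rtrancl[rotated])
  qed simp
qed

lemma tight_path_decreasing:
  assumes "tight_path N w D z p m" and "i < j" and "j \<le> m"
  shows "D (p j) < D (p i)"
  using assms(2,3)
proof (induction j)
  case (Suc j)
  have "D (p (Suc j)) < D (p j)" using assms(1) Suc.prems by (auto simp: tight_path_def)
  then show ?case using Suc by (cases "i = j") auto
qed simp

lemma tight_path_inj:
  assumes p: "tight_path N w D z p m" shows "inj_on p {..m}"
proof (rule inj_onI)
  fix i j assume ij: "i \<in> {..m}" "j \<in> {..m}" "p i = p j"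
  have "\<not> i < j" "\<not> j < i"
    using tight_path_decreasing[OF p, of i j] tight_path_decreasing[OF p, of j i] ij by auto
  then show "i = j" by simp
qed

text \<open>
  Distances are assigned in increasing order; the loop for distance \<open>d\<close> has treated all pairs that
  are lexicographically smaller than \<open>(u, v)\<close>.
\<close>

definition sp_inv :: "nat \<Rightarrow> (nat \<Rightarrow> nat \<Rightarrow> nat) \<Rightarrow> nat \<Rightarrow> nat \<Rightarrow> nat \<Rightarrow> nat \<Rightarrow> nat \<Rightarrow> (nat \<Rightarrow> nat) \<Rightarrow> bool" where
  "sp_inv N w z c d u v D \<longleftrightarrow> D z = 0 \<and>
     (\<forall>a<N. a \<noteq> z \<longrightarrow> D a = c \<or> D a \<le> d) \<and>
     (\<forall>a<N. a \<noteq> z \<longrightarrow> D a < c \<longrightarrow> (\<exists>b<N. 0 < w a b \<and> D a = w a b + D b)) \<and>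
     (\<forall>a<N. \<forall>b<N. 0 < w a b \<longrightarrow>
        w a b + D b < d \<or> w a b + D b = d \<and> (a < u \<or> a = u \<and> b < v) \<longrightarrow> D a \<le> w a b + D b)"

lemma sp_inv_hit:
  assumes I: "sp_inv N w z c d u v D" and uv: "u < N" "v < N" "d < c"
    and hit: "D u = c" "0 < w u v" "w u v + D v = d"
  shows "sp_inv N w z c d u (Suc v) (D(u := d))"
proof -
  have I1: "D z = 0" "\<And>a. a < N \<Longrightarrow> a \<noteq> z \<Longrightarrow> D a = c \<or> D a \<le> d"
    and I2: "\<And>a. a < N \<Longrightarrow> a \<noteq> z \<Longrightarrow> D a < c \<Longrightarrow> \<exists>b<N. 0 < w a b \<and> D a = w a b + D b"
    and I3: "\<And>a b. a < N \<Longrightarrow> b < N \<Longrightarrow> 0 < w a b \<Longrightarrow>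
        w a b + D b < d \<or> w a b + D b = d \<and> (a < u \<or> a = u \<and> b < v) \<Longrightarrow> D a \<le> w a b + D b"
    using I unfolding sp_inv_def by blast+
  let ?D = "D(u := d)"
  have uz: "u \<noteq> z" using I1 uv hit by auto
  have "\<exists>b<N. 0 < w a b \<and> ?D a = w a b + ?D b" if a: "a < N" "a \<noteq> z" "?D a < c" for a
  proof (cases "a = u")
    case True
    then show ?thesis using hit uv by (intro exI[of _ v]) auto
  next
    case False
    then obtain b where "b < N" "0 < w a b" "D a = w a b + D b" using I2 a by auto
    moreover have "b \<noteq> u" using calculation hit a False by auto
    ultimately show ?thesis by (intro exI[of _ b]) (use False in auto)
  qed
  moreover have "?D a \<le> w a b + ?D b"
    if ab: "a < N" "b < N" "0 < w a b" "w a b + ?D b < d \<or> w a b + ?D b = d \<and> (a < u \<or> a = u \<and> b < Suc v)" for a b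
  proof (cases "b = u")
    case True then show ?thesis using ab by auto
  next
    case False
    show ?thesis
    proof (cases "a = u")
      case True
      then show ?thesis using I3[of a b] ab False hit uv by auto
    next
      case a: False
      then show ?thesis using I3[of a b] ab False by auto
    qed
  qed
  ultimately show ?thesis unfolding sp_inv_def using I1 uz by simp
qed

lemma sp_inv_miss:
  assumes I: "sp_inv N w z c d u v D" and uv: "u < N" "v < N" "d < c"
    and miss: "\<not> (D u = c \<and> 0 < w u v \<and> w u v + D v = d)"
  shows "sp_inv N w z c d u (Suc v) D"
proof -
  have I1: "D z = 0" "\<And>a. a < N \<Longrightarrow> a \<noteq> z \<Longrightarrow> D a = c \<or> D a \<le> d"
    and I3: "\<And>a b. a < N \<Longrightarrow> b < N \<Longrightarrow> 0 < w a b \<Longrightarrow>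
        w a b + D b < d \<or> w a b + D b = d \<and> (a < u \<or> a = u \<and> b < v) \<Longrightarrow> D a \<le> w a b + D b"
    using I unfolding sp_inv_def by blast+
  have "D a \<le> w a b + D b"
    if ab: "a < N" "b < N" "0 < w a b" "w a b + D b < d \<or> w a b + D b = d \<and> (a < u \<or> a = u \<and> b < Suc v)" for a b
  proof (cases "a = u \<and> b = v \<and> w a b + D b = d")
    case True
    then have "D u \<noteq> c" using miss ab by auto
    then show ?thesis using I1(1) I1(2)[of u] True uv by (cases "u = z") auto
  next
    case False
    then show ?thesis using I3[of a b] ab by (auto simp: less_Suc_eq)
  qed
  then show ?thesis using I unfolding sp_inv_def by simp
qed

lemma sp_inv_row: "sp_inv N w z c d u N D \<Longrightarrow> sp_inv N w z c d (Suc u) 0 D"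
  unfolding sp_inv_def by (simp add: less_Suc_eq)

lemma sp_inv_next: "sp_inv N w z c d N 0 D \<Longrightarrow> sp_inv N w z c (Suc d) 0 0 D"
  unfolding sp_inv_def by (simp add: less_Suc_eq le_Suc_eq) blast

lemma sp_inv_potential:
  assumes I: "sp_inv N w z c c 0 0 D" shows "potential N w z c D"
proof -
  have le: "D a \<le> c" if "a < N" for a using I that unfolding sp_inv_def by (cases "a = z") auto
  moreover have "D a \<le> w a b + D b" if "a < N" "b < N" "0 < w a b" for a b
    using I that le[of a] unfolding sp_inv_def by (cases "w a b + D b < c") auto
  ultimately show ?thesis using I unfolding sp_inv_def potential_def by simp
qed

section \<open>Programs that compute distances and follow a shortest path\<close>

abbreviation W_cell :: "aexp \<Rightarrow> aexp \<Rightarrow> aexp" where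
  "W_cell u v \<equiv> Cell ''W'' (Plus (Cell ''ro'' u) v)"

definition RELAX :: prg where
  "RELAX = PIf (Conj (Cell ''D'' (V ''u'') === V ''cap'') (Conj (pos_exp (W_cell (V ''u'') (V ''v'')))
       (Plus (W_cell (V ''u'') (V ''v'')) (Cell ''D'' (V ''v'')) === V ''d'')))
     (PStore ''D'' (V ''u'') (V ''d'')) PSkip"

text \<open>The content of \<open>cap\<close> doubles as infinity, and every smaller number is tried
  as a distance.\<close>

definition SP :: prg where
  "SP = PFor ''u'' ''Nv'' (PStore ''D'' (V ''u'') (V ''cap'')) ;; PStore ''D'' (V ''z'') (Lit 0) ;;
    PFor ''d'' ''cap'' (PFor ''u'' ''Nv'' (PFor ''v'' ''Nv'' RELAX))"

definition NEXT :: prg where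
  "NEXT = PFor ''v'' ''Nv'' (PIf (Conj (pos_exp (W_cell (V ''x'') (V ''v'')))
       (Cell ''D'' (V ''x'') === Plus (W_cell (V ''x'') (V ''v'')) (Cell ''D'' (V ''v''))))
     (''y'' :::= V ''v'') PSkip)"

definition FW :: prg where
  "FW = PStore ''PV'' (Lit 0) (V ''x'') ;; ''len'' :::= Lit 0 ;;
    PFor ''d'' ''cap'' (PIf (pos_exp (Cell ''D'' (V ''x'')))
      (NEXT ;; ''x'' :::= V ''y'' ;; ''len'' :::= Plus (V ''len'') (Lit 1) ;;
       PStore ''PV'' (V ''len'') (V ''x'')) PSkip)"

lemma writes_RELAX [simp]: "writes RELAX = {''D''}"
  and writes_NEXT [simp]: "writes NEXT = {''v'', ''y''}"
  by (auto simp: RELAX_def NEXT_def)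

lemma writes_SP [simp]: "writes SP = {''D'', ''u'', ''v'', ''d''}"
  and writes_FW [simp]: "writes FW = {''PV'', ''len'', ''d'', ''v'', ''y'', ''x''}"
  by (auto simp: SP_def FW_def)

lemma loops_ok_SP [simp]: "loops_ok SP" and loops_ok_FW [simp]: "loops_ok FW"
  by (simp_all add: SP_def FW_def) (simp_all add: RELAX_def NEXT_def)

abbreviation wpc :: "prg \<Rightarrow> (memory \<Rightarrow> bool) \<Rightarrow> memory \<Rightarrow> bool" where
  "wpc \<equiv> wp ''cap''"

text \<open>The array \<open>ro\<close> holds the offsets of the rows of the weight matrix.\<close>

definition sp_setup :: "nat \<Rightarrow> memory \<Rightarrow> bool" where
  "sp_setup N s \<longleftrightarrow> s ''Nv'' 0 = N \<and> N \<le> s ''cap'' 0 \<and> 0 < s ''cap'' 0 \<and> (\<forall>u<N. s ''ro'' u = u * N)"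

abbreviation weight :: "nat \<Rightarrow> memory \<Rightarrow> nat \<Rightarrow> nat \<Rightarrow> nat" where
  "weight N s u v \<equiv> s ''W'' (u * N + v)"

lemma wp_RELAX:
  assumes "sp_inv N (weight N s) z c d u v (s ''D'')" and "u < N" "v < N" "d < c"
    and "s ''u'' 0 = u" "s ''v'' 0 = v" "s ''d'' 0 = d" "s ''cap'' 0 = c" "s ''ro'' u = u * N"
  shows "wpc RELAX (\<lambda>r. sp_inv N (weight N s) z c d u (Suc v) (r ''D'')) s"
  unfolding RELAX_def using sp_inv_hit[OF assms(1-4)] sp_inv_miss[OF assms(1-4)] assms(5-) by auto

lemma wp_SP:
  assumes S: "sp_setup N s" and z: "s ''z'' 0 < N"
  shows "wpc SP (\<lambda>r. potential N (weight N s) (s ''z'' 0) (s ''cap'' 0) (r ''D'')) s"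
proof -
  let ?w = "weight N s" and ?c = "s ''cap'' 0" and ?z = "s ''z'' 0"
  have s: "s ''Nv'' 0 = N" "N \<le> ?c" "0 < ?c" "\<And>u. u < N \<Longrightarrow> s ''ro'' u = u * N"
    using S by (auto simp: sp_setup_def)
  let ?same = "\<lambda>r. \<forall>y. y \<notin> {''D'', ''u'', ''v'', ''d''} \<longrightarrow> r y = s y"
  show ?thesis
    unfolding SP_def
  proof (rule wp_seqI, rule wp_map[where f = "\<lambda>_. ?c"], goal_cases)
    case (4 r)
    show ?case
      unfolding wp_PSeq wp_PStore
    proof (rule wp_loop[where I = "\<lambda>d r. sp_inv N ?w ?z ?c d 0 0 (r ''D'')"], goal_cases)
      case 4
      have "r ''z'' 0 = ?z" using \<open>\<And>y. y \<noteq> ''D'' \<Longrightarrow> y \<noteq> ''u'' \<Longrightarrow> r y = s y\<close> by simp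
      then show ?case using \<open>r ''D'' = _\<close> s z by (simp add: sp_inv_def)
    next
      case (5 d q)
      have q: "?same q" "d < ?c" using 4(1) 5(1,4) by simp_all
      show ?case
      proof (rule wp_loop[where I = "\<lambda>u r. sp_inv N ?w ?z ?c d u 0 (r ''D'')"], goal_cases)
        case (5 u p)
        have p: "?same p" "p ''d'' 0 = d" "u < N" using q(1) 5(1,4) s \<open>q ''d'' 0 = d\<close> by simp_all
        show ?case
        proof (rule wp_loop[where I = "\<lambda>v r. sp_inv N ?w ?z ?c d u v (r ''D'')"], goal_cases)
          case (5 v o')
          have o: "?same o'" "o' ''d'' 0 = d" "v < N" "o' ''u'' 0 = u"
            using p 5(1,4) s \<open>p ''u'' 0 = u\<close> by simp_all
          then have "weight N o' = ?w" by simp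
          then show ?case using wp_RELAX[of N o' ?z ?c d u v] 5(2,3) o p(3) q(2) s by simp
        qed (use p s 5(2) in \<open>auto intro: sp_inv_row\<close>)
      qed (use q s 5(2) in \<open>auto intro: sp_inv_next\<close>)
    qed (use 4 s in \<open>auto intro: sp_inv_potential\<close>)
  qed (use s in auto)
qed

lemma next_vertexI:
  assumes "y < N" "0 < w x y" "D x = w x y + D y"
    and "\<And>y'. y' < N \<Longrightarrow> 0 < w x y' \<Longrightarrow> D x = w x y' + D y' \<Longrightarrow> y' \<le> y"
  shows "next_vertex N w D x = y"
  unfolding next_vertex_def using assms by (intro Greatest_equality) auto

lemma wp_NEXT:
  assumes S: "sp_setup N s" and x: "s ''x'' 0 < N"
    and b: "b < N" "0 < weight N s (s ''x'' 0) b" "s ''D'' (s ''x'' 0) = weight N s (s ''x'' 0) b + s ''D'' b"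
  shows "wpc NEXT (\<lambda>r. let y = r ''y'' 0 in y < N \<and> 0 < weight N s (s ''x'' 0) y \<and>
     s ''D'' (s ''x'' 0) = weight N s (s ''x'' 0) y + s ''D'' y \<and> next_vertex N (weight N s) (s ''D'') (s ''x'' 0) = y) s"
proof -
  let ?x = "s ''x'' 0"
  let ?T = "\<lambda>v. 0 < weight N s ?x v \<and> s ''D'' ?x = weight N s ?x v + s ''D'' v"
  have s: "s ''Nv'' 0 = N" "N \<le> s ''cap'' 0" "s ''ro'' ?x = ?x * N" using S x by (auto simp: sp_setup_def)
  show ?thesis
    unfolding NEXT_def
  proof (rule wp_loop[where I = "\<lambda>v q. (\<forall>a<v. ?T a \<longrightarrow> a \<le> q ''y'' 0) \<and>
      ((\<exists>a<v. ?T a) \<longrightarrow> q ''y'' 0 < v \<and> ?T (q ''y'' 0))"], goal_cases)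
    case (5 v q)
    have q: "q ''x'' 0 = ?x" "q ''ro'' ?x = ?x * N" "q ''W'' = s ''W''" "q ''D'' = s ''D''"
      using 5(4) s by simp_all
    show ?case
    proof (cases "?T v")
      case True
      then show ?thesis using q 5(3) by auto
    next
      case False
      have J: "(\<forall>a<Suc v. ?T a \<longrightarrow> a \<le> q ''y'' 0) \<and> ((\<exists>a<Suc v. ?T a) \<longrightarrow> q ''y'' 0 < Suc v \<and> ?T (q ''y'' 0))"
        using 5(2) False unfolding less_Suc_eq by blast
      have "bval (Conj (pos_exp (W_cell (V ''x'') (V ''v'')))
         (Cell ''D'' (V ''x'') === Plus (W_cell (V ''x'') (V ''v'')) (Cell ''D'' (V ''v'')))) q = False"
        using q 5(3) False by auto
      then show ?thesis using J by (simp only: wp_PIf if_False wp_PSkip)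
    qed
  next
    case (6 q)
    then have y: "q ''y'' 0 < N" "?T (q ''y'' 0)" "\<And>a. a < N \<Longrightarrow> ?T a \<Longrightarrow> a \<le> q ''y'' 0"
      using b s by auto
    then have "next_vertex N (weight N s) (s ''D'') ?x = q ''y'' 0" by (intro next_vertexI) auto
    then show ?case using y by (simp add: Let_def)
  qed (use s in simp_all)
qed

lemma wp_FW:
  assumes S: "sp_setup N s" and D: "potential N (weight N s) z (s ''cap'' 0) (s ''D'')"
    and x: "s ''x'' 0 < N" "s ''D'' (s ''x'' 0) < s ''cap'' 0"
  shows "wpc FW (\<lambda>r. tight_path N (weight N s) (s ''D'') z (r ''PV'') (r ''len'' 0) \<and>
      r ''PV'' 0 = s ''x'' 0 \<and>
      (\<forall>i\<le>r ''len'' 0. r ''PV'' i = (next_vertex N (weight N s) (s ''D'') ^^ i) (s ''x'' 0))) s"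
proof -
  let ?w = "weight N s" and ?c = "s ''cap'' 0" and ?D = "s ''D''" and ?x = "s ''x'' 0"
  let ?nx = "next_vertex N ?w ?D"
  have s: "s ''Nv'' 0 = N" "N \<le> ?c" "0 < ?c" "\<And>u. u < N \<Longrightarrow> s ''ro'' u = u * N"
    using S by (auto simp: sp_setup_def)
  \<comment> \<open>The last two conjuncts show that the walk arrives: each move lowers the distance
    by at least 1, so the number of moves never exceeds the initial distance, which is below the
    number of iterations.\<close>
  define I where "I d r \<longleftrightarrow> r ''PV'' 0 = ?x \<and> r ''x'' 0 = r ''PV'' (r ''len'' 0) \<and>
      (\<forall>i\<le>r ''len'' 0. r ''PV'' i = (?nx ^^ i) ?x \<and> r ''PV'' i < N) \<and>
      (\<forall>i<r ''len'' 0. 0 < ?w (r ''PV'' i) (r ''PV'' (Suc i)) \<and>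
         ?D (r ''PV'' i) = ?w (r ''PV'' i) (r ''PV'' (Suc i)) + ?D (r ''PV'' (Suc i))) \<and>
      ?D (r ''x'' 0) + r ''len'' 0 \<le> ?D ?x \<and> (?D (r ''x'' 0) = 0 \<or> r ''len'' 0 = d)" for d and r :: memory
  show ?thesis
    unfolding FW_def wp_PSeq wp_PStore
  proof (rule wp_loop[where I = I], goal_cases)
    case (3 i j r)
    have "I i (mem_write r ''d'' 0 j) = I i r" by (simp add: I_def)
    then show ?case using 3 by simp
  next
    case (5 d r)
    note I = 5(2)[unfolded I_def]
    have r: "r ''Nv'' = s ''Nv''" "r ''cap'' = s ''cap''" "r ''ro'' = s ''ro''" "r ''W'' = s ''W''"
      "r ''D'' = s ''D''" using 5(4) by simp_all
    let ?m = "r ''len'' 0" and ?y = "r ''x'' 0"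
    show ?case
    proof (cases "0 < ?D ?y")
      case False
      then have "?D ?y = 0" by simp
      moreover from this have "I (Suc d) r" using I unfolding I_def by auto
      ultimately show ?thesis using r by simp
    next
      case True
      have yN: "?y < N" and yc: "?D ?y < ?c" and md: "?m = d" using I True x by auto
      have "?y \<noteq> z" using True D by (auto simp: potential_def)
      then obtain b where b: "b < N" "0 < ?w ?y b" "?D ?y = ?w ?y b + ?D b"
        using D yN yc unfolding potential_def by blast
      have Sr: "sp_setup N r" using S r by (simp add: sp_setup_def)
      have "wpc (NEXT ;; ''x'' :::= V ''y'' ;; ''len'' :::= Plus (V ''len'') (Lit 1) ;;
          PStore ''PV'' (V ''len'') (V ''x'')) (I (Suc d)) r"
      proof (rule wp_seqI, rule wp_frame[OF wp_NEXT[OF Sr, of b]], goal_cases)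
        case (5 q)
        then have q: "q ''len'' = r ''len''" "q ''PV'' = r ''PV''" by simp_all
        have y': "q ''y'' 0 < N" "0 < ?w ?y (q ''y'' 0)" "?D ?y = ?w ?y (q ''y'' 0) + ?D (q ''y'' 0)" "?nx ?y = q ''y'' 0"
          using 5(1) r by (simp_all add: Let_def)
        show ?case using I y' md by (auto simp: I_def q less_Suc_eq le_Suc_eq)
      qed (use r b yN in simp_all)
      then show ?thesis using True r by simp
    qed
  next
    case (6 r)
    then have I: "I ?c r" by simp
    let ?y = "r ''x'' 0"
    have "?D ?y = 0" using I x unfolding I_def by linarith
    moreover have "?y < N" using I unfolding I_def by (metis order_refl)
    ultimately have "?y = z" using D s unfolding potential_def by fastforce
    then show ?case using I by (auto simp: I_def tight_path_def)
  qed (use x in \<open>simp_all add: I_def\<close>)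
qed

section \<open>Computing the reduction\<close>

definition arcs_of :: "nat \<Rightarrow> (nat \<Rightarrow> nat) \<Rightarrow> (nat \<times> nat) set" where
  "arcs_of N Z = {(u, v). u < N \<and> v < N \<and> 0 < Z (u * N + v)}"

definition set_of :: "nat \<Rightarrow> (nat \<Rightarrow> nat) \<Rightarrow> nat set" where
  "set_of N Z = {v. v < N \<and> 0 < Z v}"

lemma arcs_of_upd:
  assumes "u < N" and "v < N"
  shows "arcs_of N (Z(u * N + v := c)) =
    (if 0 < c then insert (u, v) (arcs_of N Z) else arcs_of N Z - {(u, v)})"
  using assms index_inject[of _ N _ u v] by (auto simp: arcs_of_def)

lemma arcs_of_cong:
  "(\<And>u v. u < N \<Longrightarrow> v < N \<Longrightarrow> Z (u * N + v) = Z' (u * N + v)) \<Longrightarrow> arcs_of N Z = arcs_of N Z'"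
  by (auto simp: arcs_of_def)

lemma arcs_of_subset: "arcs_of N Z \<subseteq> {..<N} \<times> {..<N}"
  by (auto simp: arcs_of_def)

lemma set_of_upd:
  "v < N \<Longrightarrow> set_of N (Z(v := c)) = (if 0 < c then insert v (set_of N Z) else set_of N Z - {v})"
  by (auto simp: set_of_def)

lemma div_bound: "y < n * n \<Longrightarrow> y div n < (n::nat)"
  by (simp add: less_mult_imp_div_less)

lemma mod_bound: "y < n * n \<Longrightarrow> y mod n < (n::nat)"
  by (cases "n = 0") auto

lemma split_graph_iff:
  assumes G: "G \<subseteq> {..<n} \<times> {..<n}"
  shows "(x, y) \<in> split_graph n G t \<longleftrightarrow> x < n * n \<and> x div n \<noteq> t \<and>
    (x mod n + 1 < n \<and> y = x + 1 \<or> (x div n, x mod n) \<in> G \<and> y = (x mod n) * n)"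
proof
  assume "(x, y) \<in> split_graph n G t"
  then show "x < n * n \<and> x div n \<noteq> t \<and>
      (x mod n + 1 < n \<and> y = x + 1 \<or> (x div n, x mod n) \<in> G \<and> y = (x mod n) * n)"
  proof (cases rule: split_graphE)
    case (chain u v)
    then have "x div n = u" "x mod n = v" by simp_all
    then show ?thesis using chain index_bound[of u n v] by simp
  next
    case (jump u v)
    then have "u < n" "v < n" using G by auto
    moreover from this have "x div n = u" "x mod n = v" using jump by simp_all
    ultimately show ?thesis using jump index_bound[of u n v] by simp
  qed
next
  assume *: "x < n * n \<and> x div n \<noteq> t \<and>
      (x mod n + 1 < n \<and> y = x + 1 \<or> (x div n, x mod n) \<in> G \<and> y = (x mod n) * n)"
  obtain u v where uv: "x div n = u" "x mod n = v" "x = u * n + v" using div_mult_mod_eq by metis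
  then have "u < n" using * div_bound[of x n] by simp
  moreover have "u \<noteq> t" "v + 1 < n \<and> y = u * n + v + 1 \<or> (u, v) \<in> G \<and> y = v * n"
    using * uv by simp_all
  ultimately show "(x, y) \<in> split_graph n G t" unfolding split_graph_def uv(3) by blast
qed

text \<open>
  The arrays \<open>DU\<close> and \<open>DV\<close> decompose the index \<open>u * n + v\<close> of the arc \<open>(u, v)\<close>, which is also a node of
  the split graph. The split graph has \<open>Nv = n * n\<close> nodes, and its matrices have \<open>NN\<close> entries.
\<close>

definition tables :: "nat \<Rightarrow> memory \<Rightarrow> bool" where
  "tables n s \<longleftrightarrow> 2 \<le> n \<and> s ''n'' 0 = n \<and> s ''nn'' 0 = n * n \<and> n * n \<le> s ''cap'' 0 \<and>
     (\<forall>u<n. s ''RO'' u = u * n) \<and> (\<forall>y<n * n. s ''DU'' y = y div n \<and> s ''DV'' y = y mod n)"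

text \<open>The last bound provides enough rounds for one target: at most \<open>2 ^ Suc k\<close>
  augmentations and \<open>k\<close> expansions.\<close>

definition tables2 :: "nat \<Rightarrow> memory \<Rightarrow> bool" where
  "tables2 n s \<longleftrightarrow> tables n s \<and> sp_setup (n * n) s \<and> s ''NN'' 0 = n * n * (n * n) \<and>
     n * n * (n * n) < s ''cap'' 0 \<and> 2 ^ Suc (s ''k'' 0) + s ''k'' 0 < s ''cap'' 0"

abbreviation table_cells :: "string set" where
  "table_cells \<equiv> {''n'', ''nn'', ''cap'', ''RO'', ''DU'', ''DV'', ''Nv'', ''ro'', ''NN'', ''k''}"

lemma tables2_cong:
  assumes "tables2 n s" and "\<And>y. y \<in> table_cells \<Longrightarrow> r y = s y"
  shows "tables2 n r"
proof -
  have "r ''n'' = s ''n''" "r ''nn'' = s ''nn''" "r ''cap'' = s ''cap''" "r ''RO'' = s ''RO''"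
    "r ''DU'' = s ''DU''" "r ''DV'' = s ''DV''" "r ''Nv'' = s ''Nv''" "r ''ro'' = s ''ro''"
    "r ''NN'' = s ''NN''" "r ''k'' = s ''k''" using assms(2) by simp_all
  then show ?thesis using assms(1) by (simp add: tables2_def tables_def sp_setup_def)
qed

lemma tables2_frame:
  "tables2 n s \<Longrightarrow> (\<And>y. y \<notin> X \<Longrightarrow> r y = s y) \<Longrightarrow> X \<inter> table_cells = {} \<Longrightarrow> tables2 n r"
  by (rule tables2_cong) blast+

lemma tables2_mem_write:
  assumes "x \<notin> table_cells"
  shows "tables2 n (mem_write q x i j) \<longleftrightarrow> tables2 n q"
proof
  show "tables2 n (mem_write q x i j) \<Longrightarrow> tables2 n q"
    by (erule tables2_frame[of _ _ "{x}"]) (use assms in simp_all)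
  show "tables2 n q \<Longrightarrow> tables2 n (mem_write q x i j)"
    by (erule tables2_frame[of _ _ "{x}"]) (use assms in simp_all)
qed

section \<open>The program that thins the arcs into one target\<close>

definition BUILD :: prg where
  "BUILD = PFor ''y'' ''NN'' (PStore ''B'' (V ''y'') (Lit 0)) ;;
    PFor ''y'' ''nn'' (PIf (Cell ''DU'' (V ''y'') === V ''t'') PSkip
      (PIf (pos_exp (Cell ''GA'' (V ''y'')))
         (PStore ''B'' (Plus (Cell ''ro'' (V ''y'')) (Cell ''RO'' (Cell ''DV'' (V ''y'')))) (Lit 1)) PSkip ;;
       PIf (Less (Plus (Cell ''DV'' (V ''y'')) (Lit 1)) (V ''n''))
         (PStore ''B'' (Plus (Cell ''ro'' (V ''y'')) (Plus (V ''y'') (Lit 1))) (Lit 1)) PSkip)) ;;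
    PFor ''y'' ''NN'' (PStore ''W'' (V ''y'') (Cell ''B'' (V ''y''))) ;;
    PFor ''y'' ''Nv'' (PStore ''SS'' (V ''y'') (Lit 0)) ;;
    PStore ''SS'' (Cell ''RO'' (V ''sv'')) (Lit 1) ;;
    ''j'' :::= Lit 0 ;; ''z'' :::= Cell ''RO'' (V ''t'')"

definition PICK :: prg where
  "PICK = ''f'' :::= Lit 0 ;;
    PFor ''u'' ''Nv'' (PIf (Conj (pos_exp (Cell ''SS'' (V ''u''))) (Less (Cell ''D'' (V ''u'')) (V ''cap'')))
      (''f'' :::= Lit 1 ;; ''x'' :::= V ''u'') PSkip)"

definition FLIP :: prg where
  "FLIP = PFor ''y'' ''len'' (
    PStore ''W'' (Plus (Cell ''ro'' (Cell ''PV'' (V ''y''))) (Cell ''PV'' (Plus (V ''y'') (Lit 1)))) (Lit 0) ;;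
    PStore ''W'' (Plus (Cell ''ro'' (Cell ''PV'' (Plus (V ''y'') (Lit 1)))) (Cell ''PV'' (V ''y''))) (Lit 1))"

definition EXPAND :: prg where
  "EXPAND = PFor ''u'' ''Nv'' (PIf (Cell ''D'' (V ''u'') === V ''cap'')
      (PFor ''v'' ''Nv'' (PIf (pos_exp (Cell ''B'' (Plus (Cell ''ro'' (V ''u'')) (V ''v''))))
         (PStore ''SS'' (V ''v'') (Lit 1)) PSkip) ;;
       PStore ''SS'' (V ''u'') (Lit 1)) PSkip) ;;
    PStore ''SS'' (V ''z'') (Lit 0) ;; ''j'' :::= Plus (V ''j'') (Lit 1)"

definition STEP :: prg where
  "STEP = SP ;; PICK ;; PIf (pos_exp (V ''f'')) (FW ;; FLIP) (PIf (Less (V ''j'') (V ''k'')) EXPAND PSkip)"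

definition REDUCE :: prg where
  "REDUCE = BUILD ;; PFor ''i'' ''cap'' STEP ;;
    PFor ''u'' ''n'' (PIf (pos_exp (Cell ''W'' (Plus (Cell ''ro'' (Plus (Cell ''RO'' (V ''u'')) (V ''t'')))
        (Cell ''RO'' (V ''t'')))))
      (PStore ''GA'' (Plus (Cell ''RO'' (V ''u'')) (V ''t'')) (Lit 0)) PSkip)"

lemma writes_BUILD [simp]: "writes BUILD = {''y'', ''B'', ''W'', ''SS'', ''j'', ''z''}"
  and writes_PICK [simp]: "writes PICK = {''f'', ''u'', ''x''}"
  and writes_FLIP [simp]: "writes FLIP = {''y'', ''W''}"
  and writes_EXPAND [simp]: "writes EXPAND = {''u'', ''v'', ''SS'', ''j''}"
  by (auto simp: BUILD_def PICK_def FLIP_def EXPAND_def)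

lemma writes_STEP [simp]: "writes STEP = {''D'', ''u'', ''v'', ''d'', ''f'', ''x'', ''PV'', ''len'', ''y'', ''W'', ''SS'', ''j''}"
  by (auto simp: STEP_def)

lemma writes_REDUCE [simp]: "writes REDUCE =
    {''D'', ''u'', ''v'', ''d'', ''f'', ''x'', ''PV'', ''len'', ''y'', ''W'', ''SS'', ''j'', ''B'', ''z'', ''i'', ''GA''}"
  by (auto simp: REDUCE_def)

lemma loops_ok_REDUCE [simp]: "loops_ok REDUCE"
  by (simp add: REDUCE_def STEP_def) (simp add: BUILD_def PICK_def FLIP_def EXPAND_def)

definition bits :: "nat \<Rightarrow> (nat \<Rightarrow> nat) \<Rightarrow> bool" where
  "bits N Z \<longleftrightarrow> (\<forall>u<N. \<forall>v<N. Z (u * N + v) \<le> 1)"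

lemma bits_upd: "bits N Z \<Longrightarrow> c \<le> 1 \<Longrightarrow> bits N (Z(i := c))"
  by (simp add: bits_def)

lemma wp_BUILD:
  assumes T: "tables2 n s" and sv: "s ''sv'' 0 < n" and t: "s ''t'' 0 < n"
  shows "wpc BUILD (\<lambda>r. arcs_of (n * n) (r ''B'') = split_graph n (arcs_of n (s ''GA'')) (s ''t'' 0) \<and>
      arcs_of (n * n) (r ''W'') = arcs_of (n * n) (r ''B'') \<and> bits (n * n) (r ''W'') \<and>
      set_of (n * n) (r ''SS'') = {s ''sv'' 0 * n} \<and> r ''j'' 0 = 0 \<and> r ''z'' 0 = s ''t'' 0 * n) s"
proof -
  let ?N = "n * n" and ?t = "s ''t'' 0" and ?G = "arcs_of n (s ''GA'')"
  have s: "2 \<le> n" "s ''n'' 0 = n" "s ''nn'' 0 = ?N" "s ''Nv'' 0 = ?N" "s ''NN'' 0 = ?N * ?N"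
    "?N \<le> s ''cap'' 0" "?N * ?N \<le> s ''cap'' 0"
    "\<And>u. u < n \<Longrightarrow> s ''RO'' u = u * n" "\<And>u. u < ?N \<Longrightarrow> s ''ro'' u = u * ?N"
    "\<And>y. y < ?N \<Longrightarrow> s ''DU'' y = y div n" "\<And>y. y < ?N \<Longrightarrow> s ''DV'' y = y mod n"
    using T by (auto simp: tables2_def tables_def sp_setup_def)
  let ?E = "split_graph n ?G ?t"
  have Eiff: "(x, y) \<in> ?E \<longleftrightarrow> x < ?N \<and> x div n \<noteq> ?t \<and>
    (x mod n + 1 < n \<and> y = x + 1 \<or> 0 < s ''GA'' x \<and> y = (x mod n) * n)" for x y
  proof -
    have "(x div n, x mod n) \<in> ?G \<longleftrightarrow> 0 < s ''GA'' x" if "x < ?N"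
      using that div_bound[OF that] mod_bound[OF that] by (simp add: arcs_of_def)
    then show ?thesis using split_graph_iff[OF arcs_of_subset] by blast
  qed
  show ?thesis
    unfolding BUILD_def
  proof (rule wp_seqI, rule wp_map[where f = "\<lambda>_. 0"], goal_cases)
    case (4 r)
    then have r: "r ''n'' = s ''n''" "r ''nn'' = s ''nn''" "r ''Nv'' = s ''Nv''" "r ''NN'' = s ''NN''"
      "r ''cap'' = s ''cap''" "r ''RO'' = s ''RO''" "r ''ro'' = s ''ro''" "r ''DU'' = s ''DU''"
      "r ''DV'' = s ''DV''" "r ''GA'' = s ''GA''" "r ''t'' = s ''t''" "r ''sv'' = s ''sv''" by simp_all
    have B0: "arcs_of ?N (r ''B'') = {}" "bits ?N (r ''B'')"
      using 4(2) s index_bound[of _ ?N] by (auto simp: arcs_of_def bits_def)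
    show ?case
    proof (rule wp_seqI, rule wp_loop[where I = "\<lambda>i q. arcs_of ?N (q ''B'') = {(x, y) \<in> ?E. x < i} \<and>
        bits ?N (q ''B'')"], goal_cases)
      case (5 i q)
      then have q: "q ''n'' 0 = n" "q ''t'' 0 = ?t" "q ''GA'' = s ''GA''" "i < ?N"
        "q ''DU'' i = i div n" "q ''DV'' i = i mod n" "q ''ro'' i = i * ?N" "q ''y'' 0 = i"
        using r s by simp_all
      have m: "i mod n < n" by (rule mod_bound[OF q(4)])
      then have RO: "q ''RO'' (i mod n) = (i mod n) * n" using 5 r s by simp
      have lt: "(i mod n) * n < ?N" using m by simp
      have lt2: "i + 1 < ?N" if "i mod n + 1 < n"
        using index_bound[OF div_bound[OF q(4)] that] by simp
      have Esub: "{(x, y) \<in> ?E. x < Suc i} = {(x, y) \<in> ?E. x < i} \<union> {(i, y) |y. (i, y) \<in> ?E}"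
        by (auto simp: less_Suc_eq)
      have B: "arcs_of ?N (q ''B'') = {(x, y) \<in> ?E. x < i}" "bits ?N (q ''B'')" using 5(2) by simp_all
      show ?case
      proof (cases "i div n = ?t")
        case True
        then have "{(i, y) |y. (i, y) \<in> ?E} = {}" by (simp add: Eiff)
        then show ?thesis using True B q unfolding Esub by simp
      next
        case False
        have 1: "{(i, y) |y. (i, y) \<in> ?E} =
            (if 0 < s ''GA'' i then {(i, (i mod n) * n)} else {}) \<union> (if i mod n + 1 < n then {(i, i + 1)} else {})"
          using False q by (auto simp: Eiff)
        show ?thesis
          using False B q RO lt lt2 arcs_of_upd[OF q(4) lt] arcs_of_upd[OF q(4) lt2]
          unfolding Esub 1 by (auto simp: bits_upd)
      qed
    next
      case (6 q)
      then have q: "q ''n'' = s ''n''" "q ''Nv'' = s ''Nv''" "q ''NN'' = s ''NN''"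
        "q ''cap'' = s ''cap''" "q ''RO'' = s ''RO''" "q ''t'' = s ''t''" "q ''sv'' = s ''sv''" using r by simp_all
      have "{(x, y) \<in> ?E. x < r ''nn'' 0} = ?E" using r(2) s(3) by (auto simp: Eiff)
      then have B: "arcs_of ?N (q ''B'') = ?E" "bits ?N (q ''B'')" using 6(1) by simp_all
      show ?case
      proof (rule wp_seqI, rule wp_map[where f = "q ''B''"], goal_cases)
        case (4 p)
        then have p: "p ''n'' = s ''n''" "p ''Nv'' = s ''Nv''" "p ''B'' = q ''B''"
          "p ''cap'' = s ''cap''" "p ''RO'' = s ''RO''" "p ''t'' = s ''t''" "p ''sv'' = s ''sv''" using q by simp_all
        have "p ''W'' (u * ?N + v) = q ''B'' (u * ?N + v)" if "u < ?N" "v < ?N" for u v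
          using 4(2) q s index_bound[OF that] by simp
        then have W: "arcs_of ?N (p ''W'') = ?E" "bits ?N (p ''W'')"
          using B arcs_of_cong[of ?N "p ''W''" "q ''B''"] by (auto simp: bits_def)
        show ?case
        proof (rule wp_seqI, rule wp_map[where f = "\<lambda>_. 0"], goal_cases)
          case (4 o')
          have lt: "s ''sv'' 0 * n < ?N" using sv by simp
          have "set_of ?N (o' ''SS'') = {}" using 4(2) p(2) s(4) by (simp add: set_of_def)
          moreover have "o' ''RO'' = s ''RO''" "o' ''sv'' = s ''sv''" "o' ''t'' = s ''t''" "o' ''W'' = p ''W''" "o' ''B'' = p ''B''"
            using 4(1) p by simp_all
          moreover have "s ''RO'' (s ''sv'' 0) = s ''sv'' 0 * n" "s ''RO'' (s ''t'' 0) = s ''t'' 0 * n"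
            using s(8) sv t by simp_all
          ultimately show ?case using set_of_upd[OF lt] W B(1) p(3,5,6,7) by simp
        qed (use p s in simp_all)
      qed (use q s in simp_all)
    qed (use r s B0 in simp_all)
  qed (use s in simp_all)
qed

lemma wp_PICK:
  assumes "s ''Nv'' 0 = N" and "N \<le> s ''cap'' 0"
  shows "wpc PICK (\<lambda>r. if r ''f'' 0 = 0 then \<forall>u\<in>set_of N (s ''SS''). s ''cap'' 0 \<le> s ''D'' u
      else r ''x'' 0 \<in> set_of N (s ''SS'') \<and> s ''D'' (r ''x'' 0) < s ''cap'' 0) s"
  unfolding PICK_def
proof (simp only: wp_PSeq wp_PStore, rule wp_loop[where I = "\<lambda>i r.
    (r ''f'' 0 = 0 \<longrightarrow> (\<forall>u. u < i \<longrightarrow> u \<in> set_of N (s ''SS'') \<longrightarrow> s ''cap'' 0 \<le> s ''D'' u)) \<and>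
    (r ''f'' 0 \<noteq> 0 \<longrightarrow> r ''x'' 0 \<in> set_of N (s ''SS'') \<and> s ''D'' (r ''x'' 0) < s ''cap'' 0)"], goal_cases)
  case (5 i r)
  then have r: "r ''SS'' = s ''SS''" "r ''D'' = s ''D''" "r ''cap'' = s ''cap''" "r ''u'' 0 = i" "i < N"
    using assms by simp_all
  show ?case
  proof (cases "0 < s ''SS'' i \<and> s ''D'' i < s ''cap'' 0")
    case True
    then show ?thesis using r by (simp add: set_of_def)
  next
    case False
    then have "i \<in> set_of N (s ''SS'') \<Longrightarrow> s ''cap'' 0 \<le> s ''D'' i" by (auto simp: set_of_def)
    then have "(r ''f'' 0 = 0 \<longrightarrow> (\<forall>u. u < Suc i \<longrightarrow> u \<in> set_of N (s ''SS'') \<longrightarrow> s ''cap'' 0 \<le> s ''D'' u)) \<and>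
      (r ''f'' 0 \<noteq> 0 \<longrightarrow> r ''x'' 0 \<in> set_of N (s ''SS'') \<and> s ''D'' (r ''x'' 0) < s ''cap'' 0)"
      using 5(2) less_Suc_eq by metis
    then show ?thesis using False r by (cases "s ''SS'' i = 0") simp_all
  qed
next
  case (6 r)
  then show ?case using assms by (auto simp: set_of_def)
qed (use assms in auto)

lemma wp_FLIP:
  assumes S: "sp_setup N s" and p: "\<And>i. i \<le> s ''len'' 0 \<Longrightarrow> s ''PV'' i < N"
    and len: "s ''len'' 0 \<le> s ''cap'' 0" and b: "bits N (s ''W'')"
  shows "wpc FLIP (\<lambda>r. arcs_of N (r ''W'') = flip_path (arcs_of N (s ''W'')) (s ''PV'') (s ''len'' 0) \<and>
     bits N (r ''W'')) s"
  unfolding FLIP_def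
proof (rule wp_loop[where I = "\<lambda>i r. arcs_of N (r ''W'') = flip_path (arcs_of N (s ''W'')) (s ''PV'') i \<and>
     bits N (r ''W'')"], goal_cases)
  case (5 i r)
  then have r: "r ''PV'' = s ''PV''" "r ''ro'' = s ''ro''" "r ''y'' 0 = i" by simp_all
  have pi: "s ''PV'' i < N" "s ''PV'' (Suc i) < N" using p[of i] p[of "Suc i"] 5(1) by simp_all
  have ro: "s ''ro'' (s ''PV'' i) = s ''PV'' i * N" "s ''ro'' (s ''PV'' (Suc i)) = s ''PV'' (Suc i) * N"
    using S pi by (auto simp: sp_setup_def)
  show ?case using 5(2) r ro arcs_of_upd[OF pi] arcs_of_upd[OF pi(2,1)] by (simp add: bits_upd)
qed (use len b in auto)

lemma wp_EXPAND:
  assumes S: "sp_setup N s" and z: "s ''z'' 0 < N"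
  shows "wpc EXPAND (\<lambda>r. set_of N (r ''SS'') =
      set_of N (s ''SS'') \<union> {u. u < N \<and> s ''D'' u = s ''cap'' 0} \<union>
      {v. \<exists>u. s ''D'' u = s ''cap'' 0 \<and> (u, v) \<in> arcs_of N (s ''B'')} - {s ''z'' 0} \<and>
      r ''j'' 0 = Suc (s ''j'' 0)) s"
proof -
  let ?c = "s ''cap'' 0" and ?D = "s ''D''" and ?E = "arcs_of N (s ''B'')"
  have s: "s ''Nv'' 0 = N" "N \<le> ?c" "\<And>u. u < N \<Longrightarrow> s ''ro'' u = u * N"
    using S by (auto simp: sp_setup_def)
  let ?P = "\<lambda>i. set_of N (s ''SS'') \<union> {u. u < i \<and> ?D u = ?c} \<union> {v. \<exists>u<i. ?D u = ?c \<and> (u, v) \<in> ?E}"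
  show ?thesis
    unfolding EXPAND_def
  proof (rule wp_seqI, rule wp_loop[where I = "\<lambda>i r. set_of N (r ''SS'') = ?P i"], goal_cases)
    case (5 i r)
    then have r: "r ''D'' = ?D" "r ''cap'' = s ''cap''" "r ''u'' 0 = i" "i < N" "r ''Nv'' 0 = N"
      "r ''ro'' i = i * N" "r ''B'' = s ''B''"
      using s by simp_all
    show ?case
    proof (cases "?D i = ?c")
      case False
      then have "?P (Suc i) = ?P i" by (auto simp: less_Suc_eq)
      then show ?thesis using False 5(2) r by auto
    next
      case True
      have "wpc (PFor ''v'' ''Nv'' (PIf (pos_exp (Cell ''B'' (Plus (Cell ''ro'' (V ''u'')) (V ''v''))))
          (PStore ''SS'' (V ''v'') (Lit 1)) PSkip))
        (wpc (PStore ''SS'' (V ''u'') (Lit 1)) (\<lambda>r. set_of N (r ''SS'') = ?P (Suc i))) r"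
      proof (rule wp_loop[where I = "\<lambda>j q. set_of N (q ''SS'') = ?P i \<union> {v. v < j \<and> (i, v) \<in> ?E}"], goal_cases)
        case (5 j q)
        then have q: "q ''v'' 0 = j" "j < N" "q ''u'' 0 = i" "q ''ro'' i = i * N" "q ''B'' = s ''B''"
          using r by simp_all
        show ?case
        proof (cases "(i, j) \<in> ?E")
          case True
          then have "{v. v < Suc j \<and> (i, v) \<in> ?E} = insert j {v. v < j \<and> (i, v) \<in> ?E}"
            by (auto simp: less_Suc_eq)
          moreover have "0 < s ''B'' (i * N + j)" using True by (simp add: arcs_of_def)
          ultimately show ?thesis using q 5(2) by (simp add: set_of_upd)
        next
          case False
          then have "{v. v < Suc j \<and> (i, v) \<in> ?E} = {v. v < j \<and> (i, v) \<in> ?E}"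
            by (auto simp: less_Suc_eq)
          moreover have "s ''B'' (i * N + j) = 0" using False q r by (simp add: arcs_of_def)
          ultimately show ?thesis using q 5(2) by simp
        qed
      next
        case (6 q)
        have "{v. v < N \<and> (i, v) \<in> ?E} = {v. (i, v) \<in> ?E}" using arcs_of_subset by blast
        moreover have "q ''u'' 0 = i" using 6 r by simp
        moreover have "?P (Suc i) = insert i (?P i \<union> {v. (i, v) \<in> ?E})"
          using True by (auto simp: less_Suc_eq)
        ultimately show ?case using 6(1) r by (simp add: set_of_upd)
      qed (use r s \<open>set_of N (r ''SS'') = ?P i\<close> in simp_all)
      then show ?thesis using True r by simp
    qed
  next
    case (6 r)
    then have "r ''z'' 0 = s ''z'' 0" "r ''j'' 0 = s ''j'' 0" by simp_all
    moreover have "{v. \<exists>u<N. ?D u = ?c \<and> (u, v) \<in> ?E} = {v. \<exists>u. ?D u = ?c \<and> (u, v) \<in> ?E}"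
      using arcs_of_subset by blast
    ultimately show ?case using 6(1) s z by (simp add: set_of_upd)
  qed (use s in simp_all)
qed

section \<open>A single round: augmentation, expansion or standstill\<close>

context
  fixes n :: nat and E :: "(nat \<times> nat) set" and a z :: nat
  assumes net: "network {..<n * n} E a z"
begin

interpretation network "{..<n * n}" E a z
  by (rule net)

definition step_inv :: "nat \<Rightarrow> memory \<Rightarrow> bool" where
  "step_inv f r \<longleftrightarrow> tables2 n r \<and> arcs_of (n * n) (r ''B'') = E \<and> r ''z'' 0 = z \<and> bits (n * n) (r ''W'') \<and>
     r ''j'' 0 \<le> r ''k'' 0 \<and> residual (set_of (n * n) (r ''SS'')) (r ''j'' 0) f (arcs_of (n * n) (r ''W''))"

definition step_final :: "memory \<Rightarrow> bool" where
  "step_final r \<longleftrightarrow> r ''j'' 0 = r ''k'' 0 \<and>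
     set_of (n * n) (r ''SS'') \<subseteq> blocked (arcs_of (n * n) (r ''W''))"

text \<open>Progress is measured by the value of the flow plus the number of expansions: each round
  raises one of them by 1 unless the final state is reached, and that state persists.\<close>

lemma wp_STEP:
  assumes I: "step_inv f r"
  shows "wpc STEP (\<lambda>q. \<exists>f'. step_inv f' q \<and> (Suc (f + r ''j'' 0) \<le> f' + q ''j'' 0 \<or> step_final q) \<and>
     (step_final r \<longrightarrow> step_final q)) r"
proof -
  let ?N = "n * n" and ?c = "r ''cap'' 0" and ?S = "set_of (n * n) (r ''SS'')"
    and ?R = "arcs_of (n * n) (r ''W'')" and ?j = "r ''j'' 0" and ?k = "r ''k'' 0"
  have T: "tables2 n r" and B: "arcs_of ?N (r ''B'') = E" and z: "r ''z'' 0 = z"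
    and b: "bits ?N (r ''W'')" and jk: "?j \<le> ?k" and R: "residual ?S ?j f ?R"
    using I by (auto simp: step_inv_def)
  have su: "sp_setup ?N r" using T by (simp add: tables2_def)
  have r: "r ''Nv'' 0 = ?N" "?N \<le> ?c" "?N * ?N < ?c" using T by (auto simp: tables2_def sp_setup_def)
  have zN: "z < ?N" using z_in by simp
  have wpos: "{(u, v). u < ?N \<and> v < ?N \<and> 0 < weight ?N r u v} = ?R" by (simp add: arcs_of_def)
  show ?thesis
    unfolding STEP_def
  proof (rule wp_seqI, rule wp_frame[OF wp_SP[OF su]], simp add: z zN)
    fix q assume P: "potential ?N (weight ?N r) (r ''z'' 0) ?c (q ''D'')"
      and fr: "\<And>y. y \<notin> writes SP \<Longrightarrow> q y = r y"
    have Tq: "tables2 n q" by (rule tables2_frame[OF T, of "writes SP"]) (simp_all add: fr)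
    from fr have q: "q ''Nv'' = r ''Nv''" "q ''cap'' = r ''cap''" "q ''SS'' = r ''SS''" "q ''W'' = r ''W''"
      "q ''j'' = r ''j''" "q ''k'' = r ''k''" "q ''B'' = r ''B''" "q ''z'' = r ''z''" "q ''ro'' = r ''ro''" by simp_all
    have P': "potential ?N (weight ?N r) z ?c (q ''D'')" using P z by simp
    have lt: "q ''D'' x < ?c \<longleftrightarrow> (x, z) \<in> ?R\<^sup>*" if "x < ?N" for x
    proof
      show "(x, z) \<in> ?R\<^sup>*" if "q ''D'' x < ?c"
        using potential_imp_reach[OF P' \<open>x < ?N\<close> that] wpos by simp
      show "q ''D'' x < ?c" if "(x, z) \<in> ?R\<^sup>*"
        using that
      proof (rule potential_reach[OF P', where B = 1])
        fix u v assume "(u, v) \<in> ?R"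
        then show "u < ?N \<and> v < ?N \<and> 0 < weight ?N r u v \<and> weight ?N r u v \<le> 1"
          using b by (simp add: arcs_of_def bits_def)
      qed (use r in simp)
    qed
    have Dle: "q ''D'' x \<le> ?c" if "x < ?N" for x using P' that by (simp add: potential_def)
    have bl: "blocked ?R = {x. x < ?N \<and> q ''D'' x = ?c}"
      unfolding blocked_def using lt Dle by (auto simp: less_le)
    show "wpc (PICK ;; PIf (pos_exp (V ''f'')) (FW ;; FLIP) (PIf (Less (V ''j'') (V ''k'')) EXPAND PSkip))
       (\<lambda>q. \<exists>f'. step_inv f' q \<and> (Suc (f + ?j) \<le> f' + q ''j'' 0 \<or> step_final q) \<and>
         (step_final r \<longrightarrow> step_final q)) q"
    proof (rule wp_seqI, rule wp_frame[OF wp_PICK[of q ?N]])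
      fix p
      assume pick: "if p ''f'' 0 = 0 then \<forall>u\<in>set_of ?N (q ''SS''). q ''cap'' 0 \<le> q ''D'' u
          else p ''x'' 0 \<in> set_of ?N (q ''SS'') \<and> q ''D'' (p ''x'' 0) < q ''cap'' 0"
        and fr: "\<And>y. y \<notin> writes PICK \<Longrightarrow> p y = q y"
      have Tp: "tables2 n p" by (rule tables2_frame[OF Tq, of "writes PICK"]) (simp_all add: fr)
      from fr have p: "p ''Nv'' = r ''Nv''" "p ''cap'' = r ''cap''" "p ''SS'' = r ''SS''" "p ''W'' = r ''W''"
        "p ''j'' = r ''j''" "p ''k'' = r ''k''" "p ''B'' = r ''B''" "p ''z'' = r ''z''" "p ''D'' = q ''D''"
        "p ''ro'' = r ''ro''" using q by simp_all
      have sup: "sp_setup ?N p" using Tp by (simp add: tables2_def)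
      show "wpc (PIf (pos_exp (V ''f'')) (FW ;; FLIP) (PIf (Less (V ''j'') (V ''k'')) EXPAND PSkip))
        (\<lambda>q. \<exists>f'. step_inv f' q \<and> (Suc (f + ?j) \<le> f' + q ''j'' 0 \<or> step_final q) \<and>
         (step_final r \<longrightarrow> step_final q)) p"
      proof (cases "0 < p ''f'' 0")
        case True
        let ?x = "p ''x'' 0"
        have x: "?x \<in> ?S" "q ''D'' ?x < ?c" using pick True q by simp_all
        have nfin: "\<not> step_final r"
          using x bl by (auto simp: step_final_def)
        have "wpc FW (wpc FLIP (\<lambda>q. \<exists>f'. step_inv f' q \<and> (Suc (f + ?j) \<le> f' + q ''j'' 0 \<or> step_final q) \<and>
           (step_final r \<longrightarrow> step_final q))) p"
        proof (rule wp_frame[OF wp_FW[OF sup, of z]])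
          show "potential ?N (weight ?N p) z (p ''cap'' 0) (p ''D'')" using P' p by simp
          show "?x < ?N" using x by (simp add: set_of_def)
          show "p ''D'' ?x < p ''cap'' 0" using x p by simp
        next
          fix o'
          assume o1: "tight_path ?N (weight ?N p) (p ''D'') z (o' ''PV'') (o' ''len'' 0) \<and>
              o' ''PV'' 0 = ?x \<and> (\<forall>i\<le>o' ''len'' 0. o' ''PV'' i = (next_vertex ?N (weight ?N p) (p ''D'') ^^ i) ?x)"
            and fo: "\<And>y. y \<notin> writes FW \<Longrightarrow> o' y = p y"
          have To: "tables2 n o'" by (rule tables2_frame[OF Tp, of "writes FW"]) (simp_all add: fo)
          from fo have o: "o' ''Nv'' = r ''Nv''" "o' ''cap'' = r ''cap''" "o' ''SS'' = r ''SS''" "o' ''W'' = r ''W''"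
            "o' ''j'' = r ''j''" "o' ''k'' = r ''k''" "o' ''B'' = r ''B''" "o' ''z'' = r ''z''" using p by simp_all
          let ?p = "o' ''PV''" and ?m = "o' ''len'' 0"
          have tp: "tight_path ?N (weight ?N p) (p ''D'') z ?p ?m" and p0: "?p 0 = ?x" using o1 by auto
          have inj: "inj_on ?p {..?m}" by (rule tight_path_inj[OF tp])
          have pN: "?p i < ?N" if "i \<le> ?m" for i using tp that by (simp add: tight_path_def)
          have "card (?p ` {..?m}) \<le> card {..<?N}" using pN by (intro card_mono) auto
          then have "?m \<le> ?N" using inj by (simp add: card_image)
          have suo: "sp_setup ?N o'" using To by (simp add: tables2_def)
          show "wpc FLIP (\<lambda>q. \<exists>f'. step_inv f' q \<and> (Suc (f + ?j) \<le> f' + q ''j'' 0 \<or> step_final q) \<and>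
             (step_final r \<longrightarrow> step_final q)) o'"
          proof (rule wp_frame[OF wp_FLIP[OF suo pN]])
            show "?m \<le> o' ''cap'' 0" using \<open>?m \<le> ?N\<close> r o by simp
            show "bits ?N (o' ''W'')" using b o by simp
          next
            fix m
            assume m1: "arcs_of ?N (m ''W'') = flip_path (arcs_of ?N (o' ''W'')) ?p ?m \<and> bits ?N (m ''W'')"
              and fm: "\<And>y. y \<notin> writes FLIP \<Longrightarrow> m y = o' y"
            have Tm: "tables2 n m" by (rule tables2_frame[OF To, of "writes FLIP"]) (simp_all add: fm)
            from fm have m: "m ''SS'' = r ''SS''" "m ''j'' = r ''j''" "m ''k'' = r ''k''" "m ''B'' = r ''B''" "m ''z'' = r ''z''" using o by simp_all
            have "residual ?S ?j (Suc f) (flip_path ?R ?p ?m)"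
            proof (rule residual_augment[OF R inj])
              show "?p 0 \<in> ?S" using p0 x by simp
              show "?p ?m = z" using tp by (simp add: tight_path_def)
              fix i assume i: "i < ?m"
              then have "0 < weight ?N r (?p i) (?p (Suc i))" using tp p by (simp add: tight_path_def)
              then show "(?p i, ?p (Suc i)) \<in> ?R" using pN[of i] pN[of "Suc i"] i by (simp add: arcs_of_def)
            qed
            then have "step_inv (Suc f) m" using m1 m Tm B z jk o by (simp add: step_inv_def)
            then show "\<exists>f'. step_inv f' m \<and> (Suc (f + ?j) \<le> f' + m ''j'' 0 \<or> step_final m) \<and>
               (step_final r \<longrightarrow> step_final m)"
              using m nfin by (intro exI[of _ "Suc f"]) simp
          qed simp
        qed
        then show ?thesis using True by simp
      next
        case False
        then have S: "?S \<subseteq> blocked ?R"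
          using pick q Dle unfolding bl by (auto simp: set_of_def intro: antisym)
        show ?thesis
        proof (cases "?j < ?k")
          case True
          have "wpc EXPAND (\<lambda>q. \<exists>f'. step_inv f' q \<and> (Suc (f + ?j) \<le> f' + q ''j'' 0 \<or> step_final q) \<and>
              (step_final r \<longrightarrow> step_final q)) p"
          proof (rule wp_frame[OF wp_EXPAND[OF sup]])
            show "p ''z'' 0 < ?N" using p z zN by simp
          next
            fix m
            assume m1: "set_of ?N (m ''SS'') =
                set_of ?N (p ''SS'') \<union> {u. u < ?N \<and> p ''D'' u = p ''cap'' 0} \<union>
                {v. \<exists>u. p ''D'' u = p ''cap'' 0 \<and> (u, v) \<in> arcs_of ?N (p ''B'')} - {p ''z'' 0} \<and>
                m ''j'' 0 = Suc (p ''j'' 0)"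
              and fm: "\<And>y. y \<notin> writes EXPAND \<Longrightarrow> m y = p y"
            have Tm: "tables2 n m" by (rule tables2_frame[OF Tp, of "writes EXPAND"]) (simp_all add: fm)
            from fm m1 have m: "m ''W'' = r ''W''" "m ''k'' = r ''k''" "m ''B'' = r ''B''" "m ''z'' = r ''z''"
              "m ''j'' 0 = Suc ?j" using p by simp_all
            have "{v. \<exists>u. p ''D'' u = p ''cap'' 0 \<and> (u, v) \<in> arcs_of ?N (p ''B'')} =
                {y. \<exists>x\<in>blocked ?R. (x, y) \<in> E}"
              using E_subset unfolding bl p q B by auto
            moreover have "{u. u < ?N \<and> p ''D'' u = p ''cap'' 0} = blocked ?R" using bl p by simp
            moreover have "?S \<union> blocked ?R = blocked ?R" using S by blast
            ultimately have "set_of ?N (m ''SS'') = blocked ?R \<union> {y. \<exists>x\<in>blocked ?R. (x, y) \<in> E} - {z}"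
              using m1 p z by simp
            then have "residual (set_of ?N (m ''SS'')) (Suc ?j) f ?R" using residual_expand[OF R S] by simp
            then have "step_inv f m" using m Tm B z b True by (simp add: step_inv_def)
            then show "\<exists>f'. step_inv f' m \<and> (Suc (f + ?j) \<le> f' + m ''j'' 0 \<or> step_final m) \<and>
               (step_final r \<longrightarrow> step_final m)"
              using m True by (intro exI[of _ f]) (simp add: step_final_def)
          qed
          then show ?thesis using True False p by simp
        next
          case k: False
          then have "?j = ?k" using jk by simp
          moreover have "step_inv f p" using p Tp B z b jk R by (simp add: step_inv_def)
          ultimately have "step_inv f p \<and> step_final p" using p S by (simp add: step_final_def)
          then show ?thesis using False k p by auto
        qed
      qed
    qed (use q r in simp_all)
  qed
qed

end

lemma wp_REDUCE:
  assumes T: "tables2 n s" and sv: "s ''sv'' 0 < n" and t: "s ''t'' 0 < n" "s ''t'' 0 \<noteq> s ''sv'' 0"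
    and loop: "\<And>u. (u, u) \<notin> arcs_of n (s ''GA'')"
  shows "wpc REDUCE (\<lambda>r. reach_preserver (s ''k'' 0) (s ''sv'' 0) (arcs_of n (s ''GA'')) (arcs_of n (r ''GA'')) \<and>
     arcs_of n (r ''GA'') \<subseteq> arcs_of n (s ''GA'') \<and>
     arcs_of n (s ''GA'') - arcs_of n (r ''GA'') \<subseteq> UNIV \<times> {s ''t'' 0} \<and>
     card {u. (u, s ''t'' 0) \<in> arcs_of n (r ''GA'')} \<le> 2 ^ Suc (s ''k'' 0)) s"
proof -
  let ?N = "n * n" and ?t = "s ''t'' 0" and ?v = "s ''sv'' 0" and ?G = "arcs_of n (s ''GA'')" and ?k = "s ''k'' 0"
  let ?E = "split_graph n ?G ?t"
  have net: "network {..<?N} ?E (?v * n) (?t * n)"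
    using loop sv t by (intro network_split[OF arcs_of_subset]) auto
  note red = split_reduction[OF arcs_of_subset loop sv t(1) t(2)[symmetric]]
  interpret network "{..<?N}" ?E "?v * n" "?t * n" by (rule net)
  have s: "?N \<le> s ''cap'' 0" "s ''n'' 0 = n"
    using T by (auto simp: tables2_def tables_def)
  have "n \<le> ?N" by simp
  then have nc: "n \<le> s ''cap'' 0" using s by linarith
  show ?thesis
    unfolding REDUCE_def
  proof (rule wp_seqI, rule wp_frame[OF wp_BUILD[OF T sv t(1)]])
    fix r
    assume r1: "arcs_of ?N (r ''B'') = ?E \<and> arcs_of ?N (r ''W'') = arcs_of ?N (r ''B'') \<and> bits ?N (r ''W'') \<and>
        set_of ?N (r ''SS'') = {?v * n} \<and> r ''j'' 0 = 0 \<and> r ''z'' 0 = ?t * n"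
      and r2: "\<And>y. y \<notin> writes BUILD \<Longrightarrow> r y = s y"
    have Tr: "tables2 n r" by (rule tables2_frame[OF T, of "writes BUILD"]) (simp_all add: r2)
    have r: "r ''k'' 0 = ?k" "r ''cap'' = s ''cap''" "r ''GA'' = s ''GA''" "r ''t'' = s ''t''" "r ''n'' = s ''n''"
      using r2 by simp_all
    have inv0: "step_inv n ?E (?v * n) (?t * n) 0 r"
      using r1 Tr residual_init by (simp add: step_inv_def[OF net])
    show "wpc (PFor ''i'' ''cap'' STEP ;;
      PFor ''u'' ''n'' (PIf (pos_exp (Cell ''W'' (Plus (Cell ''ro'' (Plus (Cell ''RO'' (V ''u'')) (V ''t'')))
        (Cell ''RO'' (V ''t'')))))
      (PStore ''GA'' (Plus (Cell ''RO'' (V ''u'')) (V ''t'')) (Lit 0)) PSkip))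
      (\<lambda>r. reach_preserver ?k ?v ?G (arcs_of n (r ''GA'')) \<and> arcs_of n (r ''GA'') \<subseteq> ?G \<and>
        ?G - arcs_of n (r ''GA'') \<subseteq> UNIV \<times> {?t} \<and>
        card {u. (u, ?t) \<in> arcs_of n (r ''GA'')} \<le> 2 ^ Suc ?k) r"
    proof (rule wp_seqI, rule wp_loop[where I = "\<lambda>i q. \<exists>f. step_inv n ?E (?v * n) (?t * n) f q \<and>
        (i \<le> f + q ''j'' 0 \<or> step_final n (?t * n) q)"], goal_cases)
      case (3 i j q)
      have "tables2 n (mem_write q ''i'' 0 j) = tables2 n q" by (rule tables2_mem_write) simp
      then show ?case using 3 by (simp add: step_inv_def[OF net] step_final_def[OF net])
    next
      case 4
      show ?case using inv0 by auto
    next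
      case (5 i q)
      then obtain f where f: "step_inv n ?E (?v * n) (?t * n) f q"
        "i \<le> f + q ''j'' 0 \<or> step_final n (?t * n) q" by auto
      show ?case by (rule wp_mono[OF wp_STEP[OF net f(1)]]) (use f(2) in force)
    next
      case (6 q)
      then obtain f where f: "step_inv n ?E (?v * n) (?t * n) f q"
        "r ''cap'' 0 \<le> f + q ''j'' 0 \<or> step_final n (?t * n) q" by auto
      have q: "q ''k'' = r ''k''" "q ''GA'' = s ''GA''" "q ''t'' = s ''t''" "q ''n'' = s ''n''" "q ''cap'' = s ''cap''"
        using 6(2) r by simp_all
      have Tq: "tables2 n q" and res: "residual (set_of ?N (q ''SS'')) (q ''j'' 0) f (arcs_of ?N (q ''W''))"
        and jk: "q ''j'' 0 \<le> ?k"
        using f(1) q r by (auto simp: step_inv_def[OF net])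
      \<comment> \<open>The flow value and the number of expansions together stay below the number
        of rounds, so the loop must have reached its final state.\<close>
      have "f \<le> 2 ^ Suc ?k"
      proof -
        have "(2::nat) ^ Suc (q ''j'' 0) \<le> 2 ^ Suc ?k" using jk by (intro power_increasing) auto
        then show ?thesis using residual_le[OF res] by linarith
      qed
      moreover have "2 ^ Suc ?k + ?k < r ''cap'' 0" using T r by (simp add: tables2_def)
      ultimately have "step_final n (?t * n) q" using f(2) jk by linarith
      then have fin: "q ''j'' 0 = ?k" "set_of ?N (q ''SS'') \<subseteq> blocked (arcs_of ?N (q ''W''))"
        using q r by (auto simp: step_final_def[OF net])
      let ?R = "arcs_of ?N (q ''W'')"
      let ?H = "?G - {(u, v). v = ?t \<and> (u * n + ?t, ?t * n) \<in> ?R}"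
      have H: "reach_preserver ?k ?v ?G ?H" "card {u. (u, ?t) \<in> ?H} \<le> 2 ^ Suc ?k"
        using red[OF _ fin(2) refl] res fin(1) by auto
      show ?case
      proof (rule wp_loop[where I = "\<lambda>i p. arcs_of n (p ''GA'') =
          ?G - {(u, v). v = ?t \<and> (u * n + ?t, ?t * n) \<in> ?R \<and> u < i}"], goal_cases)
        case (5 i p)
        then have "i < n" using q s by simp
        have ix: "i * n + ?t < ?N" "?t * n < ?N" using index_bound[OF \<open>i < n\<close> t(1)] t(1) by simp_all
        have p: "p ''u'' 0 = i" "p ''t'' 0 = ?t" "p ''RO'' i = i * n" "p ''RO'' ?t = ?t * n" "p ''W'' = q ''W''"
          "p ''ro'' (i * n + ?t) = (i * n + ?t) * ?N"
          using 5 q Tq \<open>i < n\<close> t ix by (simp_all add: tables2_def tables_def sp_setup_def)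
        have R: "(i * n + ?t, ?t * n) \<in> ?R \<longleftrightarrow> 0 < q ''W'' ((i * n + ?t) * ?N + ?t * n)"
          using ix by (simp add: arcs_of_def)
        show ?case
        proof (cases "(i * n + ?t, ?t * n) \<in> ?R")
          case True
          then have "{(u, v). v = ?t \<and> (u * n + ?t, ?t * n) \<in> ?R \<and> u < Suc i} =
            insert (i, ?t) {(u, v). v = ?t \<and> (u * n + ?t, ?t * n) \<in> ?R \<and> u < i}" by (auto simp: less_Suc_eq)
          then show ?thesis using True R p 5(2) arcs_of_upd[OF \<open>i < n\<close> t(1)] by auto
        next
          case False
          then have "{(u, v). v = ?t \<and> (u * n + ?t, ?t * n) \<in> ?R \<and> u < Suc i} =
            {(u, v). v = ?t \<and> (u * n + ?t, ?t * n) \<in> ?R \<and> u < i}" by (auto simp: less_Suc_eq)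
          then show ?thesis using False R p 5(2) by simp
        qed
      next
        case (6 p)
        have "?G - {(u, v). v = ?t \<and> (u * n + ?t, ?t * n) \<in> ?R \<and> u < n} = ?H"
          using arcs_of_subset by blast
        then have "arcs_of n (p ''GA'') = ?H" using 6(1) q s by simp
        then show ?case using H by auto
      qed (use q s nc in auto)
    qed (use r in simp_all)
  qed
qed

section \<open>Subgraphs preserving reachability from and to a vertex\<close>

definition TARGETS :: prg where
  "TARGETS = PFor ''t'' ''n'' (PIf (V ''t'' === V ''sv'') PSkip REDUCE)"

text \<open>\<open>IX\<close> maps arc indices to arc indices: the identity, or the reversal of arcs.\<close>

definition DIR :: prg where
  "DIR = PFor ''y'' ''nn'' (PStore ''GA'' (V ''y'') (Cell ''G'' (Cell ''IX'' (V ''y'')))) ;;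
    PFor ''u'' ''n'' (PStore ''GA'' (Plus (Cell ''RO'' (V ''u'')) (V ''u'')) (Lit 0) ;;
      PStore ''GA'' (Plus (Cell ''RO'' (V ''u'')) (V ''sv'')) (Lit 0)) ;;
    TARGETS ;;
    PFor ''y'' ''nn'' (PIf (pos_exp (Cell ''GA'' (V ''y''))) (PStore ''H'' (Cell ''IX'' (V ''y'')) (Lit 1)) PSkip)"

text \<open>A drawn number has \<open>b\<close> random bits and need not be a vertex; such a draw is
  void. The second pass of \<open>DIR\<close> works on the reversed graph and provides reachability
  to the drawn vertex.\<close>

definition DRAWS :: prg where
  "DRAWS = PFor ''m'' ''M'' (''sv'' :::= Cell ''R'' (V ''m'') ;;
    PIf (Less (V ''sv'') (V ''n''))
      (PFor ''y'' ''nn'' (PStore ''IX'' (V ''y'') (V ''y'')) ;; DIR ;;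
       PFor ''y'' ''nn'' (PStore ''IX'' (V ''y'') (Plus (Cell ''RO'' (Cell ''DV'' (V ''y''))) (Cell ''DU'' (V ''y'')))) ;;
       DIR) PSkip)"

lemma writes_TARGETS [simp]: "writes TARGETS = {''D'', ''u'', ''v'', ''d'', ''f'', ''x'', ''PV'', ''len'', ''y'', ''W'',
    ''SS'', ''j'', ''B'', ''z'', ''i'', ''GA'', ''t''}"
  by (auto simp: TARGETS_def)

lemma writes_DIR [simp]: "writes DIR = {''D'', ''u'', ''v'', ''d'', ''f'', ''x'', ''PV'', ''len'', ''y'', ''W'',
    ''SS'', ''j'', ''B'', ''z'', ''i'', ''GA'', ''t'', ''H''}"
  by (auto simp: DIR_def)

lemma writes_DRAWS [simp]: "writes DRAWS = {''D'', ''u'', ''v'', ''d'', ''f'', ''x'', ''PV'', ''len'', ''y'', ''W'',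
    ''SS'', ''j'', ''B'', ''z'', ''i'', ''GA'', ''t'', ''H'', ''IX'', ''sv'', ''m''}"
  by (auto simp: DRAWS_def)

lemma loops_ok_DRAWS [simp]: "loops_ok DRAWS"
  by (simp add: DRAWS_def) (simp add: DIR_def, simp add: TARGETS_def)

lemma reach_preserver_mono:
  assumes "reach_preserver k s G H" and "H \<subseteq> H'" shows "reach_preserver k s G H'"
proof -
  have "(H - F)\<^sup>* \<subseteq> (H' - F)\<^sup>*" for F using assms(2) by (intro rtrancl_mono) auto
  then show ?thesis using assms(1) unfolding reach_preserver_def by blast
qed

text \<open>A loop leaves a walk where it is, and an arc into \<open>s\<close> leads back to its
  start, so both can be skipped. Removing them first meets the requirements of the split graph and
  settles the in-degree of the source, which is never a target.\<close>

lemma reach_preserver_trivial: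
  assumes "\<And>u v. (u, v) \<in> G \<Longrightarrow> (u, v) \<notin> H \<Longrightarrow> u = v \<or> v = s"
  shows "reach_preserver k s G H"
  unfolding reach_preserver_def
proof (intro allI impI)
  fix F x assume "(s, x) \<in> (G - F)\<^sup>*"
  then show "(s, x) \<in> (H - F)\<^sup>*"
  proof (induction rule: rtrancl_induct)
    case (step y x)
    show ?case
    proof (cases "(y, x) \<in> H")
      case True
      then have "(y, x) \<in> H - F" using step(2) by simp
      then show ?thesis by (rule rtrancl_into_rtrancl[OF step(3)])
    next
      case False
      then have "y = x \<or> x = s" using assms step(2) by simp
      then show ?thesis using step(3) by auto
    qed
  qed simp
qed

lemma card_in_degree:
  assumes G: "G \<subseteq> {..<n} \<times> {..<n}" and d: "\<And>v. v < n \<Longrightarrow> card {u. (u, v) \<in> G} \<le> (d::nat)"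
  shows "card G \<le> n * d"
proof -
  have fin: "finite {u. (u, v) \<in> G}" for v
    by (rule finite_subset[of _ "{..<n}"]) (use G in auto)
  have eq: "(\<Union>v\<in>{..<n}. {u. (u, v) \<in> G} \<times> {v}) = G" using G by auto
  have "card G \<le> (\<Sum>v\<in>{..<n}. card ({u. (u, v) \<in> G} \<times> {v}))"
    using card_UN_le[of "{..<n}" "\<lambda>v. {u. (u, v) \<in> G} \<times> {v}"] by (simp add: eq)
  also have "\<dots> = (\<Sum>v\<in>{..<n}. card {u. (u, v) \<in> G})" by (simp add: card_cartesian_product)
  also have "\<dots> \<le> (\<Sum>v\<in>{..<n}. d)" using d by (intro sum_mono) simp
  finally show ?thesis by simp
qed

lemma wp_TARGETS:
  assumes T: "tables2 n s" and sv: "s ''sv'' 0 < n"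
    and loop: "\<And>u. (u, u) \<notin> arcs_of n (s ''GA'')" and src: "\<And>u. (u, s ''sv'' 0) \<notin> arcs_of n (s ''GA'')"
  shows "wpc TARGETS (\<lambda>r. reach_preserver (s ''k'' 0) (s ''sv'' 0) (arcs_of n (s ''GA'')) (arcs_of n (r ''GA'')) \<and>
     arcs_of n (r ''GA'') \<subseteq> arcs_of n (s ''GA'') \<and> card (arcs_of n (r ''GA'')) \<le> n * 2 ^ Suc (s ''k'' 0)) s"
proof -
  let ?G = "arcs_of n (s ''GA'')" and ?k = "s ''k'' 0" and ?v = "s ''sv'' 0"
  have s: "s ''n'' 0 = n" "n * n \<le> s ''cap'' 0" using T by (auto simp: tables2_def tables_def)
  moreover have "n \<le> n * n" by simp
  ultimately have nc: "n \<le> s ''cap'' 0" by linarith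
  define I where "I i r \<longleftrightarrow> reach_preserver ?k ?v ?G (arcs_of n (r ''GA'')) \<and> arcs_of n (r ''GA'') \<subseteq> ?G \<and>
     (\<forall>t<i. card {u. (u, t) \<in> arcs_of n (r ''GA'')} \<le> 2 ^ Suc ?k)" for i :: nat and r :: memory
  show ?thesis
    unfolding TARGETS_def
  proof (rule wp_loop[where I = I], goal_cases)
    case (5 i r)
    have Tr: "tables2 n r"
      by (rule tables2_frame[OF T, of "insert ''t'' (writes (PIf (V ''t'' === V ''sv'') PSkip REDUCE))"])
        (simp_all add: 5(4))
    have r: "r ''t'' 0 = i" "r ''sv'' = s ''sv''" "r ''k'' = s ''k''" using 5(3,4) by simp_all
    have i: "i < n" using 5 s by simp
    note I = 5(2)[unfolded I_def]
    show ?case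
    proof (cases "i = ?v")
      case True
      have "{u. (u, ?v) \<in> arcs_of n (r ''GA'')} = {}" using I src by auto
      then have "I (Suc i) r" using I True unfolding I_def by (simp add: less_Suc_eq)
      then show ?thesis using True r by simp
    next
      case False
      have "wpc REDUCE (I (Suc i)) r"
      proof (rule wp_mono[OF wp_REDUCE[OF Tr]])
        fix q
        assume q: "reach_preserver (r ''k'' 0) (r ''sv'' 0) (arcs_of n (r ''GA'')) (arcs_of n (q ''GA'')) \<and>
          arcs_of n (q ''GA'') \<subseteq> arcs_of n (r ''GA'') \<and>
          arcs_of n (r ''GA'') - arcs_of n (q ''GA'') \<subseteq> UNIV \<times> {r ''t'' 0} \<and>
          card {u. (u, r ''t'' 0) \<in> arcs_of n (q ''GA'')} \<le> 2 ^ Suc (r ''k'' 0)"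
        have "reach_preserver ?k ?v ?G (arcs_of n (q ''GA''))"
          using I q r by (auto intro: reach_preserver_trans)
        moreover have "card {u. (u, t) \<in> arcs_of n (q ''GA'')} \<le> 2 ^ Suc ?k" if "t < Suc i" for t
        proof (cases "t = i")
          case True then show ?thesis using q r by simp
        next
          case False
          have "card {u. (u, t) \<in> arcs_of n (q ''GA'')} \<le> card {u. (u, t) \<in> arcs_of n (r ''GA'')}"
          proof (rule card_mono)
            show "finite {u. (u, t) \<in> arcs_of n (r ''GA'')}"
              by (rule finite_subset[of _ "{..<n}"]) (auto simp: arcs_of_def)
          qed (use q in blast)
          moreover have "card {u. (u, t) \<in> arcs_of n (r ''GA'')} \<le> 2 ^ Suc ?k" using I False that by auto
          ultimately show ?thesis by linarith
        qed
        ultimately show "I (Suc i) q" using I q unfolding I_def by auto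
      qed (use r i sv False I loop in auto)
      moreover have "bval (V ''t'' === V ''sv'') r = False" using False r by (simp add: neq_iff)
      ultimately show ?thesis by (simp only: wp_PIf if_False)
    qed
  next
    case (6 r)
    then have "card (arcs_of n (r ''GA'')) \<le> n * 2 ^ Suc ?k"
      using s by (intro card_in_degree[OF arcs_of_subset]) (simp add: I_def)
    then show ?case using 6 by (simp add: I_def)
  qed (use s nc in \<open>simp_all add: I_def reach_preserver_refl\<close>)
qed

section \<open>The two orientations of the graph, and all drawn sources together\<close>

definition index_map :: "nat \<Rightarrow> bool \<Rightarrow> nat \<Rightarrow> nat" where
  "index_map n rv y = (if rv then (y mod n) * n + y div n else y)"

definition orient :: "bool \<Rightarrow> (nat \<times> nat) set \<Rightarrow> (nat \<times> nat) set" where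
  "orient rv E = (if rv then E\<inverse> else E)"

lemma orient_orient [simp]: "orient rv (orient rv E) = E"
  by (simp add: orient_def)

lemma card_orient [simp]: "card (orient rv E) = card E"
  by (simp add: orient_def card_inverse)

lemma orient_mono: "E \<subseteq> E' \<Longrightarrow> orient rv E \<subseteq> orient rv E'"
  by (auto simp: orient_def)

lemma arcs_of_index_map: "arcs_of n (\<lambda>y. Z (index_map n rv y)) = orient rv (arcs_of n Z)"
  by (auto simp: arcs_of_def orient_def index_map_def)

lemma arcs_of_insert:
  assumes "y < n * n" and "0 < c"
  shows "arcs_of n (Z(index_map n rv y := c)) = orient rv (insert (y div n, y mod n) (orient rv (arcs_of n Z)))"
proof -
  have "y div n < n" "y mod n < n" "y = (y div n) * n + y mod n"
    using div_bound[OF assms(1)] mod_bound[OF assms(1)] by auto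
  then show ?thesis
    using assms(2) arcs_of_upd[of "y div n" n "y mod n" Z c] arcs_of_upd[of "y mod n" n "y div n" Z c]
    by (auto simp: index_map_def orient_def)
qed

lemma arcs_of_prefix_Suc:
  assumes "y < n * n"
  shows "{(u, v) \<in> arcs_of n Z. u * n + v < Suc y} =
    (if 0 < Z y then insert (y div n, y mod n) {(u, v) \<in> arcs_of n Z. u * n + v < y}
     else {(u, v) \<in> arcs_of n Z. u * n + v < y})"
proof -
  have y: "y div n < n" "y mod n < n" "y = (y div n) * n + y mod n"
    using div_bound[OF assms(1)] mod_bound[OF assms(1)] by auto
  have "u * n + v = y \<longleftrightarrow> u = y div n \<and> v = y mod n" if "u < n" "v < n" for u v
    using index_inject[of u n v "y div n" "y mod n"] that y by auto
  then have "{(u, v) \<in> arcs_of n Z. u * n + v = y} = (if 0 < Z y then {(y div n, y mod n)} else {})"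
    using y unfolding arcs_of_def by auto
  moreover have "{(u, v) \<in> arcs_of n Z. u * n + v < Suc y} =
      {(u, v) \<in> arcs_of n Z. u * n + v = y} \<union> {(u, v) \<in> arcs_of n Z. u * n + v < y}"
    by (auto simp: less_Suc_eq)
  ultimately show ?thesis by simp
qed

lemma arcs_of_prefix_all: "{(u, v) \<in> arcs_of n Z. u * n + v < n * n} = arcs_of n Z"
  using index_bound by (auto simp: arcs_of_def)

lemma wp_DIR:
  assumes T: "tables2 n s" and sv: "s ''sv'' 0 < n" and IX: "\<And>y. y < n * n \<Longrightarrow> s ''IX'' y = index_map n rv y"
    and H: "arcs_of n (s ''H'') \<subseteq> arcs_of n (s ''G'')"
  shows "wpc DIR (\<lambda>r. reach_preserver (s ''k'' 0) (s ''sv'' 0)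
        (orient rv (arcs_of n (s ''G''))) (orient rv (arcs_of n (r ''H''))) \<and>
      arcs_of n (s ''H'') \<subseteq> arcs_of n (r ''H'') \<and> arcs_of n (r ''H'') \<subseteq> arcs_of n (s ''G'') \<and>
      card (arcs_of n (r ''H'')) \<le> card (arcs_of n (s ''H'')) + n * 2 ^ Suc (s ''k'' 0)) s"
proof -
  let ?G = "arcs_of n (s ''G'')" and ?k = "s ''k'' 0" and ?v = "s ''sv'' 0"
  have s: "s ''n'' 0 = n" "n * n \<le> s ''cap'' 0" "s ''nn'' 0 = n * n" "\<And>u. u < n \<Longrightarrow> s ''RO'' u = u * n"
    using T by (auto simp: tables2_def tables_def)
  moreover have "n \<le> n * n" by simp
  ultimately have nc: "n \<le> s ''cap'' 0" by linarith
  show ?thesis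
    unfolding DIR_def
  proof (rule wp_seqI, rule wp_map[where f = "\<lambda>y. s ''G'' (index_map n rv y)"], goal_cases)
    case (3 i r)
    then show ?case using IX s by simp
  next
    case (4 r)
    have Tr: "tables2 n r" by (rule tables2_frame[OF T, of "{''GA'', ''y''}"]) (use 4(1) in simp_all)
    have r: "r ''G'' = s ''G''" "r ''sv'' = s ''sv''" "r ''k'' = s ''k''" "r ''RO'' = s ''RO''" "r ''n'' = s ''n''"
      "r ''cap'' = s ''cap''" "r ''IX'' = s ''IX''" "r ''H'' = s ''H''" "r ''nn'' = s ''nn''"
      using 4(1) by simp_all
    have GA: "arcs_of n (r ''GA'') = orient rv ?G"
      unfolding arcs_of_index_map[symmetric] using 4(2) s index_bound by (intro arcs_of_cong) simp
    show ?case
    proof (rule wp_seqI, rule wp_loop[where I = "\<lambda>i q. arcs_of n (q ''GA'') =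
        {(u, v) \<in> orient rv ?G. \<not> (u < i \<and> (v = u \<or> v = ?v))}"], goal_cases)
      case (5 i q)
      then have i: "i < n" using r s by simp
      have q: "q ''u'' 0 = i" "q ''sv'' 0 = ?v" "q ''RO'' i = i * n" using 5 r s i by simp_all
      have "{(u, v) \<in> orient rv ?G. \<not> (u < Suc i \<and> (v = u \<or> v = ?v))} =
          {(u, v) \<in> orient rv ?G. \<not> (u < i \<and> (v = u \<or> v = ?v))} - {(i, i)} - {(i, ?v)}"
        by (auto simp: less_Suc_eq)
      then show ?case using 5(2) q arcs_of_upd[OF i i] arcs_of_upd[OF i sv] by simp
    next
      case (6 q)
      have Tq: "tables2 n q"
        by (rule tables2_frame[OF Tr, of "{''u'', ''GA''}"]) (use 6(2) in simp_all)
      have q: "q ''G'' = s ''G''" "q ''sv'' = s ''sv''" "q ''k'' = s ''k''" "q ''IX'' = s ''IX''" "q ''H'' = s ''H''"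
        "q ''nn'' = s ''nn''" "q ''cap'' = s ''cap''"
        using 6(2) r by simp_all
      have lt: "(u, v) \<in> orient rv ?G \<Longrightarrow> u < n" for u v
        by (auto simp: orient_def arcs_of_def split: if_splits)
      have A: "arcs_of n (q ''GA'') = {(u, v) \<in> orient rv ?G. v \<noteq> u \<and> v \<noteq> ?v}"
        using 6(1) lt r s by auto
      have pre: "reach_preserver ?k ?v (orient rv ?G) (arcs_of n (q ''GA''))"
        by (rule reach_preserver_trivial) (auto simp: A)
      show ?case
      proof (rule wp_seqI, rule wp_frame[OF wp_TARGETS[OF Tq]])
        fix p
        assume p1: "reach_preserver (q ''k'' 0) (q ''sv'' 0) (arcs_of n (q ''GA'')) (arcs_of n (p ''GA'')) \<and>
            arcs_of n (p ''GA'') \<subseteq> arcs_of n (q ''GA'') \<and> card (arcs_of n (p ''GA'')) \<le> n * 2 ^ Suc (q ''k'' 0)"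
          and p2: "\<And>y. y \<notin> writes TARGETS \<Longrightarrow> p y = q y"
        have p: "p ''IX'' = s ''IX''" "p ''H'' = s ''H''" "p ''nn'' = s ''nn''" "p ''cap'' = s ''cap''"
          using p2 q by simp_all
        let ?P = "arcs_of n (p ''GA'')"
        have rp: "reach_preserver ?k ?v (orient rv ?G) ?P"
          using p1 q reach_preserver_trans[OF pre] by simp
        have PG: "?P \<subseteq> orient rv ?G" using p1 A by auto
        show "wpc (PFor ''y'' ''nn'' (PIf (pos_exp (Cell ''GA'' (V ''y'')))
            (PStore ''H'' (Cell ''IX'' (V ''y'')) (Lit 1)) PSkip))
          (\<lambda>r. reach_preserver ?k ?v (orient rv ?G) (orient rv (arcs_of n (r ''H''))) \<and>
            arcs_of n (s ''H'') \<subseteq> arcs_of n (r ''H'') \<and> arcs_of n (r ''H'') \<subseteq> ?G \<and>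
            card (arcs_of n (r ''H'')) \<le> card (arcs_of n (s ''H'')) + n * 2 ^ Suc ?k) p"
        proof (rule wp_loop[where I = "\<lambda>i m. arcs_of n (m ''H'') =
            orient rv (orient rv (arcs_of n (s ''H'')) \<union> {(u, v) \<in> ?P. u * n + v < i})"], goal_cases)
          case (5 i m)
          then have i: "i < n * n" using p s by simp
          have m: "m ''y'' 0 = i" "m ''GA'' = p ''GA''" "m ''IX'' i = index_map n rv i"
            using 5 p IX[OF i] by simp_all
          show ?case
            using 5(2) m arcs_of_prefix_Suc[OF i, of "p ''GA''"] arcs_of_insert[OF i, of 1 "m ''H''" rv] by simp
        next
          case (6 m)
          have Hm: "arcs_of n (m ''H'') = orient rv (orient rv (arcs_of n (s ''H'')) \<union> ?P)"
            using 6(1) p s arcs_of_prefix_all by simp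
          have "arcs_of n (s ''H'') \<subseteq> arcs_of n (m ''H'')"
            unfolding Hm by (auto simp: orient_def)
          moreover have "arcs_of n (m ''H'') \<subseteq> ?G"
            unfolding Hm using H PG by (auto simp: orient_def split: if_splits)
          moreover have "card (arcs_of n (m ''H'')) \<le> card (arcs_of n (s ''H'')) + n * 2 ^ Suc ?k"
            using card_Un_le[of "orient rv (arcs_of n (s ''H''))" ?P] p1 q unfolding Hm by simp
          moreover have "reach_preserver ?k ?v (orient rv ?G) (orient rv (arcs_of n (m ''H'')))"
            by (rule reach_preserver_mono[OF rp]) (simp add: Hm)
          ultimately show ?case by simp
        qed (use p s in simp_all)
      next
        show "\<And>u. (u, u) \<notin> arcs_of n (q ''GA'')" "\<And>u. (u, q ''sv'' 0) \<notin> arcs_of n (q ''GA'')"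
          using A q by auto
      qed (use q sv in simp)
    qed (use r s nc GA in auto)
  qed (use s in simp_all)
qed

lemma wp_DRAWS:
  assumes T: "tables2 n s" and H: "arcs_of n (s ''H'') \<subseteq> arcs_of n (s ''G'')" and M: "s ''M'' 0 \<le> s ''cap'' 0"
  shows "wpc DRAWS (\<lambda>r. arcs_of n (s ''H'') \<subseteq> arcs_of n (r ''H'') \<and> arcs_of n (r ''H'') \<subseteq> arcs_of n (s ''G'') \<and>
      (\<forall>m<s ''M'' 0. \<forall>rv. s ''R'' m < n \<longrightarrow> reach_preserver (s ''k'' 0) (s ''R'' m)
        (orient rv (arcs_of n (s ''G''))) (orient rv (arcs_of n (r ''H'')))) \<and>
      card (arcs_of n (r ''H'')) \<le> card (arcs_of n (s ''H'')) + s ''M'' 0 * (2 * (n * 2 ^ Suc (s ''k'' 0)))) s"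
proof -
  let ?G = "arcs_of n (s ''G'')" and ?k = "s ''k'' 0" and ?H = "arcs_of n (s ''H'')" and ?c = "n * 2 ^ Suc (s ''k'' 0)"
  have s: "s ''n'' 0 = n" "n * n \<le> s ''cap'' 0" "s ''nn'' 0 = n * n"
    "\<And>u. u < n \<Longrightarrow> s ''RO'' u = u * n"
    "\<And>y. y < n * n \<Longrightarrow> s ''DU'' y = y div n" "\<And>y. y < n * n \<Longrightarrow> s ''DV'' y = y mod n"
    using T by (auto simp: tables2_def tables_def)
  define I where "I i r \<longleftrightarrow> ?H \<subseteq> arcs_of n (r ''H'') \<and> arcs_of n (r ''H'') \<subseteq> ?G \<and>
      (\<forall>m<i. \<forall>rv. s ''R'' m < n \<longrightarrow> reach_preserver ?k (s ''R'' m) (orient rv ?G) (orient rv (arcs_of n (r ''H'')))) \<and>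
      card (arcs_of n (r ''H'')) \<le> card ?H + i * (2 * ?c)" for i :: nat and r :: memory
  show ?thesis
    unfolding DRAWS_def
  proof (rule wp_loop[where I = I], goal_cases)
    case (5 i r)
    let ?v = "s ''R'' i"
    have Tr: "tables2 n r"
      by (rule tables2_frame[OF T, of "insert ''m'' (writes DIR \<union> {''IX'', ''sv'', ''y''})"]) (use 5(4) in simp_all)
    have r: "r ''R'' = s ''R''" "r ''k'' = s ''k''" "r ''n'' = s ''n''" "r ''G'' = s ''G''" "r ''nn'' = s ''nn''"
      "r ''cap'' = s ''cap''" "r ''RO'' = s ''RO''" "r ''DU'' = s ''DU''" "r ''DV'' = s ''DV''" "r ''m'' 0 = i"
      using 5(3,4) by simp_all
    note I = 5(2)[unfolded I_def]
    show ?case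
    proof (cases "?v < n")
      case False
      then have "I (Suc i) r" using I unfolding I_def by (auto simp: less_Suc_eq)
      then have "I (Suc i) (mem_write r ''sv'' 0 ?v)" unfolding I_def by simp
      then show ?thesis using False r s by simp
    next
      case v: True
      let ?r = "mem_write r ''sv'' 0 ?v"
      have "wpc (PFor ''y'' ''nn'' (PStore ''IX'' (V ''y'') (V ''y'')) ;; DIR ;;
         PFor ''y'' ''nn'' (PStore ''IX'' (V ''y'') (Plus (Cell ''RO'' (Cell ''DV'' (V ''y''))) (Cell ''DU'' (V ''y'')))) ;;
         DIR) (I (Suc i)) ?r"
      proof (rule wp_seqI, rule wp_map[where f = "\<lambda>y. y"], goal_cases)
        case (4 q)
        have Tq: "tables2 n q"
          by (rule tables2_frame[OF Tr, of "{''IX'', ''y'', ''sv''}"]) (use 4(1) in simp_all)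
        have q: "q ''k'' = s ''k''" "q ''n'' = s ''n''" "q ''G'' = s ''G''" "q ''nn'' = s ''nn''"
          "q ''cap'' = s ''cap''" "q ''RO'' = s ''RO''" "q ''DU'' = s ''DU''" "q ''DV'' = s ''DV''"
          "q ''H'' = r ''H''" "q ''sv'' 0 = ?v"
          using 4(1) r by simp_all
        show ?case
        proof (rule wp_seqI, rule wp_frame[OF wp_DIR[OF Tq, of False]])
          show "q ''IX'' y = index_map n False y" if "y < n * n" for y
            using 4(2) r s that by (simp add: index_map_def)
        next
          fix p
          assume p1: "reach_preserver (q ''k'' 0) (q ''sv'' 0)
                (orient False (arcs_of n (q ''G''))) (orient False (arcs_of n (p ''H''))) \<and>
              arcs_of n (q ''H'') \<subseteq> arcs_of n (p ''H'') \<and> arcs_of n (p ''H'') \<subseteq> arcs_of n (q ''G'') \<and>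
              card (arcs_of n (p ''H'')) \<le> card (arcs_of n (q ''H'')) + n * 2 ^ Suc (q ''k'' 0)"
            and p2: "\<And>y. y \<notin> writes DIR \<Longrightarrow> p y = q y"
          have Tp: "tables2 n p" by (rule tables2_frame[OF Tq, of "writes DIR"]) (use p2 in simp_all)
          have p: "p ''k'' = s ''k''" "p ''n'' = s ''n''" "p ''G'' = s ''G''" "p ''nn'' = s ''nn''"
            "p ''cap'' = s ''cap''" "p ''RO'' = s ''RO''" "p ''DU'' = s ''DU''" "p ''DV'' = s ''DV''"
            "p ''sv'' 0 = ?v"
            using p2 q by simp_all
          show "wpc (PFor ''y'' ''nn'' (PStore ''IX'' (V ''y'')
              (Plus (Cell ''RO'' (Cell ''DV'' (V ''y''))) (Cell ''DU'' (V ''y'')))) ;; DIR) (I (Suc i)) p"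
          proof (rule wp_seqI, rule wp_map[where f = "index_map n True"], goal_cases)
            case (3 j o')
            then show ?case using p s mod_bound[of j n] by (simp add: index_map_def)
          next
            case (4 o')
            have To: "tables2 n o'"
              by (rule tables2_frame[OF Tp, of "{''IX'', ''y''}"]) (use 4(1) in simp_all)
            have o: "o' ''k'' = s ''k''" "o' ''G'' = s ''G''" "o' ''H'' = p ''H''" "o' ''sv'' 0 = ?v"
              using 4(1) p by simp_all
            show ?case
            proof (rule wp_mono[OF wp_DIR[OF To, of True]])
              show "o' ''IX'' y = index_map n True y" if "y < n * n" for y
                using 4(2) p s that by simp
            next
              fix m
              assume m: "reach_preserver (o' ''k'' 0) (o' ''sv'' 0)
                    (orient True (arcs_of n (o' ''G''))) (orient True (arcs_of n (m ''H''))) \<and>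
                  arcs_of n (o' ''H'') \<subseteq> arcs_of n (m ''H'') \<and> arcs_of n (m ''H'') \<subseteq> arcs_of n (o' ''G'') \<and>
                  card (arcs_of n (m ''H'')) \<le> card (arcs_of n (o' ''H'')) + n * 2 ^ Suc (o' ''k'' 0)"
              have sub: "arcs_of n (r ''H'') \<subseteq> arcs_of n (m ''H'')" "arcs_of n (p ''H'') \<subseteq> arcs_of n (m ''H'')"
                using m p1 o q by auto
              have "reach_preserver ?k (s ''R'' j) (orient rv ?G) (orient rv (arcs_of n (m ''H'')))"
                if j: "j < Suc i" "s ''R'' j < n" for j rv
              proof (cases "j = i")
                case True
                show ?thesis
                proof (cases rv)
                  case t: True
                  then show ?thesis using m o True by simp
                next
                  case False
                  then have rv: "rv = False" by simp
                  have "reach_preserver ?k (s ''R'' j) (orient False ?G) (orient False (arcs_of n (p ''H'')))"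
                    using p1 q True by simp
                  then show ?thesis unfolding rv by (rule reach_preserver_mono) (rule orient_mono[OF sub(2)])
                qed
              next
                case False
                then have "reach_preserver ?k (s ''R'' j) (orient rv ?G) (orient rv (arcs_of n (r ''H'')))"
                  using I j by auto
                then show ?thesis by (rule reach_preserver_mono) (rule orient_mono[OF sub(1)])
              qed
              moreover have "card (arcs_of n (m ''H'')) \<le> card (arcs_of n (r ''H'')) + 2 * ?c"
                using m p1 o q by simp
              then have "card (arcs_of n (m ''H'')) \<le> card ?H + Suc i * (2 * ?c)"
                using I by simp
              ultimately show "I (Suc i) m" unfolding I_def using I sub m o by auto
            qed (use o p1 q v in simp_all)
          qed (use p s in simp_all)
        qed (use q I v in simp_all)
      qed (use r s in simp_all)
      then show ?thesis using v r s by simp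
    qed
  qed (use M H in \<open>simp_all add: I_def\<close>)
qed

section \<open>Pairs that are connected by few vertices\<close>

definition mid :: "('a \<times> 'a) set \<Rightarrow> 'a \<Rightarrow> 'a \<Rightarrow> ('a \<times> 'a) set \<Rightarrow> 'a set" where
  "mid E s t F = {x. (s, x) \<in> (E - F)\<^sup>* \<and> (x, t) \<in> (E - F)\<^sup>*}"

text \<open>A pair connected via more than \<open>L\<close> vertices is left to the random sources.\<close>

definition covered :: "('a \<times> 'a) set \<Rightarrow> nat \<Rightarrow> 'a \<Rightarrow> 'a \<Rightarrow> ('a \<times> 'a) set \<Rightarrow> ('a \<times> 'a) set \<Rightarrow> bool" where
  "covered E L s t H F \<longleftrightarrow> ((s, t) \<in> (E - F)\<^sup>* \<longrightarrow> (s, t) \<in> (H - F)\<^sup>* \<or> L < card (mid E s t F))"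

definition path_arcs :: "(nat \<Rightarrow> 'a) \<Rightarrow> nat \<Rightarrow> ('a \<times> 'a) set" where
  "path_arcs p m = (\<lambda>i. (p i, p (Suc i))) ` {..<m}"

definition is_path :: "('a \<times> 'a) set \<Rightarrow> 'a \<Rightarrow> 'a \<Rightarrow> (nat \<Rightarrow> 'a) \<Rightarrow> nat \<Rightarrow> bool" where
  "is_path R s t p m \<longleftrightarrow> p 0 = s \<and> p m = t \<and> inj_on p {..m} \<and> path_arcs p m \<subseteq> R"

lemma path_arcs_rtrancl:
  assumes "path_arcs p m \<subseteq> R" and "i \<le> j" and "j \<le> m"
  shows "(p i, p j) \<in> R\<^sup>*"
  using assms(2,3)
proof (induction j rule: dec_induct)
  case (step j)
  then have "(p j, p (Suc j)) \<in> R" using assms(1) by (auto simp: path_arcs_def)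
  then show ?case using step by (auto intro: rtrancl_into_rtrancl)
qed simp

lemma finite_mid:
  assumes "finite E" shows "finite (mid E s t F)"
proof (rule finite_subset)
  show "mid E s t F \<subseteq> insert s (snd ` E)"
  proof
    fix x assume "x \<in> mid E s t F"
    then have "(s, x) \<in> (E - F)\<^sup>*" by (simp add: mid_def)
    then show "x \<in> insert s (snd ` E)" by (cases rule: rtrancl.cases) force+
  qed
qed (use assms in simp)

text \<open>A path with at most \<open>L\<close> arcs lies in \<open>H\<close>. A longer one has
  more than \<open>L\<close> distinct vertices, all of which belong to \<open>mid\<close>.\<close>

lemma covered_by_path:
  assumes "finite E" and p: "is_path (E - F) s t p m" and H: "m \<le> L \<Longrightarrow> path_arcs p m \<subseteq> H"
  shows "covered E L s t H F"
proof (cases "m \<le> L")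
  case True
  then have "path_arcs p m \<subseteq> H - F" using H p by (auto simp: is_path_def)
  from path_arcs_rtrancl[OF this, of 0 m] show ?thesis using p by (simp add: covered_def is_path_def)
next
  case False
  have "p ` {..m} \<subseteq> mid E s t F"
    using path_arcs_rtrancl[of p m "E - F" 0] path_arcs_rtrancl[of p m "E - F" _ m] p
    by (auto simp: mid_def is_path_def)
  then have "card (p ` {..m}) \<le> card (mid E s t F)" by (rule card_mono[OF finite_mid[OF assms(1)]])
  then show ?thesis using p False by (simp add: covered_def is_path_def card_image)
qed

lemma covered_mono:
  assumes "covered E L s t H F" and "H \<subseteq> H'" shows "covered E L s t H' F"
proof -
  have "(H - F)\<^sup>* \<subseteq> (H' - F)\<^sup>*" using assms(2) by (intro rtrancl_mono) auto
  then show ?thesis using assms(1) unfolding covered_def by blast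
qed

lemma rtrancl_imp_path:
  assumes "(s, t) \<in> R\<^sup>*"
  obtains p m where "is_path R s t p m"
proof -
  define m where "m = (LEAST m. (s, t) \<in> R ^^ m)"
  have m: "(s, t) \<in> R ^^ m"
    unfolding m_def using assms by (auto simp: rtrancl_power intro: LeastI)
  have least: "m \<le> m'" if "(s, t) \<in> R ^^ m'" for m' unfolding m_def using that by (rule Least_le)
  obtain p where p: "p 0 = s" "p m = t" "\<forall>i<m. (p i, p (Suc i)) \<in> R"
    using m by (auto simp: relpow_fun_conv)
  have seg: "(p i, p (i + j)) \<in> R ^^ j" if "i + j \<le> m" for i j
    using that p(3) by (auto simp: relpow_fun_conv intro!: exI[of _ "\<lambda>l. p (i + l)"])
  have False if "i < j" "j \<le> m" "p i = p j" for i j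
  proof -
    have "(s, p i) \<in> R ^^ i" "(p j, t) \<in> R ^^ (m - j)"
      using seg[of 0 i] seg[of j "m - j"] that p by simp_all
    then have "(s, t) \<in> R ^^ (i + (m - j))" using that(3) by (auto simp: relpow_add)
    then show False using least[of "i + (m - j)"] that by simp
  qed
  then have "inj_on p {..m}" by (intro inj_onI) (metis atMost_iff linorder_neqE_nat)
  then have "is_path R s t p m" using p by (auto simp: is_path_def path_arcs_def)
  then show ?thesis by (rule that)
qed

text \<open>
  The search tree: a node is a set \<open>F\<close> of faults, \<open>pe F\<close> is the list of arcs of a shortest path
  that avoids them, and every arc in it leads to a child. The branches are encoded by
  numbers in base \<open>L\<close>.
\<close>

definition walk_step :: "nat \<Rightarrow> (('a \<times> 'a) set \<Rightarrow> ('a \<times> 'a) list) \<Rightarrow> ('a \<times> 'a) set \<times> nat \<Rightarrow> ('a \<times> 'a) set \<times> nat" where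
  "walk_step L pe = (\<lambda>(F, q). (if q mod L < length (pe F) then insert (pe F ! (q mod L)) F else F, q div L))"

text \<open>The three alternatives are the cases in which the descent through the tree ends: the
  path is too long to branch on, it avoids all faults, or at most one fault is left.\<close>

definition settled ::
    "('a \<times> 'a) set \<Rightarrow> nat \<Rightarrow> 'a \<Rightarrow> 'a \<Rightarrow> (('a \<times> 'a) set \<Rightarrow> ('a \<times> 'a) list) \<Rightarrow> ('a \<times> 'a) set \<Rightarrow> ('a \<times> 'a) set \<Rightarrow> bool" where
  "settled E L s t pe H F \<longleftrightarrow> set (pe F) \<inter> F = {} \<and> (\<forall>F'. F \<subseteq> F' \<longrightarrow> finite F' \<longrightarrow>
     L < length (pe F) \<or> F' \<inter> set (pe F) = {} \<or> card (F' - F) \<le> 1 \<longrightarrow> covered E L s t H F')"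

lemma settled_mono: "settled E L s t pe H F \<Longrightarrow> H \<subseteq> H' \<Longrightarrow> settled E L s t pe H' F"
  unfolding settled_def by (elim conjE, intro conjI allI impI, assumption, rule covered_mono[of E L s t H]) blast+

text \<open>If the descent does not end at \<open>F\<close>, a fault lies on a path with at most
  \<open>L\<close> arcs. Its position there is a digit below \<open>L\<close>, and the corresponding
  child uses up one fault. After \<open>m\<close> such moves one fault is left, which a settled node
  handles without branching.\<close>

lemma walk_covers:
  assumes L: "0 < L" and F': "finite F'"
    and "F \<subseteq> F'" and "card (F' - F) \<le> Suc m"
    and "\<And>q j. q < L ^ m \<Longrightarrow> j \<le> m \<Longrightarrow> settled E L s t pe H (fst ((walk_step L pe ^^ j) (F, q)))"
  shows "covered E L s t H F'"
  using assms(3-)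
proof (induction m arbitrary: F)
  case 0
  then have "settled E L s t pe H F" using 0(3)[of 0 0] by simp
  then show ?case using 0 F' unfolding settled_def by auto
next
  case (Suc m)
  have S: "settled E L s t pe H F" using Suc.prems(3)[of 0 0] L by simp
  show ?case
  proof (cases "L < length (pe F) \<or> F' \<inter> set (pe F) = {}")
    case True
    then show ?thesis using S Suc.prems(1) F' unfolding settled_def by blast
  next
    case False
    then obtain e where "e \<in> F'" "e \<in> set (pe F)" by blast
    then obtain d where d: "d < length (pe F)" "pe F ! d \<in> F'" "length (pe F) \<le> L"
      using False unfolding in_set_conv_nth by auto
    let ?e = "pe F ! d"
    have "?e \<notin> F" using S nth_mem[OF d(1)] unfolding settled_def by blast
    show ?thesis
    proof (rule Suc.IH[of "insert ?e F"])
      show "insert ?e F \<subseteq> F'" using d Suc.prems by simp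
      have "card (F' - insert ?e F) = card (F' - F) - 1"
        using d F' \<open>?e \<notin> F\<close> by (metis DiffI card_Diff_singleton Diff_insert)
      then show "card (F' - insert ?e F) \<le> Suc m" using Suc.prems by simp
      fix q j :: nat assume qj: "q < L ^ m" "j \<le> m"
      have dL: "d < L" using d by simp
      \<comment> \<open>The code of the branch through the child is extended by \<open>d\<close> as
        its least significant digit.\<close>
      have "d + L * q < L * Suc q" using dL by simp
      also have "\<dots> \<le> L * L ^ m" using qj by (intro mult_left_mono) auto
      finally have "d + L * q < L ^ Suc m" by simp
      moreover have "walk_step L pe (F, d + L * q) = (insert ?e F, q)"
        using dL d by (simp add: walk_step_def)
      ultimately show "settled E L s t pe H (fst ((walk_step L pe ^^ j) (insert ?e F, q)))"
        using Suc.prems(3)[of "d + L * q" "Suc j"] qj by (simp add: funpow_swap1)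
    qed
  qed
qed

section \<open>Penalizing used arcs\<close>

definition non_bridges :: "('a \<times> 'a) set \<Rightarrow> 'a \<Rightarrow> 'a \<Rightarrow> ('a \<times> 'a) set" where
  "non_bridges E s t = {e \<in> E. (s, t) \<in> (E - {e})\<^sup>*}"

text \<open>One arc in \<open>X\<close> outweighs all arcs outside \<open>X\<close> on a simple
  path, so a shortest path uses as few arcs of \<open>X\<close> as possible.\<close>

definition penalty :: "nat \<Rightarrow> (nat \<times> nat) set \<Rightarrow> (nat \<times> nat) set \<Rightarrow> nat \<Rightarrow> nat \<Rightarrow> nat" where
  "penalty n E X u v = (if (u, v) \<in> E then if (u, v) \<in> X then n + 1 else 1 else 0)"

lemma penalty_arcs:
  "E \<subseteq> {..<n} \<times> {..<n} \<Longrightarrow> {(u, v). u < n \<and> v < n \<and> 0 < penalty n E X u v} = E"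
  by (auto simp: penalty_def)

lemma tight_path_is_path:
  assumes "tight_path n (penalty n E X) D t p m"
  shows "is_path E (p 0) t p m"
  using assms tight_path_inj[OF assms]
  by (auto simp: is_path_def path_arcs_def tight_path_def penalty_def split: if_splits)

text \<open>Pigeonhole: each of the \<open>n\<close> values excludes one of the \<open>n + 1\<close>
  possible shifts.\<close>

lemma ex_residue:
  fixes D :: "nat \<Rightarrow> nat"
  obtains c where "c \<le> n" "\<And>x. x < n \<Longrightarrow> (D x + c) mod (n + 1) \<noteq> 0"
proof -
  let ?bad = "(\<lambda>x. (n + 1 - D x mod (n + 1)) mod (n + 1)) ` {..<n}"
  have "card ?bad \<le> n" using card_image_le[of "{..<n}"] by fastforce
  then have "\<not> {..n} \<subseteq> ?bad" using card_mono[of ?bad "{..n}"] by auto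
  then obtain c where c: "c \<le> n" "c \<notin> ?bad" by auto
  have "(D x + c) mod (n + 1) \<noteq> 0" if x: "x < n" for x
  proof
    assume 0: "(D x + c) mod (n + 1) = 0"
    define r where "r = D x mod (n + 1)"
    have "r \<le> n" unfolding r_def using mod_less_divisor[of "n + 1" "D x"] by linarith
    have "(r + c) mod (n + 1) = 0" using 0 unfolding r_def by (simp only: mod_add_left_eq)
    then obtain a where a: "r + c = (n + 1) * a" by (metis mod_0_imp_dvd dvdE)
    have "a < 2"
    proof (rule ccontr)
      assume "\<not> a < 2"
      then have "(n + 1) * 2 \<le> (n + 1) * a" by (intro mult_left_mono) auto
      then show False using a c \<open>r \<le> n\<close> by simp
    qed
    then have "c = (n + 1 - r) mod (n + 1)"
      using a c \<open>r \<le> n\<close> by (cases "a = 0") (auto simp: less_2_cases_iff)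
    then show False using c(2) x unfolding r_def by blast
  qed
  then show ?thesis using that c(1) by blast
qed

text \<open>
  After a shift of the distances that makes them indivisible by \<open>n + 1\<close>, their quotients by \<open>n + 1\<close>
  are levels that change only along arcs in \<open>X\<close>, and by at most 1. An arc in \<open>X\<close> on the path that is not
  a bridge shares its level with an arc in \<open>X\<close> off the path.
\<close>

lemma non_bridges_halve:
  assumes E: "E \<subseteq> {..<n} \<times> {..<n}" and D: "potential n (penalty n E X) t c D"
    and p: "tight_path n (penalty n E X) D t p m" and s: "p 0 = s"
  shows "2 * card (X \<inter> path_arcs p m \<inter> non_bridges E s t) \<le> card (X \<inter> non_bridges E s t)"
proof -
  let ?M = "path_arcs p m" and ?B = "non_bridges E s t"
  obtain c0 where c0: "c0 \<le> n" "\<And>x. x < n \<Longrightarrow> (D x + c0) mod (n + 1) \<noteq> 0" by (rule ex_residue[of n D]) blast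
  define q where "q x = (D x + c0) div (n + 1)" for x
  have finE: "finite E" by (rule finite_subset[OF E]) simp
  have pM: "is_path E s t p m" using tight_path_is_path[OF p] s by simp
  have mono: "q x \<le> q y" if "D x \<le> D y" for x y
    unfolding q_def using that by (intro div_le_mono) simp
  have D_le: "D u \<le> penalty n E X u v + D v" if "(u, v) \<in> E" for u v
  proof -
    have "u < n" "v < n" "0 < penalty n E X u v" using E that by (auto simp: penalty_def)
    then show ?thesis using D unfolding potential_def by blast
  qed
  \<comment> \<open>An arc outside \<open>X\<close> has weight 1. To lie on a higher level than
    \<open>v\<close>, its tail \<open>u\<close> would have to sit exactly on a multiple of
    \<open>n + 1\<close>, which the shift excludes.\<close>
  have q_le: "q u \<le> q v" if "(u, v) \<in> E" "(u, v) \<notin> X" for u v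
  proof (rule ccontr)
    assume "\<not> q u \<le> q v"
    then have "Suc (q v) \<le> (D u + c0) div (n + 1)" unfolding q_def by linarith
    then have "Suc (q v) * (n + 1) \<le> (D u + c0) div (n + 1) * (n + 1)" by (rule mult_right_mono) simp
    also have "\<dots> \<le> D u + c0" using div_times_less_eq_dividend by blast
    finally have 1: "Suc (q v) * (n + 1) \<le> D u + c0" .
    have 2: "D v + c0 < Suc (q v) * (n + 1)"
      unfolding q_def using dividend_less_div_times[of "n + 1" "D v + c0"] by simp
    have "D u \<le> 1 + D v" using D_le[OF that(1)] that by (simp add: penalty_def)
    then have "D u + c0 \<le> Suc (q v) * (n + 1)" using 2 by linarith
    then have "D u + c0 = Suc (q v) * (n + 1)" using 1 by (rule antisym)
    then have "(D u + c0) mod (n + 1) = 0" by (metis mod_mult_self2_is_0)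
    moreover have "u < n" using that E by auto
    ultimately show False using c0(2)[of u] by simp
  qed
  have shift: "(a + (n + 1)) div (n + 1) = Suc (a div (n + 1))" for a
    by (subst div_add_self2) auto
  have q_Suc: "q u \<le> Suc (q v)" if "(u, v) \<in> E" for u v
  proof -
    have "D u + c0 \<le> D v + c0 + (n + 1)" using D_le[OF that] by (auto simp: penalty_def split: if_splits)
    then have "q u \<le> (D v + c0 + (n + 1)) div (n + 1)" unfolding q_def by (rule div_le_mono)
    also have "\<dots> = Suc (q v)" unfolding q_def by (rule shift)
    finally show ?thesis .
  qed
  have q_tight: "q (p i) = Suc (q (p (Suc i)))" if "i < m" "(p i, p (Suc i)) \<in> X" for i
  proof -
    have "(p i, p (Suc i)) \<in> E" using pM that by (auto simp: is_path_def path_arcs_def)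
    then have "D (p i) + c0 = D (p (Suc i)) + c0 + (n + 1)"
      using p that by (auto simp: tight_path_def penalty_def)
    then show ?thesis unfolding q_def by (simp only: shift)
  qed
  have D_path: "D (p j) \<le> D (p i)" if "i \<le> j" "j \<le> m" for i j
    using tight_path_decreasing[OF p, of i j] that by (cases "i = j") auto
  have less: False if ij: "i < j" "j < m" "(p j, p (Suc j)) \<in> X" "q (p (Suc i)) = q (p (Suc j))" for i j
  proof -
    have "q (p j) \<le> q (p (Suc i))" using ij by (intro mono D_path) auto
    then show False using q_tight[of j] ij by simp
  qed
  \<comment> \<open>Along the path the level never rises, and it drops at every arc in
    \<open>X\<close>. An arc in \<open>X\<close> on the path is therefore determined by the level of
    its head.\<close>
  have uniq: "e = e'" if e: "e \<in> X \<inter> ?M" "e' \<in> X \<inter> ?M" "q (snd e) = q (snd e')" for e e'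
  proof -
    obtain i where i: "e = (p i, p (Suc i))" "i < m" using e(1) unfolding path_arcs_def by blast
    obtain j where j: "e' = (p j, p (Suc j))" "j < m" using e(2) unfolding path_arcs_def by blast
    note ij = i j
    have "\<not> i < j" "\<not> j < i" using less[of i j] less[of j i] ij e by auto
    then show ?thesis using ij by simp
  qed
  have "\<exists>f. f \<in> (X \<inter> ?B) - ?M \<and> q (snd f) = q (snd e)" if e: "e \<in> X \<inter> ?M \<inter> ?B" for e
  proof -
    obtain i where i: "e = (p i, p (Suc i))" "i < m" using e unfolding path_arcs_def by blast
    let ?l = "q (p (Suc i))"
    have "q (p i) = Suc ?l" using q_tight i e by auto
    moreover have "q (p i) \<le> q s" using D_path[of 0 i] i s by (intro mono) auto
    moreover have "q t = 0"
    proof -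
      have "D t = 0" using D by (simp add: potential_def)
      then show ?thesis using c0(1) by (simp add: q_def)
    qed
    moreover have "(s, t) \<in> (E - {e})\<^sup>*" using e by (auto simp: non_bridges_def)
    \<comment> \<open>A path that avoids \<open>e\<close> also starts on a level above
      \<open>?l\<close> and ends on level 0. Where it crosses to \<open>?l\<close> or below, its arc
      must be in \<open>X\<close> and end exactly on \<open>?l\<close>.\<close>
    ultimately obtain x y where xy: "(x, y) \<in> E - {e}" "?l < q x" "\<not> ?l < q y"
      using rtrancl_leaves[of s t "E - {e}" "{x. ?l < q x}"] by auto
    then have X: "(x, y) \<in> X" using q_le[of x y] by force
    have l: "q y = ?l" using q_Suc[of x y] xy by auto
    have nM: "(x, y) \<notin> ?M" using uniq[of "(x, y)" e] X l e i xy by auto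
    have "(s, t) \<in> (E - {(x, y)})\<^sup>*"
      using path_arcs_rtrancl[of p m "E - {(x, y)}" 0 m] pM nM by (auto simp: is_path_def)
    then show ?thesis using X l nM xy i by (intro exI[of _ "(x, y)"]) (auto simp: non_bridges_def)
  qed
  then obtain f where f: "\<And>e. e \<in> X \<inter> ?M \<inter> ?B \<Longrightarrow> f e \<in> (X \<inter> ?B) - ?M \<and> q (snd (f e)) = q (snd e)"
    by metis
  have finB: "finite ?B" using finE by (auto simp: non_bridges_def)
  have "inj_on f (X \<inter> ?M \<inter> ?B)"
  proof (rule inj_onI)
    fix e e' assume e: "e \<in> X \<inter> ?M \<inter> ?B" "e' \<in> X \<inter> ?M \<inter> ?B" "f e = f e'"
    then have "q (snd e) = q (snd e')" using f[OF e(1)] f[OF e(2)] by simp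
    then show "e = e'" using uniq e by blast
  qed
  then have "card (X \<inter> ?M \<inter> ?B) \<le> card ((X \<inter> ?B) - ?M)"
    using f finB by (intro card_inj_on_le[of f]) auto
  moreover have "card (X \<inter> ?B) = card (X \<inter> ?M \<inter> ?B) + card ((X \<inter> ?B) - ?M)"
  proof -
    have "X \<inter> ?B = (X \<inter> ?M \<inter> ?B) \<union> ((X \<inter> ?B) - ?M)" by auto
    then show ?thesis using finB card_Un_disjoint[of "X \<inter> ?M \<inter> ?B" "(X \<inter> ?B) - ?M"] by auto
  qed
  ultimately show ?thesis by simp
qed

text \<open>In the first round of a node all arcs are penalized alike, so distances are
  \<open>n + 1\<close> times the number of arcs, and the path found is shortest in the ordinary
  sense.\<close>

lemma tight_path_length:
  assumes p: "tight_path n (penalty n E X) D t p m" and D: "potential n (penalty n E X) t c D" and X: "E \<subseteq> X"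
  shows "D (p 0) = (n + 1) * m"
proof -
  have "D (p (m - i)) = (n + 1) * i" if "i \<le> m" for i
    using that
  proof (induction i)
    case 0
    then show ?case using p D by (simp add: tight_path_def potential_def)
  next
    case (Suc i)
    let ?j = "m - Suc i"
    have j: "?j < m" "Suc ?j = m - i" using Suc by auto
    then have "0 < penalty n E X (p ?j) (p (m - i))" "D (p ?j) = penalty n E X (p ?j) (p (m - i)) + D (p (m - i))"
      using p unfolding tight_path_def by metis+
    then show ?case using Suc X by (auto simp: penalty_def split: if_splits)
  qed
  from this[of m] show ?thesis by simp
qed

lemma tight_path_shortest:
  assumes E: "E \<subseteq> {..<n} \<times> {..<n}"
    and p: "tight_path n (penalty n E X) D t p m" and D: "potential n (penalty n E X) t c D" and X: "E \<subseteq> X"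
    and p': "is_path E (p 0) t p' m'"
  shows "m \<le> m'"
proof -
  have "(p 0, t) \<in> E ^^ m'"
    using p' unfolding is_path_def path_arcs_def relpow_fun_conv by (intro exI[of _ p']) auto
  then have "D (p 0) \<le> (n + 1) * m'"
    by (rule potential_walk[OF D]) (use E in \<open>auto simp: penalty_def\<close>)
  then have "(n + 1) * m \<le> (n + 1) * m'" using tight_path_length[OF p D X] by simp
  then show ?thesis by (simp only: mult_le_cancel1)
qed

text \<open>
  The state after \<open>r\<close> rounds: \<open>X\<close> contains the arcs that are common to all paths found so far.
\<close>

definition rounds_inv ::
    "nat \<Rightarrow> (nat \<times> nat) set \<Rightarrow> nat \<Rightarrow> nat \<Rightarrow> nat \<Rightarrow> (nat \<times> nat) set \<Rightarrow> nat \<Rightarrow> (nat \<times> nat) set \<Rightarrow> bool" where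
  "rounds_inv n E L s t H r X \<longleftrightarrow> 2 ^ r * card (X \<inter> non_bridges E s t) \<le> n * n \<and>
     (\<forall>e\<in>E - X. \<exists>p m. is_path (E - {e}) s t p m \<and> (m \<le> L \<longrightarrow> path_arcs p m \<subseteq> H))"

lemma rounds_inv_0:
  assumes "E \<subseteq> {..<n} \<times> {..<n}" and "E \<subseteq> X" shows "rounds_inv n E L s t H 0 X"
proof -
  have "card (X \<inter> non_bridges E s t) \<le> card ({..<n} \<times> {..<n})"
    using assms by (intro card_mono) (auto simp: non_bridges_def)
  then show ?thesis using assms by (auto simp: rounds_inv_def)
qed

text \<open>An arc that leaves \<open>X\<close> in this round is avoided by the new path, and one
  that left earlier keeps its old witness. The halving of the common non-bridges gives the new
  factor 2.\<close>

lemma rounds_inv_Suc: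
  assumes E: "E \<subseteq> {..<n} \<times> {..<n}" and D: "potential n (penalty n E X) t c D"
    and p: "tight_path n (penalty n E X) D t p m" and s: "p 0 = s"
    and I: "rounds_inv n E L s t H r X" and H: "H \<subseteq> H'" "m \<le> L \<Longrightarrow> path_arcs p m \<subseteq> H'"
  shows "rounds_inv n E L s t H' (Suc r) (X \<inter> path_arcs p m)"
proof -
  have "2 ^ r * (2 * card (X \<inter> path_arcs p m \<inter> non_bridges E s t)) \<le> 2 ^ r * card (X \<inter> non_bridges E s t)"
    by (rule mult_left_mono[OF non_bridges_halve[OF E D p s]]) simp
  also have "\<dots> \<le> n * n" using I by (simp add: rounds_inv_def)
  finally have 1: "2 ^ Suc r * card (X \<inter> path_arcs p m \<inter> non_bridges E s t) \<le> n * n" by simp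
  have pM: "is_path E s t p m" using tight_path_is_path[OF p] s by simp
  have "\<exists>p m. is_path (E - {e}) s t p m \<and> (m \<le> L \<longrightarrow> path_arcs p m \<subseteq> H')" if e: "e \<in> E - X \<inter> path_arcs p m" for e
  proof (cases "e \<in> X")
    case True
    then have "is_path (E - {e}) s t p m" using pM e by (auto simp: is_path_def)
    then show ?thesis using H(2) by blast
  next
    case False
    then obtain p m where "is_path (E - {e}) s t p m" "m \<le> L \<longrightarrow> path_arcs p m \<subseteq> H"
      using I e unfolding rounds_inv_def by blast
    then show ?thesis using H(1) by blast
  qed
  then show ?thesis using 1 by (simp add: rounds_inv_def)
qed

text \<open>If the first path is longer than \<open>L\<close>, so is every path that avoids more
  faults, because the first one is shortest. If a single further fault lies on the first path and
  the pair stays connected, it is no bridge. After \<open>J\<close> rounds with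
  \<open>n * n < 2 ^ J\<close> no non-bridge is common to all paths found, so one of them avoids
  this fault.\<close>

lemma settledI:
  assumes E: "E \<subseteq> {..<n} \<times> {..<n}" and X0: "E - F \<subseteq> X0"
    and D: "potential n (penalty n (E - F) X0) t c D"
    and p: "tight_path n (penalty n (E - F) X0) D t p m" and s: "p 0 = s"
    and H: "m \<le> L \<Longrightarrow> path_arcs p m \<subseteq> H"
    and I: "rounds_inv n (E - F) L s t H J X" and J: "n * n < 2 ^ J"
    and pe: "set (pe F) = path_arcs p m" "length (pe F) = m"
  shows "settled E L s t pe H F"
  unfolding settled_def
proof (intro conjI allI impI)
  show "set (pe F) \<inter> F = {}" using tight_path_is_path[OF p] pe by (auto simp: is_path_def)
next
  fix F' assume F': "F \<subseteq> F'" "finite F'" and c: "L < length (pe F) \<or> F' \<inter> set (pe F) = {} \<or> card (F' - F) \<le> 1"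
  have finE: "finite E" by (rule finite_subset[OF E]) simp
  have EF: "E - F \<subseteq> {..<n} \<times> {..<n}" using E by auto
  have pM: "is_path (E - F) s t p m" using tight_path_is_path[OF p] s by simp
  have avoid: "covered E L s t H F'" if "F' \<inter> path_arcs p m = {}"
    by (rule covered_by_path[OF finE, of F' s t p m]) (use pM that H in \<open>auto simp: is_path_def\<close>)
  show "covered E L s t H F'"
  proof (cases "(s, t) \<in> (E - F')\<^sup>*")
    case False
    then show ?thesis by (simp add: covered_def)
  next
    case True
    consider "L < m" | "F' \<inter> path_arcs p m = {}" | "F' \<inter> path_arcs p m \<noteq> {}" "card (F' - F) \<le> 1"
      using c pe by auto
    then show ?thesis
    proof cases
      case 1
      obtain p' m' where p': "is_path (E - F') s t p' m'" using rtrancl_imp_path[OF True] by blast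
      then have "is_path (E - F) (p 0) t p' m'" using F' s by (auto simp: is_path_def)
      then have "m \<le> m'" using tight_path_shortest[OF EF p D X0] by blast
      then show ?thesis using 1 by (intro covered_by_path[OF finE p']) simp
    next
      case 2 then show ?thesis by (rule avoid)
    next
      case 3
      then obtain e where e: "e \<in> F'" "e \<in> path_arcs p m" by blast
      then have eE: "e \<in> E - F" using pM by (auto simp: is_path_def)
      then have "F' - F = {e}"
        using card_le_Suc0_iff_eq[of "F' - F"] 3 e F' by auto
      then have F'_eq: "E - F' = E - F - {e}" using F' by auto
      then have "e \<in> non_bridges (E - F) s t" using eE True by (simp add: non_bridges_def)
      moreover have "X \<inter> non_bridges (E - F) s t = {}"
      proof -
        have "finite (X \<inter> non_bridges (E - F) s t)"
          using finE by (auto simp: non_bridges_def)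
        moreover have "card (X \<inter> non_bridges (E - F) s t) = 0"
        proof (rule ccontr)
          assume "card (X \<inter> non_bridges (E - F) s t) \<noteq> 0"
          then have "2 ^ J * 1 \<le> 2 ^ J * card (X \<inter> non_bridges (E - F) s t)" by (intro mult_left_mono) auto
          moreover have "2 ^ J * card (X \<inter> non_bridges (E - F) s t) \<le> n * n" using I by (simp add: rounds_inv_def)
          ultimately show False using J by linarith
        qed
        ultimately show ?thesis by simp
      qed
      ultimately have "e \<in> (E - F) - X" using eE by auto
      then obtain p' m' where "is_path (E - F - {e}) s t p' m'" "m' \<le> L \<longrightarrow> path_arcs p' m' \<subseteq> H"
        using I unfolding rounds_inv_def by blast
      then show ?thesis using covered_by_path[OF finE, of F' s t p' m'] F'_eq by simp
    qed
  qed
qed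

lemma settled_unreachable:
  assumes "(s, t) \<notin> (E - F)\<^sup>*" and "pe F = []" shows "settled E L s t pe H F"
  unfolding settled_def covered_def
proof (intro conjI allI impI)
  show "set (pe F) \<inter> F = {}" using assms(2) by simp
next
  fix F' assume "F \<subseteq> F'" and *: "(s, t) \<in> (E - F')\<^sup>*"
  then have "(E - F')\<^sup>* \<subseteq> (E - F)\<^sup>*" by (intro rtrancl_mono) auto
  then show "(s, t) \<in> (H - F')\<^sup>* \<or> L < card (mid E s t F')" using * assms by blast
qed

section \<open>Exploring the search tree\<close>

lemma potential_cong:
  "(\<And>u v. u < N \<Longrightarrow> v < N \<Longrightarrow> w u v = w' u v) \<Longrightarrow> potential N w z c D = potential N w' z c D"
  by (simp add: potential_def cong: conj_cong)

lemma tight_path_cong: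
  assumes "\<And>u v. u < N \<Longrightarrow> v < N \<Longrightarrow> w u v = w' u v" and p: "tight_path N w D z p m"
  shows "tight_path N w' D z p m"
proof -
  have "w (p i) (p (Suc i)) = w' (p i) (p (Suc i))" if "i < m" for i
    using p that by (intro assms(1)) (auto simp: tight_path_def)
  then show ?thesis using p by (simp add: tight_path_def)
qed

lemma next_vertex_cong:
  assumes "\<And>u v. u < N \<Longrightarrow> v < N \<Longrightarrow> w u v = w' u v" and "\<And>v. v < N \<Longrightarrow> D v = D' v" and "x < N"
  shows "next_vertex N w D x = next_vertex N w' D' x"
proof -
  have "(y < N \<and> 0 < w x y \<and> D x = w x y + D y) = (y < N \<and> 0 < w' x y \<and> D' x = w' x y + D' y)" for y
    using assms by auto
  then show ?thesis by (simp add: next_vertex_def)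
qed

lemma penalty_UNIV: "E \<subseteq> X \<Longrightarrow> penalty n E X = penalty n E UNIV"
  by (auto simp: penalty_def fun_eq_iff)

text \<open>
  The list of arcs of the path found by the program depends only on the graph, the pair and the faults,
  so that different branches agree on their common initial part.
\<close>

definition canonical_dist :: "nat \<Rightarrow> (nat \<times> nat) set \<Rightarrow> nat \<Rightarrow> nat \<Rightarrow> nat \<Rightarrow> nat" where
  "canonical_dist n E t c = (SOME D. potential n (penalty n E UNIV) t c D)"

definition canonical_path :: "nat \<Rightarrow> (nat \<times> nat) set \<Rightarrow> nat \<Rightarrow> nat \<Rightarrow> nat \<Rightarrow> (nat \<times> nat) list" where
  "canonical_path n E s t c = (if (s, t) \<in> E\<^sup>* then
     (let p = \<lambda>i. (next_vertex n (penalty n E UNIV) (canonical_dist n E t c) ^^ i) s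
      in map (\<lambda>i. (p i, p (Suc i))) [0..<canonical_dist n E t c s div (n + 1)]) else [])"

text \<open>Potentials are unique on the vertices, so the computed distances and the chosen ones
  lead to the same next vertices. The length is recovered as the distance divided by
  \<open>n + 1\<close>, the common weight of all arcs.\<close>

lemma canonical_path:
  assumes w: "\<And>u v. u < n \<Longrightarrow> v < n \<Longrightarrow> w u v = penalty n E UNIV u v"
    and D: "potential n w t c D" and p: "tight_path n w D t p m" and s: "p 0 = s" and reach: "(s, t) \<in> E\<^sup>*"
    and nx: "\<And>i. i \<le> m \<Longrightarrow> p i = (next_vertex n w D ^^ i) s"
  shows "canonical_path n E s t c = map (\<lambda>i. (p i, p (Suc i))) [0..<m]"
proof -
  let ?w = "penalty n E UNIV" and ?D = "canonical_dist n E t c"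
  have D': "potential n ?w t c D" using D potential_cong[of n w ?w, OF w] by simp
  have P: "potential n ?w t c ?D" unfolding canonical_dist_def by (rule someI[where P = "potential n ?w t c", OF D'])
  have eq: "D v = ?D v" if "v < n" for v by (rule potential_unique[OF D' P that])
  have pn: "p i < n" if "i \<le> m" for i using p that by (simp add: tight_path_def)
  have pi: "p i = (next_vertex n ?w ?D ^^ i) s" if "i \<le> m" for i
    using that
  proof (induction i)
    case (Suc i)
    have "p (Suc i) = next_vertex n w D (p i)" using nx[of i] nx[of "Suc i"] Suc.prems by simp
    also have "\<dots> = next_vertex n ?w ?D (p i)" using Suc.prems by (intro next_vertex_cong w eq pn) auto
    finally show ?case using Suc by simp
  qed (use s in simp)
  have "D s = (n + 1) * m" using tight_path_length[OF tight_path_cong[OF w p] D'] s by simp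
  then have l: "?D s = (n + 1) * m" using eq[of s] pn[of 0] s by simp
  have "?D s div (n + 1) = m" unfolding l by (rule nonzero_mult_div_cancel_left) simp
  then show ?thesis using reach pi by (auto simp: canonical_path_def Let_def)
qed

section \<open>Programs for a round, a node, a branch and the whole search tree\<close>

definition WEIGHTS :: prg where
  "WEIGHTS = PFor ''y'' ''nn'' (PIf (Less (Cell ''FA'' (V ''y'')) (Cell ''G'' (V ''y'')))
     (PIf (pos_exp (Cell ''X'' (V ''y''))) (PStore ''W'' (V ''y'') (Plus (V ''n'') (Lit 1)))
        (PStore ''W'' (V ''y'') (Lit 1)))
     (PStore ''W'' (V ''y'') (Lit 0)))"

abbreviation PV_arc :: aexp where
  "PV_arc \<equiv> Plus (Cell ''RO'' (Cell ''PV'' (V ''y''))) (Cell ''PV'' (Plus (V ''y'') (Lit 1)))"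

text \<open>Only the path of round 0 is recorded for branching: it is the shortest and the canonical
  one.\<close>

definition MARK :: prg where
  "MARK = PFor ''y'' ''nn'' (PStore ''MK'' (V ''y'') (Lit 0)) ;;
    PFor ''y'' ''len'' (PStore ''MK'' PV_arc (Lit 1)) ;;
    PFor ''y'' ''nn'' (PIf (pos_exp (Cell ''MK'' (V ''y''))) PSkip (PStore ''X'' (V ''y'') (Lit 0))) ;;
    PIf (Less (V ''L'') (V ''len'')) PSkip
      (PFor ''y'' ''nn'' (PIf (pos_exp (Cell ''MK'' (V ''y''))) (PStore ''H'' (V ''y'') (Lit 1)) PSkip)) ;;
    PIf (pos_exp (V ''r'')) PSkip (''len0'' :::= V ''len'' ;; PFor ''y'' ''len'' (PStore ''PE'' (V ''y'') PV_arc))"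

definition ROUND :: prg where
  "ROUND = WEIGHTS ;; ''z'' :::= V ''t'' ;; SP ;;
    PIf (Less (Cell ''D'' (V ''s'')) (V ''cap'')) (''x'' :::= V ''s'' ;; FW ;; MARK) PSkip"

text \<open>Division with remainder by repeated subtraction, splitting off the next digit of the
  code. Codes are at most \<open>n * n\<close> and \<open>L\<close> is positive, so
  \<open>nn\<close> iterations suffice.\<close>

definition DIVIDE :: prg where
  "DIVIDE = ''dg'' :::= V ''q'' ;; ''q'' :::= Lit 0 ;;
    PFor ''y'' ''nn'' (PIf (Less (V ''dg'') (V ''L'')) PSkip
      (''dg'' :::= Minus (V ''dg'') (V ''L'') ;; ''q'' :::= Plus (V ''q'') (Lit 1)))"

definition NODE :: prg where
  "NODE = PFor ''y'' ''nn'' (PStore ''X'' (V ''y'') (Lit 1)) ;; ''len0'' :::= Lit 0 ;;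
    PFor ''r'' ''J'' ROUND ;; DIVIDE ;;
    PIf (Less (V ''dg'') (V ''len0'')) (PStore ''FA'' (Cell ''PE'' (V ''dg'')) (Lit 1)) PSkip"

text \<open>Each code replays its branch from the root, so only one branch is ever in memory. Nodes
  near the root are computed many times; counting all these visits gives the factor \<open>k\<close>
  in the size bound of the tree.\<close>

definition CODE :: prg where
  "CODE = PFor ''y'' ''nn'' (PStore ''FA'' (V ''y'') (Lit 0)) ;; ''q'' :::= V ''c'' ;; PFor ''j'' ''k'' NODE"

definition TREE :: prg where
  "TREE = PFor ''e'' ''nn'' (PIf (pos_exp (Cell ''P'' (V ''e'')))
     (''s'' :::= Cell ''DU'' (V ''e'') ;; ''t'' :::= Cell ''DV'' (V ''e'') ;; PFor ''c'' ''w'' CODE) PSkip)"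

lemma writes_WEIGHTS [simp]: "writes WEIGHTS = {''y'', ''W''}"
  and writes_MARK [simp]: "writes MARK = {''y'', ''MK'', ''X'', ''H'', ''len0'', ''PE''}"
  and writes_DIVIDE [simp]: "writes DIVIDE = {''dg'', ''q'', ''y''}"
  by (auto simp: WEIGHTS_def MARK_def DIVIDE_def)

lemma writes_ROUND [simp]: "writes ROUND =
    {''y'', ''W'', ''z'', ''D'', ''u'', ''v'', ''d'', ''x'', ''PV'', ''len'', ''MK'', ''X'', ''H'', ''len0'', ''PE''}"
  by (auto simp: ROUND_def)

lemma writes_NODE [simp]: "writes NODE = {''y'', ''W'', ''z'', ''D'', ''u'', ''v'', ''d'', ''x'', ''PV'', ''len'',
    ''MK'', ''X'', ''H'', ''len0'', ''PE'', ''r'', ''dg'', ''q'', ''FA''}"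
  by (auto simp: NODE_def)

lemma writes_CODE [simp]: "writes CODE = {''y'', ''W'', ''z'', ''D'', ''u'', ''v'', ''d'', ''x'', ''PV'', ''len'',
    ''MK'', ''X'', ''H'', ''len0'', ''PE'', ''r'', ''dg'', ''q'', ''FA'', ''j''}"
  by (auto simp: CODE_def)

lemma writes_TREE [simp]: "writes TREE = {''y'', ''W'', ''z'', ''D'', ''u'', ''v'', ''d'', ''x'', ''PV'', ''len'',
    ''MK'', ''X'', ''H'', ''len0'', ''PE'', ''r'', ''dg'', ''q'', ''FA'', ''j'', ''e'', ''s'', ''t'', ''c''}"
  by (auto simp: TREE_def)

lemma loops_ok_TREE [simp]: "loops_ok TREE"
  by (simp add: TREE_def, simp add: CODE_def, simp add: NODE_def, simp add: ROUND_def DIVIDE_def)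
    (simp add: WEIGHTS_def MARK_def)

text \<open>The bound \<open>(n + 1) * (n * n)\<close> keeps \<open>cap\<close> above all penalized
  distances, as its role of infinity requires. The bound on \<open>w\<close> keeps the number of
  branches polynomial.\<close>

definition tree_ok :: "nat \<Rightarrow> memory \<Rightarrow> bool" where
  "tree_ok n s \<longleftrightarrow> tables n s \<and> sp_setup n s \<and> (n + 1) * (n * n) < s ''cap'' 0 \<and>
     (\<forall>y<n * n. s ''G'' y \<le> 1) \<and> 0 < s ''L'' 0 \<and> n * n < 2 ^ s ''J'' 0 \<and>
     s ''J'' 0 \<le> s ''cap'' 0 \<and> s ''k'' 0 \<le> s ''cap'' 0 \<and> s ''w'' 0 \<le> n * n"

abbreviation tree_cells :: "string set" where
  "tree_cells \<equiv> {''n'', ''nn'', ''cap'', ''RO'', ''DU'', ''DV'', ''Nv'', ''ro'', ''k'', ''G'', ''L'', ''J'', ''w''}"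

lemma tree_ok_frame:
  assumes "tree_ok n s" and fr: "\<And>y. y \<notin> X \<Longrightarrow> r y = s y" and X: "X \<inter> tree_cells = {}"
  shows "tree_ok n r"
proof -
  have "r ''n'' = s ''n''" "r ''nn'' = s ''nn''" "r ''cap'' = s ''cap''" "r ''RO'' = s ''RO''"
    "r ''DU'' = s ''DU''" "r ''DV'' = s ''DV''" "r ''Nv'' = s ''Nv''" "r ''ro'' = s ''ro''"
    "r ''k'' = s ''k''" "r ''G'' = s ''G''" "r ''L'' = s ''L''" "r ''J'' = s ''J''" "r ''w'' = s ''w''"
    using X by (auto intro!: fr)
  then show ?thesis using assms(1) by (simp add: tree_ok_def tables_def sp_setup_def)
qed

lemma tree_okD:
  assumes "tree_ok n s"
  shows "s ''n'' 0 = n" "s ''nn'' 0 = n * n" "n * n \<le> s ''cap'' 0" "sp_setup n s"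
    "\<And>u. u < n \<Longrightarrow> s ''RO'' u = u * n" "\<And>y. y < n * n \<Longrightarrow> s ''DU'' y = y div n"
    "\<And>y. y < n * n \<Longrightarrow> s ''DV'' y = y mod n" "\<And>y. y < n * n \<Longrightarrow> s ''G'' y \<le> 1" "0 < s ''L'' 0"
    "(n + 1) * (n * n) < s ''cap'' 0" "2 \<le> n"
  using assms by (auto simp: tree_ok_def tables_def)

lemma wp_WEIGHTS:
  assumes T: "tree_ok n s"
  shows "wpc WEIGHTS (\<lambda>r. \<forall>u<n. \<forall>v<n. weight n r u v =
     penalty n (arcs_of n (s ''G'') - arcs_of n (s ''FA'')) (arcs_of n (s ''X'')) u v) s"
proof -
  note s = tree_okD[OF T]
  define f where "f y = (if s ''FA'' y < s ''G'' y then if 0 < s ''X'' y then n + 1 else 1 else (0::nat))" for y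
  show ?thesis
    unfolding WEIGHTS_def
  proof (rule wp_loop[where I = "\<lambda>i r. \<forall>y<i. r ''W'' y = f y"], goal_cases)
    case (5 i r)
    then have "r ''FA'' = s ''FA''" "r ''G'' = s ''G''" "r ''X'' = s ''X''" "r ''n'' 0 = n" using s by simp_all
    then show ?case using 5(2,3) by (simp add: f_def less_Suc_eq)
  next
    case (6 r)
    show ?case
    proof (intro allI impI)
      fix u v assume uv: "u < n" "v < n"
      let ?y = "u * n + v"
      have y: "?y < n * n" by (rule index_bound[OF uv])
      then have "weight n r u v = f ?y" using 6(1) s by simp
      moreover have "s ''FA'' ?y < s ''G'' ?y \<longleftrightarrow> 0 < s ''G'' ?y \<and> \<not> 0 < s ''FA'' ?y" using s(8)[OF y] by auto
      ultimately show "weight n r u v =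
          penalty n (arcs_of n (s ''G'') - arcs_of n (s ''FA'')) (arcs_of n (s ''X'')) u v"
        using uv by (simp add: f_def penalty_def arcs_of_def)
    qed
  qed (use s in simp_all)
qed

lemma path_arcs_Suc: "path_arcs p (Suc m) = insert (p m, p (Suc m)) (path_arcs p m)"
  by (simp add: path_arcs_def lessThan_Suc)

lemma wp_MARK:
  assumes T: "tree_ok n s" and p: "\<And>i. i \<le> s ''len'' 0 \<Longrightarrow> s ''PV'' i < n" and len: "s ''len'' 0 \<le> s ''cap'' 0"
  shows "wpc MARK (\<lambda>r.
     arcs_of n (r ''X'') = arcs_of n (s ''X'') \<inter> path_arcs (s ''PV'') (s ''len'' 0) \<and>
     arcs_of n (r ''H'') = arcs_of n (s ''H'') \<union>
       (if s ''len'' 0 \<le> s ''L'' 0 then path_arcs (s ''PV'') (s ''len'' 0) else {}) \<and>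
     (if s ''r'' 0 = 0 then r ''len0'' 0 = s ''len'' 0 \<and>
        (\<forall>i<s ''len'' 0. r ''PE'' i = s ''PV'' i * n + s ''PV'' (Suc i))
      else r ''len0'' = s ''len0'' \<and> r ''PE'' = s ''PE'')) s"
proof -
  note s = tree_okD[OF T]
  let ?p = "s ''PV''" and ?m = "s ''len'' 0"
  let ?M = "path_arcs ?p ?m"
  have arc: "aval PV_arc r = ?p i * n + ?p (Suc i)"
    if "i < ?m" "r ''y'' 0 = i" "r ''PV'' = ?p" "r ''RO'' = s ''RO''" for i and r :: memory
    using that p[of i] s(5)[of "?p i"] by simp
  show ?thesis
    unfolding MARK_def
  proof (rule wp_seqI, rule wp_map[where f = "\<lambda>_. 0"], goal_cases)
    case (4 r)
    have MK0: "arcs_of n (r ''MK'') = {}" using 4(2) s index_bound[of _ n] by (auto simp: arcs_of_def)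
    have r: "r ''PV'' = ?p" "r ''RO'' = s ''RO''" "r ''len'' = s ''len''" "r ''cap'' = s ''cap''" "r ''X'' = s ''X''"
      "r ''H'' = s ''H''" "r ''nn'' = s ''nn''" "r ''L'' = s ''L''" "r ''r'' = s ''r''" "r ''len0'' = s ''len0''"
      "r ''PE'' = s ''PE''"
      using 4(1) by simp_all
    show ?case
    proof (rule wp_seqI, rule wp_loop[where I = "\<lambda>i q. arcs_of n (q ''MK'') = path_arcs ?p i"], goal_cases)
      case (5 i q)
      then have i: "i < ?m" using r by simp
      have "aval PV_arc q = ?p i * n + ?p (Suc i)" using 5 r by (intro arc[OF i]) simp_all
      moreover have "?p i < n" "?p (Suc i) < n" using p[of i] p[of "Suc i"] i by simp_all
      ultimately show ?case using 5(2) unfolding wp_PStore by (simp add: arcs_of_upd path_arcs_Suc del: aval.simps(3))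
    next
      case (6 q)
      have MK: "arcs_of n (q ''MK'') = ?M" using 6(1) r by simp
      have q: "q ''PV'' = ?p" "q ''RO'' = s ''RO''" "q ''len'' = s ''len''" "q ''cap'' = s ''cap''" "q ''X'' = s ''X''"
        "q ''H'' = s ''H''" "q ''nn'' = s ''nn''" "q ''L'' = s ''L''" "q ''r'' = s ''r''" "q ''len0'' = s ''len0''"
        "q ''PE'' = s ''PE''"
        using 6(2) r by simp_all
      show ?case
      proof (rule wp_seqI, rule wp_loop[where I = "\<lambda>i o'. o' ''X'' =
          (\<lambda>y. if y < i \<and> q ''MK'' y = 0 then 0 else s ''X'' y)"], goal_cases)
        case (5 i o')
        then have "o' ''MK'' = q ''MK''" by simp
        then show ?case using 5(2,3) by (auto simp: fun_eq_iff less_Suc_eq)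
      next
        case (6 o')
        have X: "arcs_of n (o' ''X'') = arcs_of n (s ''X'') \<inter> ?M"
          unfolding MK[symmetric] using 6(1) q s index_bound[of _ n] by (auto simp: arcs_of_def)
        have o: "o' ''PV'' = ?p" "o' ''RO'' = s ''RO''" "o' ''len'' = s ''len''" "o' ''cap'' = s ''cap''"
          "o' ''H'' = s ''H''" "o' ''nn'' = s ''nn''" "o' ''L'' = s ''L''" "o' ''r'' = s ''r''" "o' ''MK'' = q ''MK''"
          "o' ''len0'' = s ''len0''" "o' ''PE'' = s ''PE''"
          using 6(2) q by simp_all
        let ?H = "arcs_of n (s ''H'') \<union> (if ?m \<le> s ''L'' 0 then ?M else {})"
        let ?rest = "PIf (pos_exp (V ''r'')) PSkip
          (''len0'' :::= V ''len'' ;; PFor ''y'' ''len'' (PStore ''PE'' (V ''y'') PV_arc))"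
        let ?Q = "\<lambda>r. arcs_of n (r ''X'') = arcs_of n (s ''X'') \<inter> ?M \<and> arcs_of n (r ''H'') = ?H \<and>
          (if s ''r'' 0 = 0 then r ''len0'' 0 = ?m \<and> (\<forall>i<?m. r ''PE'' i = ?p i * n + ?p (Suc i))
           else r ''len0'' = s ''len0'' \<and> r ''PE'' = s ''PE'')"
        have rest: "wpc ?rest ?Q m"
          if "m ''X'' = o' ''X''" "arcs_of n (m ''H'') = ?H" "m ''PV'' = ?p" "m ''RO'' = s ''RO''" "m ''len'' = s ''len''"
            "m ''cap'' = s ''cap''" "m ''r'' = s ''r''" "m ''len0'' = s ''len0''" "m ''PE'' = s ''PE''" for m
        proof (cases "s ''r'' 0 = 0")
          case False
          then show ?thesis using that X by simp
        next
          case True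
          have "wpc (''len0'' :::= V ''len'' ;; PFor ''y'' ''len'' (PStore ''PE'' (V ''y'') PV_arc)) ?Q m"
          proof (simp only: wp_PSeq wp_PStore, rule wp_map[where f = "\<lambda>i. ?p i * n + ?p (Suc i)"], goal_cases)
            case (3 i l)
            then show ?case using that by (intro arc) simp_all
          next
            case (4 l)
            then show ?case using that X True by simp
          qed (use that len in simp_all)
          then show ?thesis using True that by simp
        qed
        show ?case
        proof (cases "?m \<le> s ''L'' 0")
          case False
          then show ?thesis using rest[of o'] o by simp
        next
          case True
          have "wpc (PFor ''y'' ''nn'' (PIf (pos_exp (Cell ''MK'' (V ''y''))) (PStore ''H'' (V ''y'') (Lit 1)) PSkip))
             (wpc ?rest ?Q) o'"
          proof (rule wp_loop[where I = "\<lambda>i l. l ''H'' = (\<lambda>y. if y < i \<and> 0 < q ''MK'' y then 1 else s ''H'' y)"], goal_cases)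
            case (5 i l)
            then have "l ''MK'' = q ''MK''" using o by simp
            then show ?case using 5(2,3) by (auto simp: fun_eq_iff less_Suc_eq)
          next
            case (6 l)
            have "arcs_of n (l ''H'') = ?H"
              using True 6(1) o s index_bound[of _ n] unfolding MK[symmetric] by (auto simp: arcs_of_def)
            then show ?case using 6(2) o by (intro rest) simp_all
          qed (use o s in simp_all)
          then show ?thesis using True o by simp
        qed
      qed (use q s in simp_all)
    qed (use r len MK0 in \<open>simp_all add: path_arcs_def\<close>)
  qed (use s in simp_all)
qed

section \<open>One round of the path search at a node\<close>

definition round_post :: "nat \<Rightarrow> memory \<Rightarrow> memory \<Rightarrow> bool" where
  "round_post n s r \<longleftrightarrow> (\<exists>D p m.
     let E = arcs_of n (s ''G'') - arcs_of n (s ''FA''); X = arcs_of n (s ''X''); t = s ''t'' 0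
     in potential n (penalty n E X) t (s ''cap'' 0) D \<and> tight_path n (penalty n E X) D t p m \<and> p 0 = s ''s'' 0 \<and>
       arcs_of n (r ''X'') = X \<inter> path_arcs p m \<and>
       arcs_of n (r ''H'') = arcs_of n (s ''H'') \<union> (if m \<le> s ''L'' 0 then path_arcs p m else {}) \<and>
       (if s ''r'' 0 = 0 then r ''len0'' 0 = m \<and> (\<forall>i<m. r ''PE'' i = p i * n + p (Suc i)) \<and>
           (E \<subseteq> X \<longrightarrow> canonical_path n E (s ''s'' 0) t (s ''cap'' 0) = map (\<lambda>i. (p i, p (Suc i))) [0..<m])
        else r ''len0'' = s ''len0'' \<and> r ''PE'' = s ''PE''))"

lemma wp_ROUND:
  assumes T: "tree_ok n s" and ss: "s ''s'' 0 < n" and tt: "s ''t'' 0 < n"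
  shows "wpc ROUND (\<lambda>r. if (s ''s'' 0, s ''t'' 0) \<in> (arcs_of n (s ''G'') - arcs_of n (s ''FA''))\<^sup>*
     then round_post n s r
     else r ''H'' = s ''H'' \<and> r ''len0'' = s ''len0'') s"
proof -
  note s = tree_okD[OF T]
  let ?E = "arcs_of n (s ''G'') - arcs_of n (s ''FA'')" and ?X = "arcs_of n (s ''X'')"
    and ?s = "s ''s'' 0" and ?t = "s ''t'' 0" and ?c = "s ''cap'' 0"
  let ?w = "penalty n ?E ?X"
  have En: "?E \<subseteq> {..<n} \<times> {..<n}" using arcs_of_subset by blast
  show ?thesis
    unfolding ROUND_def
  proof (rule wp_seqI, rule wp_frame[OF wp_WEIGHTS[OF T]])
    fix r0
    assume w0: "\<forall>u<n. \<forall>v<n. weight n r0 u v = ?w u v" and fr0: "\<And>y. y \<notin> writes WEIGHTS \<Longrightarrow> r0 y = s y"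
    define r where "r = mem_write r0 ''z'' 0 ?t"
    have w: "weight n r u v = ?w u v" if "u < n" "v < n" for u v using w0 that by (simp add: r_def)
    have fr: "r y = s y" if "y \<notin> insert ''z'' (writes WEIGHTS)" for y using fr0 that by (simp add: r_def)
    have r: "r ''G'' = s ''G''" "r ''FA'' = s ''FA''" "r ''X'' = s ''X''" "r ''s'' = s ''s''" "r ''t'' = s ''t''"
      "r ''cap'' = s ''cap''" "r ''H'' = s ''H''" "r ''len0'' = s ''len0''" "r ''PE'' = s ''PE''" "r ''r'' = s ''r''"
      "r ''L'' = s ''L''" "r ''z'' 0 = ?t"
      using fr by (simp_all add: r_def)
    have Tr: "tree_ok n r" by (rule tree_ok_frame[OF T, of "insert ''z'' (writes WEIGHTS)"]) (simp_all add: fr)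
    have "wpc (SP ;; PIf (Less (Cell ''D'' (V ''s'')) (V ''cap'')) (''x'' :::= V ''s'' ;; FW ;; MARK) PSkip)
      (\<lambda>r. if (?s, ?t) \<in> ?E\<^sup>* then round_post n s r else r ''H'' = s ''H'' \<and> r ''len0'' = s ''len0'') r"
    proof (rule wp_seqI, rule wp_frame[OF wp_SP[OF tree_okD(4)[OF Tr]]])
      show "r ''z'' 0 < n" using r tt by simp
    next
      fix q
      assume P0: "potential n (weight n r) (r ''z'' 0) (r ''cap'' 0) (q ''D'')"
        and fq: "\<And>y. y \<notin> writes SP \<Longrightarrow> q y = r y"
      have q: "q ''G'' = s ''G''" "q ''FA'' = s ''FA''" "q ''X'' = s ''X''" "q ''s'' = s ''s''" "q ''t'' = s ''t''"
        "q ''cap'' = s ''cap''" "q ''H'' = s ''H''" "q ''len0'' = s ''len0''" "q ''PE'' = s ''PE''" "q ''r'' = s ''r''"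
        "q ''L'' = s ''L''" "q ''W'' = r ''W''"
        using fq r by simp_all
      have Tq: "tree_ok n q" by (rule tree_ok_frame[OF Tr, of "writes SP"]) (simp_all add: fq)
      let ?D = "q ''D''"
      have P: "potential n (weight n r) ?t ?c ?D" using P0 r by simp
      then have P': "potential n ?w ?t ?c ?D" using potential_cong[OF w, of n] by simp
      have lt: "?D ?s < ?c \<longleftrightarrow> (?s, ?t) \<in> ?E\<^sup>*"
      proof
        show "(?s, ?t) \<in> ?E\<^sup>*" if "?D ?s < ?c"
          using potential_imp_reach[OF P' ss that] penalty_arcs[OF En] by simp
        show "?D ?s < ?c" if "(?s, ?t) \<in> ?E\<^sup>*"
          by (rule potential_reach[OF P' that, of "n + 1"]) (use En s(10) in \<open>auto simp: penalty_def\<close>)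
      qed
      show "wpc (PIf (Less (Cell ''D'' (V ''s'')) (V ''cap'')) (''x'' :::= V ''s'' ;; FW ;; MARK) PSkip)
        (\<lambda>r. if (?s, ?t) \<in> ?E\<^sup>* then round_post n s r else r ''H'' = s ''H'' \<and> r ''len0'' = s ''len0'') q"
      proof (cases "(?s, ?t) \<in> ?E\<^sup>*")
        case False
        then show ?thesis using lt q by simp
      next
        case True
        define q' where "q' = mem_write q ''x'' 0 ?s"
        have fq': "q' y = q y" if "y \<notin> {''x''}" for y using that by (simp add: q'_def)
        have q': "q' ''W'' = r ''W''" "q' ''D'' = ?D" "q' ''cap'' = s ''cap''" "q' ''x'' 0 = ?s"
          using q by (simp_all add: q'_def)
        have Tq': "tree_ok n q'" by (rule tree_ok_frame[OF Tq, of "{''x''}"]) (simp_all add: fq')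
        have "wpc (FW ;; MARK) (round_post n s) q'"
        proof (rule wp_seqI, rule wp_frame[OF wp_FW[OF tree_okD(4)[OF Tq'], of ?t]])
          show "potential n (weight n q') ?t (q' ''cap'' 0) (q' ''D'')" using P q' by simp
          show "q' ''x'' 0 < n" "q' ''D'' (q' ''x'' 0) < q' ''cap'' 0" using q' ss lt True by simp_all
        next
          fix o'
          assume o1: "tight_path n (weight n q') (q' ''D'') ?t (o' ''PV'') (o' ''len'' 0) \<and> o' ''PV'' 0 = q' ''x'' 0 \<and>
              (\<forall>i\<le>o' ''len'' 0. o' ''PV'' i = (next_vertex n (weight n q') (q' ''D'') ^^ i) (q' ''x'' 0))"
            and fo: "\<And>y. y \<notin> writes FW \<Longrightarrow> o' y = q' y"
          let ?p = "o' ''PV''" and ?m = "o' ''len'' 0"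
          have tp: "tight_path n (weight n r) ?D ?t ?p ?m" and p0: "?p 0 = ?s"
            and nx: "\<And>i. i \<le> ?m \<Longrightarrow> ?p i = (next_vertex n (weight n r) ?D ^^ i) ?s"
            using o1 q' by simp_all
          have tp': "tight_path n ?w ?D ?t ?p ?m" by (rule tight_path_cong[OF w tp])
          have To: "tree_ok n o'" by (rule tree_ok_frame[OF Tq', of "writes FW"]) (simp_all add: fo)
          have o: "o' ''X'' = s ''X''" "o' ''cap'' = s ''cap''" "o' ''H'' = s ''H''" "o' ''len0'' = s ''len0''"
            "o' ''PE'' = s ''PE''" "o' ''r'' = s ''r''" "o' ''L'' = s ''L''"
            using fo fq' q by simp_all
          have pn: "?p i < n" if "i \<le> ?m" for i using tp that by (simp add: tight_path_def)
          have "card (?p ` {..?m}) \<le> card {..<n}" using pn by (intro card_mono) auto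
          then have "?m \<le> n" using tight_path_inj[OF tp] by (simp add: card_image)
          moreover have "n \<le> o' ''cap'' 0" using tree_okD(4)[OF To] by (simp add: sp_setup_def)
          ultimately have mc: "?m \<le> o' ''cap'' 0" by simp
          show "wpc MARK (round_post n s) o'"
          proof (rule wp_mono[OF wp_MARK[OF To pn mc]])
            fix l
            assume l: "arcs_of n (l ''X'') = arcs_of n (o' ''X'') \<inter> path_arcs ?p ?m \<and>
              arcs_of n (l ''H'') = arcs_of n (o' ''H'') \<union> (if ?m \<le> o' ''L'' 0 then path_arcs ?p ?m else {}) \<and>
              (if o' ''r'' 0 = 0 then l ''len0'' 0 = ?m \<and> (\<forall>i<?m. l ''PE'' i = ?p i * n + ?p (Suc i))
               else l ''len0'' = o' ''len0'' \<and> l ''PE'' = o' ''PE'')"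
            have "canonical_path n ?E ?s ?t ?c = map (\<lambda>i. (?p i, ?p (Suc i))) [0..<?m]" if "?E \<subseteq> ?X"
              using w penalty_UNIV[OF that, of n] by (intro canonical_path[OF _ P tp p0 True nx]) simp_all
            then show "round_post n s l"
              unfolding round_post_def Let_def using P' tp' p0 l o
              by (intro exI[of _ ?D] exI[of _ ?p] exI[of _ ?m]) simp
          qed
        qed
        then show ?thesis using True lt q unfolding q'_def by simp
      qed
    qed
    then show "wpc (''z'' :::= V ''t'' ;; SP ;;
        PIf (Less (Cell ''D'' (V ''s'')) (V ''cap'')) (''x'' :::= V ''s'' ;; FW ;; MARK) PSkip)
      (\<lambda>r. if (?s, ?t) \<in> ?E\<^sup>* then round_post n s r else r ''H'' = s ''H'' \<and> r ''len0'' = s ''len0'') r0"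
      using fr0 unfolding r_def by simp
  qed
qed

lemma wp_DIVIDE:
  assumes T: "tree_ok n s" and q: "s ''q'' 0 \<le> n * n"
  shows "wpc DIVIDE (\<lambda>r. r ''dg'' 0 = s ''q'' 0 mod s ''L'' 0 \<and> r ''q'' 0 = s ''q'' 0 div s ''L'' 0) s"
  unfolding DIVIDE_def
proof (simp only: wp_PSeq wp_PStore, rule wp_loop[where I = "\<lambda>i r. r ''dg'' 0 + s ''L'' 0 * r ''q'' 0 = s ''q'' 0 \<and>
    (r ''dg'' 0 < s ''L'' 0 \<or> r ''q'' 0 = i)"], goal_cases)
  case (5 i r)
  then have "r ''L'' = s ''L''" by simp
  then show ?case using 5(2) by auto
next
  case (6 r)
  let ?L = "s ''L'' 0"
  have I: "r ''dg'' 0 + ?L * r ''q'' 0 = s ''q'' 0" "r ''dg'' 0 < ?L \<or> r ''q'' 0 = n * n"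
    using 6(1) tree_okD(2)[OF T] by simp_all
  have L: "0 < ?L" by (rule tree_okD[OF T])
  have "r ''dg'' 0 < ?L"
  proof (rule ccontr)
    assume a: "\<not> r ''dg'' 0 < ?L"
    then have "1 * (n * n) \<le> ?L * r ''q'' 0" using I L by (intro mult_mono) auto
    then show False using a I(1) q L by simp
  qed
  then show ?case unfolding I(1)[symmetric] using L by simp
qed (use tree_okD[OF T] in auto)

section \<open>Nodes, branches, and the trees of all pairs\<close>

abbreviation tree_path :: "nat \<Rightarrow> memory \<Rightarrow> (nat \<times> nat) set \<Rightarrow> (nat \<times> nat) list" where
  "tree_path n s F \<equiv> canonical_path n (arcs_of n (s ''G'') - F) (s ''s'' 0) (s ''t'' 0) (s ''cap'' 0)"

definition first_path :: "nat \<Rightarrow> memory \<Rightarrow> (nat \<times> nat) set \<Rightarrow> memory \<Rightarrow> bool" where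
  "first_path n s F r \<longleftrightarrow> (\<exists>X D p m.
     let E = arcs_of n (s ''G'') - F; t = s ''t'' 0
     in E \<subseteq> X \<and> potential n (penalty n E X) t (s ''cap'' 0) D \<and> tight_path n (penalty n E X) D t p m \<and>
       p 0 = s ''s'' 0 \<and> (m \<le> s ''L'' 0 \<longrightarrow> path_arcs p m \<subseteq> arcs_of n (r ''H'')) \<and> r ''len0'' 0 = m \<and>
       (\<forall>i<m. r ''PE'' i = p i * n + p (Suc i)) \<and> tree_path n s F = map (\<lambda>i. (p i, p (Suc i))) [0..<m])"

lemma first_path_write:
  "first_path n s F (mem_write r ''r'' i j) = first_path n s F r"
  by (simp add: first_path_def)

lemma first_path_mono:
  assumes "first_path n s F r" and "arcs_of n (r ''H'') \<subseteq> arcs_of n (q ''H'')"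
    and "q ''len0'' = r ''len0''" and "q ''PE'' = r ''PE''"
  shows "first_path n s F q"
proof -
  obtain X D p m where a: "arcs_of n (s ''G'') - F \<subseteq> X"
    "potential n (penalty n (arcs_of n (s ''G'') - F) X) (s ''t'' 0) (s ''cap'' 0) D"
    "tight_path n (penalty n (arcs_of n (s ''G'') - F) X) D (s ''t'' 0) p m" "p 0 = s ''s'' 0"
    "m \<le> s ''L'' 0 \<longrightarrow> path_arcs p m \<subseteq> arcs_of n (r ''H'')" "r ''len0'' 0 = m"
    "\<forall>i<m. r ''PE'' i = p i * n + p (Suc i)" "tree_path n s F = map (\<lambda>i. (p i, p (Suc i))) [0..<m]"
    using assms(1) unfolding first_path_def Let_def by blast
  then have "m \<le> s ''L'' 0 \<longrightarrow> path_arcs p m \<subseteq> arcs_of n (q ''H'')" using assms(2) by blast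
  then show ?thesis unfolding first_path_def Let_def
    using a assms(3,4) by (intro exI[of _ X] exI[of _ D] exI[of _ p] exI[of _ m]) simp
qed

definition rounds_state :: "nat \<Rightarrow> memory \<Rightarrow> (nat \<times> nat) set \<Rightarrow> nat \<Rightarrow> memory \<Rightarrow> bool" where
  "rounds_state n s F i r \<longleftrightarrow>
     (let E = arcs_of n (s ''G''); H = arcs_of n (s ''H''); H' = arcs_of n (r ''H'')
      in H \<subseteq> H' \<and> H' \<subseteq> E \<and> card H' \<le> card H + i * s ''L'' 0 \<and>
        (if (s ''s'' 0, s ''t'' 0) \<in> (E - F)\<^sup>*
         then rounds_inv n (E - F) (s ''L'' 0) (s ''s'' 0) (s ''t'' 0) H' i (arcs_of n (r ''X'')) \<and>
           (if i = 0 then E - F \<subseteq> arcs_of n (r ''X'') else first_path n s F r)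
         else r ''len0'' 0 = 0))"

lemma card_path_arcs_le: "card (path_arcs p m) \<le> m"
  unfolding path_arcs_def using card_image_le[of "{..<m}"] by fastforce

lemma wp_rounds_step:
  assumes T: "tree_ok n s" and F: "F = arcs_of n (s ''FA'')" and ss: "s ''s'' 0 < n" and tt: "s ''t'' 0 < n"
    and I: "rounds_state n s F i r" and i: "r ''r'' 0 = i"
    and fr: "\<And>y. y \<in> {''G'', ''FA'', ''s'', ''t'', ''cap'', ''L''} \<Longrightarrow> r y = s y" and Tr: "tree_ok n r"
  shows "wpc ROUND (rounds_state n s F (Suc i)) r"
proof -
  have r: "r ''G'' = s ''G''" "r ''FA'' = s ''FA''" "r ''s'' = s ''s''" "r ''t'' = s ''t''" "r ''cap'' = s ''cap''"
    "r ''L'' = s ''L''" using fr by simp_all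
  let ?E = "arcs_of n (s ''G'')" and ?H = "arcs_of n (s ''H'')" and ?s = "s ''s'' 0" and ?t = "s ''t'' 0"
    and ?L = "s ''L'' 0" and ?c = "s ''cap'' 0"
  have En: "?E \<subseteq> {..<n} \<times> {..<n}" and EF: "?E - F \<subseteq> {..<n} \<times> {..<n}" using arcs_of_subset by blast+
  have H: "?H \<subseteq> arcs_of n (r ''H'')" "arcs_of n (r ''H'') \<subseteq> ?E" "card (arcs_of n (r ''H'')) \<le> card ?H + i * ?L"
    using I by (simp_all add: rounds_state_def Let_def)
  show ?thesis
  proof (rule wp_mono[OF wp_ROUND[OF Tr]])
    fix q
    assume post: "if (r ''s'' 0, r ''t'' 0) \<in> (arcs_of n (r ''G'') - arcs_of n (r ''FA''))\<^sup>*
      then round_post n r q else q ''H'' = r ''H'' \<and> q ''len0'' = r ''len0''"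
    show "rounds_state n s F (Suc i) q"
    proof (cases "(?s, ?t) \<in> (?E - F)\<^sup>*")
      case False
      then have "q ''H'' = r ''H''" "q ''len0'' = r ''len0''" using post r F by simp_all
      then show ?thesis using I False H by (simp add: rounds_state_def Let_def)
    next
      case True
      let ?X = "arcs_of n (r ''X'')"
      have "round_post n r q" using post r F True by simp
      then obtain D p m where D: "potential n (penalty n (?E - F) ?X) ?t ?c D"
        and p: "tight_path n (penalty n (?E - F) ?X) D ?t p m" and p0: "p 0 = ?s"
        and X: "arcs_of n (q ''X'') = ?X \<inter> path_arcs p m"
        and Hq: "arcs_of n (q ''H'') = arcs_of n (r ''H'') \<union> (if m \<le> ?L then path_arcs p m else {})"
        and PE: "if i = 0 then q ''len0'' 0 = m \<and> (\<forall>i<m. q ''PE'' i = p i * n + p (Suc i)) \<and>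
           (?E - F \<subseteq> ?X \<longrightarrow> tree_path n s F = map (\<lambda>i. (p i, p (Suc i))) [0..<m])
          else q ''len0'' = r ''len0'' \<and> q ''PE'' = r ''PE''"
        unfolding round_post_def Let_def r i F by auto
      have pE: "path_arcs p m \<subseteq> ?E - F" using tight_path_is_path[OF p] by (simp add: is_path_def)
      have I': "rounds_inv n (?E - F) ?L ?s ?t (arcs_of n (r ''H'')) i ?X"
        and J: "if i = 0 then ?E - F \<subseteq> ?X else first_path n s F r"
        using I True by (simp_all add: rounds_state_def Let_def)
      have Hsub: "arcs_of n (r ''H'') \<subseteq> arcs_of n (q ''H'')" "m \<le> ?L \<Longrightarrow> path_arcs p m \<subseteq> arcs_of n (q ''H'')"
        unfolding Hq by auto
      have inv: "rounds_inv n (?E - F) ?L ?s ?t (arcs_of n (q ''H'')) (Suc i) (arcs_of n (q ''X''))"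
        unfolding X by (rule rounds_inv_Suc[OF EF D p p0 I' Hsub])
      have fp: "first_path n s F q"
      proof (cases "i = 0")
        case True
        then show ?thesis
          unfolding first_path_def Let_def using D p p0 Hsub(2) PE J
          by (intro exI[of _ ?X] exI[of _ D] exI[of _ p] exI[of _ m]) simp
      next
        case False
        then have f: "first_path n s F r" "q ''len0'' = r ''len0''" "q ''PE'' = r ''PE''" using PE J by simp_all
        show ?thesis by (rule first_path_mono[OF f(1) Hsub(1) f(2,3)])
      qed
      have "card (arcs_of n (q ''H'')) \<le> card (arcs_of n (r ''H'')) + ?L"
      proof (cases "m \<le> ?L")
        case True
        then show ?thesis
          using card_Un_le[of "arcs_of n (r ''H'')" "path_arcs p m"] card_path_arcs_le[of p m] unfolding Hq by simp
      qed (simp add: Hq)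
      then have "card (arcs_of n (q ''H'')) \<le> card ?H + Suc i * ?L" using H by simp
      moreover have "arcs_of n (q ''H'') \<subseteq> ?E" unfolding Hq using H pE by auto
      ultimately show ?thesis
        using True inv fp H Hsub unfolding rounds_state_def Let_def by simp
    qed
  qed (use r ss tt in simp_all)
qed

lemma wp_NODE:
  assumes T: "tree_ok n s" and ss: "s ''s'' 0 < n" and tt: "s ''t'' 0 < n" and q: "s ''q'' 0 \<le> n * n"
    and H: "arcs_of n (s ''H'') \<subseteq> arcs_of n (s ''G'')" and F: "F = arcs_of n (s ''FA'')"
  shows "wpc NODE (\<lambda>r. settled (arcs_of n (s ''G'')) (s ''L'' 0) (s ''s'' 0) (s ''t'' 0) (tree_path n s) (arcs_of n (r ''H'')) F \<and>
     arcs_of n (s ''H'') \<subseteq> arcs_of n (r ''H'') \<and> arcs_of n (r ''H'') \<subseteq> arcs_of n (s ''G'') \<and>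
     card (arcs_of n (r ''H'')) \<le> card (arcs_of n (s ''H'')) + s ''J'' 0 * s ''L'' 0 \<and>
     (arcs_of n (r ''FA''), r ''q'' 0) = walk_step (s ''L'' 0) (tree_path n s) (F, s ''q'' 0)) s"
proof -
  let ?E = "arcs_of n (s ''G'')" and ?H = "arcs_of n (s ''H'')" and ?s = "s ''s'' 0" and ?t = "s ''t'' 0"
    and ?L = "s ''L'' 0" and ?J = "s ''J'' 0"
  note s = tree_okD[OF T]
  have En: "?E \<subseteq> {..<n} \<times> {..<n}" and EF: "?E - F \<subseteq> {..<n} \<times> {..<n}" using arcs_of_subset by blast+
  have J: "n * n < 2 ^ ?J" "?J \<le> s ''cap'' 0" using T by (simp_all add: tree_ok_def)
  \<comment> \<open>At least one round takes place, so \<open>len0\<close> and \<open>PE\<close>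
    describe the first path whenever the pair is connected.\<close>
  have "?J \<noteq> 0" using J(1) s(11) by (cases "?J") auto
  show ?thesis
    unfolding NODE_def
  proof (rule wp_seqI, rule wp_map[where f = "\<lambda>_. 1"], goal_cases)
    case (4 r0)
    define r where "r = mem_write r0 ''len0'' 0 0"
    have fr: "r y = s y" if "y \<notin> {''X'', ''y'', ''len0''}" for y using that 4(1) by (simp add: r_def)
    have Tr: "tree_ok n r" by (rule tree_ok_frame[OF T, of "{''X'', ''y'', ''len0''}"]) (simp_all add: fr)
    have r: "r ''H'' = s ''H''" "r ''J'' = s ''J''" "r ''cap'' = s ''cap''" "r ''q'' = s ''q''" "r ''FA'' = s ''FA''"
      "r ''len0'' 0 = 0" using fr by (simp_all add: r_def)
    have X: "?E - F \<subseteq> arcs_of n (r ''X'')"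
      using 4(2) s(2) index_bound[of _ n] by (auto simp: arcs_of_def r_def)
    have I0: "rounds_state n s F 0 r"
      using r H X rounds_inv_0[OF EF X] by (simp add: rounds_state_def Let_def)
    have "wpc (PFor ''r'' ''J'' ROUND ;; DIVIDE ;;
        PIf (Less (V ''dg'') (V ''len0'')) (PStore ''FA'' (Cell ''PE'' (V ''dg'')) (Lit 1)) PSkip)
      (\<lambda>r. settled ?E ?L ?s ?t (tree_path n s) (arcs_of n (r ''H'')) F \<and> ?H \<subseteq> arcs_of n (r ''H'') \<and>
         arcs_of n (r ''H'') \<subseteq> ?E \<and> card (arcs_of n (r ''H'')) \<le> card ?H + ?J * ?L \<and>
         (arcs_of n (r ''FA''), r ''q'' 0) = walk_step ?L (tree_path n s) (F, s ''q'' 0)) r"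
    proof (rule wp_seqI, rule wp_loop[where I = "rounds_state n s F"], goal_cases)
      case (3 i j q)
      then show ?case by (simp add: rounds_state_def first_path_write Let_def)
    next
      case (5 i q)
      have fq: "q y = s y" if "y \<notin> insert ''r'' (writes ROUND)" for y
        using that 5(4)[of y] fr[of y] by simp
      have Tq: "tree_ok n q" by (rule tree_ok_frame[OF T, of "insert ''r'' (writes ROUND)"]) (simp_all add: fq)
      show ?case by (rule wp_rounds_step[OF T F ss tt 5(2,3) _ Tq]) (auto simp: fq)
    next
      case (6 q)
      have fq: "q y = s y" if "y \<notin> insert ''r'' (writes ROUND)" for y
        using that 6(2)[of y] fr[of y] by simp
      have Tq: "tree_ok n q" by (rule tree_ok_frame[OF T, of "insert ''r'' (writes ROUND)"]) (simp_all add: fq)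
      have I: "rounds_state n s F ?J q" using 6(1) r by simp
      let ?H' = "arcs_of n (q ''H'')"
      have H': "?H \<subseteq> ?H'" "?H' \<subseteq> ?E" "card ?H' \<le> card ?H + ?J * ?L"
        using I by (simp_all add: rounds_state_def Let_def)
      have len: "q ''len0'' 0 = length (tree_path n s F) \<and>
          (\<forall>i<length (tree_path n s F). \<exists>u v. tree_path n s F ! i = (u, v) \<and> q ''PE'' i = u * n + v \<and> u < n \<and> v < n) \<and>
          settled ?E ?L ?s ?t (tree_path n s) ?H' F"
      proof (cases "(?s, ?t) \<in> (?E - F)\<^sup>*")
        case False
        then have "tree_path n s F = []" by (simp add: canonical_path_def)
        then show ?thesis using I False settled_unreachable[OF False, of "tree_path n s"] by (simp add: rounds_state_def Let_def)
      next
        case True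
        then have inv: "rounds_inv n (?E - F) ?L ?s ?t ?H' ?J (arcs_of n (q ''X''))" and "first_path n s F q"
          using I \<open>?J \<noteq> 0\<close> by (simp_all add: rounds_state_def Let_def)
        then obtain X D p m where X: "?E - F \<subseteq> X" and D: "potential n (penalty n (?E - F) X) ?t (s ''cap'' 0) D"
          and p: "tight_path n (penalty n (?E - F) X) D ?t p m" and p0: "p 0 = ?s"
          and mL: "m \<le> ?L \<longrightarrow> path_arcs p m \<subseteq> ?H'" and m: "q ''len0'' 0 = m"
          and PE: "\<forall>i<m. q ''PE'' i = p i * n + p (Suc i)"
          and tp: "tree_path n s F = map (\<lambda>i. (p i, p (Suc i))) [0..<m]"
          unfolding first_path_def Let_def by blast
        have l: "length (tree_path n s F) = m" "set (tree_path n s F) = path_arcs p m"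
          unfolding tp by (auto simp: path_arcs_def)
        have "settled ?E ?L ?s ?t (tree_path n s) ?H' F"
        proof (rule settledI[where F = F and pe = "tree_path n s"])
          show "m \<le> ?L \<Longrightarrow> path_arcs p m \<subseteq> ?H'" using mL by simp
        qed (fact En X D p p0 inv J(1) l)+
        moreover have "p i < n" if "i \<le> m" for i using p that by (simp add: tight_path_def)
        ultimately show ?thesis using m PE unfolding l by (simp add: tp)
      qed
      show ?case
      proof (rule wp_seqI, rule wp_frame[OF wp_DIVIDE[OF Tq]])
        show "q ''q'' 0 \<le> n * n" using fq q by simp
      next
        fix p
        assume p1: "p ''dg'' 0 = q ''q'' 0 mod q ''L'' 0 \<and> p ''q'' 0 = q ''q'' 0 div q ''L'' 0"
          and p2: "\<And>y. y \<notin> writes DIVIDE \<Longrightarrow> p y = q y"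
        have p: "p ''dg'' 0 = s ''q'' 0 mod ?L" "p ''q'' 0 = s ''q'' 0 div ?L" "p ''H'' = q ''H''"
          "p ''len0'' = q ''len0''" "p ''PE'' = q ''PE''" "p ''FA'' = s ''FA''"
          using p1 p2 fq by simp_all
        show "wpc (PIf (Less (V ''dg'') (V ''len0'')) (PStore ''FA'' (Cell ''PE'' (V ''dg'')) (Lit 1)) PSkip)
           (\<lambda>r. settled ?E ?L ?s ?t (tree_path n s) (arcs_of n (r ''H'')) F \<and> ?H \<subseteq> arcs_of n (r ''H'') \<and>
             arcs_of n (r ''H'') \<subseteq> ?E \<and> card (arcs_of n (r ''H'')) \<le> card ?H + ?J * ?L \<and>
             (arcs_of n (r ''FA''), r ''q'' 0) = walk_step ?L (tree_path n s) (F, s ''q'' 0)) p"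
        proof (cases "s ''q'' 0 mod ?L < length (tree_path n s F)")
          case False
          then show ?thesis using p len H' F by (simp add: walk_step_def)
        next
          case True
          let ?d = "s ''q'' 0 mod ?L"
          obtain u v where uv: "tree_path n s F ! ?d = (u, v)" "q ''PE'' ?d = u * n + v" "u < n" "v < n"
            using len True by blast
          show ?thesis using True p len H' F uv arcs_of_upd[OF uv(3,4), of "s ''FA''" 1] by (simp add: walk_step_def)
        qed
      qed
    qed (use r J I0 in simp_all)
    then show ?case unfolding r_def by simp
  qed (use s in simp_all)
qed

definition code_state :: "nat \<Rightarrow> memory \<Rightarrow> nat \<Rightarrow> nat \<Rightarrow> memory \<Rightarrow> bool" where
  "code_state n s c i r \<longleftrightarrow>
     (let E = arcs_of n (s ''G''); H = arcs_of n (s ''H''); H' = arcs_of n (r ''H'')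
      in H \<subseteq> H' \<and> H' \<subseteq> E \<and> card H' \<le> card H + i * (s ''J'' 0 * s ''L'' 0) \<and> r ''q'' 0 \<le> c \<and>
        (arcs_of n (r ''FA''), r ''q'' 0) = (walk_step (s ''L'' 0) (tree_path n s) ^^ i) ({}, c) \<and>
        (\<forall>i'<i. settled E (s ''L'' 0) (s ''s'' 0) (s ''t'' 0) (tree_path n s) H'
           (fst ((walk_step (s ''L'' 0) (tree_path n s) ^^ i') ({}, c)))))"

lemma wp_CODE:
  assumes T: "tree_ok n s" and ss: "s ''s'' 0 < n" and tt: "s ''t'' 0 < n" and c: "s ''c'' 0 \<le> n * n"
    and H: "arcs_of n (s ''H'') \<subseteq> arcs_of n (s ''G'')"
  shows "wpc CODE (code_state n s (s ''c'' 0) (s ''k'' 0)) s"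
  unfolding CODE_def
proof (rule wp_seqI, rule wp_map[where f = "\<lambda>_. 0"], goal_cases)
  case (4 r0)
  let ?c = "s ''c'' 0" and ?L = "s ''L'' 0"
  define r where "r = mem_write r0 ''q'' 0 ?c"
  have fr: "r y = s y" if "y \<notin> {''FA'', ''y'', ''q''}" for y using that 4(1) by (simp add: r_def)
  have FA: "arcs_of n (r ''FA'') = {}"
    using 4(2) tree_okD(2)[OF T] index_bound[of _ n] by (auto simp: arcs_of_def r_def)
  have r: "r ''H'' = s ''H''" "r ''k'' = s ''k''" "r ''cap'' = s ''cap''" "r ''q'' 0 = ?c"
    using fr by (simp_all add: r_def)
  have "wpc (PFor ''j'' ''k'' NODE) (code_state n s ?c (s ''k'' 0)) r"
  proof (rule wp_loop[where I = "code_state n s ?c"], goal_cases)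
    case (3 i j q)
    then show ?case by (simp add: code_state_def Let_def)
  next
    case (5 i q)
    have fq: "q y = s y" if "y \<notin> insert ''j'' (writes NODE)" for y
      using that 5(4)[of y] fr[of y] by simp
    have Tq: "tree_ok n q" by (rule tree_ok_frame[OF T, of "insert ''j'' (writes NODE)"]) (simp_all add: fq)
    have q: "q ''G'' = s ''G''" "q ''L'' = s ''L''" "q ''J'' = s ''J''" "q ''s'' = s ''s''" "q ''t'' = s ''t''"
      "q ''cap'' = s ''cap''" using fq by simp_all
    let ?pe = "tree_path n s" and ?H = "arcs_of n (s ''H'')" and ?E = "arcs_of n (s ''G'')"
    have I: "?H \<subseteq> arcs_of n (q ''H'')" "arcs_of n (q ''H'') \<subseteq> ?E"
      "card (arcs_of n (q ''H'')) \<le> card ?H + i * (s ''J'' 0 * ?L)" "q ''q'' 0 \<le> ?c"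
      and w: "(arcs_of n (q ''FA''), q ''q'' 0) = (walk_step ?L ?pe ^^ i) ({}, ?c)"
      and S: "\<forall>i'<i. settled ?E ?L (s ''s'' 0) (s ''t'' 0) ?pe (arcs_of n (q ''H''))
           (fst ((walk_step ?L ?pe ^^ i') ({}, ?c)))"
      using 5(2) by (simp_all add: code_state_def Let_def)
    show ?case
    proof (rule wp_mono[OF wp_NODE[OF Tq _ _ _ _ refl]])
      show "q ''s'' 0 < n" "q ''t'' 0 < n" "q ''q'' 0 \<le> n * n" "arcs_of n (q ''H'') \<subseteq> arcs_of n (q ''G'')"
        using ss tt q I c by simp_all
    next
      fix p
      assume "settled (arcs_of n (q ''G'')) (q ''L'' 0) (q ''s'' 0) (q ''t'' 0) (tree_path n q) (arcs_of n (p ''H''))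
           (arcs_of n (q ''FA'')) \<and>
         arcs_of n (q ''H'') \<subseteq> arcs_of n (p ''H'') \<and> arcs_of n (p ''H'') \<subseteq> arcs_of n (q ''G'') \<and>
         card (arcs_of n (p ''H'')) \<le> card (arcs_of n (q ''H'')) + q ''J'' 0 * q ''L'' 0 \<and>
         (arcs_of n (p ''FA''), p ''q'' 0) = walk_step (q ''L'' 0) (tree_path n q) (arcs_of n (q ''FA''), q ''q'' 0)"
      then have p: "settled ?E ?L (s ''s'' 0) (s ''t'' 0) ?pe (arcs_of n (p ''H'')) (arcs_of n (q ''FA''))"
        "arcs_of n (q ''H'') \<subseteq> arcs_of n (p ''H'')" "arcs_of n (p ''H'') \<subseteq> ?E"
        "card (arcs_of n (p ''H'')) \<le> card (arcs_of n (q ''H'')) + s ''J'' 0 * ?L"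
        "(arcs_of n (p ''FA''), p ''q'' 0) = walk_step ?L ?pe (arcs_of n (q ''FA''), q ''q'' 0)"
        unfolding q by auto
      have "arcs_of n (q ''FA'') = fst ((walk_step ?L ?pe ^^ i) ({}, ?c))" using w by (metis fst_conv)
      then have "settled ?E ?L (s ''s'' 0) (s ''t'' 0) ?pe (arcs_of n (p ''H'')) (fst ((walk_step ?L ?pe ^^ i') ({}, ?c)))"
        if "i' < Suc i" for i'
        using that p(1) S settled_mono[OF _ p(2)] by (cases "i' = i") auto
      moreover have "(arcs_of n (p ''FA''), p ''q'' 0) = (walk_step ?L ?pe ^^ Suc i) ({}, ?c)"
        using p(5) w by simp
      moreover have "p ''q'' 0 \<le> q ''q'' 0"
        using p(5) by (simp add: walk_step_def)
      ultimately show "code_state n s ?c (Suc i) p"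
        unfolding code_state_def Let_def using p I by auto
    qed
  next
    case (6 q)
    then show ?case using r by simp
  qed (use r FA H T in \<open>simp_all add: code_state_def tree_ok_def\<close>)
  then show ?case using 4(1) unfolding r_def by simp
qed (use tree_okD[OF T] in simp_all)

lemma code_state_covered:
  assumes L: "0 < s ''L'' 0" and W: "s ''w'' 0 = s ''L'' 0 ^ (s ''k'' 0 - 1)" and k: "0 < s ''k'' 0"
    and S: "\<And>c i. c < s ''w'' 0 \<Longrightarrow> i < s ''k'' 0 \<Longrightarrow> settled (arcs_of n (s ''G'')) (s ''L'' 0) (s ''s'' 0) (s ''t'' 0)
           (tree_path n s) H (fst ((walk_step (s ''L'' 0) (tree_path n s) ^^ i) ({}, c)))"
    and F: "finite F" "card F \<le> s ''k'' 0"
  shows "covered (arcs_of n (s ''G'')) (s ''L'' 0) (s ''s'' 0) (s ''t'' 0) H F"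
proof (rule walk_covers[OF L F(1), where F = "{}" and m = "s ''k'' 0 - 1" and pe = "tree_path n s"])
  show "card (F - {}) \<le> Suc (s ''k'' 0 - 1)" using F k by simp
qed (use S W k in simp_all)

definition pair_covered :: "nat \<Rightarrow> memory \<Rightarrow> memory \<Rightarrow> nat \<Rightarrow> nat \<Rightarrow> bool" where
  "pair_covered n s r a b \<longleftrightarrow> (\<forall>F. finite F \<longrightarrow> card F \<le> s ''k'' 0 \<longrightarrow>
     covered (arcs_of n (s ''G'')) (s ''L'' 0) a b (arcs_of n (r ''H'')) F)"

lemma pair_covered_mono:
  "pair_covered n s r a b \<Longrightarrow> arcs_of n (r ''H'') \<subseteq> arcs_of n (q ''H'') \<Longrightarrow> pair_covered n s q a b"
  by (auto simp: pair_covered_def intro: covered_mono)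

definition codes_state :: "nat \<Rightarrow> memory \<Rightarrow> nat \<Rightarrow> memory \<Rightarrow> bool" where
  "codes_state n s i r \<longleftrightarrow> arcs_of n (s ''H'') \<subseteq> arcs_of n (r ''H'') \<and> arcs_of n (r ''H'') \<subseteq> arcs_of n (s ''G'') \<and>
     card (arcs_of n (r ''H'')) \<le> card (arcs_of n (s ''H'')) + i * (s ''k'' 0 * (s ''J'' 0 * s ''L'' 0)) \<and>
     (\<forall>c<i. \<forall>j<s ''k'' 0. settled (arcs_of n (s ''G'')) (s ''L'' 0) (s ''s'' 0) (s ''t'' 0) (tree_path n s)
        (arcs_of n (r ''H'')) (fst ((walk_step (s ''L'' 0) (tree_path n s) ^^ j) ({}, c))))"

lemma wp_CODES:
  assumes T: "tree_ok n s" and ss: "s ''s'' 0 < n" and tt: "s ''t'' 0 < n"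
    and H: "arcs_of n (s ''H'') \<subseteq> arcs_of n (s ''G'')"
  shows "wpc (PFor ''c'' ''w'' CODE) (codes_state n s (s ''w'' 0)) s"
proof (rule wp_loop[where I = "codes_state n s"], goal_cases)
  case 1
  then show ?case using T by (simp add: tree_ok_def tables_def)
next
  case (3 i j q)
  then show ?case by (simp add: codes_state_def)
next
  case (5 i r)
  have fr: "r y = s y" if "y \<notin> insert ''c'' (writes CODE)" for y using that 5(4)[of y] by simp
  have Tr: "tree_ok n r" by (rule tree_ok_frame[OF T, of "insert ''c'' (writes CODE)"]) (simp_all add: fr)
  have r: "r ''G'' = s ''G''" "r ''L'' = s ''L''" "r ''J'' = s ''J''" "r ''s'' = s ''s''" "r ''t'' = s ''t''"
    "r ''cap'' = s ''cap''" "r ''k'' = s ''k''" "r ''c'' 0 = i" using fr 5(3) by simp_all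
  have I: "arcs_of n (s ''H'') \<subseteq> arcs_of n (r ''H'')" "arcs_of n (r ''H'') \<subseteq> arcs_of n (s ''G'')"
    "card (arcs_of n (r ''H'')) \<le> card (arcs_of n (s ''H'')) + i * (s ''k'' 0 * (s ''J'' 0 * s ''L'' 0))"
    and S: "\<And>c j. c < i \<Longrightarrow> j < s ''k'' 0 \<Longrightarrow> settled (arcs_of n (s ''G'')) (s ''L'' 0) (s ''s'' 0) (s ''t'' 0) (tree_path n s)
        (arcs_of n (r ''H'')) (fst ((walk_step (s ''L'' 0) (tree_path n s) ^^ j) ({}, c)))"
    using 5(2) by (simp_all add: codes_state_def)
  have i: "i \<le> n * n" using 5(1) T by (simp add: tree_ok_def)
  show ?case
  proof (rule wp_mono[OF wp_CODE[OF Tr]])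
    show "r ''s'' 0 < n" "r ''t'' 0 < n" "r ''c'' 0 \<le> n * n" "arcs_of n (r ''H'') \<subseteq> arcs_of n (r ''G'')"
      using ss tt r I i by simp_all
  next
    fix q assume "code_state n r (r ''c'' 0) (r ''k'' 0) q"
    then have q: "arcs_of n (r ''H'') \<subseteq> arcs_of n (q ''H'')" "arcs_of n (q ''H'') \<subseteq> arcs_of n (s ''G'')"
      "card (arcs_of n (q ''H'')) \<le> card (arcs_of n (r ''H'')) + s ''k'' 0 * (s ''J'' 0 * s ''L'' 0)"
      "\<And>j. j < s ''k'' 0 \<Longrightarrow> settled (arcs_of n (s ''G'')) (s ''L'' 0) (s ''s'' 0) (s ''t'' 0) (tree_path n s)
        (arcs_of n (q ''H'')) (fst ((walk_step (s ''L'' 0) (tree_path n s) ^^ j) ({}, i)))"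
      unfolding code_state_def Let_def r by blast+
    have "settled (arcs_of n (s ''G'')) (s ''L'' 0) (s ''s'' 0) (s ''t'' 0) (tree_path n s)
        (arcs_of n (q ''H'')) (fst ((walk_step (s ''L'' 0) (tree_path n s) ^^ j) ({}, c)))"
      if "c < Suc i" "j < s ''k'' 0" for c j
      using that q(4) settled_mono[OF S[of c j] q(1)] by (cases "c = i") auto
    moreover have "card (arcs_of n (q ''H'')) \<le> card (arcs_of n (s ''H'')) + Suc i * (s ''k'' 0 * (s ''J'' 0 * s ''L'' 0))"
      using q(3) I(3) by simp
    ultimately show "codes_state n s (Suc i) q" using I(1) q(1,2) unfolding codes_state_def by blast
  qed
qed (use H in \<open>simp_all add: codes_state_def\<close>)

lemma wp_TREE:
  assumes T: "tree_ok n s" and H: "arcs_of n (s ''H'') = {}"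
    and k: "0 < s ''k'' 0" and W: "s ''w'' 0 = s ''L'' 0 ^ (s ''k'' 0 - 1)"
  shows "wpc TREE (\<lambda>r. arcs_of n (r ''H'') \<subseteq> arcs_of n (s ''G'') \<and>
      card (arcs_of n (r ''H'')) \<le> card (arcs_of n (s ''P'')) * (s ''w'' 0 * (s ''k'' 0 * (s ''J'' 0 * s ''L'' 0))) \<and>
      (\<forall>(a, b)\<in>arcs_of n (s ''P''). pair_covered n s r a b)) s"
proof -
  note s = tree_okD[OF T]
  let ?K = "s ''w'' 0 * (s ''k'' 0 * (s ''J'' 0 * s ''L'' 0))"
  let ?P = "\<lambda>i. {(u, v) \<in> arcs_of n (s ''P''). u * n + v < i}"
  define I where "I i r \<longleftrightarrow> arcs_of n (r ''H'') \<subseteq> arcs_of n (s ''G'') \<and> card (arcs_of n (r ''H'')) \<le> card (?P i) * ?K \<and>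
     (\<forall>(a, b)\<in>?P i. pair_covered n s r a b)" for i r
  show ?thesis
    unfolding TREE_def
  proof (rule wp_loop[where I = I], goal_cases)
    case (3 i j r)
    then show ?case by (simp add: I_def pair_covered_def)
  next
    case (5 i r)
    let ?wr = "{''e'', ''s'', ''t'', ''c''} \<union> writes CODE"
    have fr: "r y = s y" if "y \<notin> ?wr" for y using that 5(4)[of y] by simp
    have r: "r ''G'' = s ''G''" "r ''L'' = s ''L''" "r ''J'' = s ''J''" "r ''cap'' = s ''cap''" "r ''k'' = s ''k''"
      "r ''w'' = s ''w''" "r ''P'' = s ''P''" "r ''DU'' = s ''DU''" "r ''DV'' = s ''DV''" "r ''e'' 0 = i"
      using fr 5(3) by simp_all
    have i: "i < n * n" using 5(1) s by simp
    let ?a = "i div n" and ?b = "i mod n"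
    have ab: "?a < n" "?b < n" using div_bound[OF i] mod_bound[OF i] by auto
    show ?case
    proof (cases "0 < s ''P'' i")
      case False
      then have "?P (Suc i) = ?P i" using arcs_of_prefix_Suc[OF i] by simp
      then have "I (Suc i) r" using 5(2) by (simp add: I_def)
      then show ?thesis using False r by simp
    next
      case True
      define q where "q = mem_write (mem_write r ''s'' 0 ?a) ''t'' 0 ?b"
      have fq: "q y = s y" if "y \<notin> ?wr" for y using that fr[of y] by (simp add: q_def)
      have Tq: "tree_ok n q" by (rule tree_ok_frame[OF T, of ?wr]) (simp_all add: fq)
      have q: "q ''G'' = s ''G''" "q ''L'' = s ''L''" "q ''J'' = s ''J''" "q ''k'' = s ''k''" "q ''w'' = s ''w''"
        "q ''s'' 0 = ?a" "q ''t'' 0 = ?b" "q ''H'' = r ''H''" using r by (simp_all add: q_def)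
      have P: "?P (Suc i) = insert (?a, ?b) (?P i)" using arcs_of_prefix_Suc[OF i] True by simp
      have "(?a, ?b) \<notin> ?P i" by simp
      moreover have "finite (?P i)" by (rule finite_subset[of _ "{..<n} \<times> {..<n}"]) (auto simp: arcs_of_def)
      ultimately have cP: "card (?P (Suc i)) = Suc (card (?P i))" unfolding P by simp
      have "wpc (PFor ''c'' ''w'' CODE) (I (Suc i)) q"
      proof (rule wp_mono[OF wp_CODES[OF Tq]])
        show "q ''s'' 0 < n" "q ''t'' 0 < n" "arcs_of n (q ''H'') \<subseteq> arcs_of n (q ''G'')"
          using ab q 5(2) by (simp_all add: I_def)
      next
        fix p assume p: "codes_state n q (q ''w'' 0) p"
        have Hp: "arcs_of n (r ''H'') \<subseteq> arcs_of n (p ''H'')" "arcs_of n (p ''H'') \<subseteq> arcs_of n (s ''G'')"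
          "card (arcs_of n (p ''H'')) \<le> card (arcs_of n (r ''H'')) + ?K"
          using p q by (simp_all add: codes_state_def)
        have new: "pair_covered n s p ?a ?b"
          unfolding pair_covered_def
        proof (intro allI impI)
          fix F :: "(nat \<times> nat) set" assume F: "finite F" "card F \<le> s ''k'' 0"
          have "covered (arcs_of n (q ''G'')) (q ''L'' 0) (q ''s'' 0) (q ''t'' 0) (arcs_of n (p ''H'')) F"
          proof (rule code_state_covered)
            show "settled (arcs_of n (q ''G'')) (q ''L'' 0) (q ''s'' 0) (q ''t'' 0) (tree_path n q) (arcs_of n (p ''H''))
               (fst ((walk_step (q ''L'' 0) (tree_path n q) ^^ i) ({}, c)))"
              if "c < q ''w'' 0" "i < q ''k'' 0" for c i using p that by (simp add: codes_state_def)
          qed (use q W k s(9) F in simp_all)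
          then show "covered (arcs_of n (s ''G'')) (s ''L'' 0) ?a ?b (arcs_of n (p ''H'')) F" using q by simp
        qed
        have "pair_covered n s p a b" if "(a, b) \<in> ?P (Suc i)" for a b
        proof (cases "(a, b) = (?a, ?b)")
          case True then show ?thesis using new by simp
        next
          case False
          then have "(a, b) \<in> ?P i" using that unfolding P by blast
          then have "pair_covered n s r a b" using 5(2) unfolding I_def by blast
          then show ?thesis using Hp(1) by (rule pair_covered_mono)
        qed
        moreover have "card (arcs_of n (p ''H'')) \<le> card (?P (Suc i)) * ?K"
          using Hp(3) 5(2) unfolding cP I_def by simp
        ultimately show "I (Suc i) p" using Hp(2) unfolding I_def by blast
      qed
      then show ?thesis using True r s i unfolding q_def by simp
    qed
  next
    case (6 r)
    then show ?case using s arcs_of_prefix_all by (simp add: I_def)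
  qed (use H s in \<open>simp_all add: I_def\<close>)
qed

section \<open>Random vertices\<close>

lemma prob_bind_pmf:
  "measure_pmf.prob (bind_pmf p f) A = (\<integral>x. measure_pmf.prob (f x) A \<partial>p)"
  unfolding measure_pmf_bind
  by (rule measure_pmf.measure_bind[where N = "count_space UNIV"])
    (auto simp: space_subprob_algebra intro!: measure_pmf.subprob_space_axioms)

lemma prob_bind_le:
  assumes "\<And>x. x \<in> set_pmf p \<Longrightarrow> x \<in> B \<Longrightarrow> measure_pmf.prob (f x) A \<le> c"
    and "\<And>x. x \<in> set_pmf p \<Longrightarrow> x \<notin> B \<Longrightarrow> measure_pmf.prob (f x) A = 0"
  shows "measure_pmf.prob (bind_pmf p f) A \<le> measure_pmf.prob p B * c"
proof -
  have "(\<integral>x. measure_pmf.prob (f x) A \<partial>p) \<le> (\<integral>x. indicator B x * c \<partial>p)"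
  proof (rule integral_mono_AE)
    show "integrable (measure_pmf p) (\<lambda>x. measure_pmf.prob (f x) A)"
      by (rule measure_pmf.integrable_const_bound[of _ 1]) auto
    show "integrable (measure_pmf p) (\<lambda>x. indicator B x * c)"
      by (rule measure_pmf.integrable_const_bound[of _ "\<bar>c\<bar>"]) (auto simp: indicator_def)
    show "AE x in measure_pmf p. measure_pmf.prob (f x) A \<le> indicator B x * c"
      using assms by (auto simp: AE_measure_pmf_iff indicator_def)
  qed
  then show ?thesis by (simp add: prob_bind_pmf)
qed

lemma prob_bind_ge:
  assumes "\<And>x. x \<in> set_pmf p \<Longrightarrow> x \<in> B \<Longrightarrow> c \<le> measure_pmf.prob (f x) A"
  shows "measure_pmf.prob p B * c \<le> measure_pmf.prob (bind_pmf p f) A"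
proof -
  have "(\<integral>x. indicator B x * c \<partial>p) \<le> (\<integral>x. measure_pmf.prob (f x) A \<partial>p)"
  proof (rule integral_mono_AE)
    show "integrable (measure_pmf p) (\<lambda>x. measure_pmf.prob (f x) A)"
      by (rule measure_pmf.integrable_const_bound[of _ 1]) auto
    show "integrable (measure_pmf p) (\<lambda>x. indicator B x * c)"
      by (rule measure_pmf.integrable_const_bound[of _ "\<bar>c\<bar>"]) (auto simp: indicator_def)
    show "AE x in measure_pmf p. indicator B x * c \<le> measure_pmf.prob (f x) A"
      using assms by (auto simp: AE_measure_pmf_iff indicator_def)
  qed
  then show ?thesis by (simp add: prob_bind_pmf)
qed

section \<open>Uniform random numbers from coin tosses\<close>

definition RBITS :: prg where
  "RBITS = ''x'' :::= Plus (V ''x'') (V ''x'') ;; PToss ''z'' ;; ''x'' :::= Plus (V ''x'') (V ''z'')"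

definition RNUM :: prg where
  "RNUM = ''x'' :::= Lit 0 ;; PFor ''j'' ''b'' RBITS ;; PStore ''R'' (V ''m'') (V ''x'')"

definition RANDOM :: prg where
  "RANDOM = PFor ''m'' ''M'' RNUM"

lemma writes_RBITS [simp]: "writes RBITS = {''x'', ''z''}"
  and writes_RNUM [simp]: "writes RNUM = {''x'', ''z'', ''j'', ''R''}"
  and writes_RANDOM [simp]: "writes RANDOM = {''x'', ''z'', ''j'', ''R'', ''m''}"
  by (auto simp: RBITS_def RNUM_def RANDOM_def)

lemma loops_ok_RANDOM [simp]: "loops_ok RANDOM"
  by (simp add: RANDOM_def) (simp add: RNUM_def, simp add: RBITS_def)

text \<open>With \<open>r\<close> bits still to come, the final number is uniform on a block of
  length \<open>2 ^ r\<close>. The next bit selects one half of the block, and the induction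
  hypothesis applies there.\<close>

lemma prob_RBITS:
  "measure_pmf.prob (iter_pmf r (\<lambda>s. map_pmf (inc ''j'') (den cap RBITS s)) s) {s'. s' ''x'' 0 \<in> Q} =
     card (Q \<inter> {s ''x'' 0 * 2 ^ r..<Suc (s ''x'' 0) * 2 ^ r}) / 2 ^ r"
proof (induction r arbitrary: s)
  case 0
  then show ?case by (cases "s ''x'' 0 \<in> Q") (simp_all add: atLeastLessThanSuc)
next
  case (Suc r)
  let ?f = "\<lambda>s. map_pmf (inc ''j'') (den cap RBITS s)" and ?x = "s ''x'' 0"
  define g where "g b = (let s1 = mem_write s ''x'' 0 (?x + ?x); s2 = mem_write s1 ''z'' 0 (of_bool b)
    in inc ''j'' (mem_write s2 ''x'' 0 (s2 ''x'' 0 + s2 ''z'' 0)))" for b :: bool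
  have f: "?f s = map_pmf g (bernoulli_pmf (1 / 2))"
    by (simp add: RBITS_def g_def Let_def map_pmf_def bind_assoc_pmf bind_return_pmf)
  have gx: "g b ''x'' 0 = 2 * ?x + of_bool b" for b by (simp add: g_def Let_def)
  let ?I = "\<lambda>a. {a * 2 ^ r..<Suc a * (2::nat) ^ r}"
  have "iter_pmf (Suc r) ?f s = bind_pmf (bernoulli_pmf (1 / 2)) (\<lambda>b. iter_pmf r ?f (g b))"
    by (simp only: iter_pmf.simps f bind_map_pmf)
  then have "measure_pmf.prob (iter_pmf (Suc r) ?f s) {s'. s' ''x'' 0 \<in> Q} =
      (card (Q \<inter> ?I (2 * ?x + 1)) / 2 ^ r + card (Q \<inter> ?I (2 * ?x)) / 2 ^ r) / 2"
    by (simp only: prob_bind_pmf integral_bernoulli_pmf[of "1/2"] Suc.IH gx) simp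
  also have "\<dots> = (card (Q \<inter> ?I (2 * ?x)) + card (Q \<inter> ?I (2 * ?x + 1))) / 2 ^ Suc r"
    by (simp add: field_simps)
  also have "card (Q \<inter> ?I (2 * ?x)) + card (Q \<inter> ?I (2 * ?x + 1)) =
      card (Q \<inter> {?x * 2 ^ Suc r..<Suc ?x * 2 ^ Suc r})"
  proof -
    have "{?x * 2 ^ Suc r..<Suc ?x * 2 ^ Suc r} = ?I (2 * ?x) \<union> ?I (2 * ?x + 1)"
    proof -
      have "?x * 2 ^ Suc r = 2 * ?x * 2 ^ r" "Suc ?x * 2 ^ Suc r = Suc (2 * ?x + 1) * 2 ^ r"
        "(2 * ?x + 1) * 2 ^ r = Suc (2 * ?x) * (2::nat) ^ r" by simp_all
      moreover have "2 * ?x * 2 ^ r \<le> Suc (2 * ?x) * (2::nat) ^ r"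
        "Suc (2 * ?x) * 2 ^ r \<le> Suc (2 * ?x + 1) * (2::nat) ^ r" by simp_all
      ultimately show ?thesis
        by (simp only: ivl_disj_un_two(3)[of "2 * ?x * 2 ^ r" "Suc (2 * ?x) * 2 ^ r"])
    qed
    then have "Q \<inter> {?x * 2 ^ Suc r..<Suc ?x * 2 ^ Suc r} = (Q \<inter> ?I (2 * ?x)) \<union> (Q \<inter> ?I (2 * ?x + 1))"
      by blast
    moreover have "(Q \<inter> ?I (2 * ?x)) \<inter> (Q \<inter> ?I (2 * ?x + 1)) = {}" by auto
    ultimately show ?thesis by (simp add: card_Un_disjoint)
  qed
  finally show ?case .
qed

lemma prob_RNUM:
  assumes "s ''b'' 0 \<le> s cap 0" and "cap \<notin> {''x'', ''j''}" and Q: "Q \<subseteq> {..<2 ^ s ''b'' 0}"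
  shows "measure_pmf.prob (den cap RNUM s) {s'. s' ''R'' (s ''m'' 0) \<in> Q} = card Q / 2 ^ s ''b'' 0"
proof -
  let ?b = "s ''b'' 0" and ?f = "\<lambda>s. map_pmf (inc ''j'') (den cap RBITS s)" and ?m = "s ''m'' 0"
  let ?s = "mem_write (mem_write s ''x'' 0 0) ''j'' 0 0"
  let ?h = "\<lambda>s. mem_write s ''R'' (s ''m'' 0) (s ''x'' 0)"
  have "den cap (PStore ''R'' (V ''m'') (V ''x'')) = (\<lambda>s. return_pmf (?h s))" by (simp add: fun_eq_iff)
  then have d: "den cap RNUM s = map_pmf ?h (iter_pmf ?b ?f ?s)"
    using assms(1,2) by (simp add: RNUM_def bind_return_pmf map_pmf_def min_absorb1)
  have m: "s' ''m'' 0 = ?m" if "s' \<in> set_pmf (iter_pmf ?b ?f ?s)" for s'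
    by (rule iter_pmf_invariant[OF that]) (use den_frame[of _ cap RBITS] in fastforce)+
  have "measure_pmf.prob (den cap RNUM s) {s'. s' ''R'' ?m \<in> Q} =
      measure_pmf.prob (iter_pmf ?b ?f ?s) (?h -` {s'. s' ''R'' ?m \<in> Q})"
    by (simp add: d)
  also have "\<dots> = measure_pmf.prob (iter_pmf ?b ?f ?s) {s'. s' ''x'' 0 \<in> Q}"
  proof (rule measure_pmf.finite_measure_eq_AE)
    show "AE x in measure_pmf (iter_pmf ?b ?f ?s). (x \<in> ?h -` {s'. s' ''R'' ?m \<in> Q}) = (x \<in> {s'. s' ''x'' 0 \<in> Q})"
      using m by (simp add: AE_measure_pmf_iff)
  qed auto
  also have "\<dots> = card (Q \<inter> {..<2 ^ ?b}) / 2 ^ ?b"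
    using prob_RBITS[of ?b cap ?s Q] by (simp add: lessThan_atLeast0)
  also have "Q \<inter> {..<2 ^ ?b} = Q" using Q by blast
  finally show ?thesis .
qed

text \<open>Independence is obtained by conditioning on one draw at a time: whatever memory it
  leaves, the bound for the remaining draws is the same, and they never overwrite its cell.\<close>

theorem prob_RANDOM_miss:
  assumes b: "s ''b'' 0 \<le> s cap 0" and M: "s ''M'' 0 \<le> s cap 0" and cap: "cap \<notin> writes RANDOM"
    and Q: "Q \<subseteq> {..<2 ^ s ''b'' 0}"
  shows "measure_pmf.prob (den cap RANDOM s) {r. \<forall>m<s ''M'' 0. r ''R'' m \<notin> Q}
    \<le> (1 - card Q / 2 ^ s ''b'' 0) ^ s ''M'' 0"
proof -
  let ?g = "\<lambda>s. map_pmf (inc ''m'') (den cap RNUM s)" and ?q = "card Q / 2 ^ s ''b'' 0"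
  have "card Q \<le> 2 ^ s ''b'' 0" using card_mono[OF _ Q] by simp
  then have q: "?q \<le> 1" by simp
  have step: "r' ''b'' = r ''b'' \<and> r' cap = r cap \<and> r' ''m'' 0 = Suc (r ''m'' 0) \<and>
      (\<forall>i. i \<noteq> r ''m'' 0 \<longrightarrow> r' ''R'' i = r ''R'' i)"
    if r: "r' \<in> set_pmf (?g r)" for r r'
  proof -
    obtain r0 where r0: "r0 \<in> set_pmf (den cap RNUM r)" "r' = inc ''m'' r0" using r by auto
    have fr: "r0 y = r y" if "y \<notin> writes RNUM" for y by (rule den_frame[OF r0(1) that])
    obtain r1 where r1: "r1 \<in> set_pmf (den cap (''x'' :::= Lit 0 ;; PFor ''j'' ''b'' RBITS) r)"
      "r0 = mem_write r1 ''R'' (r1 ''m'' 0) (r1 ''x'' 0)"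
      using r0(1) by (auto simp: RNUM_def set_bind_pmf)
    have "r1 ''m'' = r ''m''" "r1 ''R'' = r ''R''"
      using den_frame[OF r1(1)] by simp_all
    then show ?thesis using r0(2) r1(2) fr[of "''b''"] fr[of cap] fr[of "''m''"] cap by auto
  qed
  have "measure_pmf.prob (iter_pmf k ?g r) {r'. \<forall>i. r ''m'' 0 \<le> i \<longrightarrow> i < r ''m'' 0 + k \<longrightarrow> r' ''R'' i \<notin> Q} \<le> (1 - ?q) ^ k"
    if "r ''b'' = s ''b''" "r cap = s cap" for k r
    using that
  proof (induction k arbitrary: r)
    case 0 then show ?case by simp
  next
    case (Suc k)
    let ?m = "r ''m'' 0" and ?B = "- {r'. r' ''R'' (r ''m'' 0) \<in> Q}"
    let ?A = "{r'. \<forall>i. ?m \<le> i \<longrightarrow> i < ?m + Suc k \<longrightarrow> r' ''R'' i \<notin> Q}"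
    have "measure_pmf.prob (bind_pmf (?g r) (iter_pmf k ?g)) ?A \<le> measure_pmf.prob (?g r) ?B * (1 - ?q) ^ k"
    proof (rule prob_bind_le)
      fix r' assume r': "r' \<in> set_pmf (?g r)"
      note st = step[OF r']
      have "?A \<subseteq> {r''. \<forall>i. r' ''m'' 0 \<le> i \<longrightarrow> i < r' ''m'' 0 + k \<longrightarrow> r'' ''R'' i \<notin> Q}" using st by auto
      then have "measure_pmf.prob (iter_pmf k ?g r') ?A \<le>
          measure_pmf.prob (iter_pmf k ?g r') {r''. \<forall>i. r' ''m'' 0 \<le> i \<longrightarrow> i < r' ''m'' 0 + k \<longrightarrow> r'' ''R'' i \<notin> Q}"
        by (intro measure_pmf.finite_measure_mono) auto
      also have "\<dots> \<le> (1 - ?q) ^ k" using st Suc.prems by (intro Suc.IH) simp_all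
      finally show "measure_pmf.prob (iter_pmf k ?g r') ?A \<le> (1 - ?q) ^ k" .
      assume "r' \<notin> ?B"
      then have R: "r' ''R'' ?m \<in> Q" by simp
      have "r'' ''R'' ?m = r' ''R'' ?m" if r'': "r'' \<in> set_pmf (iter_pmf k ?g r')" for r''
      proof -
        have "?m < r'' ''m'' 0 \<and> r'' ''R'' ?m = r' ''R'' ?m"
        proof (rule iter_pmf_invariant[OF r''])
          show "?m < r' ''m'' 0 \<and> r' ''R'' ?m = r' ''R'' ?m" using st by simp
          fix a a' assume "?m < a ''m'' 0 \<and> a ''R'' ?m = r' ''R'' ?m" "a' \<in> set_pmf (?g a)"
          then show "?m < a' ''m'' 0 \<and> a' ''R'' ?m = r' ''R'' ?m" using step[of a' a] by auto
        qed
        then show ?thesis by simp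
      qed
      then have "set_pmf (iter_pmf k ?g r') \<inter> ?A = {}" using R by fastforce
      then show "measure_pmf.prob (iter_pmf k ?g r') ?A = 0" by (simp add: measure_pmf_zero_iff)
    qed
    moreover have "measure_pmf.prob (?g r) ?B = 1 - ?q"
    proof -
      have "measure_pmf.prob (?g r) {r'. r' ''R'' ?m \<in> Q} = ?q"
        using prob_RNUM[of r cap Q] Suc.prems b Q cap by (simp add: vimage_def)
      then show ?thesis using measure_pmf.prob_compl[of "{r'. r' ''R'' ?m \<in> Q}" "?g r"] by (simp add: Compl_eq_Diff_UNIV)
    qed
    ultimately show ?case by (simp only: iter_pmf.simps power_Suc)
  qed
  from this[of "mem_write s ''m'' 0 0" "s ''M'' 0"] show ?thesis
    using M cap unfolding RANDOM_def den.simps by (auto simp: min_absorb1)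
qed

section \<open>Computing the parameters\<close>

definition MUL :: "string \<Rightarrow> string \<Rightarrow> prg" where
  "MUL x l = ''acc'' :::= Lit 0 ;; PFor ''i0'' l (''acc'' :::= Plus (V ''acc'') (V x)) ;; x :::= V ''acc''"

text \<open>Since \<open>cap\<close> is itself being computed here, this program is compiled with
  \<open>n\<close> in the role of the cap. The order \<open>n ^ 4\<close> is dictated by the loops
  over the adjacency matrix of the split graph.\<close>

definition CAP :: "nat \<Rightarrow> prg" where
  "CAP K = ''cap'' :::= Lit K ;; MUL ''cap'' ''n'' ;; MUL ''cap'' ''n'' ;; MUL ''cap'' ''n'' ;; MUL ''cap'' ''n''"

definition TABLES :: prg where
  "TABLES = ''nn'' :::= V ''n'' ;; MUL ''nn'' ''n'' ;; ''NN'' :::= V ''nn'' ;; MUL ''NN'' ''nn'' ;;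
    ''a'' :::= Lit 0 ;;
    PFor ''u'' ''n'' (PStore ''RO'' (V ''u'') (V ''a'') ;; ''a'' :::= Plus (V ''a'') (V ''n'')) ;;
    PFor ''u'' ''n'' (PFor ''v'' ''n'' (PStore ''DU'' (Plus (Cell ''RO'' (V ''u'')) (V ''v'')) (V ''u'') ;;
       PStore ''DV'' (Plus (Cell ''RO'' (V ''u'')) (V ''v'')) (V ''v'')))"

definition LOG :: prg where
  "LOG = ''pw'' :::= Lit 1 ;; ''b'' :::= Lit 0 ;;
    PFor ''i'' ''n'' (PIf (Less (V ''pw'') (V ''n''))
      (''pw'' :::= Plus (V ''pw'') (V ''pw'') ;; ''b'' :::= Plus (V ''b'') (Lit 1)) PSkip)"

definition COUNT :: prg where
  "COUNT = ''cp'' :::= Lit 0 ;;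
    PFor ''y'' ''nn'' (PIf (pos_exp (Cell ''P'' (V ''y''))) (''cp'' :::= Plus (V ''cp'') (Lit 1)) PSkip)"

text \<open>Only the comparison with \<open>nn\<close> matters, so a product beyond it is replaced
  by \<open>nn + 1\<close>, which keeps the numbers small.\<close>

definition POWER :: prg where
  "POWER = ''pr'' :::= V ''cp'' ;; PFor ''e'' ''k1'' (MUL ''pr'' ''ci'' ;;
     PIf (Less (V ''nn'') (V ''pr'')) (''pr'' :::= Plus (V ''nn'') (Lit 1)) PSkip)"

definition LVAL :: prg where
  "LVAL = ''k1'' :::= Plus (V ''k'') (Lit 1) ;; ''L'' :::= Lit 0 ;; ''ci'' :::= Lit 0 ;;
    PFor ''i'' ''n'' (''ci'' :::= Plus (V ''ci'') (Lit 1) ;; POWER ;;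
      PIf (Less (V ''nn'') (V ''pr'')) PSkip (''L'' :::= V ''ci''))"

definition WVAL :: prg where
  "WVAL = ''w'' :::= Lit 1 ;; ''km'' :::= Minus (V ''k'') (Lit 1) ;; PFor ''e'' ''km'' (MUL ''w'' ''L'')"

text \<open>The number of draws is the quotient of \<open>tg\<close> and \<open>L\<close> rounded
  up, computed by repeated addition of \<open>L\<close>.\<close>

definition MVAL :: "nat \<Rightarrow> prg" where
  "MVAL a = ''tg'' :::= V ''pw'' ;; MUL ''tg'' ''b'' ;; MUL ''tg'' ''k'' ;; ''la'' :::= Lit (a + 10) ;; MUL ''tg'' ''la'' ;;
    ''M'' :::= Lit 0 ;; ''a'' :::= Lit 0 ;;
    PFor ''i'' ''cap'' (PIf (Less (V ''a'') (V ''tg''))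
      (''a'' :::= Plus (V ''a'') (V ''L'') ;; ''M'' :::= Plus (V ''M'') (Lit 1)) PSkip)"

definition PREP :: "nat \<Rightarrow> prg" where
  "PREP a = ''J'' :::= Plus (Plus (V ''b'') (V ''b'')) (Lit 1) ;; LVAL ;; WVAL ;; MVAL a"

definition ROWS :: prg where
  "ROWS = ''a'' :::= Lit 0 ;;
    PFor ''u'' ''Nv'' (PStore ''ro'' (V ''u'') (V ''a'') ;; ''a'' :::= Plus (V ''a'') (V ''Nv''))"

lemma writes_MUL [simp]: "writes (MUL x l) = {''acc'', ''i0'', x}"
  by (auto simp: MUL_def)

lemma writes_CAP [simp]: "writes (CAP K) = {''acc'', ''i0'', ''cap''}"
  and writes_TABLES [simp]: "writes TABLES = {''acc'', ''i0'', ''nn'', ''NN'', ''a'', ''u'', ''v'', ''RO'', ''DU'', ''DV''}"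
  and writes_LOG [simp]: "writes LOG = {''pw'', ''b'', ''i''}"
  and writes_COUNT [simp]: "writes COUNT = {''cp'', ''y''}"
  and writes_POWER [simp]: "writes POWER = {''acc'', ''i0'', ''pr'', ''e''}"
  and writes_WVAL [simp]: "writes WVAL = {''acc'', ''i0'', ''w'', ''km'', ''e''}"
  and writes_MVAL [simp]: "writes (MVAL a) = {''acc'', ''i0'', ''tg'', ''la'', ''M'', ''a'', ''i''}"
  and writes_ROWS [simp]: "writes ROWS = {''a'', ''u'', ''ro''}"
  by (auto simp: CAP_def TABLES_def LOG_def COUNT_def POWER_def WVAL_def MVAL_def ROWS_def)

lemma writes_LVAL [simp]: "writes LVAL = {''acc'', ''i0'', ''k1'', ''L'', ''ci'', ''i'', ''pr'', ''e''}"
  by (auto simp: LVAL_def)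

lemma writes_PREP [simp]: "writes (PREP a) = {''acc'', ''i0'', ''k1'', ''L'', ''ci'', ''i'', ''pr'', ''e'',
    ''w'', ''km'', ''tg'', ''la'', ''M'', ''a'', ''J''}"
  by (auto simp: PREP_def)

lemma loops_ok_MUL [simp]: "x \<notin> {''acc'', ''i0''} \<Longrightarrow> l \<notin> {''acc'', ''i0''} \<Longrightarrow> loops_ok (MUL x l)"
  by (auto simp: MUL_def)

lemma loops_ok_setup [simp]: "loops_ok (CAP K)" "loops_ok TABLES" "loops_ok LOG" "loops_ok COUNT" "loops_ok (PREP a)"
    "loops_ok ROWS"
  by (simp_all add: CAP_def TABLES_def LOG_def COUNT_def PREP_def LVAL_def POWER_def WVAL_def MVAL_def ROWS_def)

lemma wp_MUL:
  assumes "s l 0 \<le> s cap 0" and "x \<notin> {''acc'', ''i0''}" and "l \<notin> {''acc'', ''i0''}" and "cap \<notin> {''acc'', ''i0''}"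
  shows "wp cap (MUL x l) (\<lambda>r. r x 0 = s x 0 * s l 0) s"
  unfolding MUL_def
proof (simp only: wp_PSeq wp_PStore, rule wp_loop[where I = "\<lambda>i r. r ''acc'' 0 = s x 0 * i"], goal_cases)
  case (5 i r)
  then have "r x = s x" using assms by auto
  then show ?case using 5(2) by simp
qed (use assms in auto)

lemma wp_CAP:
  shows "wp ''n'' (CAP K) (\<lambda>r. r ''cap'' 0 = K * s ''n'' 0 ^ 4) s"
proof -
  have m: "wp ''n'' (MUL ''cap'' ''n'') (\<lambda>q. q ''cap'' 0 = x * s ''n'' 0 ^ Suc i \<and> q ''n'' 0 = s ''n'' 0) r"
    if "r ''cap'' 0 = x * s ''n'' 0 ^ i \<and> r ''n'' 0 = s ''n'' 0" for r x i
    by (rule wp_frame[OF wp_MUL[of r "''n''" "''n''" "''cap''"]]) (use that in simp_all)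
  show ?thesis
    unfolding CAP_def wp_PSeq wp_PStore
    by (rule wp_mono[OF m[of _ K 0]], simp, rule wp_mono[OF m[of _ K 1]], simp,
        rule wp_mono[OF m[of _ K 2]], simp add: numeral_2_eq_2, rule wp_mono[OF m[of _ K 3]]) (simp_all add: eval_nat_numeral)
qed

lemma wp_TABLES:
  assumes n: "s ''n'' 0 = n" "2 \<le> n" and c: "n * n \<le> s ''cap'' 0"
  shows "wpc TABLES (\<lambda>r. tables n r \<and> r ''NN'' 0 = n * n * (n * n)) s"
proof -
  have "n \<le> n * n" by simp
  then have nc: "n \<le> s ''cap'' 0" using c by linarith
  show ?thesis
    unfolding TABLES_def
  proof (rule wp_seqI, simp only: wp_PStore, rule wp_seqI, rule wp_frame[OF wp_MUL], goal_cases)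
    case (5 r)
    have r: "r ''nn'' 0 = n * n" "r ''n'' = s ''n''" "r ''cap'' = s ''cap''" using 5 n by simp_all
    show ?case
    proof (rule wp_seqI, simp only: wp_PStore, rule wp_seqI, rule wp_frame[OF wp_MUL], goal_cases)
      case (5 q)
      have q: "q ''NN'' 0 = n * n * (n * n)" "q ''nn'' 0 = n * n" "q ''n'' = s ''n''" "q ''cap'' = s ''cap''"
        using 5 r by simp_all
      show ?case
      proof (rule wp_seqI, simp only: wp_PStore, rule wp_seqI,
          rule wp_loop[where I = "\<lambda>i p. p ''a'' 0 = i * n \<and> (\<forall>u<i. p ''RO'' u = u * n)"], goal_cases)
        case (5 i p)
        then have "p ''n'' 0 = n" using q n by simp
        then show ?case using 5(2,3) by (simp add: less_Suc_eq)
      next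
        case (6 p)
        have p: "p ''NN'' 0 = n * n * (n * n)" "p ''nn'' 0 = n * n" "p ''n'' = s ''n''" "p ''cap'' = s ''cap''"
          "\<And>u. u < n \<Longrightarrow> p ''RO'' u = u * n"
          using 6 q n by simp_all
        define ok where "ok r y \<longleftrightarrow> r ''DU'' y = y div n \<and> r ''DV'' y = y mod n" for r :: memory and y
        show ?case
        proof (rule wp_loop[where I = "\<lambda>i o'. \<forall>y<i * n. ok o' y"], goal_cases)
          case (3 i j r) then show ?case by (simp add: ok_def)
        next
          case (5 i o')
          then have o: "o' ''n'' 0 = n" "o' ''RO'' i = i * n" "o' ''u'' 0 = i" "o' ''cap'' = s ''cap''" using p n by simp_all
          show ?case
          proof (rule wp_loop[where I = "\<lambda>j o'. \<forall>y<i * n + j. ok o' y"], goal_cases)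
            case (3 i j r) then show ?case by (simp add: ok_def)
          next
            case (5 j l)
            then have l: "l ''RO'' i = i * n" "l ''u'' 0 = i" "l ''v'' 0 = j" "j < n" using o by simp_all
            then show ?case using 5(2) by (simp add: ok_def less_Suc_eq)
          next
            case (6 l)
            then show ?case using o by (simp add: add.commute)
          qed (use o nc 5(2) in simp_all)
        next
          case (6 o')
          then show ?case using p n c by (simp add: tables_def ok_def)
        qed (use p n nc in simp_all)
      qed (use q n nc in simp_all)
    qed (use r c in simp_all)
  qed (use n nc in simp_all)
qed

lemma wp_LOG:
  assumes n: "s ''n'' 0 = n" "1 \<le> n" and nc: "n \<le> s ''cap'' 0"
  shows "wpc LOG (\<lambda>r. r ''pw'' 0 = 2 ^ r ''b'' 0 \<and> n \<le> 2 ^ r ''b'' 0 \<and>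
     (0 < r ''b'' 0 \<longrightarrow> 2 ^ (r ''b'' 0 - 1) < n) \<and> r ''b'' 0 \<le> n) s"
  unfolding LOG_def
proof (simp only: wp_PSeq wp_PStore, rule wp_loop[where I = "\<lambda>i r. r ''pw'' 0 = 2 ^ r ''b'' 0 \<and>
    (n \<le> 2 ^ r ''b'' 0 \<or> r ''b'' 0 = i) \<and> (0 < r ''b'' 0 \<longrightarrow> 2 ^ (r ''b'' 0 - 1) < n) \<and> r ''b'' 0 \<le> i"], goal_cases)
  case (5 i r)
  then have "r ''n'' 0 = n" using n by simp
  then show ?case using 5(2) by auto
next
  case (6 r)
  have "n < 2 ^ n" by simp
  then show ?case using 6(1) n by auto
qed (use n nc in auto)

lemma wp_COUNT:
  assumes n: "s ''nn'' 0 = n * n" and c: "n * n \<le> s ''cap'' 0"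
  shows "wpc COUNT (\<lambda>r. r ''cp'' 0 = card (arcs_of n (s ''P''))) s"
  unfolding COUNT_def
proof (simp only: wp_PSeq wp_PStore, rule wp_loop[where
    I = "\<lambda>i r. r ''cp'' 0 = card {(u, v) \<in> arcs_of n (s ''P''). u * n + v < i}"], goal_cases)
  case (5 i r)
  then have r: "r ''P'' = s ''P''" "i < n * n" using n by simp_all
  have "(i div n, i mod n) \<notin> {(u, v) \<in> arcs_of n (s ''P''). u * n + v < i}" by simp
  moreover have "finite {(u, v) \<in> arcs_of n (s ''P''). u * n + v < i}"
    by (rule finite_subset[of _ "{..<n} \<times> {..<n}"]) (auto simp: arcs_of_def)
  ultimately show ?case using 5(2,3) r arcs_of_prefix_Suc[OF r(2)] by simp
next
  case (6 r)
  then show ?case using n arcs_of_prefix_all by simp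
qed (use n c in simp_all)

lemma wp_POWER:
  assumes "s ''k1'' 0 \<le> s ''cap'' 0" and "s ''ci'' 0 \<le> s ''cap'' 0" and ci: "0 < s ''ci'' 0"
  shows "wpc POWER (\<lambda>r. r ''pr'' 0 \<le> s ''nn'' 0 \<longleftrightarrow> s ''cp'' 0 * s ''ci'' 0 ^ s ''k1'' 0 \<le> s ''nn'' 0) s"
  unfolding POWER_def
proof (simp only: wp_PSeq wp_PStore, rule wp_loop[where I = "\<lambda>i r.
    (if s ''cp'' 0 * s ''ci'' 0 ^ i \<le> s ''nn'' 0 then r ''pr'' 0 = s ''cp'' 0 * s ''ci'' 0 ^ i
     else s ''nn'' 0 < r ''pr'' 0)"], goal_cases)
  case (5 i r)
  have fr: "r ''ci'' = s ''ci''" "r ''nn'' = s ''nn''" "r ''cap'' = s ''cap''" using 5(4) by simp_all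
  let ?p = "s ''cp'' 0 * s ''ci'' 0 ^ i"
  show ?case
  proof (rule wp_seqI, rule wp_frame[OF wp_MUL], goal_cases)
    case (5 q)
    have q: "q ''pr'' 0 = r ''pr'' 0 * s ''ci'' 0" "q ''nn'' = s ''nn''" using 5 fr by simp_all
    have mono: "x \<le> x * s ''ci'' 0" for x using ci by simp
    have S: "s ''cp'' 0 * s ''ci'' 0 ^ Suc i = ?p * s ''ci'' 0" by simp
    have "if ?p * s ''ci'' 0 \<le> s ''nn'' 0 then q ''pr'' 0 = ?p * s ''ci'' 0 else s ''nn'' 0 < q ''pr'' 0"
    proof (cases "?p \<le> s ''nn'' 0")
      case True
      then have "r ''pr'' 0 = ?p" using \<open>if ?p \<le> s ''nn'' 0 then r ''pr'' 0 = ?p else s ''nn'' 0 < r ''pr'' 0\<close> by simp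
      then show ?thesis using q by simp
    next
      case False
      then have "s ''nn'' 0 < r ''pr'' 0" using \<open>if ?p \<le> s ''nn'' 0 then r ''pr'' 0 = ?p else s ''nn'' 0 < r ''pr'' 0\<close> by simp
      then have "s ''nn'' 0 < r ''pr'' 0 * s ''ci'' 0" using mono[of "r ''pr'' 0"] by (rule less_le_trans)
      moreover have "\<not> ?p * s ''ci'' 0 \<le> s ''nn'' 0" using False mono[of ?p] by linarith
      ultimately show ?thesis using q by simp
    qed
    then show ?case unfolding S using q by (auto split: if_splits)
  qed (use assms fr in simp_all)
next
  case (6 r)
  then show ?case by (auto split: if_splits)
qed (use assms in auto)

lemma wp_LVAL:
  assumes n: "s ''n'' 0 = n" "s ''nn'' 0 = n * n" "1 \<le> n" and c: "n \<le> s ''cap'' 0" "s ''k'' 0 + 1 \<le> s ''cap'' 0"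
    and k: "1 \<le> s ''k'' 0" and cp: "1 \<le> s ''cp'' 0" "s ''cp'' 0 \<le> n * n"
  shows "wpc LVAL (\<lambda>r. 1 \<le> r ''L'' 0 \<and> s ''cp'' 0 * r ''L'' 0 ^ (s ''k'' 0 + 1) \<le> n * n \<and>
     n * n < s ''cp'' 0 * (r ''L'' 0 + 1) ^ (s ''k'' 0 + 1)) s"
proof -
  let ?g = "\<lambda>x. s ''cp'' 0 * x ^ (s ''k'' 0 + 1)"
  define I where "I i r \<longleftrightarrow> r ''ci'' 0 = i \<and> r ''L'' 0 \<le> i \<and> (0 < i \<longrightarrow> 1 \<le> r ''L'' 0 \<and> ?g (r ''L'' 0) \<le> n * n) \<and>
      (\<forall>j. r ''L'' 0 < j \<longrightarrow> j \<le> i \<longrightarrow> n * n < ?g j)" for i and r :: memory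
  show ?thesis
    unfolding LVAL_def
  proof (simp only: wp_PSeq wp_PStore, rule wp_loop[where I = I], goal_cases)
    case (5 i r)
    define q where "q = mem_write r ''ci'' 0 (Suc i)"
    have fr: "r ''k1'' 0 = s ''k'' 0 + 1" "r ''nn'' 0 = n * n" "r ''cap'' = s ''cap''" "r ''cp'' = s ''cp''" "i < n"
      using 5(1,4) n by simp_all
    have q: "q ''k1'' 0 = s ''k'' 0 + 1" "q ''nn'' 0 = n * n" "q ''cap'' = s ''cap''" "q ''cp'' = s ''cp''"
      "q ''ci'' 0 = Suc i" "q ''L'' = r ''L''" using fr by (simp_all add: q_def)
    have "wpc (POWER ;; PIf (Less (V ''nn'') (V ''pr'')) PSkip (''L'' :::= V ''ci'')) (I (Suc i)) q"
    proof (rule wp_seqI, rule wp_frame[OF wp_POWER], goal_cases)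
      case (4 p)
      have p: "p ''pr'' 0 \<le> n * n \<longleftrightarrow> ?g (Suc i) \<le> n * n" "p ''nn'' 0 = n * n" "p ''ci'' 0 = Suc i" "p ''L'' = r ''L''"
        using 4 q by simp_all
      show ?case
      proof (cases "?g (Suc i) \<le> n * n")
        case True
        then show ?thesis using p 5(2) by (simp add: I_def)
      next
        case False
        \<comment> \<open>The candidate 1 always passes, because there are at most
          \<open>n * n\<close> pairs.\<close>
        have "0 < i"
        proof (rule ccontr)
          assume "\<not> 0 < i"
          then show False using False cp by simp
        qed
        then show ?thesis using p 5(2) False unfolding I_def by (auto simp: le_Suc_eq)
      qed
    qed (use q c fr in simp_all)
    then show ?case using 5(2) unfolding q_def by (simp add: I_def)
  next
    case (6 r)
    then have I: "1 \<le> r ''L'' 0" "?g (r ''L'' 0) \<le> n * n" "r ''L'' 0 \<le> n"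
      "\<forall>j. r ''L'' 0 < j \<longrightarrow> j \<le> n \<longrightarrow> n * n < ?g j" using n by (simp_all add: I_def)
    have "n * n < ?g (r ''L'' 0 + 1)"
    proof (cases "r ''L'' 0 + 1 \<le> n")
      case True
      show ?thesis by (rule I(4)[rule_format, OF less_add_one True])
    next
      case False
      \<comment> \<open>Candidates beyond \<open>n\<close> are not tested. They fail anyway: already
        the square exceeds \<open>n * n\<close>, and the exponent is at least 2.\<close>
      then have "n < r ''L'' 0 + 1" by simp
      then have "n * n < (r ''L'' 0 + 1) ^ 2" unfolding power2_eq_square by (intro mult_strict_mono) auto
      also have "\<dots> \<le> (r ''L'' 0 + 1) ^ (s ''k'' 0 + 1)" using k by (intro power_increasing) auto
      also have "\<dots> \<le> ?g (r ''L'' 0 + 1)" using cp by simp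
      finally show ?thesis .
    qed
    then show ?case using I by simp
  qed (use n c in \<open>simp_all add: I_def\<close>)
qed

lemma wp_WVAL:
  assumes "s ''k'' 0 \<le> s ''cap'' 0" and "s ''L'' 0 \<le> s ''cap'' 0"
  shows "wpc WVAL (\<lambda>r. r ''w'' 0 = s ''L'' 0 ^ (s ''k'' 0 - 1)) s"
  unfolding WVAL_def
proof (simp only: wp_PSeq wp_PStore, rule wp_loop[where I = "\<lambda>i r. r ''w'' 0 = s ''L'' 0 ^ i"], goal_cases)
  case (5 i r)
  then have "r ''L'' = s ''L''" "r ''cap'' = s ''cap''" by simp_all
  then show ?case using 5(2) assms by (intro wp_mono[OF wp_MUL]) simp_all
qed (use assms in simp_all)

lemma wp_MVAL:
  assumes b: "s ''b'' 0 \<le> s ''cap'' 0" "s ''k'' 0 \<le> s ''cap'' 0" "a + 10 \<le> s ''cap'' 0"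
    and tg: "s ''pw'' 0 * s ''b'' 0 * s ''k'' 0 * (a + 10) \<le> s ''cap'' 0" and L: "1 \<le> s ''L'' 0"
  shows "wpc (MVAL a) (\<lambda>r. s ''pw'' 0 * s ''b'' 0 * s ''k'' 0 * (a + 10) \<le> r ''M'' 0 * s ''L'' 0 \<and>
     r ''M'' 0 * s ''L'' 0 \<le> s ''pw'' 0 * s ''b'' 0 * s ''k'' 0 * (a + 10) + s ''L'' 0 \<and> r ''M'' 0 \<le> s ''cap'' 0) s"
proof -
  let ?tg = "s ''pw'' 0 * s ''b'' 0 * s ''k'' 0 * (a + 10)"
  show ?thesis
    unfolding MVAL_def
  proof (rule wp_seqI, simp only: wp_PStore, rule wp_seqI, rule wp_frame[OF wp_MUL], goal_cases)
    case (5 r)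
    have r: "r ''tg'' 0 = s ''pw'' 0 * s ''b'' 0" "r ''k'' = s ''k''" "r ''cap'' = s ''cap''" "r ''L'' = s ''L''"
      using 5 by simp_all
    show ?case
    proof (rule wp_seqI, rule wp_frame[OF wp_MUL], goal_cases)
      case (5 q)
      have q: "q ''tg'' 0 = s ''pw'' 0 * s ''b'' 0 * s ''k'' 0" "q ''cap'' = s ''cap''" "q ''L'' = s ''L''"
        using 5 r by simp_all
      show ?case
      proof (rule wp_seqI, simp only: wp_PStore, rule wp_seqI, rule wp_frame[OF wp_MUL], goal_cases)
        case (5 p)
        have p: "p ''tg'' 0 = ?tg" "p ''cap'' = s ''cap''" "p ''L'' = s ''L''"
          using 5 q by simp_all
        show ?case
        proof (simp only: wp_PSeq wp_PStore, rule wp_loop[where I = "\<lambda>i o'. o' ''a'' 0 = o' ''M'' 0 * s ''L'' 0 \<and>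
            o' ''a'' 0 \<le> ?tg + s ''L'' 0 \<and> (?tg \<le> o' ''a'' 0 \<or> o' ''M'' 0 = i) \<and> o' ''M'' 0 \<le> i"], goal_cases)
          case (5 i o')
          then have "o' ''tg'' 0 = ?tg" "o' ''L'' = s ''L''" using p by simp_all
          then show ?case using 5(2) by auto
        next
          case (6 o')
          have "?tg \<le> o' ''M'' 0 * s ''L'' 0"
          proof (cases "?tg \<le> o' ''a'' 0")
            case True then show ?thesis using 6(1) by simp
          next
            case False
            then have "o' ''M'' 0 = s ''cap'' 0" using 6(1) p by auto
            moreover have "s ''cap'' 0 * 1 \<le> s ''cap'' 0 * s ''L'' 0" using L by (intro mult_left_mono) auto
            ultimately show ?thesis using tg by (simp only: mult_1_right)
          qed
          then show ?case using 6(1) p by simp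
        qed (use p in auto)
      qed (use q b in simp_all)
    qed (use r b in simp_all)
  qed (use b in simp_all)
qed

lemma wp_ROWS:
  assumes "s ''Nv'' 0 = N" and "N \<le> s ''cap'' 0" and "0 < s ''cap'' 0"
  shows "wpc ROWS (sp_setup N) s"
  unfolding ROWS_def
proof (simp only: wp_PSeq wp_PStore, rule wp_loop[where
    I = "\<lambda>i r. r ''a'' 0 = i * N \<and> (\<forall>u<i. r ''ro'' u = u * N)"], goal_cases)
  case (5 i r)
  then have "r ''Nv'' 0 = N" using assms by simp
  then show ?case using 5(2,3) by (simp add: less_Suc_eq)
next
  case (6 r)
  then show ?case using assms by (simp add: sp_setup_def)
qed (use assms in simp_all)

section \<open>Size and failure probability\<close>

text \<open>Roots of order \<open>k + 1\<close> in the maximality of \<open>L\<close>, with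
  \<open>L + 1 <= 2 * L\<close>, bound \<open>(n^2 / p)^e\<close> by \<open>2 * L\<close> for
  \<open>e = 1 / (k + 1)\<close>. The exponent of \<open>n\<close> in \<open>n^2 / L\<close> is then
  \<open>2 - 2 * e\<close>, which is \<open>2 * k / (k + 1)\<close>.\<close>

lemma tree_threshold:
  fixes n k p L :: nat
  assumes n: "1 \<le> n" and p: "1 \<le> p" and L: "1 \<le> L" "n * n < p * (L + 1) ^ (k + 1)"
  shows "real (n * n) / L \<le> 2 * (real n powr (2 * real k / (real k + 1)) * real p powr (1 / (real k + 1)))"
proof -
  define e where "e = 1 / (real k + 1)"
  have e: "0 < e" "e * (real k + 1) = 1" by (auto simp: e_def)
  have "real (n * n) < real (p * (L + 1) ^ (k + 1))" using L(2) by (simp only: of_nat_less_iff)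
  then have h: "real (n * n) < real ((L + 1) ^ (k + 1)) * real p" by (simp only: of_nat_mult mult.commute)
  have "real (n * n) / real p < real ((L + 1) ^ (k + 1))"
    by (rule pos_divide_less_eq[THEN iffD2, OF _ h]) (use p in simp)
  also have "\<dots> = real (L + 1) powr (real k + 1)"
    by (subst of_nat_power, subst powr_realpow[symmetric]) (auto simp: add.commute)
  finally have "(real (n * n) / real p) powr e \<le> (real (L + 1) powr (real k + 1)) powr e"
    using e by (intro powr_mono2) auto
  also have "\<dots> = real (L + 1)" by (simp add: powr_powr mult.commute[of _ e] e(2))
  finally have 1: "(real (n * n) / real p) powr e \<le> 2 * real L" using L(1) by linarith
  have pos: "0 < real p powr e" "0 < real n powr (2 * e)" using n p by auto
  have 2: "(real (n * n) / real p) powr e = real n powr (2 * e) / real p powr e"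
    using n p by (simp add: powr_divide powr_mult flip: powr_add)
  have "real n powr (2 * real k / (real k + 1)) * real n powr (2 * e) = real n powr 2"
  proof -
    have "2 * real k / (real k + 1) + 2 * e = 2 * (real k + 1) / (real k + 1)"
      unfolding e_def by (simp only: distrib_left add_divide_distrib mult_1_right times_divide_eq_right)
    also have "\<dots> = 2" by (rule nonzero_mult_div_cancel_right) simp
    finally have "2 * real k / (real k + 1) + 2 * e = 2" .
    then show ?thesis by (simp flip: powr_add)
  qed
  also have "\<dots> = real (n * n)" using n by (simp add: powr_numeral power2_eq_square)
  finally have nn: "real (n * n) = real n powr (2 * real k / (real k + 1)) * real n powr (2 * e)" ..
  have "real n powr (2 * e) \<le> 2 * real L * real p powr e" using 1 pos unfolding 2 by (simp add: pos_divide_le_eq)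
  then have "real (n * n) \<le> real n powr (2 * real k / (real k + 1)) * (2 * real L * real p powr e)"
    unfolding nn by (intro mult_left_mono) auto
  then show ?thesis using L(1) unfolding e_def[symmetric] by (simp add: pos_divide_le_eq mult_ac)
qed

lemma log_bound:
  assumes "0 < b" and "2 ^ (b - 1) < n" and "1 \<le> n"
  shows "real b \<le> 2 * (1 + ln (real n))"
proof -
  have "real 2 ^ (b - 1) \<le> real n" using assms(2) by (metis less_imp_le of_nat_le_iff of_nat_power)
  then have "ln (real 2 ^ (b - 1)) \<le> ln (real n)" using assms(3) by (intro ln_mono) auto
  then have 1: "real (b - 1) * ln 2 \<le> ln (real n)" by (simp add: ln_realpow)
  have "real (b - 1) * (1 / 2) \<le> real (b - 1) * ln 2"
    using ln2_ge_two_thirds by (intro mult_left_mono) auto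
  then have "real (b - 1) \<le> 2 * ln (real n)" using 1 by simp
  moreover have "real b = real (b - 1) + 1" using assms(1) by simp
  moreover have "0 \<le> ln (real n)" using assms(3) by simp
  ultimately show ?thesis by argo
qed

text \<open>After multiplication by \<open>L\<close> both contributions become multiples of
  \<open>n * n\<close>: the tree through \<open>p * L ^ (k + 1) <= n * n\<close>, the draws through
  the bound on \<open>M * L\<close>. There \<open>a + 10\<close> grows to \<open>a + 11\<close> to
  absorb the rounding. Dividing by \<open>L\<close> leaves the quantity bounded by
  \<open>tree_threshold\<close>; the leading 4 is the product of the factor 2 in that bound and the
  2 in \<open>log_bound\<close>.\<close>

lemma size_bound:
  fixes n k p L b M a h :: nat
  assumes n: "2 \<le> n" and k: "1 \<le> k" "k < b" and p: "1 \<le> p" and L: "1 \<le> L" "p * L ^ (k + 1) \<le> n * n"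
    and L': "n * n < p * (L + 1) ^ (k + 1)" and b: "2 ^ (b - 1) < n"
    and M: "M * L \<le> 2 ^ b * b * k * (a + 10) + L"
    and h: "h \<le> p * (L ^ (k - 1) * (k * ((2 * b + 1) * L))) + M * (2 * (n * 2 ^ Suc k))"
  shows "real h \<le> 4 * (8 * real a + 91) * (1 + ln (real n)) *
    (real k * 2 ^ k * real n powr (2 * real k / (real k + 1)) * real p powr (1 / (real k + 1)))"
proof -
  define l where "l = 1 + ln (real n)"
  have b1: "1 \<le> b" using k by simp
  have pow: "L ^ (k - 1) * L * L = L ^ (k + 1)" using k by (cases k) auto
  have "L ^ 2 \<le> L ^ (k + 1)" using L k by (intro power_increasing) auto
  also have "\<dots> \<le> p * L ^ (k + 1)" using p by simp
  also have "\<dots> \<le> n * n" by (rule L(2))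
  finally have "L ^ 2 \<le> n ^ 2" by (simp add: power2_eq_square)
  then have Ln: "L \<le> n" by (rule power2_le_imp_le) simp
  have pw: "2 ^ b \<le> 2 * n" using b b1 by (cases b) auto
  have draws_bound: "M * L \<le> 2 * n * (b * k * (a + 11))"
  proof -
    have "2 ^ b * b * k * (a + 10) \<le> 2 * n * b * k * (a + 10)" using pw by (intro mult_right_mono) auto
    moreover have "n * 1 \<le> n * (b * k)" using b1 k by (intro mult_left_mono) auto
    then have "L \<le> 2 * n * (b * k)" using Ln by linarith
    ultimately have "M * L \<le> 2 * n * b * k * (a + 10) + 2 * n * (b * k)" using M by linarith
    then show ?thesis by (simp add: algebra_simps)
  qed
  have "h * L \<le> (p * (L ^ (k - 1) * (k * ((2 * b + 1) * L))) + M * (2 * (n * 2 ^ Suc k))) * L"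
    using h by (intro mult_right_mono) auto
  also have "\<dots> = k * (2 * b + 1) * (p * (L ^ (k - 1) * L * L)) + 4 * n * 2 ^ k * (M * L)"
    by (simp add: algebra_simps)
  also have "\<dots> \<le> k * (3 * b) * (n * n) + 4 * n * 2 ^ k * (2 * n * (b * k * (a + 11)))"
  proof -
    have "k * (2 * b + 1) * (p * L ^ (k + 1)) \<le> k * (3 * b) * (n * n)"
      by (rule mult_mono[OF _ L(2)]) (use b1 in auto)
    moreover have "4 * n * 2 ^ k * (M * L) \<le> 4 * n * 2 ^ k * (2 * n * (b * k * (a + 11)))"
      by (rule mult_left_mono[OF draws_bound]) simp
    ultimately show ?thesis unfolding pow by (rule add_mono)
  qed
  also have "\<dots> \<le> k * (3 * b) * (n * n) * 2 ^ k + 4 * n * 2 ^ k * (2 * n * (b * k * (a + 11)))"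
    by (intro add_mono) auto
  \<comment> \<open>The constant is 3 from the tree plus \<open>8 * (a + 11)\<close> from the
    draws.\<close>
  also have "\<dots> = (8 * a + 91) * b * k * 2 ^ k * (n * n)" by (simp add: algebra_simps)
  finally have "real (h * L) \<le> real ((8 * a + 91) * b * k * 2 ^ k * (n * n))" by (simp only: of_nat_le_iff)
  then have "real h * real L \<le> (8 * real a + 91) * real b * (real k * 2 ^ k) * real (n * n)" by (simp add: mult_ac)
  then have "real h \<le> (8 * real a + 91) * real b * (real k * 2 ^ k) * (real (n * n) / real L)"
    using L(1) by (simp add: pos_le_divide_eq)
  also have "\<dots> \<le> (8 * real a + 91) * (2 * (1 + ln (real n))) * (real k * 2 ^ k) *
      (2 * (real n powr (2 * real k / (real k + 1)) * real p powr (1 / (real k + 1))))"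
    using tree_threshold[OF _ p L(1) L'] log_bound[OF _ b] n b1
    by (intro mult_mono mult_nonneg_nonneg divide_nonneg_nonneg) auto
  finally show ?thesis unfolding l_def[symmetric] by (simp add: algebra_simps)
qed

text \<open>For \<open>b <= k\<close> one factor \<open>n\<close> of \<open>n * n\<close> is at most
  \<open>2 ^ k\<close>. The other is at most the power of \<open>n\<close> in the bound, whose
  exponent is at least 1.\<close>

lemma size_bound_all:
  fixes n k p b h :: nat
  assumes n: "2 \<le> n" "n \<le> 2 ^ b" and k: "1 \<le> k" "b \<le> k" and p: "1 \<le> p" and h: "h \<le> n * n"
  shows "real h \<le> real k * 2 ^ k * real n powr (2 * real k / (real k + 1)) * real p powr (1 / (real k + 1))"
proof -
  have "n \<le> 2 ^ k" using n(2) k(2) power_increasing[of b k "2::nat"] by linarith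
  then have "real n \<le> real (2 ^ k)" by (simp only: of_nat_le_iff)
  then have 1: "real n \<le> real k * 2 ^ k" using k(1) by (simp add: order_trans[OF _ mult_right_mono[of 1 "real k" "2 ^ k"]])
  have "1 \<le> 2 * real k / (real k + 1)" using k(1) by (simp add: pos_le_divide_eq)
  then have "real n powr 1 \<le> real n powr (2 * real k / (real k + 1))" using n(1) by (intro powr_mono) auto
  then have 2: "real n \<le> real n powr (2 * real k / (real k + 1))" by simp
  have 3: "1 \<le> real p powr (1 / (real k + 1))" using p by (intro ge_one_powr_ge_zero) auto
  have "real h \<le> real (n * n)" using h by (simp only: of_nat_le_iff)
  also have "\<dots> = real n * real n * 1" by simp
  also have "\<dots> \<le> (real k * 2 ^ k) * real n powr (2 * real k / (real k + 1)) * real p powr (1 / (real k + 1))"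
    using 1 2 3 by (intro mult_mono) auto
  finally show ?thesis .
qed

section \<open>Failure probability by a union bound over the sets of faults\<close>

text \<open>
  Faults are enumerated as lists of length \<open>k\<close> in which the non-arc \<open>(n, n)\<close> fills up the remaining places.
\<close>

definition fault_lists :: "nat \<Rightarrow> nat \<Rightarrow> (nat \<times> nat) set \<Rightarrow> (nat \<times> nat) list set" where
  "fault_lists n k E = {xs. set xs \<subseteq> insert (n, n) E \<and> length xs = k}"

lemma fault_lists_cover:
  assumes E: "E \<subseteq> {..<n} \<times> {..<n}" and F: "F \<subseteq> E" "finite F" "card F \<le> k"
  obtains xs where "xs \<in> fault_lists n k E" "E - set xs = E - F"
proof -
  obtain ys where ys: "set ys = F" "distinct ys" using finite_distinct_list[OF F(2)] by blast
  let ?xs = "ys @ replicate (k - card F) (n, n)"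
  have "length ys = card F" using distinct_card[OF ys(2)] ys(1) by simp
  then have "?xs \<in> fault_lists n k E" using ys F by (auto simp: fault_lists_def)
  moreover have "(n, n) \<notin> E" using E by auto
  then have "E - set ?xs = E - F" using ys by auto
  ultimately show ?thesis by (rule that)
qed

lemma mid_subset:
  assumes E: "E \<subseteq> {..<n} \<times> {..<n}" and "s < n" shows "mid E s t F \<subseteq> {..<n}"
proof
  fix x assume "x \<in> mid E s t F"
  then have "(s, x) \<in> (E - F)\<^sup>*" by (simp add: mid_def)
  then show "x \<in> {..<n}" by (cases rule: rtrancl.cases) (use assms in auto)
qed

lemma mid_cong: "E - F = E - F' \<Longrightarrow> mid E s t F = mid E s t F'"
  by (simp add: mid_def)

definition hits :: "nat \<Rightarrow> nat \<Rightarrow> (nat \<times> nat) set \<Rightarrow> nat \<Rightarrow> nat \<Rightarrow> memory \<Rightarrow> bool" where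
  "hits n k E L M r \<longleftrightarrow> (\<forall>s<n. \<forall>t<n. \<forall>F. F \<subseteq> E \<longrightarrow> finite F \<longrightarrow> card F \<le> k \<longrightarrow>
     L < card (mid E s t F) \<longrightarrow> (\<exists>m<M. r ''R'' m \<in> mid E s t F))"

lemma power_one_minus_le:
  fixes q :: real assumes "0 \<le> q" "q \<le> 1" and "real N \<le> q * M"
  shows "(1 - q) ^ M \<le> 1 / 2 ^ N"
proof -
  have "(1 - q) ^ M \<le> exp (- q) ^ M" using assms exp_ge_add_one_self[of "- q"] by (intro power_mono) auto
  also have "\<dots> = exp (- (q * M))" by (simp add: exp_of_nat_mult[symmetric] mult.commute)
  also have "\<dots> \<le> exp (- real N)" using assms by simp
  also have "\<dots> = 1 / exp 1 ^ N" by (simp add: exp_minus inverse_eq_divide exp_of_nat_mult[symmetric])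
  also have "\<dots> \<le> 1 / 2 ^ N"
    using exp_ge_add_one_self[of 1] by (intro divide_left_mono power_mono mult_pos_pos) auto
  finally show ?thesis .
qed

text \<open>There are at most \<open>2 ^ (5 * (b * k))\<close> triples of two vertices and a fault
  list, and the lower bound on \<open>M * L\<close> makes each be missed with probability at most
  \<open>1 / 2 ^ (b * k * (a + 10))\<close>. The exponent left over is at least
  \<open>b * a\<close>, and \<open>n <= 2 ^ b\<close>. The 10 pays for the union bound and the
  \<open>a\<close> for the failure probability.\<close>

theorem prob_hits:
  assumes n: "2 \<le> n" "n \<le> 2 ^ b" and E: "E \<subseteq> {..<n} \<times> {..<n}" and k: "1 \<le> k" and b: "1 \<le> b"
    and s: "s ''b'' 0 = b" "b \<le> s cap 0" "s ''M'' 0 \<le> s cap 0" and cap: "cap \<notin> writes RANDOM"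
    and M: "2 ^ b * b * k * (a + 10) \<le> s ''M'' 0 * L"
  shows "measure_pmf.prob (den cap RANDOM s) {r. hits n k E L (s ''M'' 0) r} \<ge> 1 - 1 / real n ^ a"
proof -
  let ?M = "s ''M'' 0" and ?P = "measure_pmf.prob (den cap RANDOM s)"
  define T where "T = {(u, t, xs). u < n \<and> t < n \<and> xs \<in> fault_lists n k E \<and> L < card (mid E u t (set xs))}"
  have finE: "finite E" by (rule finite_subset[OF E]) simp
  have cE: "card (insert (n, n) E) \<le> n * n + 1"
    using card_mono[OF _ E] card_insert_le_m1[of "n * n + 1" E "(n, n)"] by simp
  have finL: "finite (fault_lists n k E)"
    unfolding fault_lists_def using finE by (intro finite_lists_length_eq) simp
  have "card (fault_lists n k E) = card (insert (n, n) E) ^ k"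
    unfolding fault_lists_def using finE by (intro card_lists_length_eq) simp
  also have "\<dots> \<le> (n * n + 1) ^ k" using cE by (intro power_mono) auto
  finally have cL: "card (fault_lists n k E) \<le> (n * n + 1) ^ k" .
  have T: "T \<subseteq> {..<n} \<times> {..<n} \<times> fault_lists n k E" by (auto simp: T_def)
  have finT: "finite T" by (rule finite_subset[OF T]) (use finL in simp)
  have "card T \<le> n * (n * card (fault_lists n k E))"
    using card_mono[OF _ T] finL by (simp add: card_cartesian_product)
  also have "\<dots> \<le> 2 ^ b * (2 ^ b * (2 ^ (2 * b + 1)) ^ k)"
  proof (intro mult_mono)
    have "n * n + 1 \<le> 2 ^ b * 2 ^ b + 1" using n by (intro add_mono mult_mono) auto
    also have "\<dots> \<le> 2 ^ b * 2 ^ b + 2 ^ b * 2 ^ b" by simp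
    also have "\<dots> = 2 ^ (2 * b + 1)" by (simp only: mult_2 mult_2_right power_add power_one_right)
    finally have "(n * n + 1) ^ k \<le> (2 ^ (2 * b + 1)) ^ k" by (intro power_mono) auto
    then show "card (fault_lists n k E) \<le> (2 ^ (2 * b + 1)) ^ k" using cL by simp
  qed (use n in auto)
  also have "\<dots> = 2 ^ (b + b + (2 * b + 1) * k)" by (simp only: power_add power_mult mult.assoc)
  also have "\<dots> \<le> 2 ^ (5 * (b * k))"
  proof (rule power_increasing)
    have "b \<le> b * k" "k \<le> b * k" using b k by simp_all
    moreover have "b + b + (2 * b + 1) * k = 2 * b + 2 * (b * k) + k" by (simp add: algebra_simps)
    ultimately show "b + b + (2 * b + 1) * k \<le> 5 * (b * k)" by linarith
  qed simp
  finally have cT: "card T \<le> 2 ^ (5 * (b * k))" .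
  let ?miss = "\<lambda>(u, t, xs). {r. \<forall>m<?M. r ''R'' m \<notin> mid E u t (set xs)}"
  have miss: "?P (?miss x) \<le> 1 / 2 ^ (b * k * (a + 10))" if x: "x \<in> T" for x
  proof -
    obtain u t xs where x': "x = (u, t, xs)" by (cases x)
    let ?Q = "mid E u t (set xs)"
    have Q: "?Q \<subseteq> {..<n}" "L < card ?Q" using mid_subset[OF E] x by (auto simp: T_def x')
    then have Qb: "?Q \<subseteq> {..<2 ^ b}" using n by fastforce
    let ?q = "real (card ?Q) / 2 ^ b"
    have "card ?Q \<le> 2 ^ b" using card_mono[OF _ Qb] by simp
    then have q1: "?q \<le> 1" by simp
    have "?P (?miss x) \<le> (1 - ?q) ^ ?M"
      using prob_RANDOM_miss[of s cap ?Q] s cap Qb by (simp add: x')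
    also have "\<dots> \<le> 1 / 2 ^ (b * k * (a + 10))"
    proof (rule power_one_minus_le)
      have "?M * L \<le> ?M * card ?Q" using Q(2) by (intro mult_left_mono) auto
      then have "2 ^ b * b * k * (a + 10) \<le> ?M * card ?Q" using M by linarith
      then have "real (2 ^ b * (b * k * (a + 10))) \<le> real (card ?Q * ?M)"
        by (simp only: of_nat_le_iff mult.assoc mult.commute[of "card ?Q"])
      then show "real (b * k * (a + 10)) \<le> ?q * real ?M" by (simp add: pos_le_divide_eq mult.commute)
    qed (use q1 in auto)
    finally show ?thesis .
  qed
  have sub: "- {r. hits n k E L ?M r} \<subseteq> (\<Union>x\<in>T. ?miss x)"
  proof
    fix r assume "r \<in> - {r. hits n k E L ?M r}"
    then obtain u t F where F: "u < n" "t < n" "F \<subseteq> E" "finite F" "card F \<le> k" "L < card (mid E u t F)"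
      "\<forall>m<?M. r ''R'' m \<notin> mid E u t F" by (auto simp: hits_def)
    obtain xs where xs: "xs \<in> fault_lists n k E" "E - set xs = E - F"
      by (rule fault_lists_cover[OF E F(3,4,5)])
    have "mid E u t (set xs) = mid E u t F" by (rule mid_cong[OF xs(2)])
    then have "(u, t, xs) \<in> T" "r \<in> ?miss (u, t, xs)" using F xs by (simp_all add: T_def)
    then show "r \<in> (\<Union>x\<in>T. ?miss x)" by (rule UN_I)
  qed
  have "?P (- {r. hits n k E L ?M r}) \<le> ?P (\<Union>x\<in>T. ?miss x)"
    using sub by (intro measure_pmf.finite_measure_mono) auto
  also have "\<dots> \<le> (\<Sum>x\<in>T. ?P (?miss x))"
    by (rule measure_pmf.finite_measure_subadditive_finite[OF finT]) auto
  also have "\<dots> \<le> (\<Sum>x\<in>T. 1 / 2 ^ (b * k * (a + 10)))" by (intro sum_mono miss)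
  also have "\<dots> = real (card T) / 2 ^ (b * k * (a + 10))" by simp
  also have "\<dots> \<le> real (2 ^ (5 * (b * k))) / 2 ^ (b * k * (a + 10))"
    using cT by (intro divide_right_mono) (simp_all only: of_nat_le_iff, simp)
  also have "\<dots> \<le> 1 / real n ^ a"
  proof -
    have "5 * (b * k) + b * a \<le> b * k * (a + 10)"
    proof -
      have "b * a \<le> b * k * a" using k by (intro mult_right_mono) auto
      moreover have "b * k * (a + 10) = b * k * a + 10 * (b * k)" by (simp add: algebra_simps)
      ultimately show ?thesis by linarith
    qed
    then have "(2::real) ^ (5 * (b * k) + b * a) \<le> 2 ^ (b * k * (a + 10))" by (intro power_increasing) auto
    moreover have "real n ^ a \<le> (2 ^ b) ^ a"
    proof (rule power_mono)
      have "real n \<le> real (2 ^ b)" using n(2) by (simp only: of_nat_le_iff)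
      then show "real n \<le> 2 ^ b" by simp
    qed simp
    then have "2 ^ (5 * (b * k)) * real n ^ a \<le> 2 ^ (5 * (b * k)) * 2 ^ (b * a)"
      unfolding power_mult[of 2 b a] by (rule mult_left_mono) simp
    then have "2 ^ (5 * (b * k)) * real n ^ a \<le> 2 ^ (5 * (b * k) + b * a)" by (simp only: power_add)
    ultimately have "2 ^ (5 * (b * k)) * real n ^ a \<le> 2 ^ (b * k * (a + 10))" by linarith
    then show ?thesis using n by (simp add: field_simps)
  qed
  finally have "?P (- {r. hits n k E L ?M r}) \<le> 1 / real n ^ a" .
  then show ?thesis
    using measure_pmf.prob_compl[of "{r. hits n k E L ?M r}" "den cap RANDOM s"] by (simp add: Compl_eq_Diff_UNIV)
qed

section \<open>The algorithm\<close>

definition SOLVE :: prg where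
  "SOLVE = ''Nv'' :::= V ''n'' ;; ROWS ;; TREE ;; ''Nv'' :::= V ''nn'' ;; ROWS ;; DRAWS"

definition COPY :: prg where
  "COPY = PFor ''y'' ''nn'' (PStore ''H'' (V ''y'') (Cell ''G'' (V ''y'')))"

text \<open>Without pairs the initial empty \<open>H\<close> is already a solution; this case is
  separated because the choice of \<open>L\<close> needs at least one pair.\<close>

definition MAIN :: "nat \<Rightarrow> prg" where
  "MAIN a = (TABLES ;; LOG ;; COUNT) ;; PIf (pos_exp (V ''cp''))
     (PIf (Less (V ''k'') (V ''b'')) (PREP a ;; RANDOM ;; SOLVE) COPY) PSkip"

lemma writes_SOLVE [simp]: "writes SOLVE = {''Nv'', ''a'', ''u'', ''ro''} \<union> writes TREE \<union> writes DRAWS"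
  by (auto simp: SOLVE_def)

lemma writes_COPY [simp]: "writes COPY = {''y'', ''H''}"
  by (auto simp: COPY_def)

lemma loops_ok_MAIN: "loops_ok (MAIN a)"
  by (simp add: MAIN_def SOLVE_def COPY_def)

lemma cap_notin_MAIN: "''cap'' \<notin> writes (MAIN a)"
  by (simp add: MAIN_def)

section \<open>Sufficiency of the cap and choice of the parameters\<close>

definition ready :: "nat \<Rightarrow> nat \<Rightarrow> memory \<Rightarrow> bool" where
  "ready n a s \<longleftrightarrow> 2 \<le> n \<and> tables n s \<and> s ''NN'' 0 = n * n * (n * n) \<and> n * n * (n * n) < s ''cap'' 0 \<and>
     2 * n * n * n * (a + 10) \<le> s ''cap'' 0 \<and> (\<forall>y<n * n. s ''G'' y \<le> 1) \<and> 1 \<le> s ''k'' 0 \<and> s ''k'' 0 < s ''b'' 0 \<and>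
     s ''b'' 0 \<le> n \<and> n \<le> 2 ^ s ''b'' 0 \<and> 2 ^ (s ''b'' 0 - 1) < n \<and> s ''pw'' 0 = 2 ^ s ''b'' 0 \<and>
     s ''cp'' 0 = card (arcs_of n (s ''P'')) \<and> 1 \<le> s ''cp'' 0 \<and> s ''H'' = (\<lambda>_. 0)"

definition prepared :: "nat \<Rightarrow> nat \<Rightarrow> memory \<Rightarrow> bool" where
  "prepared n a s \<longleftrightarrow> ready n a s \<and> s ''J'' 0 = 2 * s ''b'' 0 + 1 \<and> 1 \<le> s ''L'' 0 \<and>
     s ''cp'' 0 * s ''L'' 0 ^ (s ''k'' 0 + 1) \<le> n * n \<and> n * n < s ''cp'' 0 * (s ''L'' 0 + 1) ^ (s ''k'' 0 + 1) \<and>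
     s ''w'' 0 = s ''L'' 0 ^ (s ''k'' 0 - 1) \<and>
     2 ^ s ''b'' 0 * s ''b'' 0 * s ''k'' 0 * (a + 10) \<le> s ''M'' 0 * s ''L'' 0 \<and>
     s ''M'' 0 * s ''L'' 0 \<le> 2 ^ s ''b'' 0 * s ''b'' 0 * s ''k'' 0 * (a + 10) + s ''L'' 0 \<and> s ''M'' 0 \<le> s ''cap'' 0"

abbreviation ready_cells :: "string set" where
  "ready_cells \<equiv> {''n'', ''nn'', ''cap'', ''RO'', ''DU'', ''DV'', ''NN'', ''G'', ''k'', ''b'', ''pw'', ''cp'', ''P'', ''H''}"

lemma ready_frame:
  assumes "ready n a s" and fr: "\<And>y. y \<notin> X \<Longrightarrow> r y = s y" and X: "X \<inter> ready_cells = {}"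
  shows "ready n a r"
proof -
  have "r ''n'' = s ''n''" "r ''nn'' = s ''nn''" "r ''cap'' = s ''cap''" "r ''RO'' = s ''RO''" "r ''DU'' = s ''DU''"
    "r ''DV'' = s ''DV''" "r ''NN'' = s ''NN''" "r ''G'' = s ''G''" "r ''k'' = s ''k''" "r ''b'' = s ''b''"
    "r ''pw'' = s ''pw''" "r ''cp'' = s ''cp''" "r ''P'' = s ''P''" "r ''H'' = s ''H''"
    using X by (auto intro!: fr)
  then show ?thesis using assms(1) by (simp add: ready_def tables_def)
qed

lemma readyD:
  assumes "ready n a s"
  shows "2 \<le> n" "s ''n'' 0 = n" "s ''nn'' 0 = n * n" "n * n \<le> s ''cap'' 0" "n \<le> s ''cap'' 0"
    "2 * n + 1 \<le> s ''cap'' 0" "a + 10 \<le> s ''cap'' 0" "(n + 1) * (n * n) < s ''cap'' 0"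
    "2 ^ s ''b'' 0 \<le> 2 * n" "2 ^ s ''b'' 0 * s ''b'' 0 * s ''k'' 0 * (a + 10) \<le> s ''cap'' 0"
    "s ''k'' 0 \<le> n" "1 \<le> s ''b'' 0" "2 ^ Suc (s ''k'' 0) + s ''k'' 0 < s ''cap'' 0" "s ''cp'' 0 \<le> n * n"
proof -
  note s = assms[unfolded ready_def]
  let ?c = "s ''cap'' 0" and ?b = "s ''b'' 0" and ?k = "s ''k'' 0"
  show n: "2 \<le> n" "s ''n'' 0 = n" "s ''nn'' 0 = n * n" "n * n \<le> ?c" using s by (auto simp: tables_def)
  have c4: "n * n * (n * n) < ?c" "2 * n * n * n * (a + 10) \<le> ?c" using s by auto
  have nn: "2 * n \<le> n * n" using n(1) by simp
  show "n \<le> ?c" using n(1,4) nn by linarith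
  have "2 * n * (n * n) \<le> n * n * (n * n)" by (rule mult_right_mono[OF nn]) simp
  moreover have "2 \<le> n * n" using n(1) nn by linarith
  then have n3: "2 * n * 2 \<le> 2 * n * (n * n)" by (rule mult_left_mono) simp
  moreover have "(n + 1) * (n * n) \<le> 2 * n * (n * n)" using n(1) by (intro mult_right_mono) auto
  ultimately show "(n + 1) * (n * n) < ?c" and c4n: "2 * n + 1 \<le> ?c" using c4(1) n(1) by linarith+
  have "1 * (a + 10) \<le> 2 * n * n * n * (a + 10)" using n(1) by (intro mult_right_mono) auto
  from le_trans[OF this c4(2)] show "a + 10 \<le> ?c" by simp
  show b1: "1 \<le> ?b" using s by auto
  then show pw: "2 ^ ?b \<le> 2 * n" using s by (cases ?b) auto
  show kn: "?k \<le> n" using s by auto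
  have "2 ^ ?b * ?b * ?k * (a + 10) \<le> 2 * n * n * n * (a + 10)"
    using pw kn s by (intro mult_mono) auto
  from le_trans[OF this c4(2)] show "2 ^ ?b * ?b * ?k * (a + 10) \<le> ?c" .
  have "(2::nat) ^ Suc ?k \<le> 2 ^ ?b" using s by (intro power_increasing) auto
  then have "2 ^ Suc ?k + ?k < 2 * n + n" using pw kn s by linarith
  moreover have "3 * n \<le> (n + 1) * (n * n)" using n(1) nn by (intro mult_mono) auto
  ultimately show "2 ^ Suc ?k + ?k < ?c" using \<open>(n + 1) * (n * n) < ?c\<close> by linarith
  have "card (arcs_of n (s ''P'')) \<le> card ({..<n} \<times> {..<n})"
    using arcs_of_subset by (intro card_mono) auto
  then show "s ''cp'' 0 \<le> n * n" using s by simp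
qed

lemma wp_PREP:
  assumes R: "ready n a s"
  shows "wpc (PREP a) (prepared n a) s"
proof -
  note s = readyD[OF R]
  define r where "r = mem_write s ''J'' 0 (s ''b'' 0 + s ''b'' 0 + 1)"
  have Rr: "ready n a r" by (rule ready_frame[OF R, of "{''J''}"]) (simp_all add: r_def)
  note r = readyD[OF Rr]
  have J: "r ''J'' 0 = 2 * r ''b'' 0 + 1" by (simp add: r_def)
  have k: "1 \<le> r ''k'' 0" "1 \<le> r ''cp'' 0" "r ''pw'' 0 = 2 ^ r ''b'' 0" "r ''b'' 0 \<le> n" using Rr by (simp_all add: ready_def)
  have "wpc (LVAL ;; WVAL ;; MVAL a) (prepared n a) r"
  proof (rule wp_seqI, rule wp_frame[OF wp_LVAL[of r n]], goal_cases)
    case (9 q)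
    have Rq: "ready n a q" by (rule ready_frame[OF Rr, of "writes LVAL"]) (use 9(2) in simp_all)
    have q: "q ''k'' = r ''k''" "q ''cp'' = r ''cp''" "q ''J'' = r ''J''" "q ''b'' = r ''b''" "q ''cap'' = r ''cap''"
      "q ''pw'' = r ''pw''" using 9(2) by simp_all
    have L: "1 \<le> q ''L'' 0" "r ''cp'' 0 * q ''L'' 0 ^ (r ''k'' 0 + 1) \<le> n * n"
      "n * n < r ''cp'' 0 * (q ''L'' 0 + 1) ^ (r ''k'' 0 + 1)" using 9(1) by simp_all
    have "q ''L'' 0 \<le> q ''L'' 0 ^ (r ''k'' 0 + 1)" using L(1) by (intro self_le_power) auto
    moreover have "q ''L'' 0 ^ (r ''k'' 0 + 1) \<le> r ''cp'' 0 * q ''L'' 0 ^ (r ''k'' 0 + 1)" using k by simp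
    moreover have "q ''cap'' 0 = r ''cap'' 0" using q by simp
    ultimately have Lc: "q ''L'' 0 \<le> q ''cap'' 0" using L(2) r(4) by linarith
    show ?case
    proof (rule wp_seqI, rule wp_frame[OF wp_WVAL[of q]], goal_cases)
      case (3 p)
      have Rp: "ready n a p" by (rule ready_frame[OF Rq, of "writes WVAL"]) (use 3(2) in simp_all)
      have p: "p ''k'' = r ''k''" "p ''cp'' = r ''cp''" "p ''J'' = r ''J''" "p ''b'' = r ''b''" "p ''cap'' = r ''cap''"
        "p ''L'' = q ''L''" "p ''pw'' = r ''pw''" using 3(2) q by simp_all
      note p' = readyD[OF Rp]
      show ?case
      proof (rule wp_frame[OF wp_MVAL[of p a]], goal_cases)
        case (6 m)
        have Rm: "ready n a m" by (rule ready_frame[OF Rp, of "writes (MVAL a)"]) (use 6(2) in simp_all)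
        have m: "m ''k'' = r ''k''" "m ''cp'' = r ''cp''" "m ''J'' = r ''J''" "m ''b'' = r ''b''" "m ''cap'' = r ''cap''"
          "m ''L'' = q ''L''" "m ''w'' = p ''w''" using 6(2) p by simp_all
        show ?case unfolding prepared_def using Rm m J L 3(1) 6(1) p q k by simp
      qed (use p p' k L r in simp_all)
    qed (use q r k Lc in simp_all)
  qed (use r k in simp_all)
  then show ?thesis unfolding PREP_def r_def by simp
qed

section \<open>Correctness of the assembled algorithm\<close>

definition solution :: "nat \<Rightarrow> nat \<Rightarrow> (nat \<times> nat) set \<Rightarrow> (nat \<times> nat) set \<Rightarrow> (nat \<times> nat) set \<Rightarrow> bool" where
  "solution a k E P H \<longleftrightarrow> H \<subseteq> E \<and>
     (\<forall>(s, t)\<in>P. \<forall>F. F \<subseteq> E \<longrightarrow> finite F \<longrightarrow> card F \<le> k \<longrightarrow> (s, t) \<in> (E - F)\<^sup>* \<longrightarrow> (s, t) \<in> (H - F)\<^sup>*)"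

text \<open>Where the tree provides no path, a drawn vertex \<open>v\<close> lies between
  \<open>s\<close> and \<open>t\<close>. The path from \<open>v\<close> to \<open>t\<close> survives
  in \<open>H\<close> by the preserver from \<open>v\<close>. The path from \<open>s\<close> to
  \<open>v\<close> survives by the preserver from \<open>v\<close> in the reversed graph, applied to
  the reversed faults.\<close>

lemma solution_from_hits:
  assumes E: "E \<subseteq> {..<n} \<times> {..<n}" and P: "P \<subseteq> {..<n} \<times> {..<n}" and H: "H \<subseteq> E"
    and hits: "hits n k E L M r"
    and cov: "\<And>s t F. (s, t) \<in> P \<Longrightarrow> finite F \<Longrightarrow> card F \<le> k \<Longrightarrow> covered E L s t H F"
    and rp: "\<And>m rv. m < M \<Longrightarrow> r ''R'' m < n \<Longrightarrow> reach_preserver k (r ''R'' m) (orient rv E) (orient rv H)"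
  shows "solution a k E P H"
  unfolding solution_def
proof (intro conjI H ballI, clarify)
  fix s t F assume st: "(s, t) \<in> P" and F: "F \<subseteq> E" "finite F" "card F \<le> k" and path: "(s, t) \<in> (E - F)\<^sup>*"
  have "s < n" "t < n" using st P by auto
  show "(s, t) \<in> (H - F)\<^sup>*"
  proof (rule ccontr)
    assume no: "(s, t) \<notin> (H - F)\<^sup>*"
    then have "L < card (mid E s t F)" using cov[OF st F(2,3)] path by (auto simp: covered_def)
    then obtain m where m: "m < M" "r ''R'' m \<in> mid E s t F"
      using hits F \<open>s < n\<close> \<open>t < n\<close> unfolding hits_def by blast
    let ?v = "r ''R'' m"
    have "?v < n" using m mid_subset[OF E \<open>s < n\<close>] by blast
    note rp = rp[OF m(1) this]
    have sv: "(s, ?v) \<in> (E - F)\<^sup>*" and vt: "(?v, t) \<in> (E - F)\<^sup>*" using m by (auto simp: mid_def)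
    have "(?v, t) \<in> (H - F)\<^sup>*"
      using rp[of False] F vt by (simp add: reach_preserver_def orient_def)
    moreover have "(s, ?v) \<in> (H - F)\<^sup>*"
    proof -
      have conv: "(A - F)\<inverse> = A\<inverse> - F\<inverse>" for A :: "(nat \<times> nat) set" by auto
      have "(?v, s) \<in> (E\<inverse> - F\<inverse>)\<^sup>*" using sv unfolding conv[symmetric] by (simp add: rtrancl_converse)
      then have "(?v, s) \<in> (H\<inverse> - F\<inverse>)\<^sup>*"
        using rp[of True] F by (simp add: reach_preserver_def orient_def card_inverse)
      then show ?thesis unfolding conv[symmetric] by (simp add: rtrancl_converse)
    qed
    ultimately show False using no by (meson rtrancl_trans)
  qed
qed

definition output_ok :: "nat \<Rightarrow> nat \<Rightarrow> memory \<Rightarrow> memory \<Rightarrow> bool" where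
  "output_ok n a s r \<longleftrightarrow>
     (let E = arcs_of n (s ''G''); P = arcs_of n (s ''P''); H = arcs_of n (r ''H''); k = s ''k'' 0 in
      solution a k E P H \<and> real (card H) \<le> 4 * (8 * real a + 91) * (1 + ln (real n)) ^ 1 *
        (real k * 2 ^ k * real n powr (2 * real k / (real k + 1)) * real (card P) powr (1 / (real k + 1))))"

lemma wp_SOLVE:
  assumes Pr: "prepared n a s" and hits: "hits n (s ''k'' 0) (arcs_of n (s ''G'')) (s ''L'' 0) (s ''M'' 0) s"
  shows "wpc SOLVE (output_ok n a s) s"
proof -
  have R: "ready n a s" using Pr by (simp add: prepared_def)
  note s = readyD[OF R] and pr = Pr[unfolded prepared_def] and rd = R[unfolded ready_def]
  let ?E = "arcs_of n (s ''G'')" and ?P = "arcs_of n (s ''P'')" and ?k = "s ''k'' 0" and ?L = "s ''L'' 0" and ?M = "s ''M'' 0"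
  define r where "r = mem_write s ''Nv'' 0 n"
  have "wpc (ROWS ;; TREE ;; ''Nv'' :::= V ''nn'' ;; ROWS ;; DRAWS) (output_ok n a s) r"
  proof (rule wp_seqI, rule wp_frame[OF wp_ROWS[of r n]], goal_cases)
    case (4 q)
    let ?X = "{''Nv'', ''a'', ''u'', ''ro''}"
    have fr: "q y = s y" if "y \<notin> ?X" for y using that 4(2)[of y] by (simp add: r_def)
    have Rq: "ready n a q" by (rule ready_frame[OF R, of ?X]) (simp_all add: fr)
    have q: "q ''G'' = s ''G''" "q ''P'' = s ''P''" "q ''k'' = s ''k''" "q ''L'' = s ''L''" "q ''M'' = s ''M''"
      "q ''J'' = s ''J''" "q ''w'' = s ''w''" "q ''b'' = s ''b''" "q ''cap'' = s ''cap''" "q ''H'' = s ''H''"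
      using fr by simp_all
    have "n * n < 2 ^ (2 * s ''b'' 0 + 1)"
    proof -
      have "n * n \<le> 2 ^ s ''b'' 0 * 2 ^ s ''b'' 0" using rd by (intro mult_mono) auto
      also have "\<dots> < 2 * (2 ^ s ''b'' 0 * 2 ^ s ''b'' 0)" by simp
      also have "\<dots> = 2 ^ (2 * s ''b'' 0 + 1)" by (simp only: mult_2[of "s ''b'' 0"] power_add power_one_right mult.commute)
      finally show ?thesis .
    qed
    moreover have "?L ^ (?k - 1) \<le> n * n"
    proof -
      have "?L ^ (?k - 1) \<le> ?L ^ (?k + 1)" using pr by (intro power_increasing) auto
      also have "\<dots> \<le> s ''cp'' 0 * ?L ^ (?k + 1)" using rd by simp
      finally show ?thesis using pr by linarith
    qed
    moreover have "2 * s ''b'' 0 + 1 \<le> s ''cap'' 0" using s(6) rd by linarith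
    ultimately have T: "tree_ok n q"
      using Rq 4(1) pr q s by (simp add: tree_ok_def ready_def)
    show ?case
    proof (rule wp_seqI, rule wp_frame[OF wp_TREE[OF T]], goal_cases)
      case 1
      then show ?case using q rd by (simp add: arcs_of_def)
    next
      case (4 p)
      let ?H1 = "arcs_of n (p ''H'')"
      have p: "p ''G'' = s ''G''" "p ''P'' = s ''P''" "p ''k'' = s ''k''" "p ''M'' = s ''M''" "p ''cap'' = s ''cap''"
        "p ''nn'' = q ''nn''" "p ''NN'' = q ''NN''" "p ''R'' = s ''R''"
        using 4(2) q fr by simp_all
      have Tp: "tree_ok n p" by (rule tree_ok_frame[OF T, of "writes TREE"]) (simp_all add: 4(2))
      define p' where "p' = mem_write p ''Nv'' 0 (n * n)"
      have H1: "?H1 \<subseteq> ?E" "card ?H1 \<le> card ?P * (s ''w'' 0 * (?k * (s ''J'' 0 * ?L)))"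
        and cov: "\<And>u t F. (u, t) \<in> ?P \<Longrightarrow> finite F \<Longrightarrow> card F \<le> ?k \<Longrightarrow> covered ?E ?L u t ?H1 F"
        using 4(1) q by (auto simp: pair_covered_def)
      have "wpc (ROWS ;; DRAWS) (output_ok n a s) p'"
      proof (rule wp_seqI, rule wp_frame[OF wp_ROWS[of p' "n * n"]], goal_cases)
        case (4 l)
        have fl: "l y = p y" if "y \<notin> ?X" for y using that 4(2)[of y] by (simp add: p'_def)
        have l: "l ''G'' = s ''G''" "l ''k'' = s ''k''" "l ''M'' = s ''M''" "l ''cap'' = s ''cap''" "l ''H'' = p ''H''"
          "l ''R'' = s ''R''" "l ''NN'' = s ''NN''"
          using fl p fr by simp_all
        have "l ''n'' = p ''n''" "l ''nn'' = p ''nn''" "l ''RO'' = p ''RO''" "l ''DU'' = p ''DU''" "l ''DV'' = p ''DV''"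
          using fl by simp_all
        then have T2: "tables2 n l"
          using Tp 4(1) l p rd s(13) by (simp add: tables2_def tree_ok_def tables_def)
        show ?case
        proof (rule wp_mono[OF wp_DRAWS[OF T2]], goal_cases)
          case (3 m)
          let ?H = "arcs_of n (m ''H'')"
          have H: "?H1 \<subseteq> ?H" "?H \<subseteq> ?E" "card ?H \<le> card ?H1 + ?M * (2 * (n * 2 ^ Suc ?k))"
            and rp: "\<And>i rv. i < ?M \<Longrightarrow> s ''R'' i < n \<Longrightarrow> reach_preserver ?k (s ''R'' i) (orient rv ?E) (orient rv ?H)"
            using 3 l by auto
          have "solution a ?k ?E ?P ?H"
            by (rule solution_from_hits[OF arcs_of_subset arcs_of_subset H(2) hits _ rp])
              (use covered_mono[OF cov H(1)] in auto)
          moreover have "card ?H \<le> s ''cp'' 0 * (?L ^ (?k - 1) * (?k * ((2 * s ''b'' 0 + 1) * ?L))) + ?M * (2 * (n * 2 ^ Suc ?k))"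
            using H(3) H1(2) pr rd by simp
          then have "real (card ?H) \<le> 4 * (8 * real a + 91) * (1 + ln (real n)) * (real ?k * 2 ^ ?k *
              real n powr (2 * real ?k / (real ?k + 1)) * real (s ''cp'' 0) powr (1 / (real ?k + 1)))"
            using pr rd by (intro size_bound[where b = "s ''b'' 0" and L = ?L and M = ?M]) auto
          ultimately show ?case using rd unfolding output_ok_def Let_def by simp
        qed (use l H1 pr in simp_all)
      qed (use p s rd in \<open>simp_all add: p'_def\<close>)
      moreover have "p ''nn'' 0 = n * n" using p fr s by simp
      ultimately show ?case unfolding p'_def by simp
    qed (use q pr rd in simp_all)
  qed (use s in \<open>simp_all add: r_def\<close>)
  then show ?thesis unfolding SOLVE_def r_def using s by simp
qed

lemma prob_wp:
  assumes "wp cap c Q s" shows "measure_pmf.prob (den cap c s) {r. Q r} = 1"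
  using assms by (subst measure_pmf.prob_eq_1) (auto simp: wp_def AE_measure_pmf_iff)

lemma output_ok_cong:
  "s ''G'' = s' ''G'' \<Longrightarrow> s ''P'' = s' ''P'' \<Longrightarrow> s ''k'' = s' ''k'' \<Longrightarrow> output_ok n a s = output_ok n a s'"
  by (rule ext) (simp add: output_ok_def)

lemma wp_COPY:
  assumes s: "s ''nn'' 0 = n * n" "n * n \<le> s ''cap'' 0" "2 \<le> n" "n \<le> 2 ^ b" "b \<le> s ''k'' 0" "1 \<le> s ''k'' 0"
    and P: "1 \<le> card (arcs_of n (s ''P''))"
  shows "wpc COPY (output_ok n a s) s"
  unfolding COPY_def
proof (rule wp_map[where f = "s ''G''"], goal_cases)
  case (4 r)
  let ?E = "arcs_of n (s ''G'')" and ?k = "s ''k'' 0" and ?p = "card (arcs_of n (s ''P''))"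
  have H: "arcs_of n (r ''H'') = ?E"
    using 4(2) s index_bound[of _ n] by (intro arcs_of_cong) simp
  let ?X = "real ?k * 2 ^ ?k * real n powr (2 * real ?k / (real ?k + 1)) * real ?p powr (1 / (real ?k + 1))"
  have "card ?E \<le> card ({..<n} \<times> {..<n})" using arcs_of_subset by (intro card_mono) auto
  then have "real (card ?E) \<le> ?X" using s P by (intro size_bound_all[of n b]) auto
  also have "\<dots> = 1 * 1 * ?X" by simp
  also have "\<dots> \<le> 4 * (8 * real a + 91) * (1 + ln (real n)) ^ 1 * ?X"
    using s(3) by (intro mult_right_mono mult_mono) auto
  finally show ?case unfolding output_ok_def Let_def H by (auto simp: solution_def)
qed (use s in simp_all)

text \<open>Only the draws can fail. All other parts meet their specifications for every outcome, so
  the probability of hitting all large sets passes through unchanged.\<close>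

lemma prob_MAIN:
  assumes n: "s ''n'' 0 = n" "2 \<le> n" and k: "1 \<le> s ''k'' 0" and cap: "s ''cap'' 0 = (2 * a + 40) * n ^ 4"
    and H: "s ''H'' = (\<lambda>_. 0)" and G: "\<And>y. s ''G'' y \<le> 1"
  shows "1 - 1 / real n ^ a \<le> measure_pmf.prob (den ''cap'' (MAIN a) s) {r. output_ok n a s r}"
proof -
  let ?c = "1 - 1 / real n ^ a" and ?I = "TABLES ;; LOG ;; COUNT"
  let ?D = "PIf (pos_exp (V ''cp'')) (PIf (Less (V ''k'') (V ''b'')) (PREP a ;; RANDOM ;; SOLVE) COPY) PSkip"
  have n4: "n ^ 4 = n * n * (n * n)" by (simp add: eval_nat_numeral)
  have "1 * (n * n * (n * n)) < (2 * a + 40) * (n * n * (n * n))" using n(2) by (intro mult_strict_right_mono) auto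
  then have c1: "n * n * (n * n) < s ''cap'' 0" unfolding cap n4 by simp
  have "1 * (n * n) \<le> n * n * (n * n)" using n(2) by (intro mult_right_mono) auto
  then have c2: "n * n \<le> s ''cap'' 0" using c1 by linarith
  have c3: "2 * n * n * n * (a + 10) \<le> s ''cap'' 0"
  proof -
    have "2 * n * n * n * (a + 10) = (2 * a + 20) * (n * n * n * 1)" by (simp add: algebra_simps)
    also have "\<dots> \<le> (2 * a + 40) * (n * n * n * n)" using n(2) by (intro mult_mono) auto
    also have "\<dots> = s ''cap'' 0" unfolding cap n4 by simp
    finally show ?thesis .
  qed
  have "n \<le> n * n" by simp
  then have nc: "n \<le> s ''cap'' 0" using c2 by linarith
  define post where "post r \<longleftrightarrow> tables n r \<and> r ''NN'' 0 = n * n * (n * n) \<and> r ''pw'' 0 = 2 ^ r ''b'' 0 \<and>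
      n \<le> 2 ^ r ''b'' 0 \<and> (0 < r ''b'' 0 \<longrightarrow> 2 ^ (r ''b'' 0 - 1) < n) \<and> r ''b'' 0 \<le> n \<and>
      r ''cp'' 0 = card (arcs_of n (s ''P'')) \<and> (\<forall>y\<in>{''G'', ''P'', ''k'', ''H'', ''cap''}. r y = s y)" for r
  have init: "wpc ?I post s"
  proof (rule wp_seqI, rule wp_frame[OF wp_TABLES[of s n, OF n c2]], rule wp_seqI, rule wp_frame[OF wp_LOG[of _ n]], goal_cases)
    case (4 r q)
    have q: "q ''G'' = s ''G''" "q ''P'' = s ''P''" "q ''k'' = s ''k''" "q ''H'' = s ''H''" "q ''cap'' = s ''cap''"
      "q ''nn'' = r ''nn''" "q ''NN'' = r ''NN''" "q ''n'' = r ''n''" "q ''RO'' = r ''RO''" "q ''DU'' = r ''DU''" "q ''DV'' = r ''DV''"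
      using 4(2,4) by simp_all
    have Tq: "tables n q" using 4(1) q c2 by (simp add: tables_def)
    show ?case
    proof (rule wp_frame[OF wp_COUNT[of q n]], goal_cases)
      case (3 p)
      have "p ''n'' = q ''n''" "p ''nn'' = q ''nn''" "p ''RO'' = q ''RO''" "p ''DU'' = q ''DU''" "p ''DV'' = q ''DV''"
        "p ''cap'' = q ''cap''" "p ''NN'' = q ''NN''" "p ''pw'' = q ''pw''" "p ''b'' = q ''b''" "p ''G'' = q ''G''"
        "p ''P'' = q ''P''" "p ''k'' = q ''k''" "p ''H'' = q ''H''"
        using 3(2) by simp_all
      then show ?case unfolding post_def using 3(1) 4(1,3) Tq q by (simp add: tables_def)
    qed (use Tq in \<open>simp_all add: tables_def\<close>)
  qed (use n nc in simp_all)
  have "measure_pmf.prob (den ''cap'' ?I s) UNIV * ?c \<le>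
      measure_pmf.prob (bind_pmf (den ''cap'' ?I s) (den ''cap'' ?D)) {r. output_ok n a s r}"
  proof (rule prob_bind_ge)
    fix r assume "r \<in> set_pmf (den ''cap'' ?I s)"
    then have post: "post r" using init unfolding wp_def by blast
    then have r: "r ''G'' = s ''G''" "r ''P'' = s ''P''" "r ''k'' = s ''k''" "r ''H'' = s ''H''" "r ''cap'' = s ''cap''"
      "tables n r" by (simp_all add: post_def)
    have cong: "output_ok n a q = output_ok n a s" if "q ''G'' = s ''G''" "q ''P'' = s ''P''" "q ''k'' = s ''k''" for q
      by (rule output_ok_cong) (use that in simp_all)
    have c_le: "?c \<le> 1" by simp
    show "?c \<le> measure_pmf.prob (den ''cap'' ?D r) {r. output_ok n a s r}"
    proof (cases "0 < r ''cp'' 0")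
      case False
      then have "card (arcs_of n (s ''P'')) = 0" using post by (simp add: post_def)
      moreover have "finite (arcs_of n (s ''P''))" by (rule finite_subset[OF arcs_of_subset]) simp
      ultimately have "arcs_of n (s ''P'') = {}" by simp
      moreover have "arcs_of n (r ''H'') = {}" using r H by (simp add: arcs_of_def)
      ultimately have "output_ok n a s r" by (simp add: output_ok_def solution_def)
      then have "wpc ?D (output_ok n a s) r" using False by simp
      then show ?thesis using prob_wp c_le by metis
    next
      case cp: True
      show ?thesis
      proof (cases "r ''k'' 0 < r ''b'' 0")
        case False
        have "wpc COPY (output_ok n a r) r"
          by (rule wp_COPY[of r n "r ''b'' 0"]) (use post False r n k cp c2 in \<open>simp_all add: post_def tables_def\<close>)
        then have "wpc ?D (output_ok n a s) r" using False cp cong[OF r(1,2,3)] by simp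
        then show ?thesis using prob_wp c_le by metis
      next
        case True
        have R: "ready n a r"
          unfolding ready_def using post True r n k cp c1 c3 G H by (simp add: post_def)
        have "measure_pmf.prob (den ''cap'' (PREP a) r) UNIV * ?c \<le>
          measure_pmf.prob (bind_pmf (den ''cap'' (PREP a) r) (den ''cap'' (RANDOM ;; SOLVE))) {r. output_ok n a s r}"
        proof (rule prob_bind_ge)
          fix q assume q0: "q \<in> set_pmf (den ''cap'' (PREP a) r)"
          then have Pq: "prepared n a q" using wp_PREP[OF R] by (simp add: wp_def)
          have q: "q ''G'' = s ''G''" "q ''P'' = s ''P''" "q ''k'' = s ''k''"
            using den_frame[OF q0] r by simp_all
          have Rq: "ready n a q" using Pq by (simp add: prepared_def)
          let ?hits = "hits n (q ''k'' 0) (arcs_of n (q ''G'')) (q ''L'' 0) (q ''M'' 0)"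
          have "?c \<le> measure_pmf.prob (den ''cap'' RANDOM q) {r. ?hits r}"
            using Pq Rq readyD[OF Rq]
            by (intro prob_hits[where b = "q ''b'' 0"] arcs_of_subset) (simp_all add: prepared_def ready_def)
          also have "\<dots> = measure_pmf.prob (den ''cap'' RANDOM q) {r. ?hits r} * 1" by simp
          also have "\<dots> \<le> measure_pmf.prob (bind_pmf (den ''cap'' RANDOM q) (den ''cap'' SOLVE)) {r. output_ok n a s r}"
          proof (rule prob_bind_ge)
            fix p assume p0: "p \<in> set_pmf (den ''cap'' RANDOM q)" and hp: "p \<in> {r. ?hits r}"
            have fr: "p y = q y" if "y \<notin> writes RANDOM" for y by (rule den_frame[OF p0 that])
            have p: "p ''G'' = s ''G''" "p ''P'' = s ''P''" "p ''k'' = s ''k''" "p ''L'' = q ''L''" "p ''M'' = q ''M''"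
              "p ''J'' = q ''J''" "p ''w'' = q ''w''" "p ''b'' = q ''b''" "p ''cp'' = q ''cp''" "p ''cap'' = q ''cap''"
              using fr q by simp_all
            have Rp: "ready n a p" by (rule ready_frame[OF Rq, of "writes RANDOM"]) (simp_all add: fr)
            have "prepared n a p" using Pq Rp p q by (simp add: prepared_def)
            then have "wpc SOLVE (output_ok n a p) p" using hp p q by (intro wp_SOLVE) simp_all
            then have "wpc SOLVE (output_ok n a s) p" using cong[OF p(1,2,3)] by simp
            then show "1 \<le> measure_pmf.prob (den ''cap'' SOLVE p) {r. output_ok n a s r}" using prob_wp by simp
          qed
          finally show "?c \<le> measure_pmf.prob (den ''cap'' (RANDOM ;; SOLVE) q) {r. output_ok n a s r}" by simp
        qed
        then show ?thesis using cp True by simp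
      qed
    qed
  qed
  then show ?thesis unfolding MAIN_def by simp
qed

section \<open>Transfer to digraphs\<close>

lemma reachable_iff_rtrancl:
  assumes "parcs G \<subseteq> pverts G \<times> pverts G" and "u \<in> pverts G"
  shows "u \<rightarrow>\<^sup>*\<^bsub>with_proj G\<^esub> v \<longleftrightarrow> (u, v) \<in> (parcs G)\<^sup>*"
proof
  assume "u \<rightarrow>\<^sup>*\<^bsub>with_proj G\<^esub> v"
  then have "(u, v) \<in> rtrancl_on (pverts G) (parcs G)" by (simp add: reachable_def)
  then show "(u, v) \<in> (parcs G)\<^sup>*"
    by (induction rule: rtrancl_on_induct) (auto intro: rtrancl_into_rtrancl)
next
  assume "(u, v) \<in> (parcs G)\<^sup>*"
  then have "(u, v) \<in> rtrancl_on (pverts G) (parcs G)"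
    by (induction rule: rtrancl_induct) (use assms in \<open>auto intro: rtrancl_on_into_rtrancl_on\<close>)
  then show "u \<rightarrow>\<^sup>*\<^bsub>with_proj G\<^esub> v" by (simp add: reachable_def)
qed

lemma parcs_output_graph: "parcs (output_graph n r) = arcs_of n (r ''H'')"
  by (simp add: output_graph_def arcs_of_def)

lemma solution_fault_tolerant:
  assumes G: "pair_fin_digraph G" "pverts G = {..<n}" and P: "P \<subseteq> pverts G \<times> pverts G"
    and S: "solution a k (parcs G) P (arcs_of n (r ''H''))"
  shows "fault_tolerant_reachability_subgraph k G P (output_graph n r)"
proof -
  interpret pair_fin_digraph G by (rule G(1))
  let ?H = "output_graph n r"
  have H: "pverts ?H = pverts G" "parcs ?H \<subseteq> parcs G"
    using S by (simp_all add: G(2) output_graph_def solution_def flip: parcs_output_graph)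
  have GV: "parcs G \<subseteq> pverts G \<times> pverts G" using in_arcsD1 in_arcsD2 by auto
  have "pair_wf_digraph ?H" by unfold_locales (use H GV in auto)
  then have "subgraph (with_proj ?H) (with_proj G)"
    using H wf_digraph_wp_iff[of ?H] wf_digraph_wp_iff[of G] pair_wf_digraph_axioms
    by (simp add: subgraph_def compatible_def)
  moreover have "s \<rightarrow>\<^sup>*\<^bsub>with_proj (delete_arcs G F)\<^esub> t \<longleftrightarrow> s \<rightarrow>\<^sup>*\<^bsub>with_proj (delete_arcs ?H F)\<^esub> t"
    if st: "(s, t) \<in> P" and F: "F \<subseteq> parcs G" "finite F" "card F \<le> k" for s t F
  proof -
    have s: "s \<in> pverts G" using st P by auto
    have 1: "s \<rightarrow>\<^sup>*\<^bsub>with_proj (delete_arcs G F)\<^esub> t \<longleftrightarrow> (s, t) \<in> (parcs G - F)\<^sup>*"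
      using reachable_iff_rtrancl[of "delete_arcs G F" s t] s GV by (auto simp: delete_arcs_def)
    have 2: "s \<rightarrow>\<^sup>*\<^bsub>with_proj (delete_arcs ?H F)\<^esub> t \<longleftrightarrow> (s, t) \<in> (parcs ?H - F)\<^sup>*"
      using reachable_iff_rtrancl[of "delete_arcs ?H F" s t] s GV H by (auto simp: delete_arcs_def)
    have "(parcs ?H - F)\<^sup>* \<subseteq> (parcs G - F)\<^sup>*" using H(2) by (intro rtrancl_mono) auto
    moreover have "(s, t) \<in> (parcs G - F)\<^sup>* \<longrightarrow> (s, t) \<in> (parcs ?H - F)\<^sup>*"
      using S st F unfolding solution_def parcs_output_graph by blast
    ultimately show ?thesis unfolding 1 2 by blast
  qed
  ultimately show ?thesis unfolding fault_tolerant_reachability_subgraph_def by blast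
qed

lemma arcs_of_matrix: "R \<subseteq> {..<n} \<times> {..<n} \<Longrightarrow> arcs_of n (matrix n R) = R"
proof -
  assume R: "R \<subseteq> {..<n} \<times> {..<n}"
  have "0 < matrix n R (u * n + v) \<longleftrightarrow> (u, v) \<in> R" if "u < n" "v < n" for u v
    using index_inject[of u n v] that by (auto simp: matrix_def)
  then show ?thesis using R by (auto simp: arcs_of_def)
qed

lemma poly_nat_mono: "x \<le> y \<Longrightarrow> poly p x \<le> poly p (y::nat)"
  unfolding poly_altdef by (intro sum_mono mult_left_mono power_mono) auto

section \<open>Running time and success probability of the compiled algorithm\<close>

lemma runs_success:
  assumes "runs A s T p" and "T \<le> T'"
  shows "halts_within A s T'" and "success_prob A s T' Q = measure_pmf.prob p {r. Q r}"
proof -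
  have e: "steps T' (A, s) = map_pmf (Pair Skip) p" using assms by (simp add: runs_def)
  then show "halts_within A s T'" by (auto simp: halts_within_def)
  show "success_prob A s T' Q = measure_pmf.prob p {r. Q r}" by (simp add: success_prob_def e vimage_def)
qed

definition algorithm :: "nat \<Rightarrow> com" where
  "algorithm a = Seq (comp ''n'' (CAP (2 * a + 40))) (comp ''cap'' (MAIN a))"

text \<open>The time of the main program is polynomial in the content of \<open>cap\<close>, which
  is \<open>(2 * a + 40) * n ^ 4\<close>; hence the composition of polynomials.\<close>

definition time_bound :: "nat \<Rightarrow> nat poly" where
  "time_bound a = time_poly (CAP (2 * a + 40)) + pcompose (time_poly (MAIN a)) (monom (2 * a + 40) 4) + 1"

lemma runs_algorithm:
  assumes n: "s ''n'' 0 = n"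
  shows "runs (algorithm a) s (poly (time_bound a) n)
    (bind_pmf (den ''n'' (CAP (2 * a + 40)) s) (den ''cap'' (MAIN a)))"
proof -
  let ?K = "2 * a + 40"
  have 1: "runs (comp ''n'' (CAP ?K)) s (poly (time_poly (CAP ?K)) n) (den ''n'' (CAP ?K) s)"
    by (rule runs_comp) (use n in simp_all)
  have 2: "runs (comp ''cap'' (MAIN a)) r (poly (time_poly (MAIN a)) (?K * n ^ 4)) (den ''cap'' (MAIN a) r)"
    if r: "r \<in> set_pmf (den ''n'' (CAP ?K) s)" for r
  proof (rule runs_comp[OF loops_ok_MAIN cap_notin_MAIN])
    show "r ''cap'' 0 \<le> ?K * n ^ 4" using wp_CAP[of ?K s] r n by (simp add: wp_def)
  qed
  show ?thesis
    using runs_Seq[OF 1 2] unfolding algorithm_def time_bound_def by (simp add: poly_pcompose poly_monom)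
qed

theorem theorem7p1:
  shows "\<forall>a::nat. \<exists>(A::com) (C::real) (c::nat) (p::nat poly).
    \<forall>(n::nat) (k::nat) (G::nat pair_pre_digraph) (P::(nat \<times> nat) set).
      k \<ge> 1 \<and> pair_fin_digraph G \<and> pverts G = {..<n} \<and> P \<subseteq> pverts G \<times> pverts G \<longrightarrow>
        (let T = poly p (input_size n k) in
          halts_within A (initial_memory n k G P) T \<and>
          success_prob A (initial_memory n k G P) T
            (\<lambda>\<sigma>. let H = output_graph n \<sigma> in
               fault_tolerant_reachability_subgraph k G P H \<and>
               real (card (parcs H)) \<le>
                 C * (1 + ln (real n)) ^ c *
                 (real k * 2 ^ k * real n powr (2 * real k / (real k + 1)) *
                  real (card P) powr (1 / (real k + 1))))
            \<ge> 1 - 1 / real n ^ a)"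
\<comment> \<open>The witnesses are fixed by unification at the end and depend on \<open>a\<close>
  only: \<open>algorithm a\<close>, the constant \<open>4 * (8 * a + 91)\<close>, a single
  logarithmic factor, and \<open>time_bound a\<close>.\<close>
proof (intro allI exI impI, elim conjE)
  fix a n k :: nat and G :: "nat pair_pre_digraph" and P :: "(nat \<times> nat) set"
  assume k: "1 \<le> k" and G: "pair_fin_digraph G" "pverts G = {..<n}" and P: "P \<subseteq> pverts G \<times> pverts G"
  let ?s = "initial_memory n k G P" and ?T = "poly (time_bound a) (input_size n k)"
  let ?X = "real k * 2 ^ k * real n powr (2 * real k / (real k + 1)) * real (card P) powr (1 / (real k + 1))"
  let ?Q = "\<lambda>\<sigma>. let H = output_graph n \<sigma> in fault_tolerant_reachability_subgraph k G P H \<and>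
      real (card (parcs H)) \<le> 4 * (8 * real a + 91) * (1 + ln (real n)) ^ 1 * ?X"
  interpret pair_fin_digraph G by (rule G(1))
  have GV: "parcs G \<subseteq> {..<n} \<times> {..<n}" using in_arcsD1 in_arcsD2 G(2) by auto
  have PV: "P \<subseteq> {..<n} \<times> {..<n}" using P G(2) by simp
  have s: "?s ''n'' 0 = n" "?s ''k'' 0 = k" "?s ''G'' = matrix n (parcs G)" "?s ''P'' = matrix n P" "?s ''H'' = (\<lambda>_. 0)"
    by (simp_all add: initial_memory_def)
  let ?D = "bind_pmf (den ''n'' (CAP (2 * a + 40)) ?s) (den ''cap'' (MAIN a))"
  have "n \<le> n\<^sup>2" by (simp add: power2_eq_square)
  then have "n \<le> input_size n k" by (simp add: input_size_def)
  then have T: "poly (time_bound a) n \<le> ?T" by (rule poly_nat_mono)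
  note run = runs_success[OF runs_algorithm[of ?s n a, OF s(1)] T]
  have Q: "?Q r" if "output_ok n a q r" "q ''G'' = ?s ''G''" "q ''P'' = ?s ''P''" "q ''k'' = ?s ''k''" for q r
    using that solution_fault_tolerant[OF G P, of a k r]
    unfolding output_ok_def Let_def by (simp add: s arcs_of_matrix GV PV parcs_output_graph)
  have "1 - 1 / real n ^ a \<le> measure_pmf.prob ?D {r. ?Q r}"
  proof -
    \<comment> \<open>For \<open>n = 1\<close> the required probability is 0. For
      \<open>n = 0\<close> and positive \<open>a\<close> division by zero makes it 1, so the
      property has to hold for every outcome.\<close>
    consider "n = 0" | "n = 1" | "2 \<le> n" by linarith
    then show ?thesis
    proof cases
      case 1
      have "solution a k (parcs G) P (arcs_of n (r ''H''))" for r :: memory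
        using GV PV 1 by (simp add: solution_def arcs_of_def)
      moreover have "card P = 0" "\<And>r :: memory. arcs_of n (r ''H'') = {}" using PV 1 by (simp_all add: arcs_of_def)
      ultimately have "?Q r" for r
        using solution_fault_tolerant[OF G P, of a k r] by (simp add: parcs_output_graph)
      then show ?thesis by simp
    next
      case 2
      then show ?thesis by simp
    next
      case 3
      have "measure_pmf.prob (den ''n'' (CAP (2 * a + 40)) ?s) UNIV * (1 - 1 / real n ^ a) \<le> measure_pmf.prob ?D {r. ?Q r}"
      proof (rule prob_bind_ge)
        fix q assume q0: "q \<in> set_pmf (den ''n'' (CAP (2 * a + 40)) ?s)"
        have q: "q ''n'' = ?s ''n''" "q ''k'' = ?s ''k''" "q ''G'' = ?s ''G''" "q ''P'' = ?s ''P''" "q ''H'' = ?s ''H''"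
          using den_frame[OF q0] by simp_all
        have "q ''cap'' 0 = (2 * a + 40) * n ^ 4" using wp_CAP[of "2 * a + 40" ?s] q0 s by (simp add: wp_def)
        then have "1 - 1 / real n ^ a \<le> measure_pmf.prob (den ''cap'' (MAIN a) q) {r. output_ok n a q r}"
          using q s k 3 by (intro prob_MAIN) (simp_all add: matrix_def)
        also have "\<dots> \<le> measure_pmf.prob (den ''cap'' (MAIN a) q) {r. ?Q r}"
          using Q q by (intro measure_pmf.finite_measure_mono) auto
        finally show "1 - 1 / real n ^ a \<le> measure_pmf.prob (den ''cap'' (MAIN a) q) {r. ?Q r}" .
      qed
      then show ?thesis by simp
    qed
  qed
  then show "let T = ?T in halts_within (algorithm a) ?s T \<and> 1 - 1 / real n ^ a \<le> success_prob (algorithm a) ?s T ?Q"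
    using run by (simp only: Let_def)
qed

end
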